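(* For every $k\in\mathbb{Z}$, every $d\in\mathbb{Z}_{\ge0}$, and every one of the following cases associated with the weight $k$ (where $d\geq 1$ is required in Case IIId), there exist a finite index subgroup $\Gamma\subset\mathrm{SL}_2(\mathbb{Z})$, a finite dimensional complex representation $\rho$ of $\Gamma$, and a (vector-valued) polyharmonic weak Maaß form $f$ for $\rho$ of weight $k$ and exact depth $d$ that realizes this case. Cases for $k<1$: (Ia) $\mathrm{L}_k\Delta_k^d f=0$ and $\mathrm{R}_k^{1-k}\Delta_k^d f=0$; (Ib) $\mathrm{L}_k\Delta_k^d f=0$ and $\mathrm{R}_k^{1-k}\Delta_k^d f\neq 0$; (Ic) $\mathrm{L}_k\Delta_k^d f\ne 0$ and $\mathrm{R}_k^{1-k}\Delta_k^d f=0$; (Id) $\mathrm{L}_k\Delta_k^d f\neq 0$ and $\mathrm{R}_k^{1-k}\Delta_k^d f\neq 0$. Cases for $k=1$: (IIa) $\mathrm{L}_k\Delta_k^d f=0$; (IIb) $\mathrm{L}_k\Delta_k^d f\neq0$. Cases for $k>1$: (IIIa) $\mathrm{L}_k\Delta_k^d f=0$ and, if $d\ge 1$, $\mathrm{L}_k^k\Delta_k^{d-1} f\neq 0$; (IIIb) $\mathrm{L}_k\Delta_k^d f\neq0$ and $\mathrm{L}_k^k\Delta_k^{d} f=0$; (IIIc) $\mathrm{L}_k^k\Delta_k^{d} f\neq 0$; (IIId) $d\ge1$ and $\mathrm{L}_k^k\Delta_k^{d-1} f=0$.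
   Context: $\mathbb{H}=\{\tau=x+iy: y>0\}$, $(f|_k g)(\tau)=(c\tau+d)^{-k}f(g\tau)$ for $g=\begin{pmatrix}a&b\\c&d\end{pmatrix}\in\mathrm{SL}_2(\mathbb{R})$. The Maaß lowering, raising and Laplace operators of weight $k$ are $\mathrm{L}_k=-2iy^2\partial_{\bar\tau}$, $\mathrm{R}_k=2i\partial_\tau+ky^{-1}$, $\Delta_k=-\mathrm{R}_{k-2}\mathrm{L}_k$; iterates are $\mathrm{L}_k^j=\mathrm{L}_{k-2(j-1)}\circ\cdots\circ\mathrm{L}_{k-2}\circ\mathrm{L}_k$ and $\mathrm{R}_k^j=\mathrm{R}_{k+2(j-1)}\circ\cdots\circ\mathrm{R}_{k+2}\circ\mathrm{R}_k$. Let $\Gamma\subset\mathrm{SL}_2(\mathbb{Z})$ have finite index and let $\rho:\Gamma\to\mathrm{GL}(V(\rho))$ be a representation on a finite dimensional complex vector space. A smooth function $f:\mathbb{H}\to V(\rho)$ is a polyharmonic weak Maaß form for $\rho$ of weight $k$ and depth $d$ if (i) $f|_k\gamma=\rho(\gamma)f$ for all $\gamma\in\Gamma$, (ii) $\Delta_k^{d+1}f=0$, (iii) $\|(f|_k\gamma)(\tau)\|\ll\exp(ay)$ as $y\to\infty$ for some $a\in\mathbb{R}$, some norm on $V(\rho)$ and all $\gamma\in\mathrm{SL}_2(\mathbb{Z})$. A nonzero such $f$ has exact depth $d$ if $d=0$ or $\Delta_k^d f\neq0$. *)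

theory Defs
  imports
    "HOL-Analysis.Analysis"
    "HOL-Algebra.Coset"
    "Jordan_Normal_Form.Determinant"
begin

text \<open>
  A finite dimensional complex representation is a homomorphism into \<open>GL\<^sub>n(\<complex>)\<close>, where the
  dimension \<open>n\<close> is a number and not a type, so that one can quantify over it.  Accordingly,
  vector-valued functions on the upper half plane have type \<open>complex \<Rightarrow> complex vec\<close> (the
  carrier-based vectors of the theory \<open>Matrix\<close>); their values outside the upper half plane are
  irrelevant.
\<close>

unbundle no vec_syntax
hide_type (open) Finite_Cartesian_Product.vec
hide_const (open) Finite_Cartesian_Product.vec Finite_Cartesian_Product.mat Determinants.det

definition upper_half_plane :: "complex set" where
  "upper_half_plane = {\<tau>. Im \<tau> > 0}"

subsection \<open>Groups and representations\<close>

definition SL2Z :: "int mat monoid" where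
  "SL2Z = \<lparr>carrier = {A \<in> carrier_mat 2 2. Determinant.det A = 1}, mult = (*), one = 1\<^sub>m 2\<rparr>"

definition GL :: "nat \<Rightarrow> complex mat monoid" where
  "GL n = units_of (ring_mat TYPE(complex) n ())"

definition finite_index_subgroup :: "'a set \<Rightarrow> ('a, 'b) monoid_scheme \<Rightarrow> bool" where
  "finite_index_subgroup H G \<longleftrightarrow> subgroup H G \<and> finite (rcosets\<^bsub>G\<^esub> H)"

definition matrix_representation :: "int mat set \<Rightarrow> nat \<Rightarrow> (int mat \<Rightarrow> complex mat) \<Rightarrow> bool" where
  "matrix_representation \<Gamma> n \<rho> \<longleftrightarrow> \<rho> \<in> hom (SL2Z\<lparr>carrier := \<Gamma>\<rparr>) (GL n)"

subsection \<open>The slash action\<close>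

definition moebius :: "int mat \<Rightarrow> complex \<Rightarrow> complex" where
  "moebius g \<tau> = (of_int (g $$ (0,0)) * \<tau> + of_int (g $$ (0,1))) /
                 (of_int (g $$ (1,0)) * \<tau> + of_int (g $$ (1,1)))"

definition slash :: "int \<Rightarrow> (complex \<Rightarrow> complex vec) \<Rightarrow> int mat \<Rightarrow> complex \<Rightarrow> complex vec" where
  "slash k f g \<tau> =
     ((of_int (g $$ (1,0)) * \<tau> + of_int (g $$ (1,1))) powi (- k)) \<cdot>\<^sub>v f (moebius g \<tau>)"

subsection \<open>Smooth functions and the Maass operators\<close>

definition partial_x :: "(complex \<Rightarrow> complex) \<Rightarrow> complex \<Rightarrow> complex" where
  "partial_x f \<tau> = frechet_derivative f (at \<tau>) 1"

definition partial_y :: "(complex \<Rightarrow> complex) \<Rightarrow> complex \<Rightarrow> complex" where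
  "partial_y f \<tau> = frechet_derivative f (at \<tau>) \<i>"

text \<open>Differentiability is real (Frechet) differentiability in \<open>\<tau> = x + iy\<close>, so \<open>smooth\<close> is
  \<open>C\<^sup>\<infinity>\<close> in the real variables \<open>x, y\<close>, not holomorphy.\<close>

primrec times_differentiable :: "nat \<Rightarrow> (complex \<Rightarrow> complex) \<Rightarrow> bool" where
  "times_differentiable 0 f \<longleftrightarrow> continuous_on upper_half_plane f"
| "times_differentiable (Suc m) f \<longleftrightarrow>
     f differentiable_on upper_half_plane \<and>
     times_differentiable m (partial_x f) \<and> times_differentiable m (partial_y f)"

definition smooth :: "(complex \<Rightarrow> complex) \<Rightarrow> bool" where
  "smooth f \<longleftrightarrow> (\<forall>m. times_differentiable m f)"

definition smooth_vec :: "nat \<Rightarrow> (complex \<Rightarrow> complex vec) \<Rightarrow> bool" where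
  "smooth_vec n f \<longleftrightarrow>
     (\<forall>\<tau>\<in>upper_half_plane. f \<tau> \<in> carrier_vec n) \<and> (\<forall>i<n. smooth (\<lambda>\<tau>. f \<tau> $ i))"

definition wirtinger :: "(complex \<Rightarrow> complex) \<Rightarrow> complex \<Rightarrow> complex" where
  "wirtinger f \<tau> = (partial_x f \<tau> - \<i> * partial_y f \<tau>) / 2"

definition wirtinger_bar :: "(complex \<Rightarrow> complex) \<Rightarrow> complex \<Rightarrow> complex" where
  "wirtinger_bar f \<tau> = (partial_x f \<tau> + \<i> * partial_y f \<tau>) / 2"

definition componentwise ::
  "((complex \<Rightarrow> complex) \<Rightarrow> complex \<Rightarrow> complex) \<Rightarrow> (complex \<Rightarrow> complex vec) \<Rightarrow> complex \<Rightarrow> complex vec"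
  where "componentwise D f \<tau> = Matrix.vec (dim_vec (f \<tau>)) (\<lambda>i. D (\<lambda>w. f w $ i) \<tau>)"

text \<open>The lowering operator does not actually depend on the weight \<open>k\<close>; the argument is kept for
  uniformity with the usual notation.\<close>

definition lowering :: "int \<Rightarrow> (complex \<Rightarrow> complex vec) \<Rightarrow> complex \<Rightarrow> complex vec" where
  "lowering k =
     componentwise (\<lambda>f \<tau>. - 2 * \<i> * of_real ((Im \<tau>)\<^sup>2) * wirtinger_bar f \<tau>)"

definition raising :: "int \<Rightarrow> (complex \<Rightarrow> complex vec) \<Rightarrow> complex \<Rightarrow> complex vec" where
  "raising k =
     componentwise (\<lambda>f \<tau>. 2 * \<i> * wirtinger f \<tau> + of_int k / of_real (Im \<tau>) * f \<tau>)"

definition laplace :: "int \<Rightarrow> (complex \<Rightarrow> complex vec) \<Rightarrow> complex \<Rightarrow> complex vec" where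
  "laplace k f = (\<lambda>\<tau>. - raising (k - 2) (lowering k f) \<tau>)"

primrec lowering_iter ::
  "int \<Rightarrow> nat \<Rightarrow> (complex \<Rightarrow> complex vec) \<Rightarrow> complex \<Rightarrow> complex vec" where
  "lowering_iter k 0 f = f"
| "lowering_iter k (Suc j) f = lowering (k - 2 * int j) (lowering_iter k j f)"

primrec raising_iter ::
  "int \<Rightarrow> nat \<Rightarrow> (complex \<Rightarrow> complex vec) \<Rightarrow> complex \<Rightarrow> complex vec" where
  "raising_iter k 0 f = f"
| "raising_iter k (Suc j) f = raising (k + 2 * int j) (raising_iter k j f)"

abbreviation laplace_iter ::
  "int \<Rightarrow> nat \<Rightarrow> (complex \<Rightarrow> complex vec) \<Rightarrow> complex \<Rightarrow> complex vec" where
  "laplace_iter k j \<equiv> laplace k ^^ j"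

definition vanishes :: "nat \<Rightarrow> (complex \<Rightarrow> complex vec) \<Rightarrow> bool" where
  "vanishes n f \<longleftrightarrow> (\<forall>\<tau>\<in>upper_half_plane. f \<tau> = 0\<^sub>v n)"

subsection \<open>Polyharmonic weak Maass forms\<close>

definition is_norm :: "nat \<Rightarrow> (complex vec \<Rightarrow> real) \<Rightarrow> bool" where
  "is_norm n N \<longleftrightarrow>
     (\<forall>v\<in>carrier_vec n. N v \<ge> 0 \<and> (N v = 0 \<longleftrightarrow> v = 0\<^sub>v n)) \<and>
     (\<forall>v\<in>carrier_vec n. \<forall>c. N (c \<cdot>\<^sub>v v) = cmod c * N v) \<and>
     (\<forall>v\<in>carrier_vec n. \<forall>w\<in>carrier_vec n. N (v + w) \<le> N v + N w)"

text \<open>The bound as \<open>y \<rightarrow> \<infinity>\<close> is locally uniform in \<open>x\<close>.  It is not required uniformly for all real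
  \<open>x\<close>: as \<open>\<rho>\<close> need not be unitary, the matrices \<open>\<rho> (T\<^sup>m)\<close> for a translation \<open>T\<close> can be
  unbounded, as they are for symmetric powers of the standard representation.\<close>

definition exponential_growth :: "int \<Rightarrow> nat \<Rightarrow> (complex \<Rightarrow> complex vec) \<Rightarrow> bool" where
  "exponential_growth k n f \<longleftrightarrow>
     (\<exists>a N. is_norm n N \<and>
       (\<forall>\<gamma>\<in>carrier SL2Z. \<forall>B. \<exists>C. \<exists>Y>0. \<forall>x y. \<bar>x\<bar> \<le> B \<longrightarrow> y \<ge> Y \<longrightarrow>
          N (slash k f \<gamma> (Complex x y)) \<le> C * exp (a * y)))"

definition polyharmonic_weak_maass_form ::
  "int mat set \<Rightarrow> nat \<Rightarrow> (int mat \<Rightarrow> complex mat) \<Rightarrow> int \<Rightarrow> nat \<Rightarrow> (complex \<Rightarrow> complex vec) \<Rightarrow> bool"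
  where
  "polyharmonic_weak_maass_form \<Gamma> n \<rho> k d f \<longleftrightarrow>
     smooth_vec n f \<and>
     (\<forall>\<gamma>\<in>\<Gamma>. \<forall>\<tau>\<in>upper_half_plane. slash k f \<gamma> \<tau> = \<rho> \<gamma> *\<^sub>v f \<tau>) \<and>
     vanishes n (laplace_iter k (d + 1) f) \<and>
     exponential_growth k n f"

definition form_of_exact_depth ::
  "int mat set \<Rightarrow> nat \<Rightarrow> (int mat \<Rightarrow> complex mat) \<Rightarrow> int \<Rightarrow> nat \<Rightarrow> (complex \<Rightarrow> complex vec) \<Rightarrow> bool"
  where
  "form_of_exact_depth \<Gamma> n \<rho> k d f \<longleftrightarrow>
     polyharmonic_weak_maass_form \<Gamma> n \<rho> k d f \<and> \<not> vanishes n f \<and>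
     (d = 0 \<or> \<not> vanishes n (laplace_iter k d f))"

definition modular_data ::
  "int mat set \<Rightarrow> nat \<Rightarrow> (int mat \<Rightarrow> complex mat) \<Rightarrow> int \<Rightarrow> nat \<Rightarrow> (complex \<Rightarrow> complex vec) \<Rightarrow> bool"
  where
  "modular_data \<Gamma> n \<rho> k d f \<longleftrightarrow>
     finite_index_subgroup \<Gamma> SL2Z \<and> matrix_representation \<Gamma> n \<rho> \<and> form_of_exact_depth \<Gamma> n \<rho> k d f"

end

(*
  All forms are built from the Eisenstein-type series
    E(tau) = sum over (c,d) <> (0,0) of l^(-kappa) (y l / conj l)^j chi(ln(|l|^2 / y)),   l = c tau + d,
  attached to smooth functions chi on the real line.  The Maass operators act on them by ordinary first order
  differential operators on chi.  Multiplied with the basis A^(m-i) B^i, A = tau - w, B = (conj tau - w) / y, of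
  the polynomials of degree at most m in w, they give forms for the symmetric power representation Sym^m of
  SL_2(Z), and the operators become triangular systems of ordinary differential equations for (chi_0, ..., chi_m).
  These can be solved within functions of prescribed decay, so the Laplace operator is surjective and any
  harmonic form of this kind is the top of a tower of arbitrary depth.  It remains to find the top of the tower
  in each case.  Powers chi_i = c_i exp(n x) reduce most cases to binomial identities.  The two cases in which
  constants or antiholomorphic polynomials are needed use the kernel
  psi(x) = exp(-(pi/2) e^x) - 2 exp(-2 pi e^x), for which Poisson summation shows that the series is equal to 1.
*)
theory Submission
  imports Defs "HOL-Probability.Characteristic_Functions"
begin

unbundle no vec_syntax
hide_type (open) Finite_Cartesian_Product.vec
hide_const (open) Finite_Cartesian_Product.vec Finite_Cartesian_Product.mat Determinants.det

section \<open>Functions with prescribed decay\<close>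

text \<open>The obstacle is that a Laplace preimage has to be modular again, in every weight and at
  every depth, while summation over the lattice needs decay. Solving for \<chi> before summing
  settles modularity, and the twist by Sym^m frees the weight: k = \<kappa> - m, where \<kappa> and
  the decay rate \<alpha> of the kernels only have to satisfy \<kappa> + 2\<alpha> \<ge> 4. Decay is
  needed at +\<infinity>, that is for long lattice vectors; exponential growth at -\<infinity> costs
  just a power of y. Solving \<chi>' + c \<chi> = \<phi> may produce factors x by resonance, which
  is why the rates \<beta> < \<alpha> are prescribed and not \<alpha> itself. The top of a tower has
  to be such a series as well. For tops with constant components the powers exp(n x) are of no use,
  as in weight 0 their series are non-constant Eisenstein series; the number 1 comes from the
  inversion formula of a theta function instead. An even \<kappa> keeps the terms of \<omega> and
  -\<omega> from cancelling.\<close>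

definition exp_bound :: "real \<Rightarrow> (real \<Rightarrow> real) \<Rightarrow> bool" where
  "exp_bound \<beta> \<phi> \<longleftrightarrow> (\<exists>C b. 0 \<le> b \<and> (\<forall>x. \<bar>\<phi> x\<bar> \<le> C * (exp (- \<beta> * x) * (1 + exp (- b * x)))))"

text \<open>Smoothness together with the decay of all derivatives is one closed condition, so a
  coinductive predicate replaces an induction over the order of the derivative.
  \<open>exp_bound\<close> fixes the rate \<beta> only at +\<infinity>: the factor 1 + exp (- b x)
  with a free b admits any exponential growth at -\<infinity>.\<close>

coinductive decaying :: "real \<Rightarrow> (real \<Rightarrow> real) \<Rightarrow> bool" for \<alpha> where
  decaying: "\<lbrakk>\<And>x. (\<phi> has_real_derivative \<phi>' x) (at x); \<And>\<beta>. \<beta> < \<alpha> \<Longrightarrow> exp_bound \<beta> \<phi>; decaying \<alpha> \<phi>'\<rbrakk>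
    \<Longrightarrow> decaying \<alpha> \<phi>"

lemma exp_bound_weight_mono:
  fixes u v x :: real
  assumes "0 \<le> u" "u \<le> v"
  shows "exp (- u * x) \<le> 1 + exp (- v * x)"
proof (cases "x \<ge> 0")
  case True
  then have "exp (- u * x) \<le> 1" using assms by (simp add: mult_nonneg_nonneg)
  then show ?thesis using exp_ge_zero[of "- v * x"] by linarith
next
  case False
  then have "- u * x \<le> - v * x" using assms by (simp add: mult_right_mono_neg)
  then have "exp (- u * x) \<le> exp (- v * x)" by simp
  then show ?thesis by linarith
qed

lemma exp_bound_weight_mono2:
  fixes u v x :: real
  assumes "0 \<le> u" "u \<le> v"
  shows "1 + exp (- u * x) \<le> 2 * (1 + exp (- v * x))"
proof -
  have "1 + E \<le> 2 * (1 + E')" if "E \<le> 1 + E'" "0 \<le> E'" for E E' :: real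
    using that by simp
  from this[OF exp_bound_weight_mono[OF assms] exp_ge_zero] show ?thesis .
qed

text \<open>The exponent b may be enlarged at the cost of a factor 2. This brings two bounds to a
  common b and keeps b away from resonant values.\<close>

lemma exp_boundE:
  assumes "exp_bound \<beta> \<phi>"
  obtains C b where "0 \<le> C" "b0 \<le> b" "0 \<le> b"
    "\<And>x. \<bar>\<phi> x\<bar> \<le> C * (exp (- \<beta> * x) * (1 + exp (- b * x)))"
proof -
  obtain C b where b: "0 \<le> b" and C: "\<And>x. \<bar>\<phi> x\<bar> \<le> C * (exp (- \<beta> * x) * (1 + exp (- b * x)))"
    using assms unfolding exp_bound_def by blast
  have "0 \<le> C"
  proof -
    have "0 \<le> C * (exp (- \<beta> * 0) * (1 + exp (- b * 0)))" using C[of 0] by linarith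
    then show ?thesis by simp
  qed
  have "\<bar>\<phi> x\<bar> \<le> 2 * C * (exp (- \<beta> * x) * (1 + exp (- (max b b0) * x)))" for x
  proof -
    have "1 + exp (- b * x) \<le> 2 * (1 + exp (- (max b b0) * x))"
      by (rule exp_bound_weight_mono2[OF b]) simp
    then have "C * (exp (- \<beta> * x) * (1 + exp (- b * x))) \<le> C * (exp (- \<beta> * x) * (2 * (1 + exp (- (max b b0) * x))))"
      using \<open>0 \<le> C\<close> by (intro mult_left_mono) auto
    with C[of x] show ?thesis by (simp add: algebra_simps)
  qed
  with \<open>0 \<le> C\<close> b show thesis by (intro that[of "2 * C" "max b b0"]) auto
qed

text \<open>For x \<ge> 0 a faster rate is the stronger condition; for x < 0 the surplus factor exp
  (- (\<beta>' - \<beta>) x) is large and goes into the free exponent b, which grows by \<beta>' -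
  \<beta>.\<close>

lemma exp_bound_antimono:
  assumes "exp_bound \<beta>' \<phi>" "\<beta> \<le> \<beta>'"
  shows "exp_bound \<beta> \<phi>"
proof -
  obtain C b where *: "0 \<le> C" "0 \<le> b" "\<And>x. \<bar>\<phi> x\<bar> \<le> C * (exp (- \<beta>' * x) * (1 + exp (- b * x)))"
    using exp_boundE[OF assms(1)] by metis
  have "\<bar>\<phi> x\<bar> \<le> (4 * C) * (exp (- \<beta> * x) * (1 + exp (- (b + (\<beta>' - \<beta>)) * x)))" for x
  proof -
    have e: "exp (- \<beta>' * x) = exp (- \<beta> * x) * exp (- (\<beta>' - \<beta>) * x)"
      by (simp add: exp_add[symmetric] algebra_simps)
    have "exp (- (\<beta>' - \<beta>) * x) * (1 + exp (- b * x)) = exp (- (\<beta>' - \<beta>) * x) + exp (- (b + (\<beta>' - \<beta>)) * x)"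
      by (simp add: exp_add[symmetric] algebra_simps)
    also have "\<dots> \<le> 2 * (1 + exp (- (b + (\<beta>' - \<beta>)) * x))"
      using exp_bound_weight_mono[of "\<beta>' - \<beta>" "b + (\<beta>' - \<beta>)" x] assms(2) *(2) by simp
    also have "\<dots> \<le> 4 * (1 + exp (- (b + (\<beta>' - \<beta>)) * x))" by (simp add: add_nonneg_nonneg)
    finally have "exp (- \<beta> * x) * (exp (- (\<beta>' - \<beta>) * x) * (1 + exp (- b * x))) \<le> exp (- \<beta> * x) * (4 * (1 + exp (- (b + (\<beta>' - \<beta>)) * x)))"
      by (rule mult_left_mono) simp
    then have "C * (exp (- \<beta>' * x) * (1 + exp (- b * x))) \<le> C * (exp (- \<beta> * x) * (4 * (1 + exp (- (b + (\<beta>' - \<beta>)) * x))))"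
      unfolding e mult.assoc using *(1) by (rule mult_left_mono)
    with *(3)[of x] show ?thesis by (simp add: algebra_simps)
  qed
  moreover have "0 \<le> b + (\<beta>' - \<beta>)" using * assms by simp
  ultimately show ?thesis unfolding exp_bound_def by blast
qed

lemma exp_bound_linear:
  assumes "exp_bound \<beta> \<phi>" "exp_bound \<beta> \<psi>"
  shows "exp_bound \<beta> (\<lambda>x. c * \<phi> x + d * \<psi> x)"
proof -
  obtain C b where 1: "0 \<le> C" "0 \<le> b" "\<And>x. \<bar>\<phi> x\<bar> \<le> C * (exp (- \<beta> * x) * (1 + exp (- b * x)))"
    using exp_boundE[OF assms(1)] by metis
  obtain D b' where 2: "0 \<le> D" "b \<le> b'" "\<And>x. \<bar>\<psi> x\<bar> \<le> D * (exp (- \<beta> * x) * (1 + exp (- b' * x)))"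
    using exp_boundE[OF assms(2), of b] by metis
  have "\<bar>c * \<phi> x + d * \<psi> x\<bar> \<le> (2 * \<bar>c\<bar> * C + \<bar>d\<bar> * D) * (exp (- \<beta> * x) * (1 + exp (- b' * x)))" for x
  proof -
    let ?E = "exp (- \<beta> * x) * (1 + exp (- b' * x))"
    have "1 + exp (- b * x) \<le> 2 * (1 + exp (- b' * x))"
      by (rule exp_bound_weight_mono2[OF 1(2) 2(2)])
    then have "exp (- \<beta> * x) * (1 + exp (- b * x)) \<le> 2 * ?E" by simp
    then have "C * (exp (- \<beta> * x) * (1 + exp (- b * x))) \<le> C * (2 * ?E)" using 1(1) by (rule mult_left_mono)
    with 1(3)[of x] have p: "\<bar>\<phi> x\<bar> \<le> 2 * C * ?E" by (simp add: algebra_simps)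
    have "\<bar>c * \<phi> x + d * \<psi> x\<bar> \<le> \<bar>c\<bar> * \<bar>\<phi> x\<bar> + \<bar>d\<bar> * \<bar>\<psi> x\<bar>"
      by (metis abs_mult abs_triangle_ineq)
    also have "\<dots> \<le> \<bar>c\<bar> * (2 * C * ?E) + \<bar>d\<bar> * (D * ?E)"
      using p 2(3)[of x] by (intro add_mono mult_left_mono) auto
    finally show ?thesis by (simp add: algebra_simps)
  qed
  moreover have "0 \<le> b'" using 1 2 by simp
  ultimately show ?thesis unfolding exp_bound_def by blast
qed

lemma decayingD:
  assumes "decaying \<alpha> \<phi>"
  shows "(\<phi> has_real_derivative deriv \<phi> x) (at x)" "decaying \<alpha> (deriv \<phi>)" "\<beta> < \<alpha> \<Longrightarrow> exp_bound \<beta> \<phi>"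
proof -
  obtain \<phi>' where *: "\<And>x. (\<phi> has_real_derivative \<phi>' x) (at x)" "decaying \<alpha> \<phi>'"
    "\<And>\<beta>. \<beta> < \<alpha> \<Longrightarrow> exp_bound \<beta> \<phi>"
    using assms by (cases rule: decaying.cases) auto
  have "\<phi>' = deriv \<phi>" by (rule ext) (rule DERIV_imp_deriv[OF *(1), symmetric])
  with * show "(\<phi> has_real_derivative deriv \<phi> x) (at x)" "decaying \<alpha> (deriv \<phi>)" "\<beta> < \<alpha> \<Longrightarrow> exp_bound \<beta> \<phi>"
    by auto
qed

lemma decaying_linear:
  assumes "decaying \<alpha> \<phi>" "decaying \<alpha> \<psi>"
  shows "decaying \<alpha> (\<lambda>x. c * \<phi> x + d * \<psi> x)"
  using assms
proof (coinduction arbitrary: \<phi> \<psi> rule: decaying.coinduct)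
  case decaying
  have "((\<lambda>x. c * \<phi> x + d * \<psi> x) has_real_derivative c * deriv \<phi> x + d * deriv \<psi> x) (at x)" for x
    using decaying by (auto intro!: derivative_eq_intros decayingD(1))
  moreover have "exp_bound \<beta> (\<lambda>x. c * \<phi> x + d * \<psi> x)" if "\<beta> < \<alpha>" for \<beta>
    using decaying that by (intro exp_bound_linear decayingD(3))
  ultimately show ?case
    using decaying decayingD(2)[OF decaying(1)] decayingD(2)[OF decaying(2)]
    by (rule_tac exI[of _ "\<lambda>x. c * \<phi> x + d * \<psi> x"], rule_tac exI[of _ "\<lambda>x. c * deriv \<phi> x + d * deriv \<psi> x"])
      (intro conjI allI impI disjI1 exI[of _ "deriv \<phi>"] exI[of _ "deriv \<psi>"] refl; assumption?; simp)
qed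

lemma decaying_cmult: "decaying \<alpha> \<phi> \<Longrightarrow> decaying \<alpha> (\<lambda>x. c * \<phi> x)"
  using decaying_linear[of \<alpha> \<phi> \<phi> c 0] by simp

lemma decaying_add: "decaying \<alpha> \<phi> \<Longrightarrow> decaying \<alpha> \<psi> \<Longrightarrow> decaying \<alpha> (\<lambda>x. \<phi> x + \<psi> x)"
  using decaying_linear[of \<alpha> \<phi> \<psi> 1 1] by simp

lemma decaying_diff: "decaying \<alpha> \<phi> \<Longrightarrow> decaying \<alpha> \<psi> \<Longrightarrow> decaying \<alpha> (\<lambda>x. \<phi> x - \<psi> x)"
  using decaying_linear[of \<alpha> \<phi> \<psi> 1 "-1"] by simp

lemma decaying_exp: "decaying (- n) (\<lambda>x. c * exp (n * x))"
proof (coinduction arbitrary: c rule: decaying.coinduct)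
  case decaying
  have "exp_bound \<beta> (\<lambda>x. c * exp (n * x))" if "\<beta> < - n" for \<beta>
  proof -
    have "\<bar>c * exp (n * x)\<bar> \<le> \<bar>c\<bar> * (exp (- \<beta> * x) * (1 + exp (- (- n - \<beta>) * x)))" for x
    proof -
      have "exp (- \<beta> * x) * exp (- (- n - \<beta>) * x) = exp (n * x)"
        by (simp add: exp_add[symmetric] algebra_simps)
      then have "exp (n * x) \<le> exp (- \<beta> * x) * (1 + exp (- (- n - \<beta>) * x))"
        by (simp add: distrib_left)
      then show ?thesis by (simp add: abs_mult mult_left_mono)
    qed
    moreover have "0 \<le> - n - \<beta>" using that by simp
    ultimately show ?thesis unfolding exp_bound_def by blast
  qed
  then show ?case
    by (intro exI[of _ "\<lambda>x. c * exp (n * x)"] exI[of _ "\<lambda>x. (c * n) * exp (n * x)"])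
       (auto intro!: derivative_eq_intros)
qed

lemma decaying_zero: "decaying \<alpha> (\<lambda>x. 0)"
  using decaying_exp[of "- \<alpha>" 0] by simp

text \<open>Both G - P and G + P are nondecreasing. The form with primitives instead of integrals is
  convenient because the majorants below have explicit primitives.\<close>

lemma abs_increment_le:
  fixes P G :: "real \<Rightarrow> real"
  assumes "\<And>x. (P has_real_derivative p x) (at x)" "\<And>x. (G has_real_derivative g x) (at x)"
    and "\<And>x. \<bar>p x\<bar> \<le> g x" and "x \<le> y"
  shows "\<bar>P y - P x\<bar> \<le> G y - G x"
proof -
  have "(\<lambda>x. G x - P x) x \<le> (\<lambda>x. G x - P x) y"
    by (rule DERIV_nonneg_imp_nondecreasing[OF assms(4)])
       (metis DERIV_diff assms(1-3) abs_le_D1 diff_ge_0_iff_ge)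
  moreover have "(\<lambda>x. G x + P x) x \<le> (\<lambda>x. G x + P x) y"
  proof (rule DERIV_nonneg_imp_nondecreasing[OF assms(4)])
    fix u
    have "((\<lambda>x. G x + P x) has_real_derivative g u + p u) (at u)" "0 \<le> g u + p u"
      using assms(1,2) assms(3)[of u] by (auto intro!: DERIV_add)
    then show "\<exists>y. ((\<lambda>x. G x + P x) has_real_derivative y) (at u) \<and> 0 \<le> y" by blast
  qed
  ultimately show ?thesis by linarith
qed

text \<open>For c < \<alpha> the integrand exp (c x) \<phi> x is integrable at +\<infinity>, so P
  has a limit L there, and P - L is minus the tail integral, which inherits the decay. One and the
  same L has to serve all rates \<beta>.\<close>

lemma exp_bound_antiderivative_infinity:
  fixes P :: "real \<Rightarrow> real"
  assumes P: "\<And>x. (P has_real_derivative exp (c * x) * \<phi> x) (at x)"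
    and dec: "\<And>\<beta>. \<beta> < \<alpha> \<Longrightarrow> exp_bound \<beta> \<phi>" and "c < \<alpha>" "\<beta> < \<alpha>"
  shows "\<exists>L. \<forall>\<beta><\<alpha>. exp_bound \<beta> (\<lambda>x. exp (- c * x) * (P x - L))"
proof -
  \<comment> \<open>The subtracted term is the contribution of the upper end y. It is nonnegative,
    so both uses below drop it and keep a bound by the value at x alone.\<close>
  have key: "\<exists>C b. 0 \<le> C \<and> 0 \<le> b \<and> (\<forall>x y. x \<le> y \<longrightarrow>
      \<bar>P y - P x\<bar> \<le> C * (exp (- (\<beta> - c) * x) * (1 + exp (- b * x))) - C * (exp (- (\<beta> - c) * y) * (exp (- b * y) * ((\<beta> - c) / (\<beta> - c + b)) + 1)))"
    if \<beta>: "c < \<beta>" "\<beta> < \<alpha>" for \<beta>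
  proof -
    obtain C b where *: "0 \<le> C" "0 \<le> b" "\<And>x. \<bar>\<phi> x\<bar> \<le> C * (exp (- \<beta> * x) * (1 + exp (- b * x)))"
      using exp_boundE[OF dec[OF \<beta>(2)]] by metis
    define p where "p = \<beta> - c"
    have p: "p > 0" using \<beta> by (simp add: p_def)
    define G where "G x = - (C * (exp (- p * x) / p + exp (- (p + b) * x) / (p + b)))" for x
    have G: "(G has_real_derivative C * (exp (- p * x) + exp (- (p + b) * x))) (at x)" for x
    proof -
      have "((\<lambda>x. - (C * (exp (- p * x) / p + exp (- q * x) / q))) has_real_derivative C * (exp (- p * x) + exp (- q * x))) (at x)"
        if "q > 0" for q
        using p that by (auto intro!: derivative_eq_intros simp: field_simps)
      from this[of "p + b"] show ?thesis unfolding G_def using p *(2) by simp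
    qed
    have le: "\<bar>exp (c * x) * \<phi> x\<bar> \<le> C * (exp (- p * x) + exp (- (p + b) * x))" for x
    proof -
      have "\<bar>exp (c * x) * \<phi> x\<bar> = exp (c * x) * \<bar>\<phi> x\<bar>" by (simp add: abs_mult)
      also have "\<dots> \<le> exp (c * x) * (C * (exp (- \<beta> * x) * (1 + exp (- b * x))))"
        using *(3) by (intro mult_left_mono) auto
      also have "\<dots> = C * (exp (- p * x) + exp (- (p + b) * x))"
        by (simp add: p_def exp_add[symmetric] algebra_simps)
      finally show ?thesis .
    qed
    have "\<bar>P y - P x\<bar> \<le> C / p * (exp (- p * x) * (1 + exp (- b * x))) - C / p * (exp (- p * y) * (exp (- b * y) * (p / (p + b)) + 1))"
      if "x \<le> y" for x y
    proof -
      have "\<bar>P y - P x\<bar> \<le> G y - G x" by (rule abs_increment_le[OF P G le that])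
      also have "- G x \<le> C / p * (exp (- p * x) * (1 + exp (- b * x)))"
      proof -
        have "exp (- (p + b) * x) / (p + b) \<le> exp (- (p + b) * x) / p"
          using p *(2) by (intro divide_left_mono) auto
        then have "C * (exp (- p * x) / p + exp (- (p + b) * x) / (p + b)) \<le> C * (exp (- p * x) / p + exp (- (p + b) * x) / p)"
          using *(1) by (intro mult_left_mono) auto
        also have "\<dots> = C / p * (exp (- p * x) * (1 + exp (- b * x)))"
          by (simp add: exp_add[symmetric] algebra_simps add_divide_distrib)
        finally show ?thesis by (simp add: G_def)
      qed
      moreover have "G y = - (C / p * (exp (- p * y) * (exp (- b * y) * (p / (p + b)) + 1)))"
      proof -
        have "exp (- (p + b) * y) = exp (- p * y) * exp (- b * y)" by (simp add: exp_add[symmetric] algebra_simps)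
        then show ?thesis using p *(2) by (simp add: G_def field_simps)
      qed
      ultimately show ?thesis by linarith
    qed
    with * p show ?thesis unfolding p_def by (intro exI[of _ "C / (\<beta> - c)"] exI[of _ b]) auto
  qed
  \<comment> \<open>The midpoint is a rate strictly between c and \<alpha>; any such rate shows that
    P converges.\<close>
  define \<beta>0 where "\<beta>0 = (c + \<alpha>) / 2"
  have "Cauchy (\<lambda>n. P (real n))"
  proof -
    obtain C b where *: "0 \<le> C" "0 \<le> b" "\<And>x y. x \<le> y \<Longrightarrow>
      \<bar>P y - P x\<bar> \<le> C * (exp (- (\<beta>0 - c) * x) * (1 + exp (- b * x))) - C * (exp (- (\<beta>0 - c) * y) * (exp (- b * y) * ((\<beta>0 - c) / (\<beta>0 - c + b)) + 1))"
      using key[of \<beta>0] assms by (auto simp: \<beta>0_def)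
    have p: "\<beta>0 - c > 0" using assms by (simp add: \<beta>0_def)
    have bd: "\<bar>P y - P x\<bar> \<le> 2 * C * exp (- (\<beta>0 - c) * x)" if "0 \<le> x" "x \<le> y" for x y
    proof -
      have "0 \<le> C * (exp (- (\<beta>0 - c) * y) * (exp (- b * y) * ((\<beta>0 - c) / (\<beta>0 - c + b)) + 1))"
        using * p by (intro mult_nonneg_nonneg add_nonneg_nonneg) auto
      then have "\<bar>P y - P x\<bar> \<le> C * (exp (- (\<beta>0 - c) * x) * (1 + exp (- b * x)))"
        using *(3)[OF that(2)] by linarith
      also have "\<dots> \<le> C * (exp (- (\<beta>0 - c) * x) * 2)"
        using * that by (intro mult_left_mono) auto
      finally show ?thesis by (simp add: algebra_simps)
    qed
    have "((\<lambda>n. 2 * C * exp (- (\<beta>0 - c) * real n)) \<longlongrightarrow> 0) sequentially"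
    proof -
      have "filterlim (\<lambda>n. (\<beta>0 - c) * real n) at_top sequentially"
        using p by (intro filterlim_tendsto_pos_mult_at_top[OF tendsto_const _ filterlim_real_sequentially])
      then have "((\<lambda>n. exp (- ((\<beta>0 - c) * real n))) \<longlongrightarrow> 0) sequentially"
        by (intro filterlim_compose[OF exp_at_bot] filterlim_compose[OF filterlim_uminus_at_bot_at_top])
      then have "((\<lambda>n. 2 * C * exp (- ((\<beta>0 - c) * real n))) \<longlongrightarrow> 2 * C * 0) sequentially"
        by (rule tendsto_mult_left)
      then show ?thesis by (simp only: mult_minus_left mult_zero_right)
    qed
    then have lim: "\<forall>e>0. \<exists>N. \<forall>n\<ge>N. 2 * C * exp (- (\<beta>0 - c) * real n) < e"
      by (fastforce simp: LIMSEQ_iff)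
    show ?thesis
    proof (rule metric_CauchyI)
      fix e :: real assume "e > 0"
      then obtain N where N: "\<forall>n\<ge>N. 2 * C * exp (- (\<beta>0 - c) * real n) < e / 2"
        using lim half_gt_zero by blast
      have "\<bar>P (real n) - P (real N)\<bar> < e / 2" if "n \<ge> N" for n
        using bd[of "real N" "real n"] N that by fastforce
      then have "dist (P (real m)) (P (real n)) < e" if "m \<ge> N" "n \<ge> N" for m n
        using that unfolding dist_real_def by (smt (verit, ccfv_SIG) field_sum_of_halves)
      then show "\<exists>M. \<forall>m\<ge>M. \<forall>n\<ge>M. dist (P (real m)) (P (real n)) < e" by blast
    qed
  qed
  then obtain L where L: "(\<lambda>n. P (real n)) \<longlonglongrightarrow> L"
    using convergent_eq_Cauchy by blast
  have step: "exp_bound \<beta> (\<lambda>x. exp (- c * x) * (P x - L))" if \<beta>: "c < \<beta>" "\<beta> < \<alpha>" for \<beta>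
  proof -
    obtain C b where *: "0 \<le> C" "0 \<le> b" "\<And>x y. x \<le> y \<Longrightarrow>
      \<bar>P y - P x\<bar> \<le> C * (exp (- (\<beta> - c) * x) * (1 + exp (- b * x))) - C * (exp (- (\<beta> - c) * y) * (exp (- b * y) * ((\<beta> - c) / (\<beta> - c + b)) + 1))"
      using key[OF \<beta>] by blast
    have "\<bar>exp (- c * x) * (P x - L)\<bar> \<le> C * (exp (- \<beta> * x) * (1 + exp (- b * x)))" for x
    proof -
      have "(\<lambda>n. \<bar>P (real n) - P x\<bar>) \<longlonglongrightarrow> \<bar>L - P x\<bar>"
        using L by (intro tendsto_intros)
      moreover have "eventually (\<lambda>n. \<bar>P (real n) - P x\<bar> \<le> C * (exp (- (\<beta> - c) * x) * (1 + exp (- b * x)))) sequentially"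
      proof (rule eventually_mono[OF eventually_ge_at_top[of "nat \<lceil>x\<rceil>"]])
        fix n assume "nat \<lceil>x\<rceil> \<le> n"
        then have "x \<le> real n" by linarith
        moreover have "0 \<le> C * (exp (- (\<beta> - c) * real n) * (exp (- b * real n) * ((\<beta> - c) / (\<beta> - c + b)) + 1))"
          using * \<beta> by (intro mult_nonneg_nonneg add_nonneg_nonneg) auto
        ultimately show "\<bar>P (real n) - P x\<bar> \<le> C * (exp (- (\<beta> - c) * x) * (1 + exp (- b * x)))"
          using *(3)[of x "real n"] by linarith
      qed
      ultimately have "\<bar>L - P x\<bar> \<le> C * (exp (- (\<beta> - c) * x) * (1 + exp (- b * x)))"
        by (rule tendsto_upperbound) simp
      then have "exp (- c * x) * \<bar>L - P x\<bar> \<le> exp (- c * x) * (C * (exp (- (\<beta> - c) * x) * (1 + exp (- b * x))))"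
        by (rule mult_left_mono) simp
      also have "\<dots> = C * (exp (- \<beta> * x) * (1 + exp (- b * x)))"
        by (simp add: exp_add[symmetric] algebra_simps)
      finally show ?thesis by (simp add: abs_mult abs_minus_commute)
    qed
    with *(2) show ?thesis unfolding exp_bound_def by blast
  qed
  \<comment> \<open>A rate \<beta> \<le> c is inherited from a rate between c and \<alpha>, since
    smaller rates are weaker.\<close>
  have "exp_bound \<beta> (\<lambda>x. exp (- c * x) * (P x - L))" if "\<beta> < \<alpha>" for \<beta>
  proof (rule exp_bound_antimono)
    show "exp_bound ((max \<beta> c + \<alpha>) / 2) (\<lambda>x. exp (- c * x) * (P x - L))"
      using that assms(3) by (intro step) (auto simp: max_def)
    show "\<beta> \<le> (max \<beta> c + \<alpha>) / 2" using that by simp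
  qed
  then show ?thesis by blast
qed

text \<open>For \<beta> < c the integrand may grow like exp ((c - \<beta>) x), so the integral is
  taken from 0; the factor exp (- c x) brings its growth back to the rate \<beta>.\<close>

lemma exp_bound_antiderivative_zero:
  fixes P :: "real \<Rightarrow> real"
  assumes P: "\<And>x. (P has_real_derivative exp (c * x) * \<phi> x) (at x)"
    and dec: "exp_bound \<beta> \<phi>" and "\<beta> < c"
  shows "exp_bound \<beta> (\<lambda>x. exp (- c * x) * (P x - P 0))"
proof -
  define p where "p = c - \<beta>"
  have p: "p > 0" using assms by (simp add: p_def)
  \<comment> \<open>With b > p the exponent of the second summand does not vanish, so its primitive
    is again an exponential.\<close>
  obtain C b where *: "0 \<le> C" "p + 1 \<le> b" "\<And>x. \<bar>\<phi> x\<bar> \<le> C * (exp (- \<beta> * x) * (1 + exp (- b * x)))"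
    using exp_boundE[OF dec] by metis
  define G where "G x = C * (exp (p * x) / p - exp (- (b - p) * x) / (b - p))" for x
  have G: "(G has_real_derivative C * (exp (p * x) + exp (- (b - p) * x))) (at x)" for x
  proof -
    have "((\<lambda>x. C * (exp (p * x) / p - exp (- q * x) / q)) has_real_derivative C * (exp (p * x) + exp (- q * x))) (at x)"
      if "q > 0" for q
      using p that by (auto intro!: derivative_eq_intros simp: field_simps)
    from this[of "b - p"] show ?thesis unfolding G_def using *(2) by simp
  qed
  have le: "\<bar>exp (c * x) * \<phi> x\<bar> \<le> C * (exp (p * x) + exp (- (b - p) * x))" for x
  proof -
    have "\<bar>exp (c * x) * \<phi> x\<bar> = exp (c * x) * \<bar>\<phi> x\<bar>" by (simp add: abs_mult)
    also have "\<dots> \<le> exp (c * x) * (C * (exp (- \<beta> * x) * (1 + exp (- b * x))))"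
      using *(3) by (intro mult_left_mono) auto
    also have "\<dots> = C * (exp (p * x) + exp (- (b - p) * x))"
      by (simp add: p_def exp_add[symmetric] algebra_simps)
    finally show ?thesis .
  qed
  define K where "K = 1 / p + 1 / (b - p)"
  have K: "0 \<le> K" "1 / p \<le> K" "1 / (b - p) \<le> K" using p *(2) by (auto simp: K_def)
  have "\<bar>exp (- c * x) * (P x - P 0)\<bar> \<le> (2 * C * K) * (exp (- \<beta> * x) * (1 + exp (- b * x)))" for x
  proof -
    have "\<bar>P x - P 0\<bar> \<le> \<bar>G x - G 0\<bar>"
      using abs_increment_le[OF P G le, of 0 x] abs_increment_le[OF P G le, of x 0]
      by (cases "0 \<le> x") auto
    also have "\<dots> \<le> C * (K * (exp (p * x) + exp (- (b - p) * x) + 1))"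
    proof -
      have "\<bar>G x - G 0\<bar> = C * \<bar>exp (p * x) / p - exp (- (b - p) * x) / (b - p) - (1 / p - 1 / (b - p))\<bar>"
        using *(1) by (simp add: G_def abs_mult right_diff_distrib[symmetric])
      moreover have "\<bar>exp (p * x) / p - exp (- (b - p) * x) / (b - p) - (1 / p - 1 / (b - p))\<bar>
          \<le> K * (exp (p * x) + exp (- (b - p) * x) + 1)" (is "?l \<le> _")
      proof -
        have tri: "\<bar>a - b - (c - d)\<bar> \<le> a + b + (c + d)" if "0 \<le> a" "0 \<le> b" "0 \<le> c" "0 \<le> d" for a b c d :: real
          using that by linarith
        have "?l \<le> exp (p * x) / p + exp (- (b - p) * x) / (b - p) + K"
          unfolding K_def using p *(2) by (intro tri) auto
        also have "\<dots> = exp (p * x) * (1 / p) + exp (- (b - p) * x) * (1 / (b - p)) + K" by simp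
        also have "\<dots> \<le> exp (p * x) * K + exp (- (b - p) * x) * K + K"
          using K by (intro add_mono mult_left_mono) auto
        also have "\<dots> = K * (exp (p * x) + exp (- (b - p) * x) + 1)" by (simp add: algebra_simps)
        finally show ?thesis .
      qed
      ultimately show ?thesis using *(1) by (simp add: mult_left_mono)
    qed
    finally have "exp (- c * x) * \<bar>P x - P 0\<bar> \<le> exp (- c * x) * (C * (K * (exp (p * x) + exp (- (b - p) * x) + 1)))"
      by (rule mult_left_mono) simp
    also have "\<dots> = C * K * (exp (- \<beta> * x) * (1 + exp (- b * x) + exp (- p * x)))"
      by (simp add: p_def exp_add[symmetric] algebra_simps)
    also have "\<dots> \<le> C * K * (exp (- \<beta> * x) * (2 * (1 + exp (- b * x))))"
      using *(1,2) K p exp_bound_weight_mono[of p b x] by (intro mult_left_mono) auto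
    also have "\<dots> = (2 * C * K) * (exp (- \<beta> * x) * (1 + exp (- b * x)))"
      by (simp only: mult_ac)
    finally show ?thesis by (simp only: abs_mult abs_exp_cancel)
  qed
  moreover have "0 \<le> b" using * p by simp
  ultimately show ?thesis unfolding exp_bound_def by blast
qed

text \<open>Variation of constants: \<Phi> = exp (- c x) (P - L) with a primitive P of exp (c x)
  \<phi>. The base point of the integral is +\<infinity> if c < \<alpha> and 0 otherwise; in the
  second case every admissible \<beta> lies below c.\<close>

lemma decaying_antiderivative:
  assumes \<phi>: "decaying \<alpha> \<phi>"
  shows "\<exists>\<Phi>. decaying \<alpha> \<Phi> \<and> (\<forall>x. deriv \<Phi> x + c * \<Phi> x = \<phi> x)"
proof -
  have "isCont (\<lambda>x. exp (c * x) * \<phi> x) x" for x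
    using decayingD(1)[OF \<phi>] by (intro continuous_intros) (metis DERIV_isCont)
  then have "\<exists>P. \<forall>x. - \<infinity> < ereal x \<longrightarrow> ereal x < \<infinity> \<longrightarrow> (P has_vector_derivative (\<lambda>x. exp (c * x) * \<phi> x) x) (at x)"
    by (intro einterval_antiderivative) auto
  then obtain P where P: "\<And>x. (P has_real_derivative exp (c * x) * \<phi> x) (at x)"
    by (auto simp: has_real_derivative_iff_has_vector_derivative)
  have "\<exists>L. \<forall>\<beta><\<alpha>. exp_bound \<beta> (\<lambda>x. exp (- c * x) * (P x - L))"
  proof (cases "c < \<alpha>")
    case True
    show ?thesis
      by (rule exp_bound_antiderivative_infinity[OF P _ True, of "\<alpha> - 1"]) (use \<phi> decayingD in auto)
  next
    case False
    then show ?thesis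
      using exp_bound_antiderivative_zero[OF P] decayingD(3)[OF \<phi>] by (intro exI[of _ "P 0"]) auto
  qed
  then obtain L where L: "\<And>\<beta>. \<beta> < \<alpha> \<Longrightarrow> exp_bound \<beta> (\<lambda>x. exp (- c * x) * (P x - L))" by blast
  define \<Phi> where "\<Phi> x = exp (- c * x) * (P x - L)" for x
  have d: "(\<Phi> has_real_derivative \<phi> x - c * \<Phi> x) (at x)" for x
  proof -
    have "exp (- c * x) * (exp (c * x) * \<phi> x) = \<phi> x"
      by (simp add: mult.assoc[symmetric] exp_add[symmetric])
    then show ?thesis unfolding \<Phi>_def
      by (auto intro!: derivative_eq_intros P simp: algebra_simps)
  qed
  \<comment> \<open>Since \<Phi>' = \<phi> - c \<Phi>, differentiation maps a \<Phi> + \<psi> to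
    another expression of this shape. The whole family is the invariant of the coinduction; the case
    of interest is a = 1 and \<psi> = 0.\<close>
  have "decaying \<alpha> (\<lambda>x. a * \<Phi> x + \<psi> x)" if "decaying \<alpha> \<psi>" for a \<psi>
    using that
  proof (coinduction arbitrary: a \<psi> rule: decaying.coinduct)
    case decaying
    have "((\<lambda>x. a * \<Phi> x + \<psi> x) has_real_derivative (- c * a) * \<Phi> x + (a * \<phi> x + deriv \<psi> x)) (at x)" for x
      by (auto intro!: derivative_eq_intros d decayingD(1)[OF decaying] simp: algebra_simps)
    moreover have "exp_bound \<beta> (\<lambda>x. a * \<Phi> x + \<psi> x)" if "\<beta> < \<alpha>" for \<beta>
      using exp_bound_linear[OF L[OF that] decayingD(3)[OF decaying that], of a 1] by (simp add: \<Phi>_def)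
    moreover have "decaying \<alpha> (\<lambda>x. a * \<phi> x + deriv \<psi> x)"
      using decaying_linear[OF \<phi> decayingD(2)[OF decaying], of a 1] by simp
    ultimately show ?case
      by (rule_tac exI[of _ "\<lambda>x. a * \<Phi> x + \<psi> x"], rule_tac exI[of _ "\<lambda>x. (- c * a) * \<Phi> x + (a * \<phi> x + deriv \<psi> x)"])
        (intro conjI allI impI disjI1 exI[of _ "- c * a"] exI[of _ "\<lambda>x. a * \<phi> x + deriv \<psi> x"] refl; simp)
  qed
  from this[OF decaying_zero, of 1] have "decaying \<alpha> \<Phi>" by simp
  moreover have "deriv \<Phi> x + c * \<Phi> x = \<phi> x" for x using DERIV_imp_deriv[OF d, of x] by simp
  ultimately show ?thesis by blast
qed

section \<open>Summation over the nonzero integer vectors\<close>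

lemma summable_on_int_powr:
  assumes "s > 1"
  shows "(\<lambda>c::int. (1 + \<bar>real_of_int c\<bar>) powr - s) summable_on UNIV"
proof -
  let ?f = "\<lambda>c::int. (1 + \<bar>real_of_int c\<bar>) powr - s"
  have *: "(\<lambda>n. real (Suc n) powr - s) summable_on UNIV"
    using assms summable_Suc_iff[of "\<lambda>n. real n powr - s"]
    by (subst summable_on_UNIV_nonneg_real_iff) (auto simp: summable_real_powr_iff)
  have "?f summable_on (range int)"
    by (subst summable_on_reindex) (use * in \<open>auto simp: o_def add.commute\<close>)
  moreover have "?f summable_on (range (\<lambda>n. - int n))"
    by (subst summable_on_reindex) (use * in \<open>auto simp: o_def add.commute inj_on_def\<close>)
  moreover have "UNIV = range int \<union> range (\<lambda>n. - int n)"
    by (auto intro: int_cases2)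
  ultimately show ?thesis by (metis summable_on_union)
qed

definition lattice :: "(int \<times> int) set" where
  "lattice = UNIV - {(0, 0)}"

definition height :: "int \<times> int \<Rightarrow> real" where
  "height \<omega> = real_of_int (max \<bar>fst \<omega>\<bar> \<bar>snd \<omega>\<bar>)"

lemma height_ge_1: "\<omega> \<in> lattice \<Longrightarrow> 1 \<le> height \<omega>"
  by (cases \<omega>) (auto simp: lattice_def height_def)

lemma countable_lattice: "countable lattice" by simp

lemma infinite_lattice: "infinite lattice"
proof -
  have "infinite (UNIV :: (int \<times> int) set)"
    by (simp add: finite_prod)
  then show ?thesis unfolding lattice_def by (simp add: Diff_infinite_finite)
qed

text \<open>The maximum M dominates both coordinates, 1 + |c| \<le> 2M and 1 + |d| \<le> 2M, so
  M^(-3) splits into a product of two one-dimensional terms with exponent 3/2 > 1.\<close>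

lemma summable_height: "(\<lambda>\<omega>. inverse (height \<omega> ^ 3)) summable_on lattice"
proof -
  let ?f = "\<lambda>c::int. (1 + \<bar>real_of_int c\<bar>) powr - (3/2)"
  have s: "?f summable_on UNIV" using summable_on_int_powr[of "3/2"] by simp
  then have hs: "(?f has_sum infsum ?f UNIV) UNIV" by simp
  have "(\<lambda>(c,d). ?f c * ?f d) summable_on (Sigma UNIV (\<lambda>_. UNIV))"
    by (rule summable_on_SigmaI[where g = "\<lambda>c. ?f c * infsum ?f UNIV"])
      (auto intro: has_sum_cmult_right[OF hs] summable_on_cmult_left[OF s])
  then have "(\<lambda>(c,d). ?f c * ?f d) summable_on lattice"
    by (rule summable_on_subset_banach) auto
  then have "(\<lambda>\<omega>. 8 * (case \<omega> of (c,d) \<Rightarrow> ?f c * ?f d)) summable_on lattice"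
    by (rule summable_on_cmult_right)
  then show ?thesis
  proof (rule summable_on_comparison_test)
    fix \<omega> :: "int \<times> int" assume w: "\<omega> \<in> lattice"
    obtain c d where cd: "\<omega> = (c, d)" by (cases \<omega>)
    let ?M = "height \<omega>"
    have M: "?M \<ge> 1" using height_ge_1[OF w] .
    have X: "inverse (X ^ 3) = X powr - (3/2) * X powr - (3/2)" if "X > 0" for X :: real
    proof -
      have "X powr (3/2) * X powr (3/2) = X ^ 3"
        using that powr_add[of X "3/2" "3/2"] powr_numeral[of X "num.Bit1 num.One"] by simp
      then show ?thesis by (metis powr_minus inverse_mult_distrib)
    qed
    have "inverse (?M ^ 3) = 8 * inverse ((2 * ?M) ^ 3)" by (simp add: power_mult_distrib)
    also have "\<dots> = 8 * ((2 * ?M) powr - (3/2) * (2 * ?M) powr - (3/2))"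
      using M by (subst X) auto
    also have "\<dots> \<le> 8 * (?f c * ?f d)"
    proof -
      have "1 + \<bar>real_of_int c\<bar> \<le> 2 * ?M" "1 + \<bar>real_of_int d\<bar> \<le> 2 * ?M"
        using w by (auto simp: lattice_def height_def cd)
      then have "(2 * ?M) powr - (3/2) \<le> ?f c" "(2 * ?M) powr - (3/2) \<le> ?f d"
        by (auto intro!: powr_mono2')
      then show ?thesis by (intro mult_left_mono mult_mono) auto
    qed
    finally show "inverse (?M ^ 3) \<le> 8 * (case \<omega> of (c,d) \<Rightarrow> ?f c * ?f d)" by (simp add: cd)
  qed (auto simp: height_def)
qed

section \<open>Termwise differentiation of series in two real variables\<close>

definition has_wirtinger :: "(complex \<Rightarrow> complex) \<Rightarrow> complex \<Rightarrow> complex \<Rightarrow> complex \<Rightarrow> bool" where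
  "has_wirtinger f p q \<tau> \<longleftrightarrow> (f has_derivative (\<lambda>h. p * h + q * cnj h)) (at \<tau>)"

text \<open>One summable majorant for the terms and for both of their derivatives gives uniform
  convergence of the differentiated partial sums. The index set is enumerated to pass to an ordinary
  series, and absolute convergence makes the order irrelevant.\<close>

lemma has_wirtinger_infsum:
  fixes f p q :: "'i \<Rightarrow> complex \<Rightarrow> complex"
  assumes A: "countable A" "infinite A" and S: "open S" "convex S" "\<tau> \<in> S"
    and d: "\<And>i z. i \<in> A \<Longrightarrow> z \<in> S \<Longrightarrow> has_wirtinger (f i) (p i z) (q i z) z"
    and M: "M summable_on A"
    and b: "\<And>i z. i \<in> A \<Longrightarrow> z \<in> S \<Longrightarrow> norm (f i z) \<le> M i"
      "\<And>i z. i \<in> A \<Longrightarrow> z \<in> S \<Longrightarrow> norm (p i z) \<le> M i"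
      "\<And>i z. i \<in> A \<Longrightarrow> z \<in> S \<Longrightarrow> norm (q i z) \<le> M i"
  shows "has_wirtinger (\<lambda>z. \<Sum>\<^sub>\<infinity>i\<in>A. f i z) (\<Sum>\<^sub>\<infinity>i\<in>A. p i \<tau>) (\<Sum>\<^sub>\<infinity>i\<in>A. q i \<tau>) \<tau>"
proof -
  define e where "e = from_nat_into A"
  have e: "bij_betw e UNIV A" unfolding e_def using A by (rule bij_betw_from_nat_into)
  have eA: "e n \<in> A" for n using e by (auto simp: bij_betw_def)
  have Ms: "summable (\<lambda>n. M (e n))"
    using M summable_on_reindex_bij_betw[OF e, of M] by (simp add: summable_on_imp_summable)
  have inf: "summable (\<lambda>n. g (e n) z) \<and> (\<Sum>\<^sub>\<infinity>i\<in>A. g i z) = (\<Sum>n. g (e n) z)"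
    if "\<And>i. i \<in> A \<Longrightarrow> norm (g i z) \<le> M i" for g :: "'i \<Rightarrow> complex \<Rightarrow> complex" and z
  proof -
    have h: "summable (\<lambda>n. norm (g (e n) z))"
      by (rule summable_comparison_test[OF _ Ms]) (use that eA in auto)
    have "((\<lambda>n. g (e n) z) has_sum (\<Sum>n. g (e n) z)) UNIV"
      by (rule norm_summable_imp_has_sum[OF h summable_sums[OF summable_norm_cancel[OF h]]])
    then have "(\<Sum>\<^sub>\<infinity>n. g (e n) z) = (\<Sum>n. g (e n) z)" by (rule infsumI)
    moreover have "(\<Sum>\<^sub>\<infinity>i\<in>A. g i z) = (\<Sum>\<^sub>\<infinity>n. g (e n) z)"
      by (rule infsum_reindex_bij_betw[OF e, symmetric])
    ultimately show ?thesis using \<open>summable (\<lambda>n. norm (g (e n) z))\<close> summable_norm_cancel by auto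
  qed
  define P where "P z = (\<Sum>n. p (e n) z)" for z
  define Q where "Q z = (\<Sum>n. q (e n) z)" for z
  have uP: "uniform_limit S (\<lambda>n z. \<Sum>i<n. p (e i) z) P sequentially"
    unfolding P_def by (rule Weierstrass_m_test[OF _ Ms]) (use b eA in auto)
  have uQ: "uniform_limit S (\<lambda>n z. \<Sum>i<n. q (e i) z) Q sequentially"
    unfolding Q_def by (rule Weierstrass_m_test[OF _ Ms]) (use b eA in auto)
  have "\<exists>g. \<forall>z\<in>S. (\<lambda>n. f (e n) z) sums g z \<and> (g has_derivative (\<lambda>h. P z * h + Q z * cnj h)) (at z within S)"
  proof (rule has_derivative_series[OF S(2) _ _ S(3)])
    show "(f (e n) has_derivative (\<lambda>h. p (e n) z * h + q (e n) z * cnj h)) (at z within S)" if "z \<in> S" for n z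
      using d[OF eA that] unfolding has_wirtinger_def by (rule has_derivative_at_withinI)
    show "(\<lambda>n. f (e n) \<tau>) sums (\<Sum>n. f (e n) \<tau>)" using inf[of f \<tau>] b(1) S(3) by (simp add: summable_sums)
    show "\<forall>\<^sub>F n in sequentially. \<forall>x\<in>S. \<forall>h.
        norm ((\<Sum>i<n. p (e i) x * h + q (e i) x * cnj h) - (P x * h + Q x * cnj h)) \<le> \<epsilon> * norm h" if "\<epsilon> > 0" for \<epsilon>
    proof -
      have "\<forall>\<^sub>F n in sequentially. \<forall>x\<in>S. dist (\<Sum>i<n. p (e i) x) (P x) < \<epsilon> / 2"
        "\<forall>\<^sub>F n in sequentially. \<forall>x\<in>S. dist (\<Sum>i<n. q (e i) x) (Q x) < \<epsilon> / 2"
        using uP uQ that unfolding uniform_limit_iff by (meson half_gt_zero)+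
      then show ?thesis
      proof eventually_elim
        case (elim n)
        show ?case
        proof (intro ballI allI)
          fix x h assume x: "x \<in> S"
          have "(\<Sum>i<n. p (e i) x * h + q (e i) x * cnj h) - (P x * h + Q x * cnj h)
            = ((\<Sum>i<n. p (e i) x) - P x) * h + ((\<Sum>i<n. q (e i) x) - Q x) * cnj h"
            by (simp add: sum.distrib sum_distrib_right[symmetric] left_diff_distrib)
          also have "norm \<dots> \<le> norm ((\<Sum>i<n. p (e i) x) - P x) * norm h + norm ((\<Sum>i<n. q (e i) x) - Q x) * norm h"
            by (rule order.trans[OF norm_triangle_ineq]) (simp add: norm_mult)
          also have "\<dots> \<le> \<epsilon> / 2 * norm h + \<epsilon> / 2 * norm h"
            using elim x by (intro add_mono mult_right_mono) (auto simp: dist_norm intro: less_imp_le)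
          finally show "norm ((\<Sum>i<n. p (e i) x * h + q (e i) x * cnj h) - (P x * h + Q x * cnj h)) \<le> \<epsilon> * norm h"
            by simp
        qed
      qed
    qed
  qed
  then obtain g where "\<forall>z\<in>S. (\<lambda>n. f (e n) z) sums g z \<and> (g has_derivative (\<lambda>h. P z * h + Q z * cnj h)) (at z within S)"
    by (rule exE)
  then have g: "\<And>z. z \<in> S \<Longrightarrow> (\<lambda>n. f (e n) z) sums g z"
    "\<And>z. z \<in> S \<Longrightarrow> (g has_derivative (\<lambda>h. P z * h + Q z * cnj h)) (at z within S)"
    by simp_all
  have "(g has_derivative (\<lambda>h. P \<tau> * h + Q \<tau> * cnj h)) (at \<tau>)"
    using g(2)[OF S(3)] unfolding at_within_open[OF S(3) S(1)] .
  moreover have "g z = (\<Sum>\<^sub>\<infinity>i\<in>A. f i z)" if "z \<in> S" for z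
    using sums_unique[OF g(1)[OF that]] inf[of f z, OF b(1)[OF _ that]] by simp
  ultimately have "((\<lambda>z. \<Sum>\<^sub>\<infinity>i\<in>A. f i z) has_derivative (\<lambda>h. P \<tau> * h + Q \<tau> * cnj h)) (at \<tau>)"
    by (rule has_derivative_transform_within_open[OF _ S(1) S(3)])
  moreover have "(\<Sum>\<^sub>\<infinity>i\<in>A. p i \<tau>) = P \<tau>" "(\<Sum>\<^sub>\<infinity>i\<in>A. q i \<tau>) = Q \<tau>"
    using inf[of p \<tau>, OF b(2)[OF _ S(3)]] inf[of q \<tau>, OF b(3)[OF _ S(3)]] by (simp_all add: P_def Q_def)
  ultimately show ?thesis unfolding has_wirtinger_def by simp
qed

section \<open>Wirtinger calculus and Eisenstein series\<close>

lemma has_wirtinger_const [intro]: "has_wirtinger (\<lambda>z. c) 0 0 \<tau>"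
  by (simp add: has_wirtinger_def)

lemma has_wirtinger_id [intro]: "has_wirtinger (\<lambda>z. z) 1 0 \<tau>"
  by (simp add: has_wirtinger_def)

lemma has_wirtinger_cnj_id [intro]: "has_wirtinger cnj 0 1 \<tau>"
  unfolding has_wirtinger_def by (auto intro: has_derivative_cnj)

lemma has_wirtinger_add:
  assumes "has_wirtinger f p q \<tau>" "has_wirtinger g r s \<tau>"
  shows "has_wirtinger (\<lambda>z. f z + g z) (p + r) (q + s) \<tau>"
  using has_derivative_add[OF assms[unfolded has_wirtinger_def]]
  unfolding has_wirtinger_def by (rule has_derivative_eq_rhs) (auto simp: algebra_simps)

lemma has_wirtinger_mult:
  assumes "has_wirtinger f p q \<tau>" "has_wirtinger g r s \<tau>"
  shows "has_wirtinger (\<lambda>z. f z * g z) (p * g \<tau> + f \<tau> * r) (q * g \<tau> + f \<tau> * s) \<tau>"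
  using has_derivative_mult[OF assms[unfolded has_wirtinger_def]]
  unfolding has_wirtinger_def by (rule has_derivative_eq_rhs) (auto simp: algebra_simps)

lemma has_wirtinger_powi:
  assumes "has_wirtinger f p q \<tau>" "f \<tau> \<noteq> 0"
  shows "has_wirtinger (\<lambda>z. f z powi n) (of_int n * f \<tau> powi (n - 1) * p) (of_int n * f \<tau> powi (n - 1) * q) \<tau>"
  using has_derivative_power_int[OF assms(2) assms(1)[unfolded has_wirtinger_def]]
  unfolding has_wirtinger_def by (rule has_derivative_eq_rhs) (auto simp: algebra_simps)

lemma has_wirtinger_inverse:
  assumes "has_wirtinger f p q \<tau>" "f \<tau> \<noteq> 0"
  shows "has_wirtinger (\<lambda>z. inverse (f z)) (- p / (f \<tau>)\<^sup>2) (- q / (f \<tau>)\<^sup>2) \<tau>"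
  using Deriv.has_derivative_inverse[OF assms(2) assms(1)[unfolded has_wirtinger_def]] assms(2)
  unfolding has_wirtinger_def
  by (elim has_derivative_eq_rhs) (auto simp: field_simps power2_eq_square)

lemma has_wirtinger_cong:
  "has_wirtinger f p q \<tau> \<Longrightarrow> p = p' \<Longrightarrow> q = q' \<Longrightarrow> has_wirtinger f p' q' \<tau>"
  by simp

lemma has_wirtinger_cnj:
  assumes "has_wirtinger f p q \<tau>"
  shows "has_wirtinger (\<lambda>z. cnj (f z)) (cnj q) (cnj p) \<tau>"
  using has_derivative_cnj[OF assms[unfolded has_wirtinger_def]]
  unfolding has_wirtinger_def by (rule has_derivative_eq_rhs) (auto simp: algebra_simps)

text \<open>As \<open>of_real (g z)\<close> is real, its differential h \<mapsto> p h + q cnj h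
  takes real values and equals its own real part. This turns the real chain rule into a rule for p
  and q.\<close>

lemma has_wirtinger_of_real_compose:
  fixes g :: "complex \<Rightarrow> real"
  assumes g: "has_wirtinger (\<lambda>z. of_real (g z)) p q \<tau>"
    and \<chi>: "(\<chi> has_real_derivative \<chi>') (at (g \<tau>))"
  shows "has_wirtinger (\<lambda>z. of_real (\<chi> (g z))) (of_real \<chi>' * p) (of_real \<chi>' * q) \<tau>"
proof -
  have g': "(g has_derivative (\<lambda>h. Re (p * h + q * cnj h))) (at \<tau>)"
    using has_derivative_Re[OF g[unfolded has_wirtinger_def]] by simp
  then have "((\<lambda>z. of_real (g z) :: complex) has_derivative (\<lambda>h. of_real (Re (p * h + q * cnj h)))) (at \<tau>)"
    by (rule has_derivative_of_real)
  then have *: "(\<lambda>h. of_real (Re (p * h + q * cnj h))) = (\<lambda>h. p * h + q * cnj h)"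
    using g unfolding has_wirtinger_def by (rule has_derivative_unique)
  have "((\<lambda>z. \<chi> (g z)) has_derivative (\<lambda>h. \<chi>' * Re (p * h + q * cnj h))) (at \<tau>)"
    using has_derivative_compose[OF g' \<chi>[unfolded has_field_derivative_def]] .
  then have "((\<lambda>z. of_real (\<chi> (g z)) :: complex) has_derivative (\<lambda>h. of_real (\<chi>' * Re (p * h + q * cnj h)))) (at \<tau>)"
    by (rule has_derivative_of_real)
  moreover have "(\<lambda>h. of_real (\<chi>' * Re (p * h + q * cnj h)) :: complex) = (\<lambda>h. of_real \<chi>' * p * h + of_real \<chi>' * q * cnj h)"
  proof
    fix h
    have "of_real (\<chi>' * Re (p * h + q * cnj h)) = of_real \<chi>' * (p * h + q * cnj h)"
      using fun_cong[OF *, of h] by (simp only: of_real_mult)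
    then show "of_real (\<chi>' * Re (p * h + q * cnj h)) = of_real \<chi>' * p * h + of_real \<chi>' * q * cnj h"
      by (simp only: distrib_left mult.assoc)
  qed
  ultimately show ?thesis unfolding has_wirtinger_def by simp
qed

lemma has_wirtinger_Im: "has_wirtinger (\<lambda>z. of_real (Im z)) (1 / (2 * \<i>)) (- 1 / (2 * \<i>)) \<tau>"
proof -
  have "((\<lambda>z. of_real (Im z)) has_derivative (\<lambda>h. of_real (Im h))) (at \<tau>)"
    by (auto intro!: derivative_eq_intros)
  moreover have "(\<lambda>h. complex_of_real (Im h)) = (\<lambda>h. 1 / (2 * \<i>) * h + - 1 / (2 * \<i>) * cnj h)"
    by (rule ext) (simp add: complex_eq_iff)
  ultimately show ?thesis unfolding has_wirtinger_def by (rule has_derivative_eq_rhs)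
qed

section \<open>Terms of the Eisenstein-type series\<close>

definition ell :: "int \<times> int \<Rightarrow> complex \<Rightarrow> complex" where
  "ell \<omega> \<tau> = of_int (fst \<omega>) * \<tau> + of_int (snd \<omega>)"

text \<open>The quotient y l / cnj l has absolute value y and transforms with weight -2, while |l|^2
  / y is invariant when \<tau> and the lattice vector are transformed together. Hence j shifts the
  weight by -2j without affecting the decay in l, and \<chi> carries everything that the weight
  leaves open.\<close>

definition eis_term :: "int \<Rightarrow> int \<Rightarrow> (real \<Rightarrow> real) \<Rightarrow> int \<times> int \<Rightarrow> complex \<Rightarrow> complex" where
  "eis_term \<kappa> j \<chi> \<omega> \<tau> = ell \<omega> \<tau> powi (- \<kappa>) * (of_real (Im \<tau>) * ell \<omega> \<tau> / cnj (ell \<omega> \<tau>)) powi j *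
     of_real (\<chi> (ln ((cmod (ell \<omega> \<tau>))\<^sup>2 / Im \<tau>)))"

text \<open>If |d| \<ge> 2B|c|, the real part is at least |d| / 2; otherwise the height is at most
  2B|c| and the imaginary part, at least Y|c|, suffices. The bound is uniform on a half strip, as is
  needed for local uniform convergence and for growth.\<close>

lemma ell_ge:
  assumes "\<bar>Re \<tau>\<bar> \<le> B" "1 \<le> B" "Y \<le> Im \<tau>" "0 < Y"
  shows "min (1 / 2) (Y / (2 * B)) * height \<omega> \<le> cmod (ell \<omega> \<tau>)"
proof -
  obtain c d where \<omega>: "\<omega> = (c, d)" by (cases \<omega>)
  define c' d' where "c' = \<bar>real_of_int c\<bar>" and "d' = \<bar>real_of_int d\<bar>"
  have h: "height \<omega> = max c' d'" by (simp add: height_def \<omega> c'_def d'_def)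
  have re: "d' - B * c' \<le> cmod (ell \<omega> \<tau>)"
  proof -
    have "d' - B * c' \<le> d' - \<bar>Re \<tau>\<bar> * c'" using assms(1) by (simp add: mult_right_mono c'_def)
    also have "\<dots> \<le> \<bar>Re (ell \<omega> \<tau>)\<bar>"
    proof -
      have "\<bar>Re \<tau>\<bar> * c' = \<bar>real_of_int c * Re \<tau>\<bar>" by (simp add: c'_def abs_mult mult.commute)
      moreover have "Re (ell \<omega> \<tau>) = real_of_int c * Re \<tau> + real_of_int d" by (simp add: ell_def \<omega>)
      ultimately show ?thesis unfolding d'_def by linarith
    qed
    also have "\<dots> \<le> cmod (ell \<omega> \<tau>)" by (rule abs_Re_le_cmod)
    finally show ?thesis .
  qed
  have im: "Y * c' \<le> cmod (ell \<omega> \<tau>)"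
  proof -
    have "Y * c' \<le> Im \<tau> * c'" using assms by (simp add: mult_right_mono c'_def)
    also have "\<dots> = \<bar>Im (ell \<omega> \<tau>)\<bar>" using assms by (simp add: ell_def \<omega> c'_def abs_mult)
    also have "\<dots> \<le> cmod (ell \<omega> \<tau>)" by (rule abs_Im_le_cmod)
    finally show ?thesis .
  qed
  have pos: "0 \<le> c'" "0 \<le> d'" by (auto simp: c'_def d'_def)
  show ?thesis
  proof (cases "2 * B * c' \<le> d'")
    case True
    have "c' \<le> d'"
    proof -
      have "1 * c' \<le> 2 * B * c'" using assms pos by (intro mult_right_mono) auto
      with True show ?thesis by simp
    qed
    then have "min (1 / 2) (Y / (2 * B)) * height \<omega> \<le> 1 / 2 * d'"
      unfolding h using pos by (intro mult_mono) auto
    also have "\<dots> \<le> d' - B * c'" using True by simp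
    finally show ?thesis using re by linarith
  next
    case False
    have "1 * c' \<le> 2 * B * c'" using assms pos by (intro mult_right_mono) auto
    then have "height \<omega> \<le> 2 * B * c'" unfolding h using False by simp
    then have "min (1 / 2) (Y / (2 * B)) * height \<omega> \<le> Y / (2 * B) * (2 * B * c')"
      using assms pos h by (intro mult_mono) auto
    also have "\<dots> = Y * c'" using assms by simp
    finally show ?thesis using im by linarith
  qed
qed

lemma ell_nonzero: "\<omega> \<in> lattice \<Longrightarrow> 0 < Im \<tau> \<Longrightarrow> ell \<omega> \<tau> \<noteq> 0"
  by (cases \<omega>) (auto simp: ell_def lattice_def complex_eq_iff)

text \<open>The first entry of \<omega> is c = (l - m) / (2 i y) with m = cnj l. Hence the
  derivative of ln (|l|^2 / y) in \<tau> is - m / (2 i y l), a multiple of the inverse of W = y l /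
  m, and the derivative in cnj \<tau> is W / (2 i y^2). Both derivatives are therefore terms of the
  same kind with j shifted by one, in the first case up to the weight correction (\<kappa> - 2j) /
  y.\<close>

lemma has_wirtinger_eis_term:
  assumes \<omega>: "\<omega> \<in> lattice" and \<tau>: "0 < Im \<tau>" and \<chi>: "decaying \<alpha> \<chi>"
  shows "has_wirtinger (eis_term \<kappa> j \<chi> \<omega>)
    ((eis_term \<kappa> (j - 1) (\<lambda>x. of_int (\<kappa> - j) * \<chi> x - deriv \<chi> x) \<omega> \<tau>
      - of_int (\<kappa> - 2 * j) / of_real (Im \<tau>) * eis_term \<kappa> j \<chi> \<omega> \<tau>) / (2 * \<i>))
    (eis_term \<kappa> (j + 1) (\<lambda>x. deriv \<chi> x - of_int j * \<chi> x) \<omega> \<tau> / (2 * \<i> * (of_real (Im \<tau>))\<^sup>2)) \<tau>"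
proof -
  define c where "c = complex_of_int (fst \<omega>)"
  define l where "l = ell \<omega> \<tau>"
  define m where "m = cnj l"
  define y where "y = complex_of_real (Im \<tau>)"
  have l: "l \<noteq> 0" "m \<noteq> 0" using ell_nonzero[OF \<omega> \<tau>] by (auto simp: l_def m_def)
  have y: "y \<noteq> 0" using \<tau> by (simp add: y_def)
  have ci: "c * (2 * \<i> * y) = l - m"
    by (simp add: c_def l_def m_def y_def ell_def complex_eq_iff)
  have c: "c = (l - m) / (2 * \<i> * y)" using ci y by (simp add: field_simps)
  have hl: "has_wirtinger (ell \<omega>) c 0 \<tau>"
    unfolding ell_def c_def
    by (rule has_wirtinger_cong, rule has_wirtinger_add, rule has_wirtinger_mult) auto
  have hm: "has_wirtinger (\<lambda>z. cnj (ell \<omega> z)) 0 c \<tau>"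
    using has_wirtinger_cnj[OF hl] by (simp add: c_def)
  have hQ: "has_wirtinger (\<lambda>z. of_real ((cmod (ell \<omega> z))\<^sup>2 / Im z)) (l * m / y * (c / l - 1 / (2 * \<i> * y))) (l * m / y * (c / m + 1 / (2 * \<i> * y))) \<tau>"
  proof -
    have "has_wirtinger (\<lambda>z. (ell \<omega> z * cnj (ell \<omega> z)) * inverse (of_real (Im z)))
       (l * m / y * (c / l - 1 / (2 * \<i> * y))) (l * m / y * (c / m + 1 / (2 * \<i> * y))) \<tau>"
      by (rule has_wirtinger_cong,
          rule has_wirtinger_mult[OF has_wirtinger_mult[OF hl hm] has_wirtinger_inverse[OF has_wirtinger_Im]])
         (use \<tau> l y in \<open>auto simp: l_def[symmetric] m_def[symmetric] y_def[symmetric] field_simps power2_eq_square\<close>)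
    moreover have "(ell \<omega> z * cnj (ell \<omega> z)) * inverse (of_real (Im z)) = of_real ((cmod (ell \<omega> z))\<^sup>2 / Im z)" for z
      by (simp add: complex_norm_square[symmetric] divide_inverse)
    ultimately show ?thesis by simp
  qed
  have Qpos: "0 < (cmod (ell \<omega> \<tau>))\<^sup>2 / Im \<tau>" using l \<tau> by (simp add: l_def)
  have hln: "has_wirtinger (\<lambda>z. of_real (ln ((cmod (ell \<omega> z))\<^sup>2 / Im z))) (c / l - 1 / (2 * \<i> * y)) (c / m + 1 / (2 * \<i> * y)) \<tau>"
  proof -
    have Q: "of_real ((cmod (ell \<omega> \<tau>))\<^sup>2 / Im \<tau>) = l * m / y"
      by (simp only: l_def m_def y_def complex_norm_square of_real_divide)
    have "has_wirtinger (\<lambda>z. of_real (ln ((cmod (ell \<omega> z))\<^sup>2 / Im z)))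
        (inverse (l * m / y) * (l * m / y * (c / l - 1 / (2 * \<i> * y))))
        (inverse (l * m / y) * (l * m / y * (c / m + 1 / (2 * \<i> * y)))) \<tau>"
      using has_wirtinger_of_real_compose[OF hQ DERIV_ln[OF Qpos]] by (simp only: of_real_inverse Q)
    moreover have "inverse (l * m / y) * (l * m / y * u) = u" for u using l y by simp
    ultimately show ?thesis by simp
  qed
  have l0: "ell \<omega> \<tau> = l" by (simp add: l_def)
  define X where "X = ln ((cmod l)\<^sup>2 / Im \<tau>)"
  have h\<chi>: "has_wirtinger (\<lambda>z. of_real (\<chi> (ln ((cmod (ell \<omega> z))\<^sup>2 / Im z))))
      (of_real (deriv \<chi> X) * (c / l - 1 / (2 * \<i> * y))) (of_real (deriv \<chi> X) * (c / m + 1 / (2 * \<i> * y))) \<tau>"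
    unfolding X_def l_def by (rule has_wirtinger_of_real_compose[OF hln[unfolded l_def] decayingD(1)[OF \<chi>]])
  define W where "W = y * l / m"
  have W: "W \<noteq> 0" using l y by (simp add: W_def)
  have hW: "has_wirtinger (\<lambda>z. of_real (Im z) * ell \<omega> z / cnj (ell \<omega> z)) (W * (1 / (2 * \<i> * y) + c / l)) (W * (- 1 / (2 * \<i> * y) - c / m)) \<tau>"
    unfolding divide_inverse[of "of_real (Im _) * ell \<omega> _"]
    by (rule has_wirtinger_cong,
        rule has_wirtinger_mult[OF has_wirtinger_mult[OF has_wirtinger_Im hl] has_wirtinger_inverse[OF hm]])
       (use l y in \<open>auto simp: W_def l_def[symmetric] m_def[symmetric] y_def[symmetric] field_simps power2_eq_square\<close>)
  note rw = l0 y_def[symmetric] m_def[symmetric] W_def[symmetric] X_def[symmetric]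
  define L J where "L = l powi (- \<kappa>)" and "J = W powi j"
  have pw: "l powi (- \<kappa> - 1) = L / l" "W powi (j - 1) = J / W" "W powi (j + 1) = J * W"
    using l W by (auto simp: L_def J_def power_int_diff power_int_add)
  have h1: "has_wirtinger (\<lambda>z. ell \<omega> z powi (- \<kappa>)) (of_int (- \<kappa>) * (L / l) * c) (of_int (- \<kappa>) * (L / l) * 0) \<tau>"
    using has_wirtinger_powi[OF hl, of "- \<kappa>"] l(1) unfolding rw pw L_def[symmetric] by simp
  have h2: "has_wirtinger (\<lambda>z. (of_real (Im z) * ell \<omega> z / cnj (ell \<omega> z)) powi j)
      (of_int j * (J / W) * (W * (1 / (2 * \<i> * y) + c / l))) (of_int j * (J / W) * (W * (- 1 / (2 * \<i> * y) - c / m))) \<tau>"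
    using has_wirtinger_powi[OF hW, of j] W unfolding rw pw J_def[symmetric] by simp
  have "has_wirtinger (eis_term \<kappa> j \<chi> \<omega>)
    (L * J * (of_real (\<chi> X) * (- of_int \<kappa> * c / l + of_int j * (1 / (2 * \<i> * y) + c / l)) + of_real (deriv \<chi> X) * (c / l - 1 / (2 * \<i> * y))))
    (L * J * (of_real (\<chi> X) * (of_int j * (- 1 / (2 * \<i> * y) - c / m)) + of_real (deriv \<chi> X) * (c / m + 1 / (2 * \<i> * y)))) \<tau>"
    unfolding eis_term_def[abs_def]
  proof (rule has_wirtinger_cong[OF has_wirtinger_mult[OF has_wirtinger_mult[OF h1 h2] h\<chi>]],
      unfold rw L_def[symmetric] J_def[symmetric])
    have JW: "of_int j * (J / W) * (W * u) = of_int j * J * u" for u using W by simp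
    show "(of_int (- \<kappa>) * (L / l) * c * J + L * (of_int j * (J / W) * (W * (1 / (2 * \<i> * y) + c / l)))) * of_real (\<chi> X)
       + L * J * (of_real (deriv \<chi> X) * (c / l - 1 / (2 * \<i> * y)))
      = L * J * (of_real (\<chi> X) * (- of_int \<kappa> * c / l + of_int j * (1 / (2 * \<i> * y) + c / l)) + of_real (deriv \<chi> X) * (c / l - 1 / (2 * \<i> * y)))"
      unfolding JW by (simp add: algebra_simps)
    show "(of_int (- \<kappa>) * (L / l) * 0 * J + L * (of_int j * (J / W) * (W * (- 1 / (2 * \<i> * y) - c / m)))) * of_real (\<chi> X)
       + L * J * (of_real (deriv \<chi> X) * (c / m + 1 / (2 * \<i> * y)))
      = L * J * (of_real (\<chi> X) * (of_int j * (- 1 / (2 * \<i> * y) - c / m)) + of_real (deriv \<chi> X) * (c / m + 1 / (2 * \<i> * y)))"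
      unfolding JW by (simp add: algebra_simps)
  qed
  then show ?thesis
  proof (rule has_wirtinger_cong, unfold eis_term_def rw pw L_def[symmetric] J_def[symmetric])
    show "L * J * (of_real (\<chi> X) * (- of_int \<kappa> * c / l + of_int j * (1 / (2 * \<i> * y) + c / l)) + of_real (deriv \<chi> X) * (c / l - 1 / (2 * \<i> * y)))
      = (L * (J / W) * of_real (of_int (\<kappa> - j) * \<chi> X - deriv \<chi> X) - of_int (\<kappa> - 2 * j) / y * (L * J * of_real (\<chi> X))) / (2 * \<i>)"
      using l y by (simp add: c W_def field_simps)
    show "L * J * (of_real (\<chi> X) * (of_int j * (- 1 / (2 * \<i> * y) - c / m)) + of_real (deriv \<chi> X) * (c / m + 1 / (2 * \<i> * y)))
      = L * (J * W) * of_real (deriv \<chi> X - of_int j * \<chi> X) / (2 * \<i> * y\<^sup>2)"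
      using l y by (simp add: c W_def field_simps power2_eq_square)
  qed
qed

section \<open>Convergence, differentiation and modularity of the series\<close>

definition eis :: "int \<Rightarrow> int \<Rightarrow> (real \<Rightarrow> real) \<Rightarrow> complex \<Rightarrow> complex" where
  "eis \<kappa> j \<chi> \<tau> = (\<Sum>\<^sub>\<infinity>\<omega>\<in>lattice. eis_term \<kappa> j \<chi> \<omega> \<tau>)"

lemma norm_eis_term:
  assumes "0 < Im \<tau>" "\<omega> \<in> lattice"
  shows "norm (eis_term \<kappa> j \<chi> \<omega> \<tau>) = cmod (ell \<omega> \<tau>) powi (- \<kappa>) * Im \<tau> powi j * \<bar>\<chi> (ln ((cmod (ell \<omega> \<tau>))\<^sup>2 / Im \<tau>))\<bar>"
  using assms ell_nonzero[OF assms(2,1)]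
  by (simp add: eis_term_def norm_mult norm_power_int norm_divide)

text \<open>The rate \<beta> = \<alpha> - 1/2 leads to |l|^(-\<kappa> - 2\<beta>) = |l|^(1 -
  \<kappa> - 2\<alpha>), and the hypothesis makes this exponent at most -3, as in
  \<open>summable_height\<close>. The bound is explicit in Im \<tau> and \<delta> because it serves
  two purposes: local uniformity, with y in a compact set, and growth as y tends to
  \<infinity>.\<close>

lemma eis_term_bound:
  assumes \<chi>: "decaying \<alpha> \<chi>" and \<kappa>: "4 \<le> real_of_int \<kappa> + 2 * \<alpha>"
  shows "\<exists>C b. 0 \<le> C \<and> 0 \<le> b \<and> (\<forall>\<omega>\<in>lattice. \<forall>\<tau> \<delta>. 0 < Im \<tau> \<longrightarrow> 0 < \<delta> \<longrightarrow> \<delta> * height \<omega> \<le> cmod (ell \<omega> \<tau>) \<longrightarrow>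
    norm (eis_term \<kappa> j \<chi> \<omega> \<tau>) \<le> C * (Im \<tau> powi j * Im \<tau> powr (\<alpha> - 1/2) * \<delta> powr (1 - real_of_int \<kappa> - 2 * \<alpha>) * (1 + (Im \<tau> / \<delta>\<^sup>2) powr b)) * inverse (height \<omega> ^ 3))"
proof -
  define \<beta> where "\<beta> = \<alpha> - 1/2"
  have "\<beta> < \<alpha>" by (simp add: \<beta>_def)
  obtain C b where C: "0 \<le> C" "0 \<le> b" "\<And>x. \<bar>\<chi> x\<bar> \<le> C * (exp (- \<beta> * x) * (1 + exp (- b * x)))"
    by (rule exp_boundE[OF decayingD(3)[OF \<chi> \<open>\<beta> < \<alpha>\<close>], of 0]) (rule that; assumption)
  have "norm (eis_term \<kappa> j \<chi> \<omega> \<tau>) \<le> C * (Im \<tau> powi j * Im \<tau> powr \<beta> * \<delta> powr (1 - real_of_int \<kappa> - 2 * \<alpha>) * (1 + (Im \<tau> / \<delta>\<^sup>2) powr b)) * inverse (height \<omega> ^ 3)"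
    if \<omega>: "\<omega> \<in> lattice" and y: "0 < Im \<tau>" and \<delta>: "0 < \<delta>" and le: "\<delta> * height \<omega> \<le> cmod (ell \<omega> \<tau>)" for \<omega> \<tau> \<delta>
  proof -
    define l where "l = cmod (ell \<omega> \<tau>)"
    define Q where "Q = l\<^sup>2 / Im \<tau>"
    have h: "1 \<le> height \<omega>" by (rule height_ge_1[OF \<omega>])
    have l: "0 < l" using ell_nonzero[OF \<omega> y] by (simp add: l_def)
    have Q: "0 < Q" using l y by (simp add: Q_def)
    have \<delta>l: "\<delta> \<le> l"
      using mult_left_mono[OF h, of \<delta>] \<delta> le unfolding l_def by linarith
    have e1: "exp (- \<beta> * ln Q) = l powr (- 2 * \<beta>) * Im \<tau> powr \<beta>"
    proof -
      have "ln Q = 2 * ln l - ln (Im \<tau>)" using l y by (simp add: Q_def ln_div ln_realpow)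
      then have "- \<beta> * ln Q = - 2 * \<beta> * ln l + \<beta> * ln (Im \<tau>)" by (simp add: right_diff_distrib)
      then have "exp (- \<beta> * ln Q) = exp (- 2 * \<beta> * ln l) * exp (\<beta> * ln (Im \<tau>))"
        by (simp only: exp_add)
      then show ?thesis using l y unfolding powr_def by simp
    qed
    \<comment> \<open>The lower bound \<delta> of |l| bounds ln Q from below, so the growth of
      \<chi> at -\<infinity> costs only a power of y.\<close>
    have e2: "exp (- b * ln Q) \<le> (Im \<tau> / \<delta>\<^sup>2) powr b"
    proof -
      have "\<delta>\<^sup>2 / Im \<tau> \<le> Q" unfolding Q_def using \<delta>l \<delta> y by (intro divide_right_mono power_mono) auto
      then have "Q powr (- b) \<le> (\<delta>\<^sup>2 / Im \<tau>) powr (- b)"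
        using C(2) \<delta> y by (intro powr_mono2') auto
      also have "\<dots> = (Im \<tau> / \<delta>\<^sup>2) powr b" using \<delta> y by (simp add: powr_minus powr_divide)
      finally show ?thesis using Q by (simp add: powr_def)
    qed
    have e3: "l powi (- \<kappa>) * l powr (- 2 * \<beta>) \<le> \<delta> powr (1 - real_of_int \<kappa> - 2 * \<alpha>) * inverse (height \<omega> ^ 3)"
    proof -
      have "l powi (- \<kappa>) = l powr (- real_of_int \<kappa>)" using l powr_real_of_int'[of l "- \<kappa>"] by simp
      then have "l powi (- \<kappa>) * l powr (- 2 * \<beta>) = l powr (1 - real_of_int \<kappa> - 2 * \<alpha>)"
        by (simp add: powr_add[symmetric] \<beta>_def algebra_simps)
      also have "\<dots> \<le> (\<delta> * height \<omega>) powr (1 - real_of_int \<kappa> - 2 * \<alpha>)"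
        using le \<delta> h \<kappa> unfolding l_def by (intro powr_mono2') auto
      also have "\<dots> = \<delta> powr (1 - real_of_int \<kappa> - 2 * \<alpha>) * height \<omega> powr (1 - real_of_int \<kappa> - 2 * \<alpha>)"
        using \<delta> h by (simp add: powr_mult)
      also have "\<dots> \<le> \<delta> powr (1 - real_of_int \<kappa> - 2 * \<alpha>) * height \<omega> powr (- 3)"
        using h \<kappa> by (intro mult_left_mono powr_mono) auto
      also have "height \<omega> powr (- 3) = inverse (height \<omega> ^ 3)"
        using h powr_numeral[of "height \<omega>" "num.Bit1 num.One"] by (simp add: powr_minus)
      finally show ?thesis .
    qed
    have "\<bar>\<chi> (ln Q)\<bar> \<le> C * (l powr (- 2 * \<beta>) * Im \<tau> powr \<beta> * (1 + (Im \<tau> / \<delta>\<^sup>2) powr b))"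
    proof -
      have "\<bar>\<chi> (ln Q)\<bar> \<le> C * (exp (- \<beta> * ln Q) * (1 + exp (- b * ln Q)))" by (rule C(3))
      also have "\<dots> \<le> C * (exp (- \<beta> * ln Q) * (1 + (Im \<tau> / \<delta>\<^sup>2) powr b))"
        using C(1) e2 by (intro mult_left_mono) auto
      finally show ?thesis unfolding e1 .
    qed
    then have "norm (eis_term \<kappa> j \<chi> \<omega> \<tau>) \<le> l powi (- \<kappa>) * Im \<tau> powi j * (C * (l powr (- 2 * \<beta>) * Im \<tau> powr \<beta> * (1 + (Im \<tau> / \<delta>\<^sup>2) powr b)))"
      unfolding norm_eis_term[OF y \<omega>] l_def[symmetric] Q_def[symmetric]
      using l y by (intro mult_left_mono) auto
    also have "\<dots> = C * (Im \<tau> powi j * Im \<tau> powr \<beta> * (1 + (Im \<tau> / \<delta>\<^sup>2) powr b)) * (l powi (- \<kappa>) * l powr (- 2 * \<beta>))"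
      by (simp only: mult_ac)
    also have "\<dots> \<le> C * (Im \<tau> powi j * Im \<tau> powr \<beta> * (1 + (Im \<tau> / \<delta>\<^sup>2) powr b)) * (\<delta> powr (1 - real_of_int \<kappa> - 2 * \<alpha>) * inverse (height \<omega> ^ 3))"
      using e3 C(1) y by (intro mult_left_mono) auto
    finally show ?thesis by (simp only: mult_ac)
  qed
  then show ?thesis unfolding \<beta>_def
    by (rule_tac exI[of _ C], rule_tac exI[of _ b]) (intro conjI ballI allI impI C(1,2))
qed

lemma eis_term_locally_bounded:
  assumes \<chi>: "decaying \<alpha> \<chi>" and \<kappa>: "4 \<le> real_of_int \<kappa> + 2 * \<alpha>" and "0 < Y" "1 \<le> B"
  shows "\<exists>K\<ge>0. \<forall>\<omega>\<in>lattice. \<forall>\<tau>. \<bar>Re \<tau>\<bar> \<le> B \<longrightarrow> Y \<le> Im \<tau> \<longrightarrow> Im \<tau> \<le> Y' \<longrightarrow>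
    norm (eis_term \<kappa> j \<chi> \<omega> \<tau>) \<le> K * inverse (height \<omega> ^ 3)"
proof -
  obtain C b where C: "0 \<le> C" "0 \<le> b" "\<And>\<omega> \<tau> \<delta>. \<omega>\<in>lattice \<Longrightarrow> 0 < Im \<tau> \<Longrightarrow> 0 < \<delta> \<Longrightarrow> \<delta> * height \<omega> \<le> cmod (ell \<omega> \<tau>) \<Longrightarrow>
    norm (eis_term \<kappa> j \<chi> \<omega> \<tau>) \<le> C * (Im \<tau> powi j * Im \<tau> powr (\<alpha> - 1/2) * \<delta> powr (1 - real_of_int \<kappa> - 2 * \<alpha>) * (1 + (Im \<tau> / \<delta>\<^sup>2) powr b)) * inverse (height \<omega> ^ 3)"
    using eis_term_bound[OF \<chi> \<kappa>, of j] by metis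
  define \<delta> where "\<delta> = min (1 / 2) (Y / (2 * B))"
  have \<delta>: "0 < \<delta>" using assms by (simp add: \<delta>_def)
  define g where "g y = C * (y powi j * y powr (\<alpha> - 1/2) * \<delta> powr (1 - real_of_int \<kappa> - 2 * \<alpha>) * (1 + (y / \<delta>\<^sup>2) powr b))" for y
  have "continuous_on {Y..Y'} g"
    unfolding g_def using assms \<delta> by (intro continuous_intros) auto
  then have "bounded (g ` {Y..Y'})" by (intro compact_imp_bounded compact_continuous_image) auto
  then obtain K where "\<forall>y\<in>{Y..Y'}. \<bar>g y\<bar> \<le> K" unfolding bounded_iff by auto
  then have K: "\<And>y. y \<in> {Y..Y'} \<Longrightarrow> \<bar>g y\<bar> \<le> K" by blast
  have "norm (eis_term \<kappa> j \<chi> \<omega> \<tau>) \<le> max K 0 * inverse (height \<omega> ^ 3)"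
    if "\<omega> \<in> lattice" "\<bar>Re \<tau>\<bar> \<le> B" "Y \<le> Im \<tau>" "Im \<tau> \<le> Y'" for \<omega> \<tau>
  proof -
    have "norm (eis_term \<kappa> j \<chi> \<omega> \<tau>) \<le> g (Im \<tau>) * inverse (height \<omega> ^ 3)"
      unfolding g_def using that assms \<delta> ell_ge[of \<tau> B Y \<omega>] by (intro C(3)) (auto simp: \<delta>_def)
    also have "\<dots> \<le> max K 0 * inverse (height \<omega> ^ 3)"
      using K[of "Im \<tau>"] that height_ge_1[OF that(1)] by (intro mult_right_mono) auto
    finally show ?thesis .
  qed
  then show ?thesis by (intro exI[of _ "max K 0"]) auto
qed

lemma abs_summable_eis_term:
  assumes \<chi>: "decaying \<alpha> \<chi>" and \<kappa>: "4 \<le> real_of_int \<kappa> + 2 * \<alpha>" and "0 < Im \<tau>"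
  shows "(\<lambda>\<omega>. norm (eis_term \<kappa> j \<chi> \<omega> \<tau>)) summable_on lattice"
proof -
  have "1 \<le> \<bar>Re \<tau>\<bar> + 1" by simp
  from eis_term_locally_bounded[OF \<chi> \<kappa> assms(3) this, of "Im \<tau>" j] obtain K
    where "K \<ge> 0 \<and> (\<forall>\<omega>\<in>lattice. \<forall>\<tau>'. \<bar>Re \<tau>'\<bar> \<le> \<bar>Re \<tau>\<bar> + 1 \<longrightarrow> Im \<tau> \<le> Im \<tau>' \<longrightarrow> Im \<tau>' \<le> Im \<tau> \<longrightarrow>
      norm (eis_term \<kappa> j \<chi> \<omega> \<tau>') \<le> K * inverse (height \<omega> ^ 3))"
    by (rule exE)
  then have K: "\<forall>\<omega>\<in>lattice. norm (eis_term \<kappa> j \<chi> \<omega> \<tau>) \<le> K * inverse (height \<omega> ^ 3)"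
    by simp
  show ?thesis
    by (rule summable_on_comparison_test[OF summable_on_cmult_right[OF summable_height, of K]]) (use K in auto)
qed

lemma eis_linear:
  assumes "decaying \<alpha> \<chi>" "decaying \<alpha> \<psi>" and \<kappa>: "4 \<le> real_of_int \<kappa> + 2 * \<alpha>" and y: "0 < Im \<tau>"
  shows "eis \<kappa> j (\<lambda>x. a * \<chi> x + b * \<psi> x) \<tau> = of_real a * eis \<kappa> j \<chi> \<tau> + of_real b * eis \<kappa> j \<psi> \<tau>"
proof -
  have s: "(\<lambda>\<omega>. eis_term \<kappa> j \<chi> \<omega> \<tau>) summable_on lattice" "(\<lambda>\<omega>. eis_term \<kappa> j \<psi> \<omega> \<tau>) summable_on lattice"
    using assms by (auto intro: abs_summable_summable abs_summable_eis_term)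
  have "eis \<kappa> j (\<lambda>x. a * \<chi> x + b * \<psi> x) \<tau> = (\<Sum>\<^sub>\<infinity>\<omega>\<in>lattice. of_real a * eis_term \<kappa> j \<chi> \<omega> \<tau> + of_real b * eis_term \<kappa> j \<psi> \<omega> \<tau>)"
    unfolding eis_def by (rule infsum_cong) (simp add: eis_term_def algebra_simps)
  also have "\<dots> = (\<Sum>\<^sub>\<infinity>\<omega>\<in>lattice. of_real a * eis_term \<kappa> j \<chi> \<omega> \<tau>) + (\<Sum>\<^sub>\<infinity>\<omega>\<in>lattice. of_real b * eis_term \<kappa> j \<psi> \<omega> \<tau>)"
    using s by (intro infsum_add summable_on_cmult_right)
  finally show ?thesis by (simp add: eis_def infsum_cmult_right')
qed

lemma has_wirtinger_eis:
  assumes \<chi>: "decaying \<alpha> \<chi>" and \<kappa>: "4 \<le> real_of_int \<kappa> + 2 * \<alpha>" and y: "0 < Im \<tau>"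
  shows "has_wirtinger (eis \<kappa> j \<chi>)
    ((eis \<kappa> (j - 1) (\<lambda>x. of_int (\<kappa> - j) * \<chi> x - deriv \<chi> x) \<tau>
      - of_int (\<kappa> - 2 * j) / of_real (Im \<tau>) * eis \<kappa> j \<chi> \<tau>) / (2 * \<i>))
    (eis \<kappa> (j + 1) (\<lambda>x. deriv \<chi> x - of_int j * \<chi> x) \<tau> / (2 * \<i> * (of_real (Im \<tau>))\<^sup>2)) \<tau>"
proof -
  define \<chi>1 where "\<chi>1 = (\<lambda>x. of_int (\<kappa> - j) * \<chi> x - deriv \<chi> x)"
  define \<chi>2 where "\<chi>2 = (\<lambda>x. deriv \<chi> x - of_int j * \<chi> x)"
  have d1: "decaying \<alpha> \<chi>1" unfolding \<chi>1_def
    by (intro decaying_diff decaying_cmult decayingD(2) \<chi>)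
  have d2: "decaying \<alpha> \<chi>2" unfolding \<chi>2_def
    by (intro decaying_diff decaying_cmult decayingD(2) \<chi>)
  define p where "p \<omega> z = (eis_term \<kappa> (j - 1) \<chi>1 \<omega> z - of_int (\<kappa> - 2 * j) / of_real (Im z) * eis_term \<kappa> j \<chi> \<omega> z) / (2 * \<i>)" for \<omega> z
  define q where "q \<omega> z = eis_term \<kappa> (j + 1) \<chi>2 \<omega> z / (2 * \<i> * (of_real (Im z))\<^sup>2)" for \<omega> z
  \<comment> \<open>On a ball of radius \<open>min 1 Y\<close> the imaginary part stays between Y
    and 3Y and the real part stays in a bounded strip, so the terms and both of their derivatives
    have one common majorant there.\<close>
  define Y where "Y = Im \<tau> / 2"
  define B where "B = \<bar>Re \<tau>\<bar> + 1"
  define S where "S = ball \<tau> (min 1 Y)"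
  have Y: "0 < Y" using y by (simp add: Y_def)
  have S: "\<bar>Re z\<bar> \<le> B" "Y \<le> Im z" "Im z \<le> 3 * Y" "0 < Im z" if "z \<in> S" for z
  proof -
    have "cmod (\<tau> - z) < min 1 Y" using that by (simp add: S_def dist_norm)
    then have "\<bar>Re \<tau> - Re z\<bar> < 1" "\<bar>Im \<tau> - Im z\<bar> < Y"
      using abs_Re_le_cmod[of "\<tau> - z"] abs_Im_le_cmod[of "\<tau> - z"] by auto
    then show "\<bar>Re z\<bar> \<le> B" "Y \<le> Im z" "Im z \<le> 3 * Y" "0 < Im z"
      using Y unfolding B_def Y_def by (simp_all only: abs_less_iff) linarith+
  qed
  obtain K0 where K0: "K0 \<ge> 0" "\<And>\<omega> z. \<omega> \<in> lattice \<Longrightarrow> z \<in> S \<Longrightarrow> norm (eis_term \<kappa> j \<chi> \<omega> z) \<le> K0 * inverse (height \<omega> ^ 3)"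
    using eis_term_locally_bounded[OF \<chi> \<kappa> Y, of B "3 * Y" j] S by (auto simp: B_def)
  obtain K1 where K1: "K1 \<ge> 0" "\<And>\<omega> z. \<omega> \<in> lattice \<Longrightarrow> z \<in> S \<Longrightarrow> norm (eis_term \<kappa> (j - 1) \<chi>1 \<omega> z) \<le> K1 * inverse (height \<omega> ^ 3)"
    using eis_term_locally_bounded[OF d1 \<kappa> Y, of B "3 * Y" "j - 1"] S by (auto simp: B_def)
  obtain K2 where K2: "K2 \<ge> 0" "\<And>\<omega> z. \<omega> \<in> lattice \<Longrightarrow> z \<in> S \<Longrightarrow> norm (eis_term \<kappa> (j + 1) \<chi>2 \<omega> z) \<le> K2 * inverse (height \<omega> ^ 3)"
    using eis_term_locally_bounded[OF d2 \<kappa> Y, of B "3 * Y" "j + 1"] S by (auto simp: B_def)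
  define K where "K = K0 + (K1 + \<bar>of_int (\<kappa> - 2 * j)\<bar> / Y * K0) + K2 / Y\<^sup>2"
  have h0: "0 \<le> inverse (height \<omega> ^ 3)" if "\<omega> \<in> lattice" for \<omega> using height_ge_1[OF that] by simp
  have hw: "has_wirtinger (\<lambda>z. \<Sum>\<^sub>\<infinity>\<omega>\<in>lattice. eis_term \<kappa> j \<chi> \<omega> z) (\<Sum>\<^sub>\<infinity>\<omega>\<in>lattice. p \<omega> \<tau>) (\<Sum>\<^sub>\<infinity>\<omega>\<in>lattice. q \<omega> \<tau>) \<tau>"
  proof (rule has_wirtinger_infsum[OF countable_lattice infinite_lattice, of S])
    show "open S" "convex S" "\<tau> \<in> S" using Y by (auto simp: S_def)
    show "(\<lambda>\<omega>. K * inverse (height \<omega> ^ 3)) summable_on lattice"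
      by (rule summable_on_cmult_right[OF summable_height])
    fix \<omega> z assume \<omega>: "\<omega> \<in> lattice" and z: "z \<in> S"
    show "has_wirtinger (eis_term \<kappa> j \<chi> \<omega>) (p \<omega> z) (q \<omega> z) z"
      unfolding p_def q_def \<chi>1_def \<chi>2_def by (rule has_wirtinger_eis_term[OF \<omega> S(4)[OF z] \<chi>])
    let ?h = "inverse (height \<omega> ^ 3)"
    have Kle: "K0 \<le> K" "K1 + \<bar>of_int (\<kappa> - 2 * j)\<bar> / Y * K0 \<le> K" "K2 / Y\<^sup>2 \<le> K"
      unfolding K_def using K0(1) K1(1) K2(1) Y by auto
    show "norm (eis_term \<kappa> j \<chi> \<omega> z) \<le> K * ?h"
      using K0(2)[OF \<omega> z] mult_right_mono[OF Kle(1) h0[OF \<omega>]] by linarith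
    have "norm (p \<omega> z) \<le> norm (eis_term \<kappa> (j - 1) \<chi>1 \<omega> z) + \<bar>of_int (\<kappa> - 2 * j)\<bar> / Im z * norm (eis_term \<kappa> j \<chi> \<omega> z)"
    proof -
      have "norm (p \<omega> z) = norm (eis_term \<kappa> (j - 1) \<chi>1 \<omega> z - of_int (\<kappa> - 2 * j) / of_real (Im z) * eis_term \<kappa> j \<chi> \<omega> z) / 2"
        unfolding p_def norm_divide norm_mult[of 2 \<i>] by simp
      also have "\<dots> \<le> norm (eis_term \<kappa> (j - 1) \<chi>1 \<omega> z - of_int (\<kappa> - 2 * j) / of_real (Im z) * eis_term \<kappa> j \<chi> \<omega> z)" by simp
      also have "\<dots> \<le> norm (eis_term \<kappa> (j - 1) \<chi>1 \<omega> z) + norm (of_int (\<kappa> - 2 * j) / of_real (Im z) * eis_term \<kappa> j \<chi> \<omega> z)"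
        by (rule norm_triangle_ineq4)
      also have "norm (of_int (\<kappa> - 2 * j) / of_real (Im z) * eis_term \<kappa> j \<chi> \<omega> z) = \<bar>of_int (\<kappa> - 2 * j)\<bar> / Im z * norm (eis_term \<kappa> j \<chi> \<omega> z)"
        using S(4)[OF z] by (simp add: norm_mult norm_divide del: of_int_diff)
      finally show ?thesis .
    qed
    also have "\<dots> \<le> K1 * ?h + \<bar>of_int (\<kappa> - 2 * j)\<bar> / Y * (K0 * ?h)"
      using K0(2)[OF \<omega> z] K1(2)[OF \<omega> z] S[OF z] Y by (intro add_mono mult_mono divide_left_mono) auto
    also have "\<dots> = (K1 + \<bar>of_int (\<kappa> - 2 * j)\<bar> / Y * K0) * ?h" by (simp only: distrib_right mult.assoc)
    also have "\<dots> \<le> K * ?h" by (rule mult_right_mono[OF Kle(2) h0[OF \<omega>]])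
    finally show "norm (p \<omega> z) \<le> K * ?h" .
    have "norm (q \<omega> z) = norm (eis_term \<kappa> (j + 1) \<chi>2 \<omega> z) / (2 * (Im z)\<^sup>2)"
      by (simp add: q_def norm_divide norm_mult norm_power)
    also have "\<dots> \<le> K2 * ?h / Y\<^sup>2"
    proof (rule frac_le)
      have "Y\<^sup>2 \<le> (Im z)\<^sup>2" using S[OF z] Y by (intro power_mono) auto
      then show "Y\<^sup>2 \<le> 2 * (Im z)\<^sup>2" using zero_le_power2[of "Im z"] by linarith
    qed (use K2(2)[OF \<omega> z] Y K2(1) h0[OF \<omega>] in auto)
    also have "\<dots> = K2 / Y\<^sup>2 * ?h" by simp
    also have "\<dots> \<le> K * ?h" by (rule mult_right_mono[OF Kle(3) h0[OF \<omega>]])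
    finally show "norm (q \<omega> z) \<le> K * ?h" .
  qed
  have s: "(\<lambda>\<omega>. eis_term \<kappa> j' \<psi> \<omega> \<tau>) summable_on lattice" if "decaying \<alpha> \<psi>" for \<psi> j'
    by (rule abs_summable_summable[OF abs_summable_eis_term[OF that \<kappa> y]])
  have "(\<Sum>\<^sub>\<infinity>\<omega>\<in>lattice. p \<omega> \<tau>) = (eis \<kappa> (j - 1) \<chi>1 \<tau> - of_int (\<kappa> - 2 * j) / of_real (Im \<tau>) * eis \<kappa> j \<chi> \<tau>) / (2 * \<i>)"
  proof -
    define c where "c = - (of_int (\<kappa> - 2 * j) / complex_of_real (Im \<tau>))"
    have "p \<omega> \<tau> = (eis_term \<kappa> (j - 1) \<chi>1 \<omega> \<tau> + c * eis_term \<kappa> j \<chi> \<omega> \<tau>) * inverse (2 * \<i>)" for \<omega>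
      by (simp only: p_def c_def divide_inverse diff_conv_add_uminus mult_minus_left)
    then have "(\<Sum>\<^sub>\<infinity>\<omega>\<in>lattice. p \<omega> \<tau>) = (\<Sum>\<^sub>\<infinity>\<omega>\<in>lattice. (eis_term \<kappa> (j - 1) \<chi>1 \<omega> \<tau> + c * eis_term \<kappa> j \<chi> \<omega> \<tau>) * inverse (2 * \<i>))"
      by (simp only:)
    also have "\<dots> = (\<Sum>\<^sub>\<infinity>\<omega>\<in>lattice. eis_term \<kappa> (j - 1) \<chi>1 \<omega> \<tau> + c * eis_term \<kappa> j \<chi> \<omega> \<tau>) * inverse (2 * \<i>)"
      by (rule infsum_cmult_left')
    also have "(\<Sum>\<^sub>\<infinity>\<omega>\<in>lattice. eis_term \<kappa> (j - 1) \<chi>1 \<omega> \<tau> + c * eis_term \<kappa> j \<chi> \<omega> \<tau>)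
        = (\<Sum>\<^sub>\<infinity>\<omega>\<in>lattice. eis_term \<kappa> (j - 1) \<chi>1 \<omega> \<tau>) + (\<Sum>\<^sub>\<infinity>\<omega>\<in>lattice. c * eis_term \<kappa> j \<chi> \<omega> \<tau>)"
      by (rule infsum_add[OF s[OF d1] summable_on_cmult_right[OF s[OF \<chi>]]])
    also have "(\<Sum>\<^sub>\<infinity>\<omega>\<in>lattice. c * eis_term \<kappa> j \<chi> \<omega> \<tau>) = c * eis \<kappa> j \<chi> \<tau>"
      unfolding eis_def by (rule infsum_cmult_right')
    finally show ?thesis
      by (simp only: c_def eis_def[symmetric] divide_inverse diff_conv_add_uminus mult_minus_left)
  qed
  moreover have "(\<Sum>\<^sub>\<infinity>\<omega>\<in>lattice. q \<omega> \<tau>) = eis \<kappa> (j + 1) \<chi>2 \<tau> / (2 * \<i> * (of_real (Im \<tau>))\<^sup>2)"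
    unfolding q_def eis_def divide_inverse by (rule infsum_cmult_left')
  moreover have "(\<lambda>z. \<Sum>\<^sub>\<infinity>\<omega>\<in>lattice. eis_term \<kappa> j \<chi> \<omega> z) = eis \<kappa> j \<chi>"
    by (rule ext) (rule eis_def[symmetric])
  ultimately show ?thesis
    using hw by (simp only: \<chi>1_def \<chi>2_def)
qed

lemma Im_moebius:
  fixes a b c d :: int
  assumes "a * d - b * c = 1" "0 < Im \<tau>"
  shows "of_int c * \<tau> + of_int d \<noteq> (0::complex)"
    "Im ((of_int a * \<tau> + of_int b) / (of_int c * \<tau> + of_int d)) = Im \<tau> / (cmod (of_int c * \<tau> + of_int d))\<^sup>2"
proof -
  let ?J = "of_int c * \<tau> + of_int d"
  have "(c, d) \<in> lattice" using assms by (auto simp: lattice_def)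
  from ell_nonzero[OF this assms(2)] show J: "?J \<noteq> 0" by (simp add: ell_def)
  have "real_of_int a * real_of_int d - real_of_int b * real_of_int c = 1"
    using assms(1) by (metis of_int_1 of_int_diff of_int_mult)
  moreover have "Im ((of_int a * \<tau> + of_int b) * cnj ?J) = (real_of_int a * real_of_int d - real_of_int b * real_of_int c) * Im \<tau>"
    by (simp add: algebra_simps)
  ultimately have "Im ((of_int a * \<tau> + of_int b) * cnj ?J) = Im \<tau>" by simp
  then show "Im ((of_int a * \<tau> + of_int b) / ?J) = Im \<tau> / (cmod ?J)\<^sup>2"
    by (subst complex_div_cnj) (simp add: Im_divide_of_real)
qed

text \<open>Right multiplication by the matrix g permutes the lattice and satisfies ell \<omega> (g
  \<tau>) = ell (\<omega> g) \<tau> / J. In each term |l|^2 / y is unchanged, l^(-\<kappa>)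
  contributes J^\<kappa>, and the quotient y l / cnj l contributes J^(-2).\<close>

lemma eis_slash:
  fixes a b c d :: int
  assumes det: "a * d - b * c = 1" and y: "0 < Im \<tau>"
  defines "J \<equiv> of_int c * \<tau> + of_int d"
  shows "eis \<kappa> j \<chi> ((of_int a * \<tau> + of_int b) / J) = J powi (\<kappa> - 2 * j) * eis \<kappa> j \<chi> \<tau>"
proof -
  define \<tau>' where "\<tau>' = (of_int a * \<tau> + of_int b) / J"
  have J: "J \<noteq> 0" and Im: "Im \<tau>' = Im \<tau> / (cmod J)\<^sup>2" unfolding J_def \<tau>'_def by (rule Im_moebius[OF det y])+
  define F where "F \<omega> = (fst \<omega> * a + snd \<omega> * c, fst \<omega> * b + snd \<omega> * d)" for \<omega> :: "int \<times> int"
  define G where "G \<omega> = (fst \<omega> * d - snd \<omega> * c, snd \<omega> * a - fst \<omega> * b)" for \<omega> :: "int \<times> int"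
  have GF: "G (F \<omega>) = \<omega>" for \<omega>
  proof (rule prod_eqI)
    have "fst (G (F \<omega>)) = fst \<omega> * (a * d - b * c)" by (simp add: F_def G_def algebra_simps)
    then show "fst (G (F \<omega>)) = fst \<omega>" using det by simp
    have "snd (G (F \<omega>)) = snd \<omega> * (a * d - b * c)" by (simp add: F_def G_def algebra_simps)
    then show "snd (G (F \<omega>)) = snd \<omega>" using det by simp
  qed
  have FG: "F (G \<omega>) = \<omega>" for \<omega>
  proof (rule prod_eqI)
    have "fst (F (G \<omega>)) = fst \<omega> * (a * d - b * c)" by (simp add: F_def G_def algebra_simps)
    then show "fst (F (G \<omega>)) = fst \<omega>" using det by simp
    have "snd (F (G \<omega>)) = snd \<omega> * (a * d - b * c)" by (simp add: F_def G_def algebra_simps)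
    then show "snd (F (G \<omega>)) = snd \<omega>" using det by simp
  qed
  have z: "F (0, 0) = (0, 0)" "G (0, 0) = (0, 0)" by (auto simp: F_def G_def)
  have ell: "ell \<omega> \<tau>' = ell (F \<omega>) \<tau> / J" for \<omega>
    using J by (simp add: ell_def \<tau>'_def F_def field_simps) (simp add: J_def algebra_simps)
  have t: "eis_term \<kappa> j \<chi> \<omega> \<tau>' = J powi (\<kappa> - 2 * j) * eis_term \<kappa> j \<chi> (F \<omega>) \<tau>" if "\<omega> \<in> lattice" for \<omega>
  proof -
    let ?l = "ell (F \<omega>) \<tau>"
    have e1: "(?l / J) powi (- \<kappa>) = J powi \<kappa> * ?l powi (- \<kappa>)"
      by (simp add: power_int_divide_distrib power_int_minus field_simps)
    have e2: "of_real (Im \<tau> / (cmod J)\<^sup>2) * (?l / J) / cnj (?l / J) = inverse (J\<^sup>2) * (of_real (Im \<tau>) * ?l / cnj ?l)"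
    proof -
      have "complex_of_real ((cmod J)\<^sup>2) = J * cnj J" by (rule complex_norm_square)
      then show ?thesis using J by (simp only: of_real_divide complex_cnj_divide) (simp add: field_simps power2_eq_square)
    qed
    have e3: "(cmod (?l / J))\<^sup>2 / (Im \<tau> / (cmod J)\<^sup>2) = (cmod ?l)\<^sup>2 / Im \<tau>"
      using J by (simp add: norm_divide power_divide)
    have e4: "J powi \<kappa> * inverse (J\<^sup>2) powi j = J powi (\<kappa> - 2 * j)"
    proof -
      have "inverse (J\<^sup>2) powi j = inverse (J powi (2 * j))"
        by (simp add: power_int_inverse power_int_mult)
      then show ?thesis using J by (simp add: power_int_diff divide_inverse)
    qed
    show ?thesis
      unfolding eis_term_def ell Im e1 e2 e3 power_int_mult_distrib e4[symmetric] by (simp only: mult_ac)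
  qed
  have bij: "bij_betw F lattice lattice"
  proof (rule bij_betwI[where g = G])
    have "F \<omega> = (0, 0) \<Longrightarrow> \<omega> = (0, 0)" for \<omega> using GF[of \<omega>] z(2) by simp
    then show "F \<in> lattice \<rightarrow> lattice" unfolding lattice_def by blast
    have "G \<omega> = (0, 0) \<Longrightarrow> \<omega> = (0, 0)" for \<omega> using FG[of \<omega>] z(1) by simp
    then show "G \<in> lattice \<rightarrow> lattice" unfolding lattice_def by blast
  qed (use GF FG in auto)
  have "eis \<kappa> j \<chi> \<tau>' = (\<Sum>\<^sub>\<infinity>\<omega>\<in>lattice. J powi (\<kappa> - 2 * j) * eis_term \<kappa> j \<chi> (F \<omega>) \<tau>)"
    unfolding eis_def by (rule infsum_cong) (rule t)
  also have "\<dots> = J powi (\<kappa> - 2 * j) * (\<Sum>\<^sub>\<infinity>\<omega>\<in>lattice. eis_term \<kappa> j \<chi> (F \<omega>) \<tau>)"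
    by (rule infsum_cmult_right')
  also have "(\<Sum>\<^sub>\<infinity>\<omega>\<in>lattice. eis_term \<kappa> j \<chi> (F \<omega>) \<tau>) = eis \<kappa> j \<chi> \<tau>"
    unfolding eis_def by (rule infsum_reindex_bij_betw[OF bij])
  finally show ?thesis by (simp add: \<tau>'_def)
qed

section \<open>Growth and smoothness\<close>

definition poly_growth :: "(complex \<Rightarrow> complex) \<Rightarrow> bool" where
  "poly_growth f \<longleftrightarrow> (\<forall>B. \<exists>C N. 0 \<le> C \<and> (\<forall>\<tau>. \<bar>Re \<tau>\<bar> \<le> B \<longrightarrow> 1 \<le> Im \<tau> \<longrightarrow> norm (f \<tau>) \<le> C * Im \<tau> ^ N))"

lemma powr_le_power_nat:
  fixes y r :: real
  assumes "1 \<le> y"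
  shows "y powr r \<le> y ^ nat \<lceil>\<bar>r\<bar>\<rceil>"
proof -
  have "y powr r \<le> y powr (real (nat \<lceil>\<bar>r\<bar>\<rceil>))" using assms by (intro powr_mono) linarith+
  also have "\<dots> = y ^ nat \<lceil>\<bar>r\<bar>\<rceil>" using assms by (intro powr_realpow) auto
  finally show ?thesis .
qed

text \<open>For y \<ge> 1 the constant \<delta> from \<open>ell_ge\<close> depends on the strip
  alone, so the termwise bound sums up to a power of y.\<close>

lemma poly_growth_eis:
  assumes \<chi>: "decaying \<alpha> \<chi>" and \<kappa>: "4 \<le> real_of_int \<kappa> + 2 * \<alpha>"
  shows "poly_growth (eis \<kappa> j \<chi>)"
  unfolding poly_growth_def
proof
  fix B0 :: real
  define B where "B = max 1 B0"
  obtain C b where C: "0 \<le> C" "0 \<le> b" "\<And>\<omega> \<tau> \<delta>. \<omega>\<in>lattice \<Longrightarrow> 0 < Im \<tau> \<Longrightarrow> 0 < \<delta> \<Longrightarrow> \<delta> * height \<omega> \<le> cmod (ell \<omega> \<tau>) \<Longrightarrow>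
    norm (eis_term \<kappa> j \<chi> \<omega> \<tau>) \<le> C * (Im \<tau> powi j * Im \<tau> powr (\<alpha> - 1/2) * \<delta> powr (1 - real_of_int \<kappa> - 2 * \<alpha>) * (1 + (Im \<tau> / \<delta>\<^sup>2) powr b)) * inverse (height \<omega> ^ 3)"
    using eis_term_bound[OF \<chi> \<kappa>, of j] by metis
  define \<delta> where "\<delta> = min (1 / 2) (1 / (2 * B))"
  have \<delta>: "0 < \<delta>" by (simp add: \<delta>_def B_def)
  define S where "S = (\<Sum>\<^sub>\<infinity>\<omega>\<in>lattice. inverse (height \<omega> ^ 3))"
  have S: "0 \<le> S" unfolding S_def by (rule infsum_nonneg) (simp add: height_def)
  let ?N1 = "nat \<lceil>\<bar>real_of_int j\<bar>\<rceil>" and ?N2 = "nat \<lceil>\<bar>\<alpha> - 1/2\<bar>\<rceil>" and ?N3 = "nat \<lceil>\<bar>b\<bar>\<rceil>"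
  define D where "D = \<delta> powr (1 - real_of_int \<kappa> - 2 * \<alpha>) * (1 + (1 / \<delta>\<^sup>2) powr b)"
  have D: "0 \<le> D" by (simp add: D_def)
  have "norm (eis \<kappa> j \<chi> \<tau>) \<le> (C * D * S) * Im \<tau> ^ (?N1 + ?N2 + ?N3)" if "\<bar>Re \<tau>\<bar> \<le> B0" "1 \<le> Im \<tau>" for \<tau>
  proof -
    let ?y = "Im \<tau>"
    have y: "0 < ?y" using that by simp
    let ?g = "C * (?y powi j * ?y powr (\<alpha> - 1/2) * \<delta> powr (1 - real_of_int \<kappa> - 2 * \<alpha>) * (1 + (?y / \<delta>\<^sup>2) powr b))"
    have b: "norm (eis_term \<kappa> j \<chi> \<omega> \<tau>) \<le> ?g * inverse (height \<omega> ^ 3)" if "\<omega> \<in> lattice" for \<omega>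
      using that y \<delta> \<open>\<bar>Re \<tau>\<bar> \<le> B0\<close> \<open>1 \<le> Im \<tau>\<close> ell_ge[of \<tau> B 1 \<omega>] by (intro C(3)) (auto simp: \<delta>_def B_def)
    have "norm (eis \<kappa> j \<chi> \<tau>) \<le> (\<Sum>\<^sub>\<infinity>\<omega>\<in>lattice. norm (eis_term \<kappa> j \<chi> \<omega> \<tau>))"
      unfolding eis_def by (rule norm_infsum_bound[OF abs_summable_eis_term[OF \<chi> \<kappa> y]])
    also have "\<dots> \<le> (\<Sum>\<^sub>\<infinity>\<omega>\<in>lattice. ?g * inverse (height \<omega> ^ 3))"
      by (rule infsum_mono[OF abs_summable_eis_term[OF \<chi> \<kappa> y] summable_on_cmult_right[OF summable_height] b])
    also have "\<dots> = ?g * S" unfolding S_def by (rule infsum_cmult_right')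
    also have "\<dots> \<le> C * (?y ^ ?N1 * ?y ^ ?N2 * \<delta> powr (1 - real_of_int \<kappa> - 2 * \<alpha>) * (?y ^ ?N3 * (1 + (1 / \<delta>\<^sup>2) powr b))) * S"
    proof (intro mult_right_mono[OF _ S] mult_left_mono[OF _ C(1)] mult_mono)
      show "?y powi j \<le> ?y ^ ?N1"
        using powr_le_power_nat[OF that(2), of "real_of_int j"] powr_real_of_int'[of ?y j] y by simp
      show "?y powr (\<alpha> - 1/2) \<le> ?y ^ ?N2" by (rule powr_le_power_nat[OF that(2)])
      have "(?y / \<delta>\<^sup>2) powr b = ?y powr b * (1 / \<delta>\<^sup>2) powr b"
        using y \<delta> powr_mult[of ?y "1 / \<delta>\<^sup>2" b] by simp
      also have "\<dots> \<le> ?y ^ ?N3 * (1 / \<delta>\<^sup>2) powr b"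
        by (intro mult_right_mono powr_le_power_nat[OF that(2)]) auto
      finally show "1 + (?y / \<delta>\<^sup>2) powr b \<le> ?y ^ ?N3 * (1 + (1 / \<delta>\<^sup>2) powr b)"
        using one_le_power[OF that(2), of ?N3] by (simp add: distrib_left)
    qed (use y in auto)
    also have "\<dots> = (C * D * S) * Im \<tau> ^ (?N1 + ?N2 + ?N3)"
      unfolding D_def power_add by (simp only: mult_ac)
    finally show ?thesis .
  qed
  moreover have "0 \<le> C * D * S" using C(1) D S by simp
  ultimately show "\<exists>C N. 0 \<le> C \<and> (\<forall>\<tau>. \<bar>Re \<tau>\<bar> \<le> B0 \<longrightarrow> 1 \<le> Im \<tau> \<longrightarrow> norm (eis \<kappa> j \<chi> \<tau>) \<le> C * Im \<tau> ^ N)"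
    by blast
qed

text \<open>Derivatives of the series involve 1 / y and series with other kernels and other j. The
  algebra generated by all of these is closed under both Wirtinger derivatives, so smoothness and
  growth follow by induction over its construction instead of from a formula for higher
  derivatives.\<close>

inductive eis_alg :: "int \<Rightarrow> real \<Rightarrow> (complex \<Rightarrow> complex) \<Rightarrow> bool" for \<kappa> \<alpha> where
  const: "eis_alg \<kappa> \<alpha> (\<lambda>\<tau>. c)"
| ident: "eis_alg \<kappa> \<alpha> (\<lambda>\<tau>. \<tau>)"
| conj: "eis_alg \<kappa> \<alpha> cnj"
| inv_Im: "eis_alg \<kappa> \<alpha> (\<lambda>\<tau>. inverse (of_real (Im \<tau>)))"
| eis: "decaying \<alpha> \<chi> \<Longrightarrow> eis_alg \<kappa> \<alpha> (eis \<kappa> j \<chi>)"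
| add: "eis_alg \<kappa> \<alpha> f \<Longrightarrow> eis_alg \<kappa> \<alpha> g \<Longrightarrow> eis_alg \<kappa> \<alpha> (\<lambda>\<tau>. f \<tau> + g \<tau>)"
| mult: "eis_alg \<kappa> \<alpha> f \<Longrightarrow> eis_alg \<kappa> \<alpha> g \<Longrightarrow> eis_alg \<kappa> \<alpha> (\<lambda>\<tau>. f \<tau> * g \<tau>)"

lemma eis_alg_sum:
  "finite I \<Longrightarrow> (\<And>i. i \<in> I \<Longrightarrow> eis_alg \<kappa> \<alpha> (f i)) \<Longrightarrow> eis_alg \<kappa> \<alpha> (\<lambda>\<tau>. \<Sum>i\<in>I. f i \<tau>)"
  by (induction I rule: finite_induct) (auto intro: eis_alg.intros)

lemma eis_alg_derivative:
  assumes "eis_alg \<kappa> \<alpha> f" and \<kappa>: "4 \<le> real_of_int \<kappa> + 2 * \<alpha>"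
  shows "\<exists>p q. eis_alg \<kappa> \<alpha> p \<and> eis_alg \<kappa> \<alpha> q \<and> (\<forall>\<tau>. 0 < Im \<tau> \<longrightarrow> has_wirtinger f (p \<tau>) (q \<tau>) \<tau>)"
  using assms(1)
proof induction
  case (const c)
  show ?case
    by (rule exI[of _ "\<lambda>\<tau>. 0"], rule exI[of _ "\<lambda>\<tau>. 0"]) (auto intro: eis_alg.intros)
next
  case ident
  show ?case
    by (rule exI[of _ "\<lambda>\<tau>. 1"], rule exI[of _ "\<lambda>\<tau>. 0"]) (auto intro: eis_alg.intros)
next
  case conj
  show ?case
    by (rule exI[of _ "\<lambda>\<tau>. 0"], rule exI[of _ "\<lambda>\<tau>. 1"]) (auto intro: eis_alg.intros)
next
  case inv_Im
  let ?v = "\<lambda>\<tau>. inverse (of_real (Im \<tau>))"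
  let ?p = "\<lambda>\<tau>. - (1 / (2 * \<i>)) * (?v \<tau> * ?v \<tau>)" and ?q = "\<lambda>\<tau>. - (- 1 / (2 * \<i>)) * (?v \<tau> * ?v \<tau>)"
  have "has_wirtinger ?v (?p \<tau>) (?q \<tau>) \<tau>" if "0 < Im \<tau>" for \<tau>
  proof -
    have "complex_of_real (Im \<tau>) \<noteq> 0" using that by simp
    then show ?thesis
      by (rule has_wirtinger_cong[OF has_wirtinger_inverse[OF has_wirtinger_Im]])
         (simp_all only: divide_inverse power2_eq_square inverse_mult_distrib)
  qed
  moreover have "eis_alg \<kappa> \<alpha> ?p" "eis_alg \<kappa> \<alpha> ?q"
    by (intro eis_alg.mult eis_alg.const eis_alg.inv_Im)+
  ultimately show ?case
    by (rule_tac exI[of _ ?p], rule_tac exI[of _ ?q]) (intro conjI allI impI)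
next
  case (eis \<chi> j)
  let ?v = "\<lambda>\<tau>. inverse (of_real (Im \<tau>))"
  let ?e1 = "eis \<kappa> (j - 1) (\<lambda>x. of_int (\<kappa> - j) * \<chi> x - deriv \<chi> x)"
  let ?e2 = "eis \<kappa> (j + 1) (\<lambda>x. deriv \<chi> x - of_int j * \<chi> x)"
  have e: "eis_alg \<kappa> \<alpha> ?e1" "eis_alg \<kappa> \<alpha> ?e2" "eis_alg \<kappa> \<alpha> (eis \<kappa> j \<chi>)"
    by (intro eis_alg.eis decaying_diff decaying_cmult decayingD(2) eis.hyps)+
  define p where "p \<tau> = inverse (2 * \<i>) * (?e1 \<tau> + (- 1) * (of_int (\<kappa> - 2 * j) * (?v \<tau> * eis \<kappa> j \<chi> \<tau>)))" for \<tau>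
  define q where "q \<tau> = inverse (2 * \<i>) * (?e2 \<tau> * (?v \<tau> * ?v \<tau>))" for \<tau>
  have "eis_alg \<kappa> \<alpha> p" "eis_alg \<kappa> \<alpha> q"
    unfolding p_def q_def by (intro eis_alg.add eis_alg.mult eis_alg.const eis_alg.inv_Im e)+
  moreover have "has_wirtinger (eis \<kappa> j \<chi>) (p \<tau>) (q \<tau>) \<tau>" if "0 < Im \<tau>" for \<tau>
  proof (rule has_wirtinger_cong[OF has_wirtinger_eis[OF eis.hyps \<kappa> that]])
    have "(a - b / y * e) / c = inverse c * (a + (- 1) * (b * (inverse y * e)))" for a b c e y :: complex
      by (simp add: divide_inverse algebra_simps)
    then show "(?e1 \<tau> - of_int (\<kappa> - 2 * j) / of_real (Im \<tau>) * eis \<kappa> j \<chi> \<tau>) / (2 * \<i>) = p \<tau>"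
      by (simp only: p_def)
    have "a / (c * y\<^sup>2) = inverse c * (a * (inverse y * inverse y))" for a c y :: complex
      by (simp add: divide_inverse power2_eq_square)
    then show "?e2 \<tau> / (2 * \<i> * (of_real (Im \<tau>))\<^sup>2) = q \<tau>"
      by (simp only: q_def)
  qed
  ultimately show ?case
    by (rule_tac exI[of _ p], rule_tac exI[of _ q]) (intro conjI allI impI)
next
  case (add f g)
  then obtain p q r s where *: "eis_alg \<kappa> \<alpha> p" "eis_alg \<kappa> \<alpha> q" "\<forall>\<tau>. 0 < Im \<tau> \<longrightarrow> has_wirtinger f (p \<tau>) (q \<tau>) \<tau>"
     "eis_alg \<kappa> \<alpha> r" "eis_alg \<kappa> \<alpha> s" "\<forall>\<tau>. 0 < Im \<tau> \<longrightarrow> has_wirtinger g (r \<tau>) (s \<tau>) \<tau>" by metis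
  show ?case
    by (rule exI[of _ "\<lambda>\<tau>. p \<tau> + r \<tau>"], rule exI[of _ "\<lambda>\<tau>. q \<tau> + s \<tau>"])
       (use * in \<open>auto intro: eis_alg.intros has_wirtinger_add\<close>)
next
  case (mult f g)
  then obtain p q r s where *: "eis_alg \<kappa> \<alpha> p" "eis_alg \<kappa> \<alpha> q" "\<forall>\<tau>. 0 < Im \<tau> \<longrightarrow> has_wirtinger f (p \<tau>) (q \<tau>) \<tau>"
     "eis_alg \<kappa> \<alpha> r" "eis_alg \<kappa> \<alpha> s" "\<forall>\<tau>. 0 < Im \<tau> \<longrightarrow> has_wirtinger g (r \<tau>) (s \<tau>) \<tau>" by metis
  have "eis_alg \<kappa> \<alpha> (\<lambda>\<tau>. p \<tau> * g \<tau> + f \<tau> * r \<tau>)" "eis_alg \<kappa> \<alpha> (\<lambda>\<tau>. q \<tau> * g \<tau> + f \<tau> * s \<tau>)"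
    by (intro eis_alg.add eis_alg.mult * mult.hyps)+
  moreover have "\<forall>\<tau>. 0 < Im \<tau> \<longrightarrow> has_wirtinger (\<lambda>\<tau>. f \<tau> * g \<tau>) (p \<tau> * g \<tau> + f \<tau> * r \<tau>) (q \<tau> * g \<tau> + f \<tau> * s \<tau>) \<tau>"
    using * by (auto intro: has_wirtinger_mult)
  ultimately show ?case
    by (rule_tac exI[of _ "\<lambda>\<tau>. p \<tau> * g \<tau> + f \<tau> * r \<tau>"], rule_tac exI[of _ "\<lambda>\<tau>. q \<tau> * g \<tau> + f \<tau> * s \<tau>"])
      (intro conjI)
qed

lemma open_upper_half_plane: "open upper_half_plane"
  unfolding upper_half_plane_def by (rule open_halfspace_Im_gt)

lemma has_wirtinger_partial:
  assumes "has_wirtinger f p q \<tau>"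
  shows "partial_x f \<tau> = p + q" "partial_y f \<tau> = \<i> * p - \<i> * q"
  using frechet_derivative_at[OF assms[unfolded has_wirtinger_def], symmetric]
  by (auto simp: partial_x_def partial_y_def)

lemma has_wirtinger_wirtinger:
  assumes "has_wirtinger f p q \<tau>"
  shows "wirtinger f \<tau> = p" "wirtinger_bar f \<tau> = q"
  by (auto simp: wirtinger_def wirtinger_bar_def has_wirtinger_partial[OF assms] algebra_simps)

text \<open>The half plane is open, so partial derivatives at its points depend only on values
  inside; the computed derivatives are known only there.\<close>

lemma times_differentiable_cong:
  "(\<And>\<tau>. \<tau> \<in> upper_half_plane \<Longrightarrow> f \<tau> = g \<tau>) \<Longrightarrow> times_differentiable m f \<Longrightarrow> times_differentiable m g"
proof (induction m arbitrary: f g)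
  case 0
  then show ?case by (simp cong: continuous_on_cong)
next
  case (Suc m)
  have d: "f differentiable (at \<tau>)" if "\<tau> \<in> upper_half_plane" for \<tau>
  proof -
    have "f differentiable (at \<tau> within upper_half_plane)"
      using Suc.prems(2) that by (simp add: differentiable_on_def)
    then show ?thesis unfolding at_within_open[OF that open_upper_half_plane] .
  qed
  have eq: "frechet_derivative f (at \<tau>) = frechet_derivative g (at \<tau>)" if "\<tau> \<in> upper_half_plane" for \<tau>
    by (rule frechet_derivative_transform_within_open[OF d[OF that] open_upper_half_plane that Suc.prems(1)])
  have "g differentiable_on upper_half_plane"
    unfolding differentiable_on_def
  proof
    fix \<tau> assume \<tau>: "\<tau> \<in> upper_half_plane"
    then have "f differentiable (at \<tau> within upper_half_plane)"
      using Suc.prems(2) by (simp add: differentiable_on_def)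
    then show "g differentiable (at \<tau> within upper_half_plane)"
      by (rule differentiable_transform_within[where d = 1]) (use \<tau> Suc.prems(1) in simp_all)
  qed
  moreover have "times_differentiable m (partial_x g)"
  proof (rule Suc.IH)
    show "partial_x f \<tau> = partial_x g \<tau>" if "\<tau> \<in> upper_half_plane" for \<tau>
      unfolding partial_x_def eq[OF that] ..
    show "times_differentiable m (partial_x f)" using Suc.prems(2) by simp
  qed
  moreover have "times_differentiable m (partial_y g)"
  proof (rule Suc.IH)
    show "partial_y f \<tau> = partial_y g \<tau>" if "\<tau> \<in> upper_half_plane" for \<tau>
      unfolding partial_y_def eq[OF that] ..
    show "times_differentiable m (partial_y f)" using Suc.prems(2) by simp
  qed
  ultimately show ?case by simp
qed

lemma eis_alg_smooth:
  assumes "eis_alg \<kappa> \<alpha> f" and \<kappa>: "4 \<le> real_of_int \<kappa> + 2 * \<alpha>"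
  shows "smooth f"
proof -
  have diff: "f differentiable_on upper_half_plane" if "eis_alg \<kappa> \<alpha> f" for f
    using eis_alg_derivative[OF that \<kappa>]
    by (auto simp: differentiable_on_def has_wirtinger_def differentiable_def upper_half_plane_def
        intro: has_derivative_at_withinI)
  have "times_differentiable m f" if "eis_alg \<kappa> \<alpha> f" for f m
    using that
  proof (induction m arbitrary: f)
    case 0
    then show ?case using diff by (auto intro: differentiable_imp_continuous_on)
  next
    case (Suc m)
    obtain p q where pq: "eis_alg \<kappa> \<alpha> p" "eis_alg \<kappa> \<alpha> q" "\<And>\<tau>. 0 < Im \<tau> \<Longrightarrow> has_wirtinger f (p \<tau>) (q \<tau>) \<tau>"
      using eis_alg_derivative[OF Suc.prems \<kappa>] by metis
    have "times_differentiable m (\<lambda>\<tau>. p \<tau> + q \<tau>)"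
      by (intro Suc.IH eis_alg.intros pq)
    then have "times_differentiable m (partial_x f)"
      by (rule times_differentiable_cong[rotated])
         (simp add: upper_half_plane_def has_wirtinger_partial[OF pq(3)])
    moreover have "times_differentiable m (\<lambda>\<tau>. \<i> * p \<tau> + (- \<i>) * q \<tau>)"
      by (intro Suc.IH eis_alg.intros pq)
    then have "times_differentiable m (partial_y f)"
      by (rule times_differentiable_cong[rotated])
         (simp add: upper_half_plane_def has_wirtinger_partial[OF pq(3)])
    ultimately show ?case using diff[OF Suc.prems] by simp
  qed
  then show ?thesis using assms(1) by (simp add: smooth_def)
qed

lemma poly_growth_bound:
  assumes "poly_growth f"
  obtains C N where "0 \<le> C" "\<And>\<tau>. \<bar>Re \<tau>\<bar> \<le> B \<Longrightarrow> 1 \<le> Im \<tau> \<Longrightarrow> norm (f \<tau>) \<le> C * Im \<tau> ^ N"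
  using assms unfolding poly_growth_def by metis

lemma poly_growth_ident: "poly_growth (\<lambda>\<tau>. \<tau>)"
  unfolding poly_growth_def
proof
  fix B :: real
  have "norm \<tau> \<le> (\<bar>B\<bar> + 1) * Im \<tau> ^ 1" if "\<bar>Re \<tau>\<bar> \<le> B" "1 \<le> Im \<tau>" for \<tau>
  proof -
    have "norm \<tau> \<le> \<bar>B\<bar> * 1 + Im \<tau>" using cmod_le[of \<tau>] that by linarith
    also have "\<dots> \<le> \<bar>B\<bar> * Im \<tau> + Im \<tau>" using that by (intro add_right_mono mult_left_mono) auto
    finally show ?thesis by (simp add: algebra_simps)
  qed
  then show "\<exists>C N. 0 \<le> C \<and> (\<forall>\<tau>. \<bar>Re \<tau>\<bar> \<le> B \<longrightarrow> 1 \<le> Im \<tau> \<longrightarrow> norm \<tau> \<le> C * Im \<tau> ^ N)"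
    by (rule_tac exI[of _ "\<bar>B\<bar> + 1"], rule_tac exI[of _ 1]) auto
qed

lemma eis_alg_growth:
  assumes "eis_alg \<kappa> \<alpha> f" and \<kappa>: "4 \<le> real_of_int \<kappa> + 2 * \<alpha>"
  shows "poly_growth f"
  using assms(1)
proof induction
  case (const c)
  have "\<exists>C N. 0 \<le> C \<and> (\<forall>\<tau>. \<bar>Re \<tau>\<bar> \<le> B \<longrightarrow> 1 \<le> Im \<tau> \<longrightarrow> norm c \<le> C * Im \<tau> ^ N)" for B
    by (rule exI[of _ "norm c"], rule exI[of _ 0]) auto
  then show ?case by (simp add: poly_growth_def)
next
  case ident
  show ?case by (rule poly_growth_ident)
next
  case conj
  show ?case using poly_growth_ident by (simp add: poly_growth_def)
next
  case inv_Im
  have "norm (inverse (complex_of_real (Im \<tau>))) \<le> 1 * Im \<tau> ^ 0" if "1 \<le> Im \<tau>" for \<tau>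
    using that by (simp add: norm_inverse inverse_le_1_iff)
  then show ?case unfolding poly_growth_def
    by (intro allI, rule_tac exI[of _ 1], rule_tac exI[of _ 0]) auto
next
  case (eis \<chi> j)
  then show ?case using poly_growth_eis[OF _ \<kappa>] by blast
next
  case (add f g)
  show ?case unfolding poly_growth_def
  proof
    fix B
    obtain C N where 1: "0 \<le> C" "\<And>\<tau>. \<bar>Re \<tau>\<bar> \<le> B \<Longrightarrow> 1 \<le> Im \<tau> \<Longrightarrow> norm (f \<tau>) \<le> C * Im \<tau> ^ N"
      using poly_growth_bound[OF add.IH(1)] by metis
    obtain D M where 2: "0 \<le> D" "\<And>\<tau>. \<bar>Re \<tau>\<bar> \<le> B \<Longrightarrow> 1 \<le> Im \<tau> \<Longrightarrow> norm (g \<tau>) \<le> D * Im \<tau> ^ M"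
      using poly_growth_bound[OF add.IH(2)] by metis
    have "norm (f \<tau> + g \<tau>) \<le> (C + D) * Im \<tau> ^ (N + M)" if "\<bar>Re \<tau>\<bar> \<le> B" "1 \<le> Im \<tau>" for \<tau>
    proof -
      have "norm (f \<tau> + g \<tau>) \<le> C * Im \<tau> ^ N + D * Im \<tau> ^ M"
        using 1(2)[OF that] 2(2)[OF that] norm_triangle_ineq[of "f \<tau>" "g \<tau>"] by linarith
      also have "\<dots> \<le> C * Im \<tau> ^ (N + M) + D * Im \<tau> ^ (N + M)"
        using 1(1) 2(1) that(2) by (intro add_mono mult_left_mono power_increasing) auto
      finally show ?thesis by (simp add: distrib_right)
    qed
    then show "\<exists>C N. 0 \<le> C \<and> (\<forall>\<tau>. \<bar>Re \<tau>\<bar> \<le> B \<longrightarrow> 1 \<le> Im \<tau> \<longrightarrow> norm (f \<tau> + g \<tau>) \<le> C * Im \<tau> ^ N)"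
      by (rule_tac exI[of _ "C + D"], rule_tac exI[of _ "N + M"]) (use 1 2 in auto)
  qed
next
  case (mult f g)
  show ?case unfolding poly_growth_def
  proof
    fix B
    obtain C N where 1: "0 \<le> C" "\<And>\<tau>. \<bar>Re \<tau>\<bar> \<le> B \<Longrightarrow> 1 \<le> Im \<tau> \<Longrightarrow> norm (f \<tau>) \<le> C * Im \<tau> ^ N"
      using poly_growth_bound[OF mult.IH(1)] by metis
    obtain D M where 2: "0 \<le> D" "\<And>\<tau>. \<bar>Re \<tau>\<bar> \<le> B \<Longrightarrow> 1 \<le> Im \<tau> \<Longrightarrow> norm (g \<tau>) \<le> D * Im \<tau> ^ M"
      using poly_growth_bound[OF mult.IH(2)] by metis
    have "norm (f \<tau> * g \<tau>) \<le> (C * D) * Im \<tau> ^ (N + M)" if "\<bar>Re \<tau>\<bar> \<le> B" "1 \<le> Im \<tau>" for \<tau>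
    proof -
      have "norm (f \<tau> * g \<tau>) \<le> (C * Im \<tau> ^ N) * (D * Im \<tau> ^ M)"
        unfolding norm_mult using 1(1) 1(2)[OF that] 2(2)[OF that] that by (intro mult_mono) auto
      then show ?thesis by (simp add: power_add algebra_simps)
    qed
    then show "\<exists>C N. 0 \<le> C \<and> (\<forall>\<tau>. \<bar>Re \<tau>\<bar> \<le> B \<longrightarrow> 1 \<le> Im \<tau> \<longrightarrow> norm (f \<tau> * g \<tau>) \<le> C * Im \<tau> ^ N)"
      by (rule_tac exI[of _ "C * D"], rule_tac exI[of _ "N + M"]) (use 1 2 in auto)
  qed
qed

section \<open>Symmetric powers of the standard representation\<close>

text \<open>If the variable w is moved along with \<tau>, then \<tau> - w transforms with weight -1
  and (cnj \<tau> - w) / y with weight 1. In terms of products of the two, the Maass operators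
  become shifts of the index.\<close>

definition lin_A :: "complex \<Rightarrow> complex poly" where
  "lin_A \<tau> = [:\<tau>, -1:]"

definition lin_B :: "complex \<Rightarrow> complex poly" where
  "lin_B \<tau> = Polynomial.smult (inverse (of_real (Im \<tau>))) [:cnj \<tau>, -1:]"

definition sym_poly :: "nat \<Rightarrow> (nat \<Rightarrow> complex) \<Rightarrow> complex \<Rightarrow> complex poly" where
  "sym_poly m a \<tau> = (\<Sum>i\<le>m. Polynomial.smult (a i) (lin_A \<tau> ^ (m - i) * lin_B \<tau> ^ i))"

definition sym_vec :: "nat \<Rightarrow> (nat \<Rightarrow> complex) \<Rightarrow> complex \<Rightarrow> complex vec" where
  "sym_vec m a \<tau> = Matrix.vec (m + 1) (coeff (sym_poly m a \<tau>))"

definition vv :: "nat \<Rightarrow> (nat \<Rightarrow> complex \<Rightarrow> complex) \<Rightarrow> complex \<Rightarrow> complex vec" where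
  "vv m h \<tau> = sym_vec m (\<lambda>i. h i \<tau>) \<tau>"

definition has_poly_wirtinger ::
  "(complex \<Rightarrow> complex poly) \<Rightarrow> complex poly \<Rightarrow> complex poly \<Rightarrow> complex \<Rightarrow> bool" where
  "has_poly_wirtinger P P1 P2 \<tau> \<longleftrightarrow> (\<forall>l. has_wirtinger (\<lambda>z. coeff (P z) l) (coeff P1 l) (coeff P2 l) \<tau>)"

lemma has_wirtinger_sum:
  "finite I \<Longrightarrow> (\<And>i. i \<in> I \<Longrightarrow> has_wirtinger (f i) (p i) (q i) \<tau>) \<Longrightarrow>
    has_wirtinger (\<lambda>z. \<Sum>i\<in>I. f i z) (\<Sum>i\<in>I. p i) (\<Sum>i\<in>I. q i) \<tau>"
proof (induction I rule: finite_induct)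
  case empty
  then show ?case by (simp add: has_wirtinger_const)
next
  case (insert i I)
  have "has_wirtinger (\<lambda>z. f i z + (\<Sum>i\<in>I. f i z)) (p i + (\<Sum>i\<in>I. p i)) (q i + (\<Sum>i\<in>I. q i)) \<tau>"
    by (rule has_wirtinger_add) (use insert in auto)
  then show ?case using insert.hyps by simp
qed

lemma has_poly_wirtinger_mult:
  assumes "has_poly_wirtinger P P1 P2 \<tau>" "has_poly_wirtinger Q Q1 Q2 \<tau>"
  shows "has_poly_wirtinger (\<lambda>z. P z * Q z) (P1 * Q \<tau> + P \<tau> * Q1) (P2 * Q \<tau> + P \<tau> * Q2) \<tau>"
  unfolding has_poly_wirtinger_def coeff_mult coeff_add sum.distrib[symmetric]
  using assms unfolding has_poly_wirtinger_def
  by (intro allI has_wirtinger_sum has_wirtinger_mult) auto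

lemma has_poly_wirtinger_smult:
  assumes "has_wirtinger h p q \<tau>" "has_poly_wirtinger P P1 P2 \<tau>"
  shows "has_poly_wirtinger (\<lambda>z. Polynomial.smult (h z) (P z)) (Polynomial.smult p (P \<tau>) + Polynomial.smult (h \<tau>) P1) (Polynomial.smult q (P \<tau>) + Polynomial.smult (h \<tau>) P2) \<tau>"
  unfolding has_poly_wirtinger_def coeff_smult coeff_add
  using assms unfolding has_poly_wirtinger_def by (intro allI has_wirtinger_mult) auto

lemma has_poly_wirtinger_sum:
  assumes "finite I" "\<And>i. i \<in> I \<Longrightarrow> has_poly_wirtinger (P i) (P1 i) (P2 i) \<tau>"
  shows "has_poly_wirtinger (\<lambda>z. \<Sum>i\<in>I. P i z) (\<Sum>i\<in>I. P1 i) (\<Sum>i\<in>I. P2 i) \<tau>"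
  unfolding has_poly_wirtinger_def coeff_sum
  using assms(2) unfolding has_poly_wirtinger_def by (intro allI has_wirtinger_sum assms(1)) auto

lemma has_poly_wirtinger_power:
  assumes "has_poly_wirtinger P P1 P2 \<tau>"
  shows "has_poly_wirtinger (\<lambda>z. P z ^ n) (Polynomial.smult (of_nat n) (P \<tau> ^ (n - 1) * P1)) (Polynomial.smult (of_nat n) (P \<tau> ^ (n - 1) * P2)) \<tau>"
proof (induction n)
  case 0
  then show ?case by (simp add: has_poly_wirtinger_def has_wirtinger_const)
next
  case (Suc n)
  have e: "R * P \<tau> ^ n + P \<tau> * Polynomial.smult (of_nat n) (P \<tau> ^ (n - 1) * R) = Polynomial.smult (of_nat (Suc n)) (P \<tau> ^ (Suc n - 1) * R)" for R
  proof (cases n)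
    case (Suc k)
    have "P \<tau> * Polynomial.smult (of_nat n) (P \<tau> ^ (n - 1) * R) = Polynomial.smult (of_nat n) (P \<tau> ^ n * R)"
      by (simp add: Suc mult.assoc)
    then show ?thesis by (simp add: smult_add_left mult.commute)
  qed simp
  show ?case
    using has_poly_wirtinger_mult[OF assms Suc.IH] unfolding e power_Suc .
qed

lemma has_poly_wirtinger_lin_A: "has_poly_wirtinger lin_A 1 0 \<tau>"
  unfolding has_poly_wirtinger_def
proof
  fix l
  show "has_wirtinger (\<lambda>z. coeff (lin_A z) l) (coeff 1 l) (coeff 0 l) \<tau>"
    by (cases l) (auto simp: lin_A_def coeff_pCons one_pCons split: nat.splits intro: has_wirtinger_const)
qed

text \<open>The identity \<tau> = cnj \<tau> + 2 i y recombines the two terms of the product rule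
  into a multiple of \<open>lin_A\<close>. After multiplication by - 2 i y^2 this says that lowering
  replaces B by - A, the source of the downward shift of the index.\<close>

lemma has_poly_wirtinger_lin_B:
  assumes "0 < Im \<tau>"
  shows "has_poly_wirtinger lin_B (Polynomial.smult (- inverse (2 * \<i> * of_real (Im \<tau>))) (lin_B \<tau>))
     (Polynomial.smult (inverse (2 * \<i> * (of_real (Im \<tau>))\<^sup>2)) (lin_A \<tau>)) \<tau>"
proof -
  define y where "y = complex_of_real (Im \<tau>)"
  define I where "I = 2 * \<i>"
  have y: "y \<noteq> 0" and I: "I \<noteq> 0" using assms by (auto simp: y_def I_def)
  have yt: "I * y = \<tau> - cnj \<tau>" by (simp add: y_def I_def complex_eq_iff)
  have hv: "has_wirtinger (\<lambda>z. inverse (of_real (Im z))) (- (1 / I) / y\<^sup>2) (- (- 1 / I) / y\<^sup>2) \<tau>"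
    using has_wirtinger_inverse[OF has_wirtinger_Im[of \<tau>]] y unfolding y_def I_def by blast
  show ?thesis
    unfolding has_poly_wirtinger_def y_def[symmetric] I_def[symmetric]
  proof
    fix l
    have 0: "has_wirtinger (\<lambda>z. coeff (lin_B z) 0) (- inverse (I * y) * (inverse y * cnj \<tau>)) (inverse (I * y\<^sup>2) * \<tau>) \<tau>"
    proof -
      have "has_wirtinger (\<lambda>z. inverse (of_real (Im z)) * cnj z) (- inverse (I * y) * (inverse y * cnj \<tau>)) (inverse (I * y\<^sup>2) * \<tau>) \<tau>"
      proof (rule has_wirtinger_cong[OF has_wirtinger_mult[OF hv has_wirtinger_cnj_id]], unfold y_def[symmetric])
        show "- (1 / I) / y\<^sup>2 * cnj \<tau> + inverse y * 0 = - inverse (I * y) * (inverse y * cnj \<tau>)"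
          using y I by (simp add: field_simps power2_eq_square)
        have "\<tau> = cnj \<tau> + I * y" using yt by simp
        then show "- (- 1 / I) / y\<^sup>2 * cnj \<tau> + inverse y * 1 = inverse (I * y\<^sup>2) * \<tau>"
          using y I by (simp add: field_simps power2_eq_square)
      qed
      then show ?thesis by (simp add: lin_B_def)
    qed
    have 1: "has_wirtinger (\<lambda>z. coeff (lin_B z) (Suc 0)) (- inverse (I * y) * (- inverse y)) (inverse (I * y\<^sup>2) * (- 1)) \<tau>"
    proof -
      have "has_wirtinger (\<lambda>z. inverse (of_real (Im z)) * (- 1)) (- inverse (I * y) * (- inverse y)) (inverse (I * y\<^sup>2) * (- 1)) \<tau>"
        by (rule has_wirtinger_cong[OF has_wirtinger_mult[OF hv has_wirtinger_const]])
           (use y I in \<open>simp_all add: field_simps power2_eq_square\<close>)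
      then show ?thesis by (simp add: lin_B_def)
    qed
    consider "l = 0" | "l = Suc 0" | k where "l = Suc (Suc k)" by (metis not0_implies_Suc)
    then show "has_wirtinger (\<lambda>z. coeff (lin_B z) l) (coeff (Polynomial.smult (- inverse (I * y)) (lin_B \<tau>)) l)
        (coeff (Polynomial.smult (inverse (I * y\<^sup>2)) (lin_A \<tau>)) l) \<tau>"
    proof cases
      case 1
      then show ?thesis using 0 by (simp add: lin_B_def lin_A_def y_def)
    next
      case 2
      then show ?thesis using \<open>has_wirtinger (\<lambda>z. coeff (lin_B z) (Suc 0)) _ _ _\<close> by (simp add: lin_B_def lin_A_def y_def)
    next
      case 3
      then show ?thesis by (simp add: lin_B_def lin_A_def has_wirtinger_const)
    qed
  qed
qed

lemma has_poly_wirtinger_sym_poly: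
  assumes y: "0 < Im \<tau>" and h: "\<And>i. i \<le> m \<Longrightarrow> has_wirtinger (h i) (p i) (q i) \<tau>"
  shows "has_poly_wirtinger (\<lambda>z. sym_poly m (\<lambda>i. h i z) z)
    (\<Sum>i\<le>m. Polynomial.smult (p i) (lin_A \<tau> ^ (m - i) * lin_B \<tau> ^ i) + Polynomial.smult (h i \<tau>)
      (Polynomial.smult (of_nat (m - i)) (lin_A \<tau> ^ (m - i - 1) * 1) * lin_B \<tau> ^ i
       + lin_A \<tau> ^ (m - i) * Polynomial.smult (of_nat i) (lin_B \<tau> ^ (i - 1) * Polynomial.smult (- inverse (2 * \<i> * of_real (Im \<tau>))) (lin_B \<tau>))))
    (\<Sum>i\<le>m. Polynomial.smult (q i) (lin_A \<tau> ^ (m - i) * lin_B \<tau> ^ i) + Polynomial.smult (h i \<tau>)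
      (Polynomial.smult (of_nat (m - i)) (lin_A \<tau> ^ (m - i - 1) * 0) * lin_B \<tau> ^ i
       + lin_A \<tau> ^ (m - i) * Polynomial.smult (of_nat i) (lin_B \<tau> ^ (i - 1) * Polynomial.smult (inverse (2 * \<i> * (of_real (Im \<tau>))\<^sup>2)) (lin_A \<tau>)))) \<tau>"
  unfolding sym_poly_def
  by (intro has_poly_wirtinger_sum has_poly_wirtinger_smult h has_poly_wirtinger_mult has_poly_wirtinger_power
      has_poly_wirtinger_lin_A has_poly_wirtinger_lin_B y) auto

text \<open>Replacing one Y by X moves the term of index i to index i - 1. For i = 0 the natural
  number i - 1 is again 0, but the factor i removes this term.\<close>

lemma sum_lower_index:
  fixes X Y :: complex
  shows "(\<Sum>i\<le>m. of_nat i * h i * (X ^ (m - i) * (Y ^ (i - 1) * X)))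
    = (\<Sum>i\<le>m. (if i < m then of_nat (Suc i) * h (Suc i) else 0) * (X ^ (m - i) * Y ^ i))"
proof -
  have "(\<Sum>i\<le>m. of_nat i * h i * (X ^ (m - i) * (Y ^ (i - 1) * X)))
      = (\<Sum>i<m. of_nat (Suc i) * h (Suc i) * (X ^ (m - Suc i) * (Y ^ i * X)))"
    by (subst sum.atMost_shift) simp
  also have "\<dots> = (\<Sum>i<m. (if i < m then of_nat (Suc i) * h (Suc i) else 0) * (X ^ (m - i) * Y ^ i))"
  proof (rule sum.cong)
    fix i assume "i \<in> {..<m}"
    then have "i < m" by simp
    then have "X ^ (m - i) = X * X ^ (m - Suc i)" by (metis Suc_diff_Suc power_Suc)
    then show "of_nat (Suc i) * h (Suc i) * (X ^ (m - Suc i) * (Y ^ i * X)) = (if i < m then of_nat (Suc i) * h (Suc i) else 0) * (X ^ (m - i) * Y ^ i)"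
      using \<open>i < m\<close> by (simp only: if_True mult_ac)
  qed simp
  also have "\<dots> = (\<Sum>i\<le>m. (if i < m then of_nat (Suc i) * h (Suc i) else 0) * (X ^ (m - i) * Y ^ i))"
    by (simp add: lessThan_Suc_atMost[symmetric])
  finally show ?thesis .
qed

text \<open>Replacing one X by Y moves the term of index i to i + 1; the factor m - i removes the
  term that would leave the range.\<close>

lemma sum_raise_index:
  fixes X Y :: complex
  shows "(\<Sum>i\<le>m. of_nat (m - i) * h i * (X ^ (m - i - 1) * Y ^ Suc i))
    = (\<Sum>i\<le>m. (if 0 < i then of_nat (m - i + 1) * h (i - 1) else 0) * (X ^ (m - i) * Y ^ i))"
proof -
  have "(\<Sum>i\<le>m. (if 0 < i then of_nat (m - i + 1) * h (i - 1) else 0) * (X ^ (m - i) * Y ^ i))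
      = (\<Sum>i<m. of_nat (m - Suc i + 1) * h i * (X ^ (m - Suc i) * Y ^ Suc i))"
    by (subst sum.atMost_shift) simp
  also have "\<dots> = (\<Sum>i<m. of_nat (m - i) * h i * (X ^ (m - i - 1) * Y ^ Suc i))"
    by (rule sum.cong) (auto simp: Suc_diff_Suc)
  also have "\<dots> = (\<Sum>i\<le>m. of_nat (m - i) * h i * (X ^ (m - i - 1) * Y ^ Suc i))"
    by (simp add: lessThan_Suc_atMost[symmetric])
  finally show ?thesis by simp
qed

lemma poly_lin: "poly (lin_A \<tau>) w = \<tau> - w" "poly (lin_B \<tau>) w = inverse (of_real (Im \<tau>)) * (cnj \<tau> - w)"
  by (simp_all add: lin_A_def lin_B_def algebra_simps)

lemma poly_sym_poly:
  "poly (sym_poly m a \<tau>) w = (\<Sum>i\<le>m. a i * ((\<tau> - w) ^ (m - i) * (inverse (of_real (Im \<tau>)) * (cnj \<tau> - w)) ^ i))"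
  by (simp only: sym_poly_def poly_sum poly_lin poly_power poly_mult poly_smult)

lemma vv_component: "l < m + 1 \<Longrightarrow> (\<lambda>z. vv m h z $ l) = (\<lambda>z. coeff (sym_poly m (\<lambda>i. h i z) z) l)"
  by (simp add: vv_def sym_vec_def)

lemma componentwise_vv:
  "componentwise D (vv m h) \<tau> = Matrix.vec (m + 1) (\<lambda>l. D (\<lambda>z. coeff (sym_poly m (\<lambda>i. h i z) z) l) \<tau>)"
  unfolding componentwise_def
  by (rule eq_vecI) (simp_all add: vv_def sym_vec_def)

text \<open>A is holomorphic and B lowers to - A, so component i contributes its own lowering at
  index i and - i h_i at index i - 1.\<close>

lemma lowering_vv:
  assumes y: "0 < Im \<tau>" and h: "\<And>i. i \<le> m \<Longrightarrow> has_wirtinger (h i) (p i) (q i) \<tau>"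
  shows "lowering k (vv m h) \<tau> = sym_vec m (\<lambda>i. - 2 * \<i> * (of_real (Im \<tau>))\<^sup>2 * q i -
     (if i < m then of_nat (Suc i) * h (Suc i) \<tau> else 0)) \<tau>"
proof -
  note hw = has_poly_wirtinger_sym_poly[OF y h, unfolded has_poly_wirtinger_def, rule_format]
  define P2 where "P2 = (\<Sum>i\<le>m. Polynomial.smult (q i) (lin_A \<tau> ^ (m - i) * lin_B \<tau> ^ i) + Polynomial.smult (h i \<tau>)
      (Polynomial.smult (of_nat (m - i)) (lin_A \<tau> ^ (m - i - 1) * 0) * lin_B \<tau> ^ i
       + lin_A \<tau> ^ (m - i) * Polynomial.smult (of_nat i) (lin_B \<tau> ^ (i - 1) * Polynomial.smult (inverse (2 * \<i> * (of_real (Im \<tau>))\<^sup>2)) (lin_A \<tau>))))"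
  define c where "c = - 2 * \<i> * (complex_of_real (Im \<tau>))\<^sup>2"
  have c: "c * inverse (2 * \<i> * (of_real (Im \<tau>))\<^sup>2) = - 1"
  proof -
    have "I \<noteq> 0 \<Longrightarrow> u \<noteq> 0 \<Longrightarrow> - 2 * I * u * inverse (2 * I * u) = - 1" for I u :: complex
      by (simp add: field_simps)
    from this[of \<i> "(of_real (Im \<tau>))\<^sup>2"] show ?thesis using y by (simp add: c_def)
  qed
  have wb: "wirtinger_bar (\<lambda>z. coeff (sym_poly m (\<lambda>i. h i z) z) l) \<tau> = coeff P2 l" for l
    unfolding P2_def by (rule has_wirtinger_wirtinger(2)[OF hw])
  have eq: "Polynomial.smult c P2 = sym_poly m (\<lambda>i. c * q i - (if i < m then of_nat (Suc i) * h (Suc i) \<tau> else 0)) \<tau>"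
  proof (rule poly_ext)
    fix w
    define X where "X = \<tau> - w"
    define Y where "Y = inverse (of_real (Im \<tau>)) * (cnj \<tau> - w)"
    have pA: "poly (lin_A \<tau>) w = X" and pB: "poly (lin_B \<tau>) w = Y"
      by (simp_all only: poly_lin X_def Y_def)
    have "poly (Polynomial.smult c P2) w = (\<Sum>i\<le>m. c * q i * (X ^ (m - i) * Y ^ i)
        + (c * inverse (2 * \<i> * (of_real (Im \<tau>))\<^sup>2)) * (of_nat i * h i \<tau> * (X ^ (m - i) * (Y ^ (i - 1) * X))))"
      unfolding P2_def by (simp only: poly_smult poly_sum poly_add poly_mult poly_power pA pB sum_distrib_left
          mult_zero_right mult_zero_left poly_0 add_0_left distrib_left mult_ac)
    also have "\<dots> = (\<Sum>i\<le>m. c * q i * (X ^ (m - i) * Y ^ i)) - (\<Sum>i\<le>m. of_nat i * h i \<tau> * (X ^ (m - i) * (Y ^ (i - 1) * X)))"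
      unfolding c sum_subtractf[symmetric] by simp
    also have "\<dots> = (\<Sum>i\<le>m. (c * q i - (if i < m then of_nat (Suc i) * h (Suc i) \<tau> else 0)) * (X ^ (m - i) * Y ^ i))"
      unfolding sum_lower_index[where h = "\<lambda>i. h i \<tau>"] left_diff_distrib sum_subtractf ..
    finally show "poly (Polynomial.smult c P2) w = poly (sym_poly m (\<lambda>i. c * q i - (if i < m then of_nat (Suc i) * h (Suc i) \<tau> else 0)) \<tau>) w"
      unfolding poly_sym_poly X_def[symmetric] Y_def[symmetric] .
  qed
  show ?thesis
    unfolding lowering_def componentwise_vv wb sym_vec_def c_def[symmetric] eq[symmetric] coeff_smult
    by (simp add: c_def of_real_power)
qed

text \<open>The derivative of A is constant, and 2 i = A / y - B. The part A / y and the derivative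
  of B both modify the term in 1 / y, turning k into k + m - 2i, which is the weight of component i;
  the part - B shifts the index upwards.\<close>

lemma raising_vv:
  assumes y: "0 < Im \<tau>" and h: "\<And>i. i \<le> m \<Longrightarrow> has_wirtinger (h i) (p i) (q i) \<tau>"
  shows "raising k (vv m h) \<tau> = sym_vec m (\<lambda>i. 2 * \<i> * p i + of_int (k + int m - 2 * int i) / of_real (Im \<tau>) * h i \<tau> -
     (if 0 < i then of_nat (m - i + 1) * h (i - 1) \<tau> else 0)) \<tau>"
proof -
  note hw = has_poly_wirtinger_sym_poly[OF y h, unfolded has_poly_wirtinger_def, rule_format]
  define v where "v = inverse (complex_of_real (Im \<tau>))"
  have v: "v \<noteq> 0" using y by (simp add: v_def)
  define P1 where "P1 = (\<Sum>i\<le>m. Polynomial.smult (p i) (lin_A \<tau> ^ (m - i) * lin_B \<tau> ^ i) + Polynomial.smult (h i \<tau>)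
      (Polynomial.smult (of_nat (m - i)) (lin_A \<tau> ^ (m - i - 1) * 1) * lin_B \<tau> ^ i
       + lin_A \<tau> ^ (m - i) * Polynomial.smult (of_nat i) (lin_B \<tau> ^ (i - 1) * Polynomial.smult (- inverse (2 * \<i> * of_real (Im \<tau>))) (lin_B \<tau>))))"
  have wb: "wirtinger (\<lambda>z. coeff (sym_poly m (\<lambda>i. h i z) z) l) \<tau> = coeff P1 l" for l
    unfolding P1_def by (rule has_wirtinger_wirtinger(1)[OF hw])
  define b where "b i = 2 * \<i> * p i + of_int (k + int m - 2 * int i) / of_real (Im \<tau>) * h i \<tau> -
     (if 0 < i then of_nat (m - i + 1) * h (i - 1) \<tau> else 0)" for i
  have eq: "Polynomial.smult (2 * \<i>) P1 + Polynomial.smult (of_int k / of_real (Im \<tau>)) (sym_poly m (\<lambda>i. h i \<tau>) \<tau>) = sym_poly m b \<tau>"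
  proof (rule poly_ext)
    fix w
    define X where "X = \<tau> - w"
    define Y where "Y = v * (cnj \<tau> - w)"
    have pA: "poly (lin_A \<tau>) w = X" and pB: "poly (lin_B \<tau>) w = Y"
      by (simp_all only: poly_lin X_def Y_def v_def)
    define I where "I = 2 * \<i>"
    have I: "I = v * X - Y"
    proof -
      have "X - (cnj \<tau> - w) = I * of_real (Im \<tau>)" by (simp add: X_def I_def complex_eq_iff)
      then have "v * (X - (cnj \<tau> - w)) = I" using y by (simp add: v_def)
      then show ?thesis by (simp add: Y_def right_diff_distrib)
    qed
    have Iv: "I * - inverse (I * of_real (Im \<tau>)) = - v" by (simp add: I_def v_def)
    have t: "I * (p i * (X ^ (m - i) * Y ^ i) + h i \<tau> * (of_nat (m - i) * (X ^ (m - i - 1) * 1) * Y ^ i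
        + X ^ (m - i) * (of_nat i * (Y ^ (i - 1) * (- inverse (I * of_real (Im \<tau>)) * Y))))) + of_int k * v * (h i \<tau> * (X ^ (m - i) * Y ^ i))
      = (I * p i + of_int (k + int m - 2 * int i) * v * h i \<tau>) * (X ^ (m - i) * Y ^ i) - of_nat (m - i) * h i \<tau> * (X ^ (m - i - 1) * Y ^ Suc i)"
      if "i \<le> m" for i
    proof -
      have e1: "of_nat i * (Y ^ (i - 1) * Y) = of_nat i * Y ^ i" by (cases i) simp_all
      have e2: "of_nat (m - i) * (X ^ (m - i - 1) * X) = of_nat (m - i) * X ^ (m - i)"
        by (cases "m - i") simp_all
      have e3: "complex_of_int (k + int m - 2 * int i) = of_int k + of_nat (m - i) - of_nat i"
        using that by (simp add: of_nat_diff)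
      have "I * (p i * (X ^ (m - i) * Y ^ i) + h i \<tau> * (of_nat (m - i) * (X ^ (m - i - 1) * 1) * Y ^ i
        + X ^ (m - i) * (of_nat i * (Y ^ (i - 1) * (- inverse (I * of_real (Im \<tau>)) * Y))))) + of_int k * v * (h i \<tau> * (X ^ (m - i) * Y ^ i))
       = I * p i * (X ^ (m - i) * Y ^ i) + h i \<tau> * (I * (of_nat (m - i) * X ^ (m - i - 1))) * Y ^ i
        + (I * - inverse (I * of_real (Im \<tau>))) * h i \<tau> * X ^ (m - i) * (of_nat i * (Y ^ (i - 1) * Y)) + of_int k * v * (h i \<tau> * (X ^ (m - i) * Y ^ i))"
        by (simp only: distrib_left mult_1_right mult_1_left mult_ac add_ac)
      also have "I * (of_nat (m - i) * X ^ (m - i - 1)) = v * (of_nat (m - i) * (X ^ (m - i - 1) * X)) - of_nat (m - i) * X ^ (m - i - 1) * Y"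
        unfolding I by (simp only: left_diff_distrib right_diff_distrib mult_ac)
      finally show ?thesis unfolding e1 e2 e3 Iv
        by (simp add: algebra_simps)
    qed
    have "poly (Polynomial.smult I P1 + Polynomial.smult (of_int k * v) (sym_poly m (\<lambda>i. h i \<tau>) \<tau>)) w
      = (\<Sum>i\<le>m. I * (p i * (X ^ (m - i) * Y ^ i) + h i \<tau> * (of_nat (m - i) * (X ^ (m - i - 1) * 1) * Y ^ i
        + X ^ (m - i) * (of_nat i * (Y ^ (i - 1) * (- inverse (I * of_real (Im \<tau>)) * Y))))) + of_int k * v * (h i \<tau> * (X ^ (m - i) * Y ^ i)))"
      unfolding P1_def poly_add poly_smult poly_sym_poly v_def[symmetric] X_def[symmetric] Y_def[symmetric] I_def[symmetric]
      by (simp only: poly_sum poly_add poly_smult poly_mult poly_power poly_1 pA pB sum_distrib_left sum.distrib[symmetric])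
    also have "\<dots> = (\<Sum>i\<le>m. (I * p i + of_int (k + int m - 2 * int i) * v * h i \<tau>) * (X ^ (m - i) * Y ^ i) - of_nat (m - i) * h i \<tau> * (X ^ (m - i - 1) * Y ^ Suc i))"
      by (rule sum.cong[OF refl], rule t) simp
    also have "\<dots> = (\<Sum>i\<le>m. b i * (X ^ (m - i) * Y ^ i))"
      unfolding sum_subtractf sum_raise_index[where h = "\<lambda>i. h i \<tau>"] b_def left_diff_distrib I_def v_def divide_inverse ..
    finally show "poly (Polynomial.smult (2 * \<i>) P1 + Polynomial.smult (of_int k / of_real (Im \<tau>)) (sym_poly m (\<lambda>i. h i \<tau>) \<tau>)) w = poly (sym_poly m b \<tau>) w"
      unfolding poly_sym_poly[of m b] X_def[symmetric] v_def[symmetric] Y_def[symmetric] I_def divide_inverse .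
  qed
  show ?thesis
    unfolding raising_def componentwise_vv wb sym_vec_def b_def[symmetric] eq[symmetric]
    by (rule eq_vecI) simp_all
qed

section \<open>The modular group and its symmetric power representations\<close>

lemma det_2x2:
  assumes "A \<in> carrier_mat 2 2"
  shows "Determinant.det A = A $$ (0,0) * A $$ (1,1) - A $$ (0,1) * A $$ (1,0)"
proof -
  have d: "Determinant.det (mat_delete A i 0) = mat_delete A i 0 $$ (0,0)" if "i < 2" for i
    using assms that by (intro det_single) (auto simp: mat_delete_def)
  have "Determinant.det A = (\<Sum>i<2. A $$ (i, 0) * cofactor A i 0)"
    using laplace_expansion_column[OF assms, of 0] by simp
  also have "\<dots> = A $$ (0,0) * A $$ (1,1) - A $$ (0,1) * A $$ (1,0)"
    using assms by (simp add: numeral_2_eq_2 cofactor_def d) (simp add: mat_delete_def)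
  finally show ?thesis .
qed

lemma SL2Z_iff: "A \<in> carrier SL2Z \<longleftrightarrow> A \<in> carrier_mat 2 2 \<and> A $$ (0,0) * A $$ (1,1) - A $$ (0,1) * A $$ (1,0) = 1"
  by (auto simp: SL2Z_def det_2x2)

lemma SL2Z_D:
  assumes "A \<in> carrier SL2Z"
  shows "A \<in> carrier_mat 2 2" "A $$ (0,0) * A $$ (1,1) - A $$ (0,1) * A $$ (1,0) = 1"
  using assms by (auto simp: SL2Z_iff)

lemma mult_2x2_entries:
  fixes A B :: "int mat"
  assumes "A \<in> carrier_mat 2 2" "B \<in> carrier_mat 2 2"
  shows "(A * B) $$ (0,0) = A $$ (0,0) * B $$ (0,0) + A $$ (0,1) * B $$ (1,0)"
    "(A * B) $$ (0,1) = A $$ (0,0) * B $$ (0,1) + A $$ (0,1) * B $$ (1,1)"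
    "(A * B) $$ (1,0) = A $$ (1,0) * B $$ (0,0) + A $$ (1,1) * B $$ (1,0)"
    "(A * B) $$ (1,1) = A $$ (1,0) * B $$ (0,1) + A $$ (1,1) * B $$ (1,1)"
  using assms by (auto simp: scalar_prod_def sum.atLeast0_lessThan_Suc numeral_2_eq_2)

definition inv_2x2 :: "int mat \<Rightarrow> int mat" where
  "inv_2x2 A = Matrix.mat 2 2 (\<lambda>(i,j). if i = j then A $$ (1 - i, 1 - i) else - A $$ (i, j))"

lemma inv_2x2_entries:
  "inv_2x2 A \<in> carrier_mat 2 2" "inv_2x2 A $$ (0,0) = A $$ (1,1)" "inv_2x2 A $$ (1,1) = A $$ (0,0)"
  "inv_2x2 A $$ (0,1) = - A $$ (0,1)" "inv_2x2 A $$ (1,0) = - A $$ (1,0)"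
  by (auto simp: inv_2x2_def)

lemma eq_2x2I:
  fixes A B :: "int mat"
  assumes "A \<in> carrier_mat 2 2" "B \<in> carrier_mat 2 2" "A $$ (0,0) = B $$ (0,0)" "A $$ (0,1) = B $$ (0,1)"
    "A $$ (1,0) = B $$ (1,0)" "A $$ (1,1) = B $$ (1,1)"
  shows "A = B"
proof (rule eq_matI)
  fix i j assume "i < dim_row B" "j < dim_col B"
  then have "i < 2" "j < 2" using assms by auto
  then have "(i = 0 \<or> i = 1) \<and> (j = 0 \<or> j = 1)" by linarith
  then show "A $$ (i,j) = B $$ (i,j)" using assms by auto
qed (use assms in auto)

lemma inv_2x2_mult:
  assumes "A \<in> carrier SL2Z"
  shows "inv_2x2 A \<in> carrier SL2Z" "inv_2x2 A * A = 1\<^sub>m 2" "A * inv_2x2 A = 1\<^sub>m 2"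
proof -
  note A = SL2Z_D[OF assms]
  show "inv_2x2 A \<in> carrier SL2Z"
    unfolding SL2Z_iff inv_2x2_entries(2-) using A inv_2x2_entries(1)[of A] by (simp add: mult.commute)
  show "inv_2x2 A * A = 1\<^sub>m 2"
    by (rule eq_2x2I) (use A inv_2x2_entries(1)[of A] in
        \<open>auto simp only: mult_2x2_entries[OF inv_2x2_entries(1) A(1)] inv_2x2_entries, auto simp: algebra_simps\<close>)
  show "A * inv_2x2 A = 1\<^sub>m 2"
    by (rule eq_2x2I) (use A inv_2x2_entries(1)[of A] in
        \<open>auto simp only: mult_2x2_entries[OF A(1) inv_2x2_entries(1)] inv_2x2_entries, auto simp: algebra_simps\<close>)
qed

lemma group_SL2Z: "group SL2Z"
proof (rule groupI)
  show "x \<otimes>\<^bsub>SL2Z\<^esub> y \<in> carrier SL2Z" if "x \<in> carrier SL2Z" "y \<in> carrier SL2Z" for x y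
    using that det_mult[of x 2 y] by (auto simp: SL2Z_def)
  show "\<one>\<^bsub>SL2Z\<^esub> \<in> carrier SL2Z" by (simp add: SL2Z_def)
  show "x \<otimes>\<^bsub>SL2Z\<^esub> y \<otimes>\<^bsub>SL2Z\<^esub> z = x \<otimes>\<^bsub>SL2Z\<^esub> (y \<otimes>\<^bsub>SL2Z\<^esub> z)"
    if "x \<in> carrier SL2Z" "y \<in> carrier SL2Z" "z \<in> carrier SL2Z" for x y z
    using that by (simp add: SL2Z_def assoc_mult_mat[of _ 2 2 _ 2 _ 2])
  show "\<one>\<^bsub>SL2Z\<^esub> \<otimes>\<^bsub>SL2Z\<^esub> x = x" if "x \<in> carrier SL2Z" for x
    using that by (auto simp: SL2Z_def)
  show "\<exists>y\<in>carrier SL2Z. y \<otimes>\<^bsub>SL2Z\<^esub> x = \<one>\<^bsub>SL2Z\<^esub>" if "x \<in> carrier SL2Z" for x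
    using inv_2x2_mult[OF that] by (intro bexI[of _ "inv_2x2 x"]) (simp_all add: SL2Z_def)
qed

lemma finite_index_SL2Z: "finite_index_subgroup (carrier SL2Z) SL2Z"
proof -
  interpret group SL2Z by (rule group_SL2Z)
  have "carrier SL2Z #>\<^bsub>SL2Z\<^esub> x = carrier SL2Z" if "x \<in> carrier SL2Z" for x
    using that by (intro coset_join2 subgroup_self)
  then have "rcosets\<^bsub>SL2Z\<^esub> (carrier SL2Z) \<subseteq> {carrier SL2Z}" unfolding RCOSETS_def by auto
  then show ?thesis unfolding finite_index_subgroup_def using subgroup_self by (auto intro: finite_subset)
qed

text \<open>This is (a - c w)^m P (g^(-1) w) for P of degree at most m, written without division so
  that it is visibly a polynomial. The inverse of g makes it a left action.\<close>

definition sub_poly :: "nat \<Rightarrow> int mat \<Rightarrow> complex poly \<Rightarrow> complex poly" where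
  "sub_poly m g P = (\<Sum>j\<le>m. Polynomial.smult (coeff P j)
     ([: - of_int (g $$ (0,1)), of_int (g $$ (1,1)) :] ^ j * [: of_int (g $$ (0,0)), - of_int (g $$ (1,0)) :] ^ (m - j)))"

definition sym_rep :: "nat \<Rightarrow> int mat \<Rightarrow> complex mat" where
  "sym_rep m g = Matrix.mat (m + 1) (m + 1) (\<lambda>(l, j). coeff
     ([: - of_int (g $$ (0,1)), of_int (g $$ (1,1)) :] ^ j * [: of_int (g $$ (0,0)), - of_int (g $$ (1,0)) :] ^ (m - j)) l)"

lemma sym_rep_carrier: "sym_rep m g \<in> carrier_mat (m + 1) (m + 1)"
  by (simp add: sym_rep_def)

lemma sym_rep_mult_vec:
  "sym_rep m g *\<^sub>v Matrix.vec (m + 1) (coeff P) = Matrix.vec (m + 1) (coeff (sub_poly m g P))"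
proof (rule eq_vecI)
  fix l assume "l < dim_vec (Matrix.vec (m + 1) (coeff (sub_poly m g P)))"
  then have l: "l < m + 1" by simp
  have "(sym_rep m g *\<^sub>v Matrix.vec (m + 1) (coeff P)) $ l = (\<Sum>j = 0..<m + 1. coeff
     ([: - of_int (g $$ (0,1)), of_int (g $$ (1,1)) :] ^ j * [: of_int (g $$ (0,0)), - of_int (g $$ (1,0)) :] ^ (m - j)) l * coeff P j)"
    using l by (simp add: sym_rep_def scalar_prod_def)
  also have "{0..<m + 1} = {..m}" by auto
  finally show "(sym_rep m g *\<^sub>v Matrix.vec (m + 1) (coeff P)) $ l = Matrix.vec (m + 1) (coeff (sub_poly m g P)) $ l"
    using l by (simp add: sub_poly_def coeff_sum mult.commute)
qed (simp add: sym_rep_def)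

lemma degree_linear_powers: "degree ([: a, b :] ^ i * [: c, d :] ^ j) \<le> i + j"
proof -
  have "degree ([: a, b :] ^ i * [: c, d :] ^ j) \<le> degree ([: a, b :] ^ i) + degree ([: c, d :] ^ j)"
    by (rule degree_mult_le)
  also have "\<dots> \<le> degree [: a, b :] * i + degree [: c, d :] * j"
    by (intro add_mono degree_power_le)
  also have "\<dots> \<le> 1 * i + 1 * j"
    by (intro add_mono mult_right_mono) (auto simp: degree_pCons_eq_if)
  finally show ?thesis by simp
qed

lemma degree_sub_poly: "degree (sub_poly m g P) \<le> m"
  unfolding sub_poly_def
proof (rule degree_sum_le)
  fix j assume "j \<in> {..m}"
  then have j: "j + (m - j) = m" by simp
  show "degree (Polynomial.smult (coeff P j) ([: - of_int (g $$ (0,1)), of_int (g $$ (1,1)) :] ^ j * [: of_int (g $$ (0,0)), - of_int (g $$ (1,0)) :] ^ (m - j))) \<le> m"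
    by (rule order.trans[OF degree_smult_le]) (rule degree_linear_powers[of _ _ j _ _ "m - j", unfolded j])
qed simp

text \<open>Polynomial identities are checked only at points w of the upper half plane, where the
  denominators a - c w cannot vanish.\<close>

lemma poly_eqI_upper_half_plane:
  fixes P Q :: "complex poly"
  assumes "\<And>w. 0 < Im w \<Longrightarrow> poly P w = poly Q w"
  shows "P = Q"
proof (rule ccontr)
  assume "P \<noteq> Q"
  then have "finite {w. poly (P - Q) w = 0}" by (intro poly_roots_finite) simp
  moreover have "range (\<lambda>n. Complex 0 (real (Suc n))) \<subseteq> {w. poly (P - Q) w = 0}"
    using assms by auto
  moreover have "infinite (range (\<lambda>n. Complex 0 (real (Suc n))))"
    by (rule range_inj_infinite) (auto simp: inj_def)
  ultimately show False using finite_subset by blast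
qed

lemma poly_sub_poly:
  fixes w :: complex and g :: "int mat" and P :: "complex poly"
  defines "u \<equiv> of_int (g $$ (0,0)) - of_int (g $$ (1,0)) * w"
  assumes "degree P \<le> m" "u \<noteq> 0"
  shows "poly (sub_poly m g P) w = u ^ m * poly P ((of_int (g $$ (1,1)) * w - of_int (g $$ (0,1))) / u)"
proof -
  let ?v = "of_int (g $$ (1,1)) * w - of_int (g $$ (0,1))"
  have "poly P x = (\<Sum>j\<le>m. coeff P j * x ^ j)" for x
    unfolding poly_altdef by (rule sum.mono_neutral_left) (use assms(2) in \<open>auto simp: coeff_eq_0\<close>)
  then have "u ^ m * poly P (?v / u) = (\<Sum>j\<le>m. u ^ m * (coeff P j * (?v / u) ^ j))"
    by (simp only: sum_distrib_left)
  also have "\<dots> = (\<Sum>j\<le>m. coeff P j * (?v ^ j * u ^ (m - j)))"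
  proof (rule sum.cong)
    fix j assume "j \<in> {..m}"
    then have "u ^ m = u ^ j * u ^ (m - j)" by (simp add: power_add[symmetric])
    then show "u ^ m * (coeff P j * (?v / u) ^ j) = coeff P j * (?v ^ j * u ^ (m - j))"
      using assms(3) by (simp add: power_divide)
  qed simp
  also have "\<dots> = poly (sub_poly m g P) w"
  proof -
    have "poly [: - of_int (g $$ (0,1)), of_int (g $$ (1,1)) :] w = ?v" by (simp add: mult.commute)
    moreover have "poly [: of_int (g $$ (0,0)), - of_int (g $$ (1,0)) :] w = u" by (simp add: u_def mult.commute)
    ultimately show ?thesis unfolding sub_poly_def by (simp only: poly_sum poly_smult poly_mult poly_power)
  qed
  finally show ?thesis by simp
qed

lemma inverse_moebius:
  fixes w :: complex
  assumes g: "g \<in> carrier SL2Z" and w: "0 < Im w"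
  shows "of_int (g $$ (0,0)) - of_int (g $$ (1,0)) * w \<noteq> 0"
    "0 < Im ((of_int (g $$ (1,1)) * w - of_int (g $$ (0,1))) / (of_int (g $$ (0,0)) - of_int (g $$ (1,0)) * w))"
proof -
  have det: "g $$ (1,1) * g $$ (0,0) - (- (g $$ (0,1))) * (- (g $$ (1,0))) = 1"
    using SL2Z_D(2)[OF g] by (simp add: mult.commute)
  have e: "of_int (- (g $$ (1,0))) * w + of_int (g $$ (0,0)) = of_int (g $$ (0,0)) - of_int (g $$ (1,0)) * w"
    "of_int (g $$ (1,1)) * w + of_int (- (g $$ (0,1))) = of_int (g $$ (1,1)) * w - of_int (g $$ (0,1))" by simp_all
  note M = Im_moebius[OF det w, unfolded e]
  show n: "of_int (g $$ (0,0)) - of_int (g $$ (1,0)) * w \<noteq> 0" by (rule M(1))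
  show "0 < Im ((of_int (g $$ (1,1)) * w - of_int (g $$ (0,1))) / (of_int (g $$ (0,0)) - of_int (g $$ (1,0)) * w))"
    unfolding M(2) using n w by simp
qed

text \<open>The factor a - c w is a cocycle: with w' = g^(-1) w, the denominator of g h at w is the
  product u u' of those of g at w and of h at w', and the numerators behave in the same way.\<close>

lemma sub_poly_mult:
  assumes g: "g \<in> carrier SL2Z" and h: "h \<in> carrier SL2Z" and P: "degree P \<le> m"
  shows "sub_poly m (g * h) P = sub_poly m g (sub_poly m h P)"
proof (rule poly_eqI_upper_half_plane)
  fix w :: complex assume w: "0 < Im w"
  note c = SL2Z_D(1)[OF g] SL2Z_D(1)[OF h]
  define u where "u = of_int (g $$ (0,0)) - of_int (g $$ (1,0)) * w"
  define v where "v = of_int (g $$ (1,1)) * w - of_int (g $$ (0,1))"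
  define w' where "w' = v / u"
  have u: "u \<noteq> 0" and w': "0 < Im w'" using inverse_moebius[OF g w] by (auto simp: u_def v_def w'_def)
  define u' where "u' = of_int (h $$ (0,0)) - of_int (h $$ (1,0)) * w'"
  define v' where "v' = of_int (h $$ (1,1)) * w' - of_int (h $$ (0,1))"
  have u': "u' \<noteq> 0" using inverse_moebius(1)[OF h w'] by (simp add: u'_def)
  have uw: "u * w' = v" using u by (simp add: w'_def)
  have "u * u' = of_int (h $$ (0,0)) * u - of_int (h $$ (1,0)) * (u * w')"
    by (simp add: u'_def algebra_simps)
  then have uu: "of_int ((g * h) $$ (0,0)) - of_int ((g * h) $$ (1,0)) * w = u * u'"
    unfolding mult_2x2_entries[OF c] uw by (simp add: u_def v_def algebra_simps)
  have "u * v' = of_int (h $$ (1,1)) * (u * w') - of_int (h $$ (0,1)) * u"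
    by (simp add: v'_def algebra_simps)
  then have vv: "of_int ((g * h) $$ (1,1)) * w - of_int ((g * h) $$ (0,1)) = u * v'"
    unfolding mult_2x2_entries[OF c] uw by (simp add: u_def v_def algebra_simps)
  have "poly (sub_poly m (g * h) P) w = (u * u') ^ m * poly P (v' / u')"
    using poly_sub_poly[OF P, of "g * h" w] u u' unfolding uu vv by simp
  moreover have "poly (sub_poly m g (sub_poly m h P)) w = u ^ m * poly (sub_poly m h P) w'"
    using poly_sub_poly[OF degree_sub_poly, where g = g and w = w] u unfolding u_def[symmetric] v_def[symmetric] w'_def by simp
  moreover have "poly (sub_poly m h P) w' = u' ^ m * poly P (v' / u')"
    using poly_sub_poly[OF P, of h w'] u' unfolding u'_def[symmetric] v'_def[symmetric] by simp
  ultimately show "poly (sub_poly m (g * h) P) w = poly (sub_poly m g (sub_poly m h P)) w"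
    by (simp add: power_mult_distrib)
qed

lemma sub_poly_one: "degree P \<le> m \<Longrightarrow> sub_poly m (1\<^sub>m 2) P = P"
  by (rule poly_eqI_upper_half_plane) (use poly_sub_poly[where g = "1\<^sub>m 2"] in simp)

lemma vec_as_poly:
  fixes v :: "complex vec"
  assumes "v \<in> carrier_vec (m + 1)"
  obtains P where "degree P \<le> m" "v = Matrix.vec (m + 1) (coeff P)"
proof
  let ?P = "\<Sum>j\<le>m. monom (v $ j) j"
  show "degree ?P \<le> m" by (rule degree_sum_le) (auto intro: order.trans[OF degree_monom_le])
  show "v = Matrix.vec (m + 1) (coeff ?P)"
    using assms by (intro eq_vecI) (auto simp: coeff_sum)
qed

lemma eq_mat_by_vec:
  fixes A B :: "complex mat"
  assumes "A \<in> carrier_mat n n" "B \<in> carrier_mat n n" "\<And>v. v \<in> carrier_vec n \<Longrightarrow> A *\<^sub>v v = B *\<^sub>v v"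
  shows "A = B"
proof (rule eq_matI)
  fix i j assume ij: "i < dim_row B" "j < dim_col B"
  then have "(A *\<^sub>v unit_vec n j) $ i = (B *\<^sub>v unit_vec n j) $ i" using assms(3)[of "unit_vec n j"] by simp
  then show "A $$ (i, j) = B $$ (i, j)" using ij assms(1,2) by simp
qed (use assms in auto)

lemma sym_rep_mult:
  assumes "g \<in> carrier SL2Z" "h \<in> carrier SL2Z"
  shows "sym_rep m (g * h) = sym_rep m g * sym_rep m h"
proof (rule eq_mat_by_vec)
  fix v :: "complex vec" assume "v \<in> carrier_vec (m + 1)"
  then obtain P where P: "degree P \<le> m" "v = Matrix.vec (m + 1) (coeff P)" using vec_as_poly by blast
  have "(sym_rep m g * sym_rep m h) *\<^sub>v v = sym_rep m g *\<^sub>v (sym_rep m h *\<^sub>v v)"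
    by (rule assoc_mult_mat_vec[OF sym_rep_carrier sym_rep_carrier]) (simp add: P)
  then show "sym_rep m (g * h) *\<^sub>v v = (sym_rep m g * sym_rep m h) *\<^sub>v v"
    unfolding P(2) sym_rep_mult_vec sub_poly_mult[OF assms P(1)] by simp
qed (rule sym_rep_carrier mult_carrier_mat[OF sym_rep_carrier sym_rep_carrier])+

lemma sym_rep_one: "sym_rep m (1\<^sub>m 2) = 1\<^sub>m (m + 1)"
proof (rule eq_mat_by_vec)
  fix v :: "complex vec" assume "v \<in> carrier_vec (m + 1)"
  then obtain P where P: "degree P \<le> m" "v = Matrix.vec (m + 1) (coeff P)" using vec_as_poly by blast
  show "sym_rep m (1\<^sub>m 2) *\<^sub>v v = 1\<^sub>m (m + 1) *\<^sub>v v"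
    unfolding P(2) sym_rep_mult_vec sub_poly_one[OF P(1)] by simp
qed (rule sym_rep_carrier one_carrier_mat)+

lemma matrix_representation_sym_rep: "matrix_representation (carrier SL2Z) (m + 1) (sym_rep m)"
proof -
  have U: "sym_rep m g \<in> carrier (GL (m + 1))" if g: "g \<in> carrier SL2Z" for g
  proof -
    note I = inv_2x2_mult[OF g]
    have "sym_rep m (inv_2x2 g) * sym_rep m g = 1\<^sub>m (m + 1)" "sym_rep m g * sym_rep m (inv_2x2 g) = 1\<^sub>m (m + 1)"
      unfolding sym_rep_mult[OF I(1) g, symmetric] sym_rep_mult[OF g I(1), symmetric] I(2,3) sym_rep_one by simp_all
    then show ?thesis
      unfolding GL_def units_of_carrier Units_def ring_mat_simps
      using sym_rep_carrier[of m g] sym_rep_carrier[of m "inv_2x2 g"] by auto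
  qed
  show ?thesis
    unfolding matrix_representation_def hom_def
    using U sym_rep_mult by (auto simp: SL2Z_def GL_def units_of_mult ring_mat_simps)
qed

text \<open>With w' = g^(-1) w, the factor A at (g \<tau>, w) is u / J times A at (\<tau>, w'), and
  B is u J times B, because Im contributes J cnj J and cnj J cancels. The basis element of index i
  thus has weight 2i - m, so that h_i must have weight k + m - 2i.\<close>

lemma vv_slash:
  assumes g: "g \<in> carrier SL2Z" and y: "0 < Im \<tau>"
    and h: "\<And>i. i \<le> m \<Longrightarrow> h i (moebius g \<tau>) =
      (of_int (g $$ (1,0)) * \<tau> + of_int (g $$ (1,1))) powi (k + int m - 2 * int i) * h i \<tau>"
  shows "slash k (vv m h) g \<tau> = sym_rep m g *\<^sub>v vv m h \<tau>"
proof -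
  define a b c d where abcd: "a = g $$ (0,0)" "b = g $$ (0,1)" "c = g $$ (1,0)" "d = g $$ (1,1)"
  define J where "J = of_int c * \<tau> + of_int d"
  define t where "t = moebius g \<tau>"
  have det: "a * d - b * c = 1" using SL2Z_D(2)[OF g] by (simp add: abcd)
  have J: "J \<noteq> 0" unfolding J_def by (rule Im_moebius(1)[OF det y])
  have t: "t = (of_int a * \<tau> + of_int b) / J" by (simp add: t_def moebius_def abcd J_def)
  have It: "Im t = Im \<tau> / (cmod J)\<^sup>2" unfolding t J_def by (rule Im_moebius(2)[OF det y])
  have deg: "degree (sym_poly m f \<tau>) \<le> m" for f
    unfolding sym_poly_def
  proof (rule degree_sum_le)
    fix i assume "i \<in> {..m}"
    then have i: "i \<le> m" by simp
    have "degree (lin_A \<tau> ^ (m - i) * lin_B \<tau> ^ i) \<le> (m - i) + i"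
      unfolding lin_A_def lin_B_def smult_pCons smult_0_right by (rule degree_linear_powers)
    then show "degree (Polynomial.smult (f i) (lin_A \<tau> ^ (m - i) * lin_B \<tau> ^ i)) \<le> m"
      using degree_smult_le[of "f i" "lin_A \<tau> ^ (m - i) * lin_B \<tau> ^ i"] i by linarith
  qed simp
  have "Polynomial.smult (J powi (- k)) (sym_poly m (\<lambda>i. h i t) t) = sub_poly m g (sym_poly m (\<lambda>i. h i \<tau>) \<tau>)"
  proof (rule poly_eqI_upper_half_plane)
    fix w :: complex assume w: "0 < Im w"
    define u where "u = of_int a - of_int c * w"
    define w' where "w' = (of_int d * w - of_int b) / u"
    have u: "u \<noteq> 0" using inverse_moebius(1)[OF g w] by (simp add: u_def abcd)
    have uw: "u * w' = of_int d * w - of_int b" using u by (simp add: w'_def)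
    have Jt: "J * t = of_int a * \<tau> + of_int b" using J by (simp add: t)
    have Jt': "cnj J * cnj t = of_int a * cnj \<tau> + of_int b" using arg_cong[OF Jt, of cnj] by simp
    have A: "t - w = u * (\<tau> - w') / J"
    proof -
      have "J * (t - w) = u * (\<tau> - w')"
        by (simp only: right_diff_distrib uw Jt) (simp add: J_def u_def algebra_simps)
      then show ?thesis using J by (simp add: field_simps)
    qed
    have "cnj J * (cnj t - w) = u * (cnj \<tau> - w')"
      by (simp only: right_diff_distrib uw Jt') (simp add: J_def u_def algebra_simps)
    moreover have "inverse (complex_of_real (Im t)) = inverse (of_real (Im \<tau>)) * (J * cnj J)"
      unfolding It complex_norm_square[symmetric] using y by (simp add: field_simps)
    ultimately have B: "inverse (of_real (Im t)) * (cnj t - w) = J * (u * (inverse (of_real (Im \<tau>)) * (cnj \<tau> - w')))"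
      by (simp add: mult_ac)
    have "poly (Polynomial.smult (J powi (- k)) (sym_poly m (\<lambda>i. h i t) t)) w
      = (\<Sum>i\<le>m. J powi (- k) * (h i t * ((t - w) ^ (m - i) * (inverse (of_real (Im t)) * (cnj t - w)) ^ i)))"
      by (simp only: poly_smult poly_sym_poly sum_distrib_left)
    also have "\<dots> = (\<Sum>i\<le>m. u ^ m * (h i \<tau> * ((\<tau> - w') ^ (m - i) * (inverse (of_real (Im \<tau>)) * (cnj \<tau> - w')) ^ i)))"
    proof (rule sum.cong)
      fix i assume "i \<in> {..m}"
      then have i: "i \<le> m" by simp
      have um: "u ^ m = u ^ (m - i) * u ^ i" using i by (simp add: power_add[symmetric])
      have Jm: "J powi (- k) * J powi (k + int m - 2 * int i) * J ^ i = J ^ (m - i)"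
      proof -
        have "J powi (- k) * J powi (k + int m - 2 * int i) * J powi (int i) = J powi (int (m - i))"
        proof -
          have "int (m - i) = - k + (k + int m - 2 * int i) + int i" using i by (simp add: of_nat_diff)
          then show ?thesis by (simp only: power_int_add[OF disjI1[OF J]])
        qed
        then show ?thesis by (simp only: power_int_of_nat)
      qed
      have "h i t = J powi (k + int m - 2 * int i) * h i \<tau>" using h[OF i] by (simp add: t_def J_def abcd)
      then have "J powi (- k) * (h i t * ((t - w) ^ (m - i) * (inverse (of_real (Im t)) * (cnj t - w)) ^ i))
        = (J powi (- k) * J powi (k + int m - 2 * int i) * J ^ i) / J ^ (m - i) * (u ^ (m - i) * u ^ i)
           * (h i \<tau> * ((\<tau> - w') ^ (m - i) * (inverse (of_real (Im \<tau>)) * (cnj \<tau> - w')) ^ i))"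
        unfolding A B by (simp only: power_mult_distrib power_inverse divide_inverse mult_ac)
      also have "\<dots> = u ^ m * (h i \<tau> * ((\<tau> - w') ^ (m - i) * (inverse (of_real (Im \<tau>)) * (cnj \<tau> - w')) ^ i))"
        unfolding Jm um using J by simp
      finally show "J powi (- k) * (h i t * ((t - w) ^ (m - i) * (inverse (of_real (Im t)) * (cnj t - w)) ^ i))
        = u ^ m * (h i \<tau> * ((\<tau> - w') ^ (m - i) * (inverse (of_real (Im \<tau>)) * (cnj \<tau> - w')) ^ i))" .
    qed simp
    also have "\<dots> = u ^ m * poly (sym_poly m (\<lambda>i. h i \<tau>) \<tau>) w'"
      by (simp only: poly_sym_poly sum_distrib_left)
    also have "\<dots> = poly (sub_poly m g (sym_poly m (\<lambda>i. h i \<tau>) \<tau>)) w"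
      using poly_sub_poly[OF deg, where g = g and w = w] u by (simp add: u_def w'_def abcd)
    finally show "poly (Polynomial.smult (J powi (- k)) (sym_poly m (\<lambda>i. h i t) t)) w = poly (sub_poly m g (sym_poly m (\<lambda>i. h i \<tau>) \<tau>)) w" .
  qed
  then have "sym_rep m g *\<^sub>v vv m h \<tau> = Matrix.vec (m + 1) (coeff (Polynomial.smult (J powi (- k)) (sym_poly m (\<lambda>i. h i t) t)))"
    unfolding vv_def sym_vec_def sym_rep_mult_vec by simp
  then show ?thesis
    unfolding slash_def vv_def sym_vec_def t_def[symmetric] abcd(3,4)[symmetric] J_def[symmetric]
    by (auto intro!: eq_vecI)
qed

section \<open>Vector-valued Eisenstein series\<close>

text \<open>Index i carries the parameter j = i + r and hence the weight \<kappa> - 2i - 2r. This is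
  what the basis element of index i requires in a form of weight \<kappa> - m - 2r, so r counts
  lowerings and - r counts raisings.\<close>

definition eis_vec :: "int \<Rightarrow> nat \<Rightarrow> int \<Rightarrow> (nat \<Rightarrow> real \<Rightarrow> real) \<Rightarrow> complex \<Rightarrow> complex vec" where
  "eis_vec \<kappa> m r \<chi> = vv m (\<lambda>i. eis \<kappa> (int i + r) (\<chi> i))"

definition low :: "nat \<Rightarrow> int \<Rightarrow> (nat \<Rightarrow> real \<Rightarrow> real) \<Rightarrow> nat \<Rightarrow> real \<Rightarrow> real" where
  "low m r \<chi> i = (\<lambda>x. of_int (int i + r) * \<chi> i x - deriv (\<chi> i) x - (if i < m then of_nat (Suc i) * \<chi> (Suc i) x else 0))"

definition rai :: "int \<Rightarrow> nat \<Rightarrow> int \<Rightarrow> (nat \<Rightarrow> real \<Rightarrow> real) \<Rightarrow> nat \<Rightarrow> real \<Rightarrow> real" where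
  "rai \<kappa> m r \<chi> i = (\<lambda>x. of_int (\<kappa> - int i - r) * \<chi> i x - deriv (\<chi> i) x - (if 0 < i then of_nat (m - i + 1) * \<chi> (i - 1) x else 0))"

definition decaying_seq :: "real \<Rightarrow> (nat \<Rightarrow> real \<Rightarrow> real) \<Rightarrow> bool" where
  "decaying_seq \<alpha> \<chi> \<longleftrightarrow> (\<forall>i. decaying \<alpha> (\<chi> i))"

lemma decaying_if: "(P \<Longrightarrow> decaying \<alpha> f) \<Longrightarrow> decaying \<alpha> (\<lambda>x. if P then f x else 0)"
  by (cases P) (simp_all add: decaying_zero)

lemma decaying_low: "decaying_seq \<alpha> \<chi> \<Longrightarrow> decaying_seq \<alpha> (low m r \<chi>)"
  unfolding decaying_seq_def low_def
  by (intro allI decaying_diff decaying_cmult decayingD(2) decaying_if) auto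

lemma decaying_rai: "decaying_seq \<alpha> \<chi> \<Longrightarrow> decaying_seq \<alpha> (rai \<kappa> m r \<chi>)"
  unfolding decaying_seq_def rai_def
  by (intro allI decaying_diff decaying_cmult decayingD(2) decaying_if) auto

lemma sym_vec_cong: "(\<And>i. i \<le> m \<Longrightarrow> a i = b i) \<Longrightarrow> sym_vec m a \<tau> = sym_vec m b \<tau>"
  unfolding sym_vec_def sym_poly_def by (metis (no_types, lifting) atMost_iff sum.cong)

lemma eis_diff:
  assumes "decaying \<alpha> \<chi>" "decaying \<alpha> \<psi>" "4 \<le> real_of_int \<kappa> + 2 * \<alpha>" "0 < Im \<tau>"
  shows "eis \<kappa> j (\<lambda>x. \<chi> x - \<psi> x) \<tau> = eis \<kappa> j \<chi> \<tau> - eis \<kappa> j \<psi> \<tau>"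
  using eis_linear[OF assms, of j 1 "-1"] by simp

lemma eis_cmult:
  assumes "decaying \<alpha> \<chi>" "4 \<le> real_of_int \<kappa> + 2 * \<alpha>" "0 < Im \<tau>"
  shows "eis \<kappa> j (\<lambda>x. c * \<chi> x) \<tau> = of_real c * eis \<kappa> j \<chi> \<tau>"
  using eis_linear[OF assms(1,1,2,3), of j c 0] by simp

lemma eis_zero:
  assumes "4 \<le> real_of_int \<kappa> + 2 * \<alpha>" "0 < Im \<tau>"
  shows "eis \<kappa> j (\<lambda>x. 0) \<tau> = 0"
  using eis_cmult[OF decaying_zero assms, of j 0] by simp

lemma lowering_eis_vec:
  assumes \<chi>: "decaying_seq \<alpha> \<chi>" and \<kappa>: "4 \<le> real_of_int \<kappa> + 2 * \<alpha>" and y: "0 < Im \<tau>"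
  shows "lowering k (eis_vec \<kappa> m r \<chi>) \<tau> = eis_vec \<kappa> m (r + 1) (low m r \<chi>) \<tau>"
proof -
  have d: "decaying \<alpha> (\<chi> i)" for i using \<chi> by (simp add: decaying_seq_def)
  note L = lowering_vv[OF y has_wirtinger_eis[OF d \<kappa> y, of "int i + r" i for i]]
  show ?thesis
    unfolding eis_vec_def L vv_def
  proof (rule sym_vec_cong)
    fix i
    define c where "c = 2 * \<i> * (complex_of_real (Im \<tau>))\<^sup>2"
    define E where "E = eis \<kappa> (int i + r + 1) (\<lambda>x. deriv (\<chi> i) x - of_int (int i + r) * \<chi> i x) \<tau>"
    have c: "c \<noteq> 0" using y by (simp add: c_def)
    have "eis \<kappa> (int i + (r + 1)) (low m r \<chi> i) \<tau>
      = eis \<kappa> (int i + r + 1) (\<lambda>x. of_int (int i + r) * \<chi> i x - deriv (\<chi> i) x) \<tau>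
        - eis \<kappa> (int i + r + 1) (\<lambda>x. if i < m then of_nat (Suc i) * \<chi> (Suc i) x else 0) \<tau>"
      unfolding low_def add.assoc[symmetric]
    proof (rule eis_diff[OF _ _ \<kappa> y])
      show "decaying \<alpha> (\<lambda>x. real_of_int (int i + r) * \<chi> i x - deriv (\<chi> i) x)"
        by (intro decaying_diff decaying_cmult decayingD(2) d)
      show "decaying \<alpha> (\<lambda>x. if i < m then real (Suc i) * \<chi> (Suc i) x else 0)"
        by (cases "i < m") (simp_all del: of_nat_Suc add: decaying_cmult d decaying_zero)
    qed
    moreover have "eis \<kappa> (int i + r + 1) (\<lambda>x. of_int (int i + r) * \<chi> i x - deriv (\<chi> i) x) \<tau> = - E"
    proof -
      have "(\<lambda>x. of_int (int i + r) * \<chi> i x - deriv (\<chi> i) x) = (\<lambda>x. (- 1) * (deriv (\<chi> i) x - of_int (int i + r) * \<chi> i x))"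
        by (rule ext) (simp only: mult_minus_left mult_1_left minus_diff_eq)
      then show ?thesis
        unfolding E_def using eis_cmult[OF _ \<kappa> y, of "\<lambda>x. deriv (\<chi> i) x - of_int (int i + r) * \<chi> i x" "int i + r + 1" "- 1"]
          decaying_diff[OF decayingD(2)[OF d] decaying_cmult[OF d, of "of_int (int i + r)"]]
        by simp
    qed
    moreover have "eis \<kappa> (int i + r + 1) (\<lambda>x. if i < m then of_nat (Suc i) * \<chi> (Suc i) x else 0) \<tau>
      = (if i < m then of_nat (Suc i) * eis \<kappa> (int (Suc i) + r) (\<chi> (Suc i)) \<tau> else 0)"
    proof (cases "i < m")
      case True
      have "int i + r + 1 = int (Suc i) + r" by simp
      then show ?thesis using True eis_cmult[OF d \<kappa> y, of "int (Suc i) + r" "of_nat (Suc i)" "Suc i"]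
        by (simp only: if_True of_real_of_nat_eq)
    next
      case False
      then show ?thesis using eis_zero[OF \<kappa> y] by simp
    qed
    moreover have "- c * (E / c) = - E" using c by simp
    ultimately show "- 2 * \<i> * (complex_of_real (Im \<tau>))\<^sup>2 *
         (eis \<kappa> (int i + r + 1) (\<lambda>x. deriv (\<chi> i) x - real_of_int (int i + r) * \<chi> i x) \<tau> / (2 * \<i> * (complex_of_real (Im \<tau>))\<^sup>2)) -
         (if i < m then of_nat (Suc i) * eis \<kappa> (int (Suc i) + r) (\<chi> (Suc i)) \<tau> else 0) =
         eis \<kappa> (int i + (r + 1)) (low m r \<chi> i) \<tau>"
      unfolding E_def[symmetric] c_def by (simp only: mult_minus_left)
  qed
qed

lemma raising_eis_vec:
  assumes \<chi>: "decaying_seq \<alpha> \<chi>" and \<kappa>: "4 \<le> real_of_int \<kappa> + 2 * \<alpha>" and y: "0 < Im \<tau>"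
    and k: "k = \<kappa> - int m - 2 * r"
  shows "raising k (eis_vec \<kappa> m r \<chi>) \<tau> = eis_vec \<kappa> m (r - 1) (rai \<kappa> m r \<chi>) \<tau>"
proof -
  have d: "decaying \<alpha> (\<chi> i)" for i using \<chi> by (simp add: decaying_seq_def)
  note L = raising_vv[OF y has_wirtinger_eis[OF d \<kappa> y, of "int i + r" i for i]]
  show ?thesis
    unfolding eis_vec_def L vv_def
  proof (rule sym_vec_cong)
    fix i assume i: "i \<le> m"
    define E where "E = eis \<kappa> (int i + r - 1) (\<lambda>x. of_int (\<kappa> - (int i + r)) * \<chi> i x - deriv (\<chi> i) x) \<tau>"
    define F where "F = eis \<kappa> (int i + r) (\<chi> i) \<tau>"
    have e1: "\<kappa> - int i - r = \<kappa> - (int i + r)" and e2: "int i + (r - 1) = int i + r - 1" by simp_all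
    have "eis \<kappa> (int i + (r - 1)) (rai \<kappa> m r \<chi> i) \<tau>
      = E - eis \<kappa> (int i + r - 1) (\<lambda>x. if 0 < i then of_nat (m - i + 1) * \<chi> (i - 1) x else 0) \<tau>"
      unfolding rai_def E_def e1 e2
    proof (rule eis_diff[OF _ _ \<kappa> y])
      show "decaying \<alpha> (\<lambda>x. real_of_int (\<kappa> - (int i + r)) * \<chi> i x - deriv (\<chi> i) x)"
        by (intro decaying_diff decaying_cmult decayingD(2) d)
      show "decaying \<alpha> (\<lambda>x. if 0 < i then real (m - i + 1) * \<chi> (i - 1) x else 0)"
        by (cases "0 < i") (simp_all del: of_nat_Suc add: decaying_cmult d decaying_zero)
    qed
    moreover have "eis \<kappa> (int i + r - 1) (\<lambda>x. if 0 < i then of_nat (m - i + 1) * \<chi> (i - 1) x else 0) \<tau>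
      = (if 0 < i then of_nat (m - i + 1) * eis \<kappa> (int (i - 1) + r) (\<chi> (i - 1)) \<tau> else 0)"
    proof (cases "0 < i")
      case True
      then have "int i + r - 1 = int (i - 1) + r" by (simp add: of_nat_diff)
      then show ?thesis using True eis_cmult[OF d \<kappa> y, of "int (i - 1) + r" "of_nat (m - i + 1)" "i - 1"]
        by (simp only: if_True of_real_of_nat_eq)
    next
      case False
      then show ?thesis using eis_zero[OF \<kappa> y] by simp
    qed
    moreover have "2 * \<i> * ((E - of_int (\<kappa> - 2 * (int i + r)) / of_real (Im \<tau>) * F) / (2 * \<i>))
        + of_int (k + int m - 2 * int i) / of_real (Im \<tau>) * F = E"
    proof -
      have "k + int m - 2 * int i = \<kappa> - 2 * (int i + r)" by (simp add: k)
      moreover have "I \<noteq> 0 \<Longrightarrow> I * ((E - n / v * F) / I) + n / v * F = E" for I n v :: complex by simp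
      ultimately show ?thesis by simp
    qed
    ultimately show "2 * \<i> * ((eis \<kappa> (int i + r - 1) (\<lambda>x. of_int (\<kappa> - (int i + r)) * \<chi> i x - deriv (\<chi> i) x) \<tau> -
          of_int (\<kappa> - 2 * (int i + r)) / of_real (Im \<tau>) * eis \<kappa> (int i + r) (\<chi> i) \<tau>) / (2 * \<i>)) +
         of_int (k + int m - 2 * int i) / of_real (Im \<tau>) * eis \<kappa> (int i + r) (\<chi> i) \<tau> -
         (if 0 < i then of_nat (m - i + 1) * eis \<kappa> (int (i - 1) + r) (\<chi> (i - 1)) \<tau> else 0) =
         eis \<kappa> (int i + (r - 1)) (rai \<kappa> m r \<chi> i) \<tau>"
      unfolding E_def[symmetric] F_def[symmetric] by (simp only:)
  qed
qed

text \<open>The equation at index i couples \<chi>_i to \<chi>_(i+1) only. It is solved from i = m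
  downwards, each step being one first order equation within the decaying kernels.\<close>

lemma low_surj:
  assumes t: "decaying_seq \<alpha> t"
  shows "\<exists>\<chi>. decaying_seq \<alpha> \<chi> \<and> (\<forall>i\<le>m. low m r \<chi> i = t i)"
proof -
  have "\<exists>\<chi>. decaying_seq \<alpha> \<chi> \<and> (\<forall>i. m - n \<le> i \<longrightarrow> i \<le> m \<longrightarrow> low m r \<chi> i = t i)" if "n \<le> m" for n
    using that
  proof (induction n)
    case 0
    obtain \<Phi> where \<Phi>: "decaying \<alpha> \<Phi>" "\<And>x. deriv \<Phi> x + (- of_int (int m + r)) * \<Phi> x = - 1 * t m x"
      using decaying_antiderivative[OF decaying_cmult[of \<alpha> "t m" "-1"], of "- of_int (int m + r)"] t
      unfolding decaying_seq_def by metis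
    have "low m r (\<lambda>i. \<Phi>) m = t m"
      unfolding low_def by (rule ext) (use \<Phi>(2) in \<open>simp add: algebra_simps\<close>)
    then show ?case
      by (intro exI[of _ "\<lambda>i. \<Phi>"]) (use \<Phi>(1) in \<open>auto simp: decaying_seq_def\<close>)
  next
    case (Suc n)
    then obtain \<chi> where \<chi>: "decaying_seq \<alpha> \<chi>" "\<And>i. m - n \<le> i \<Longrightarrow> i \<le> m \<Longrightarrow> low m r \<chi> i = t i" by auto
    define l where "l = m - Suc n"
    have l: "Suc l = m - n" "l < m" using Suc.prems by (auto simp: l_def)
    have "decaying \<alpha> (\<lambda>x. - 1 * t l x + (- of_nat (Suc l)) * \<chi> (Suc l) x)"
      using t \<chi>(1) unfolding decaying_seq_def by (intro decaying_add decaying_cmult) auto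
    from decaying_antiderivative[OF this, of "- of_int (int l + r)"]
    obtain \<Phi> where \<Phi>: "decaying \<alpha> \<Phi>" "\<And>x. deriv \<Phi> x + (- of_int (int l + r)) * \<Phi> x = - 1 * t l x + (- of_nat (Suc l)) * \<chi> (Suc l) x"
      by metis
    have 1: "low m r (\<chi>(l := \<Phi>)) i = t i" if "l \<le> i" "i \<le> m" for i
    proof (cases "i = l")
      case True
      have "low m r (\<chi>(l := \<Phi>)) l = t l"
        unfolding low_def by (rule ext) (use \<Phi>(2) l in \<open>simp add: algebra_simps\<close>)
      then show ?thesis using True by simp
    next
      case False
      then have "i \<noteq> l" "Suc i \<noteq> l" using that by auto
      then have "low m r (\<chi>(l := \<Phi>)) i = low m r \<chi> i" unfolding low_def by (simp only: fun_upd_other not_False_eq_True)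
      then show ?thesis using False that \<chi>(2) l by simp
    qed
    have 2: "decaying_seq \<alpha> (\<chi>(l := \<Phi>))" using \<chi>(1) \<Phi>(1) by (simp add: decaying_seq_def)
    show ?case unfolding l_def[symmetric]
      by (rule exI[of _ "\<chi>(l := \<Phi>)"], intro conjI allI impI, rule 2, rule 1)
  qed
  from this[of m] show ?thesis by simp
qed

text \<open>Here index i is coupled to i - 1, so the system is solved upwards from i = 0.\<close>

lemma rai_surj:
  assumes t: "decaying_seq \<alpha> t"
  shows "\<exists>\<chi>. decaying_seq \<alpha> \<chi> \<and> (\<forall>i\<le>m. rai \<kappa> m r \<chi> i = t i)"
proof -
  have "\<exists>\<chi>. decaying_seq \<alpha> \<chi> \<and> (\<forall>i\<le>n. rai \<kappa> m r \<chi> i = t i)" for n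
  proof (induction n)
    case 0
    obtain \<Phi> where \<Phi>: "decaying \<alpha> \<Phi>" "\<And>x. deriv \<Phi> x + (- of_int (\<kappa> - r)) * \<Phi> x = - 1 * t 0 x"
      using decaying_antiderivative[OF decaying_cmult[of \<alpha> "t 0" "-1"], of "- of_int (\<kappa> - r)"] t
      unfolding decaying_seq_def by metis
    have "rai \<kappa> m r (\<lambda>i. \<Phi>) 0 = t 0"
      unfolding rai_def by (rule ext) (use \<Phi>(2) in \<open>simp add: algebra_simps\<close>)
    then show ?case
      by (intro exI[of _ "\<lambda>i. \<Phi>"]) (use \<Phi>(1) in \<open>auto simp: decaying_seq_def\<close>)
  next
    case (Suc n)
    then obtain \<chi> where \<chi>: "decaying_seq \<alpha> \<chi>" "\<And>i. i \<le> n \<Longrightarrow> rai \<kappa> m r \<chi> i = t i" by auto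
    have "decaying \<alpha> (\<lambda>x. - 1 * t (Suc n) x + (- of_nat (m - Suc n + 1)) * \<chi> n x)"
      using t \<chi>(1) unfolding decaying_seq_def by (intro decaying_add decaying_cmult) auto
    from decaying_antiderivative[OF this, of "- of_int (\<kappa> - int (Suc n) - r)"]
    obtain \<Phi> where \<Phi>: "decaying \<alpha> \<Phi>" "\<And>x. deriv \<Phi> x + (- of_int (\<kappa> - int (Suc n) - r)) * \<Phi> x = - 1 * t (Suc n) x + (- of_nat (m - Suc n + 1)) * \<chi> n x"
      by metis
    have 1: "rai \<kappa> m r (\<chi>(Suc n := \<Phi>)) i = t i" if "i \<le> Suc n" for i
    proof (cases "i = Suc n")
      case True
      have "rai \<kappa> m r (\<chi>(Suc n := \<Phi>)) (Suc n) = t (Suc n)"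
        unfolding rai_def by (rule ext) (use \<Phi>(2) in \<open>simp add: algebra_simps del: of_nat_Suc\<close>)
      then show ?thesis using True by simp
    next
      case False
      then have "i \<noteq> Suc n" "i - 1 \<noteq> Suc n" using that by auto
      then have "rai \<kappa> m r (\<chi>(Suc n := \<Phi>)) i = rai \<kappa> m r \<chi> i" unfolding rai_def by (simp only: fun_upd_other not_False_eq_True)
      then show ?thesis using False that \<chi>(2) by simp
    qed
    have 2: "decaying_seq \<alpha> (\<chi>(Suc n := \<Phi>))" using \<chi>(1) \<Phi>(1) by (simp add: decaying_seq_def)
    show ?case
      by (rule exI[of _ "\<chi>(Suc n := \<Phi>)"], intro conjI allI impI, rule 2, rule 1)
  qed
  from this[of m] show ?thesis .
qed

text \<open>A power of |l|^2 / y turns the term into a monomial in y, l and cnj l. Suitable n and j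
  thus give the classical holomorphic, antiholomorphic and real analytic Eisenstein series.\<close>

lemma eis_term_exp:
  assumes \<omega>: "\<omega> \<in> lattice" and \<tau>: "0 < Im \<tau>"
  shows "eis_term \<kappa> j (\<lambda>x. c * exp (of_int n * x)) \<omega> \<tau>
    = of_real c * of_real (Im \<tau>) powi (j - n) * (ell \<omega> \<tau> powi (j + n - \<kappa>) * cnj (ell \<omega> \<tau>) powi (n - j))"
proof -
  define l where "l = ell \<omega> \<tau>"
  define m where "m = cnj l"
  define y where "y = complex_of_real (Im \<tau>)"
  have l: "l \<noteq> 0" "m \<noteq> 0" using ell_nonzero[OF \<omega> \<tau>] by (auto simp: l_def m_def)
  have y: "y \<noteq> 0" using \<tau> by (simp add: y_def)
  define Q where "Q = (cmod l)\<^sup>2 / Im \<tau>"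
  have Q: "0 < Q" using l \<tau> by (simp add: Q_def)
  have "exp (of_int n * ln Q) = Q powi n"
    using Q powr_real_of_int'[of Q n] by (simp add: powr_def)
  moreover have "complex_of_real Q = l * m / y"
    unfolding Q_def m_def y_def by (simp only: of_real_divide complex_norm_square)
  ultimately have e: "complex_of_real (c * exp (of_int n * ln Q)) = of_real c * (l * m / y) powi n"
    by (metis of_real_mult of_real_power_int)
  have "l powi (- \<kappa>) * (y * l / m) powi j * (of_real c * (l * m / y) powi n)
     = of_real c * (y powi j * y powi (- n)) * ((l powi j * l powi n * l powi (- \<kappa>)) * (m powi n * m powi (- j)))"
    by (simp only: power_int_mult_distrib power_int_divide_distrib power_int_inverse power_int_minus divide_inverse mult_ac)
  also have "y powi j * y powi (- n) = y powi (j - n)"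
    using y by (simp only: power_int_add[OF disjI1[OF y], symmetric]) simp
  also have "l powi j * l powi n * l powi (- \<kappa>) = l powi (j + n - \<kappa>)"
    by (simp only: power_int_add[OF disjI1[OF l(1)], symmetric]) simp
  also have "m powi n * m powi (- j) = m powi (n - j)"
    by (simp only: power_int_add[OF disjI1[OF l(2)], symmetric]) simp
  finally show ?thesis
    unfolding eis_term_def l_def[symmetric] Q_def[symmetric] e m_def[symmetric] y_def[symmetric] .
qed

text \<open>As \<open>y \<rightarrow> \<infinity>\<close> along the imaginary axis only the lattice points with \<open>c = 0\<close> survive; they contribute positive terms.\<close>
lemma eis_exp_nonzero:
  assumes \<kappa>: "4 \<le> \<kappa> - 2 * n" "even \<kappa>" and c: "c \<noteq> 0"
  shows "\<exists>\<tau>. 0 < Im \<tau> \<and> eis \<kappa> j (\<lambda>x. c * exp (of_int n * x)) \<tau> \<noteq> 0"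
proof -
  define s where "s = \<kappa> - 2 * n"
  define f where "f y \<omega> = ell \<omega> (Complex 0 y) powi (j + n - \<kappa>) * cnj (ell \<omega> (Complex 0 y)) powi (n - j)" for y \<omega>
  define S where "S = (\<Sum>\<^sub>\<infinity>\<omega>\<in>lattice. inverse (height \<omega> ^ 3))"
  have hpos: "0 < inverse (height \<omega> ^ 3)" if "\<omega> \<in> lattice" for \<omega> using height_ge_1[OF that] by simp
  have S: "0 \<le> S" unfolding S_def by (rule infsum_nonneg) (simp add: height_def)
  \<comment> \<open>The terms with c \<noteq> 0 sum to at most 8 S / y, the factor 8 coming from |l|
    \<ge> height / 2 in the third power. This choice of y makes that less than 1, the size of the
    term of (0, 1).\<close>
  define y where "y = 8 * S + 1"
  have y: "1 \<le> y" using S by (simp add: y_def)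
  let ?\<tau> = "Complex 0 y"
  have \<tau>: "0 < Im ?\<tau>" using y by simp
  have nf: "norm (f y \<omega>) = cmod (ell \<omega> ?\<tau>) powi (- s)" if "\<omega> \<in> lattice" for \<omega>
  proof -
    have "ell \<omega> ?\<tau> \<noteq> 0" using ell_nonzero[OF that \<tau>] .
    then have n0: "cmod (ell \<omega> ?\<tau>) \<noteq> 0" by simp
    have "norm (f y \<omega>) = cmod (ell \<omega> ?\<tau>) powi (j + n - \<kappa>) * cmod (ell \<omega> ?\<tau>) powi (n - j)"
      by (simp add: f_def norm_mult norm_power_int)
    also have "\<dots> = cmod (ell \<omega> ?\<tau>) powi ((j + n - \<kappa>) + (n - j))"
      by (simp only: power_int_add[OF disjI1[OF n0]])
    also have "(j + n - \<kappa>) + (n - j) = - s" by (simp add: s_def)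
    finally show ?thesis .
  qed
  have lge: "1 / 2 * height \<omega> \<le> cmod (ell \<omega> ?\<tau>)" if "\<omega> \<in> lattice" for \<omega>
    using ell_ge[of ?\<tau> 1 1 \<omega>] y by simp
  have pw: "X powi (- s) \<le> X powi (- 4)" if "1 \<le> X" for X :: real
    using \<kappa>(1) that by (intro power_int_increasing) (auto simp: s_def)
  have ge1: "1 \<le> cmod (ell \<omega> ?\<tau>)" if "\<omega> \<in> lattice" for \<omega>
  proof (cases "fst \<omega> = 0")
    case True
    then have "snd \<omega> \<noteq> 0" using that by (cases \<omega>) (auto simp: lattice_def)
    then have "1 \<le> \<bar>real_of_int (snd \<omega>)\<bar>" by linarith
    then show ?thesis using True by (simp add: ell_def)
  next
    case False
    then have "1 \<le> \<bar>real_of_int (fst \<omega>)\<bar>" by linarith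
    then have "1 * 1 \<le> \<bar>real_of_int (fst \<omega>)\<bar> * y" using y by (intro mult_mono) auto
    also have "\<dots> = \<bar>Im (ell \<omega> ?\<tau>)\<bar>" using y by (simp add: ell_def abs_mult)
    also have "\<dots> \<le> cmod (ell \<omega> ?\<tau>)" by (rule abs_Im_le_cmod)
    finally show ?thesis by simp
  qed
  have le3: "norm (f y \<omega>) \<le> 8 * inverse (height \<omega> ^ 3) * inverse (cmod (ell \<omega> ?\<tau>))" if \<omega>: "\<omega> \<in> lattice" for \<omega>
  proof -
    let ?X = "cmod (ell \<omega> ?\<tau>)"
    have X: "1 \<le> ?X" by (rule ge1[OF \<omega>])
    have h: "1 \<le> height \<omega>" by (rule height_ge_1[OF \<omega>])
    have "norm (f y \<omega>) \<le> ?X powi (- 4)" unfolding nf[OF \<omega>] by (rule pw[OF X])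
    also have "\<dots> = inverse (?X ^ 3) * inverse ?X"
      using X by (simp add: power_int_minus power_numeral_reduce flip: inverse_mult_distrib)
    also have "inverse (?X ^ 3) \<le> inverse ((1 / 2 * height \<omega>) ^ 3)"
      using lge[OF \<omega>] h by (intro le_imp_inverse_le power_mono) auto
    also have "inverse ((1 / 2 * height \<omega>) ^ 3) = 8 * inverse (height \<omega> ^ 3)"
      by (simp add: power_mult_distrib power_divide field_simps)
    finally show ?thesis using X by (simp add: mult_right_mono)
  qed
  have le3': "norm (f y \<omega>) \<le> 8 * inverse (height \<omega> ^ 3)" if \<omega>: "\<omega> \<in> lattice" for \<omega>
  proof -
    have "8 * inverse (height \<omega> ^ 3) * inverse (cmod (ell \<omega> ?\<tau>)) \<le> 8 * inverse (height \<omega> ^ 3) * 1"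
      using ge1[OF \<omega>] hpos[OF \<omega>] by (intro mult_left_mono) (auto simp: inverse_le_1_iff)
    with le3[OF \<omega>] show ?thesis by simp
  qed
  have sm: "(\<lambda>\<omega>. norm (f y \<omega>)) summable_on lattice"
    by (rule summable_on_comparison_test[OF summable_on_cmult_right[OF summable_height, of 8]]) (use le3' in auto)
  define L0 where "L0 = {\<omega> \<in> lattice. fst \<omega> = 0}"
  define L1 where "L1 = {\<omega> \<in> lattice. fst \<omega> \<noteq> 0}"
  have L: "lattice = L0 \<union> L1" "L0 \<inter> L1 = {}" "L0 \<subseteq> lattice" "L1 \<subseteq> lattice" by (auto simp: L0_def L1_def)
  have sm0: "(\<lambda>\<omega>. norm (f y \<omega>)) summable_on L0" and sm1: "(\<lambda>\<omega>. norm (f y \<omega>)) summable_on L1"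
    by (rule summable_on_subset_banach[OF sm L(3)], rule summable_on_subset_banach[OF sm L(4)])
  have split: "(\<Sum>\<^sub>\<infinity>\<omega>\<in>lattice. f y \<omega>) = (\<Sum>\<^sub>\<infinity>\<omega>\<in>L0. f y \<omega>) + (\<Sum>\<^sub>\<infinity>\<omega>\<in>L1. f y \<omega>)"
    unfolding L(1) by (rule infsum_Un_disjoint[OF abs_summable_summable[OF sm0] abs_summable_summable[OF sm1] L(2)])
  have L1b: "norm (\<Sum>\<^sub>\<infinity>\<omega>\<in>L1. f y \<omega>) \<le> 8 / y * S"
  proof -
    have s1: "(\<lambda>\<omega>. inverse (height \<omega> ^ 3)) summable_on L1"
      by (rule summable_on_subset_banach[OF summable_height L(4)])
    have "norm (\<Sum>\<^sub>\<infinity>\<omega>\<in>L1. f y \<omega>) \<le> (\<Sum>\<^sub>\<infinity>\<omega>\<in>L1. norm (f y \<omega>))"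
      by (rule norm_infsum_bound[OF sm1])
    also have "\<dots> \<le> (\<Sum>\<^sub>\<infinity>\<omega>\<in>L1. 8 / y * inverse (height \<omega> ^ 3))"
    proof (rule infsum_mono[OF sm1 summable_on_cmult_right[OF s1]])
      fix \<omega> assume w: "\<omega> \<in> L1"
      then have \<omega>: "\<omega> \<in> lattice" and "fst \<omega> \<noteq> 0" by (auto simp: L1_def)
      then have "1 \<le> \<bar>real_of_int (fst \<omega>)\<bar>" by linarith
      then have "1 * y \<le> \<bar>real_of_int (fst \<omega>)\<bar> * y" using y by (intro mult_right_mono) auto
      also have "\<dots> = \<bar>Im (ell \<omega> ?\<tau>)\<bar>" using y by (simp add: ell_def abs_mult)
      also have "\<dots> \<le> cmod (ell \<omega> ?\<tau>)" by (rule abs_Im_le_cmod)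
      finally have "inverse (cmod (ell \<omega> ?\<tau>)) \<le> inverse y" using y by (intro le_imp_inverse_le) auto
      then have "8 * inverse (height \<omega> ^ 3) * inverse (cmod (ell \<omega> ?\<tau>)) \<le> 8 * inverse (height \<omega> ^ 3) * inverse y"
        using hpos[OF \<omega>] by (intro mult_left_mono) auto
      moreover have "8 * inverse (height \<omega> ^ 3) * inverse y = 8 / y * inverse (height \<omega> ^ 3)"
        by (simp only: divide_inverse mult_ac)
      ultimately show "norm (f y \<omega>) \<le> 8 / y * inverse (height \<omega> ^ 3)"
        using le3[OF \<omega>] by linarith
    qed
    also have "\<dots> = 8 / y * (\<Sum>\<^sub>\<infinity>\<omega>\<in>L1. inverse (height \<omega> ^ 3))" by (rule infsum_cmult_right')
    also have "\<dots> \<le> 8 / y * S"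
      unfolding S_def using y hpos L
      by (intro mult_left_mono infsum_mono_neutral[OF s1 summable_height]) (auto intro: less_imp_le)
    finally show ?thesis .
  qed
  have f0: "f y \<omega> = of_real (norm (f y \<omega>))" if "\<omega> \<in> L0" for \<omega>
  proof -
    have \<omega>: "\<omega> \<in> lattice" and "fst \<omega> = 0" using that by (auto simp: L0_def)
    define d where "d = real_of_int (snd \<omega>)"
    have d: "d \<noteq> 0" using \<omega> \<open>fst \<omega> = 0\<close> by (cases \<omega>) (auto simp: d_def lattice_def)
    have el: "ell \<omega> ?\<tau> = of_real d" using \<open>fst \<omega> = 0\<close> by (simp add: ell_def d_def)
    have "f y \<omega> = of_real (d powi (j + n - \<kappa>) * d powi (n - j))"
      unfolding f_def el by (simp add: of_real_power_int)
    also have "d powi (j + n - \<kappa>) * d powi (n - j) = d powi (- s)"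
      by (simp only: power_int_add[OF disjI1[OF d], symmetric]) (simp add: s_def)
    finally have e: "f y \<omega> = of_real (d powi (- s))" .
    \<comment> \<open>An even exponent makes \<open>d powi (- s)\<close> a square, so the vectors
      (0, d) and (0, -d) reinforce each other.\<close>
    have "even (- s)" using \<kappa>(2) by (simp add: s_def)
    then obtain t where "- s = t * 2" by (metis evenE mult.commute)
    then have "d powi (- s) = (d powi t)\<^sup>2" by (simp only: power_int_mult) simp
    then have "0 \<le> d powi (- s)" by simp
    then show ?thesis by (simp only: e norm_of_real abs_of_nonneg)
  qed
  have one: "1 \<le> norm (\<Sum>\<^sub>\<infinity>\<omega>\<in>L0. f y \<omega>)"
  proof -
    have "(\<Sum>\<^sub>\<infinity>\<omega>\<in>L0. f y \<omega>) = (\<Sum>\<^sub>\<infinity>\<omega>\<in>L0. of_real (norm (f y \<omega>)))"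
      by (rule infsum_cong) (rule f0)
    also have "\<dots> = of_real (\<Sum>\<^sub>\<infinity>\<omega>\<in>L0. norm (f y \<omega>))" by (rule infsumI[OF has_sum_of_real[OF has_sum_infsum[OF sm0]]])
    finally have "norm (\<Sum>\<^sub>\<infinity>\<omega>\<in>L0. f y \<omega>) = \<bar>\<Sum>\<^sub>\<infinity>\<omega>\<in>L0. norm (f y \<omega>)\<bar>"
      by (simp only: norm_of_real)
    moreover have "(\<Sum>\<^sub>\<infinity>\<omega>\<in>{(0,1)}. norm (f y \<omega>)) \<le> (\<Sum>\<^sub>\<infinity>\<omega>\<in>L0. norm (f y \<omega>))"
      by (rule infsum_mono_neutral[OF _ sm0]) (auto simp: L0_def lattice_def)
    moreover have "(\<Sum>\<^sub>\<infinity>\<omega>\<in>{(0,1)}. norm (f y \<omega>)) = 1"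
      by (simp add: f_def ell_def)
    ultimately show ?thesis by linarith
  qed
  have "8 / y * S < 1" using S y by (simp add: y_def field_simps)
  then have "(\<Sum>\<^sub>\<infinity>\<omega>\<in>lattice. f y \<omega>) \<noteq> 0"
  proof -
    assume lt: "8 / y * S < 1"
    show ?thesis
    proof
      assume "(\<Sum>\<^sub>\<infinity>\<omega>\<in>lattice. f y \<omega>) = 0"
      then have "(\<Sum>\<^sub>\<infinity>\<omega>\<in>L0. f y \<omega>) = - (\<Sum>\<^sub>\<infinity>\<omega>\<in>L1. f y \<omega>)"
        unfolding split by (simp add: eq_neg_iff_add_eq_0)
      then show False using one L1b lt by simp
    qed
  qed
  moreover have "eis \<kappa> j (\<lambda>x. c * exp (of_int n * x)) ?\<tau> = of_real c * of_real y powi (j - n) * (\<Sum>\<^sub>\<infinity>\<omega>\<in>lattice. f y \<omega>)"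
  proof -
    have "eis \<kappa> j (\<lambda>x. c * exp (of_int n * x)) ?\<tau> = (\<Sum>\<^sub>\<infinity>\<omega>\<in>lattice. (of_real c * of_real y powi (j - n)) * f y \<omega>)"
      unfolding eis_def
    proof (rule infsum_cong)
      fix \<omega> assume "\<omega> \<in> lattice"
      from eis_term_exp[OF this \<tau>, of \<kappa> j c n]
      show "eis_term \<kappa> j (\<lambda>x. c * exp (of_int n * x)) \<omega> ?\<tau> = (of_real c * of_real y powi (j - n)) * f y \<omega>"
        by (simp only: f_def complex.sel)
    qed
    then show ?thesis by (simp only: infsum_cmult_right')
  qed
  ultimately have "eis \<kappa> j (\<lambda>x. c * exp (of_int n * x)) ?\<tau> \<noteq> 0"
    using c y by simp
  then show ?thesis using \<tau> by blast
qed

section \<open>Theta series\<close>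

text \<open>Suppose F x0 \<noteq> 0 at an interior point. A trigonometric polynomial T that exceeds
  1 close to x0 and is at most 1 in absolute value away from x0 is raised to high powers: by
  assumption the integral of Re (cnj (F x0) F) T^N is 0, yet the peak makes it grow without bound.
  Boundary points follow by continuity.\<close>

lemma fourier_coefficients_unique:
  fixes F :: "real \<Rightarrow> complex"
  assumes F: "continuous_on {0..1} F"
    and z: "\<And>k::int. ((\<lambda>x. F x * cis (2 * pi * k * x)) has_integral 0) {0..1}"
    and x: "x \<in> {0..1}"
  shows "F x = 0"
proof -
  have inner: "F x0 = 0" if x0: "0 < x0" "x0 < 1" for x0
  proof (rule ccontr)
    assume nz: "F x0 \<noteq> 0"
    \<comment> \<open>The factor cnj (F x0) and the real part give a real function with f x0 = |F
      x0|^2 > 0 whose integrals against T^N are still 0.\<close>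
    define f where "f x = Re (cnj (F x0) * F x)" for x
    have f0: "0 < f x0"
      using nz unfolding f_def by (simp add: complex_neq_0 power2_eq_square)
    have fc: "continuous_on {0..1} f" unfolding f_def by (intro continuous_intros F)
    \<comment> \<open>Since \<delta> is less than x0 and 1 - x0, the points of [0, 1] outside the
      \<delta>-neighbourhood of x0 also keep distance \<delta> from x0 - 1 and x0 + 1, where the
      periodic T is large again.\<close>
    obtain \<delta> where \<delta>: "0 < \<delta>" "\<delta> \<le> 1/4" "\<delta> < x0" "\<delta> < 1 - x0" "\<And>x. \<bar>x - x0\<bar> \<le> \<delta> \<Longrightarrow> f x0 / 2 \<le> f x"
    proof -
      have "x0 \<in> {0..1}" using x0 by simp
      then obtain d where d: "d > 0" "\<And>x. x \<in> {0..1} \<Longrightarrow> dist x x0 < d \<Longrightarrow> dist (f x) (f x0) < f x0 / 2"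
        using fc f0 unfolding continuous_on_iff by (meson half_gt_zero)
      define \<delta> where "\<delta> = min (min (d / 2) (1/4)) (min (x0 / 2) ((1 - x0) / 2))"
      have close: "f x0 / 2 \<le> f x" if "\<bar>x - x0\<bar> \<le> \<delta>" for x
      proof -
        have b: "\<bar>x - x0\<bar> \<le> d / 2" "\<bar>x - x0\<bar> \<le> x0 / 2" "\<bar>x - x0\<bar> \<le> (1 - x0) / 2"
          using that by (auto simp: \<delta>_def)
        have "0 \<le> x" using b(2) x0 by linarith
        moreover have "x \<le> 1" using abs_le_D1[OF b(3)] x0(2) by (simp add: field_simps)
        moreover have "dist x x0 < d" using b(1) d(1) unfolding dist_real_def by linarith
        ultimately have "x \<in> {0..1}" "dist x x0 < d" by simp_all
        then have "\<bar>f x - f x0\<bar> < f x0 / 2" using d(2) by (simp add: dist_real_def)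
        then show ?thesis by linarith
      qed
      have "\<delta> \<le> x0 / 2" "\<delta> \<le> (1 - x0) / 2" by (simp_all only: \<delta>_def min_le_iff_disj order_refl simp_thms)
      then have "2 * \<delta> \<le> x0" "2 * \<delta> + x0 \<le> 1" by (simp_all add: field_simps)
      then have "\<delta> < x0" "\<delta> < 1 - x0" using x0 by linarith+
      moreover have "0 < \<delta>" "\<delta> \<le> 1/4" using x0 d(1) by (auto simp: \<delta>_def)
      ultimately show thesis by (intro that close)
    qed
    define T where "T x = 1 + cos (2 * pi * (x - x0)) - cos (2 * pi * \<delta>)" for x
    have Tcis: "complex_of_real (T x) = of_real (1 - cos (2 * pi * \<delta>)) + cis (- 2 * pi * x0) / 2 * cis (2 * pi * x) + cis (2 * pi * x0) / 2 * cis (- 2 * pi * x)" for x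
    proof -
      have "cis (- 2 * pi * x0) / 2 * cis (2 * pi * x) + cis (2 * pi * x0) / 2 * cis (- 2 * pi * x)
        = (cis (2 * pi * (x - x0)) + cis (- (2 * pi * (x - x0)))) / 2"
        by (simp add: cis_mult algebra_simps add_divide_distrib)
      also have "\<dots> = of_real (cos (2 * pi * (x - x0)))"
        by (simp add: complex_eq_iff)
      finally show ?thesis unfolding T_def by (simp add: add.assoc)
    qed
    \<comment> \<open>T is a combination of 1, cis (2 pi x) and cis (- 2 pi x), so one factor T at a
      time is removed, at the price of shifting k by at most one.\<close>
    have P: "((\<lambda>x. F x * of_real (T x) ^ N * cis (2 * pi * of_int k * x)) has_integral 0) {0..1}" for N and k :: int
    proof (induction N arbitrary: k)
      case 0
      then show ?case using z[of k] by simp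
    next
      case (Suc N)
      define A B C where "A = complex_of_real (1 - cos (2 * pi * \<delta>))" and "B = cis (- 2 * pi * x0) / 2" and "C = cis (2 * pi * x0) / 2"
      have e: "F x * of_real (T x) ^ Suc N * cis (2 * pi * of_int k * x)
        = A * (F x * of_real (T x) ^ N * cis (2 * pi * of_int k * x))
        + B * (F x * of_real (T x) ^ N * cis (2 * pi * of_int (k + 1) * x))
        + C * (F x * of_real (T x) ^ N * cis (2 * pi * of_int (k - 1) * x))" for x
      proof -
        have c1: "cis (2 * pi * of_int (k + 1) * x) = cis (2 * pi * of_int k * x) * cis (2 * pi * x)"
          "cis (2 * pi * of_int (k - 1) * x) = cis (2 * pi * of_int k * x) * cis (- 2 * pi * x)"
          by (simp_all add: cis_mult algebra_simps)
        have "F x * of_real (T x) ^ Suc N * cis (2 * pi * of_int k * x) = of_real (T x) * (F x * of_real (T x) ^ N * cis (2 * pi * of_int k * x))"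
          by (simp only: power_Suc mult_ac)
        also have "\<dots> = (A + B * cis (2 * pi * x) + C * cis (- 2 * pi * x)) * (F x * of_real (T x) ^ N * cis (2 * pi * of_int k * x))"
          by (simp only: Tcis A_def B_def C_def)
        finally show ?thesis unfolding c1 by (simp only: distrib_right distrib_left mult_ac)
      qed
      have "((\<lambda>x. A * (F x * of_real (T x) ^ N * cis (2 * pi * of_int k * x))
        + B * (F x * of_real (T x) ^ N * cis (2 * pi * of_int (k + 1) * x))
        + C * (F x * of_real (T x) ^ N * cis (2 * pi * of_int (k - 1) * x))) has_integral A * 0 + B * 0 + C * 0) {0..1}"
        by (intro has_integral_add has_integral_mult_right Suc.IH)
      then show ?case unfolding e by simp
    qed
    have I: "((\<lambda>x. f x * T x ^ N) has_integral 0) {0..1}" for N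
    proof -
      have "((\<lambda>x. cnj (F x0) * (F x * of_real (T x) ^ N)) has_integral cnj (F x0) * 0) {0..1}"
        using P[of N 0] by (intro has_integral_mult_right) simp
      then have "((\<lambda>x. Re (cnj (F x0) * (F x * of_real (T x) ^ N))) has_integral Re (cnj (F x0) * 0)) {0..1}"
        by (rule has_integral_Re)
      moreover have "Re (cnj (F x0) * (F x * of_real (T x) ^ N)) = f x * T x ^ N" for x
      proof -
        have "cnj (F x0) * (F x * of_real (T x) ^ N) = (cnj (F x0) * F x) * of_real (T x ^ N)" by (simp add: mult.assoc)
        then show ?thesis unfolding f_def by (simp only: Re_complex_of_real Im_complex_of_real times_complex.sel mult_zero_right diff_zero)
      qed
      ultimately show ?thesis by simp
    qed
    obtain M where M: "0 \<le> M" "\<And>x. x \<in> {0..1} \<Longrightarrow> \<bar>f x\<bar> \<le> M"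
    proof -
      have "bounded (f ` {0..1})" by (intro compact_imp_bounded compact_continuous_image fc) simp
      then obtain M where "\<forall>x\<in>{0..1}. \<bar>f x\<bar> \<le> M" unfolding bounded_iff by auto
      then show thesis using that[of "max M 0"] by force
    qed
    \<comment> \<open>This is the value of T at distance \<delta> / 2 from x0, hence its minimum on
      the inner neighbourhood. It exceeds 1, so q^N is unbounded.\<close>
    define q where "q = 1 + cos (pi * \<delta>) - cos (2 * pi * \<delta>)"
    define c where "c = f x0 / 2"
    have c: "0 < c" using f0 by (simp add: c_def)
    have pd: "0 < pi * \<delta>" "2 * pi * \<delta> \<le> pi" using \<delta> pi_gt_zero mult_left_mono[of \<delta> "1/4" "2 * pi"] by auto
    have cosabs: "cos (2 * pi * (x - x0)) = cos (2 * pi * \<bar>x - x0\<bar>)" for x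
      using cos_abs_real[of "2 * pi * (x - x0)"] by (simp only: abs_mult abs_numeral abs_of_pos[OF pi_gt_zero])
    have q: "1 < q"
      using cos_monotone_0_pi[of "pi * \<delta>" "2 * pi * \<delta>"] pd \<delta>(1) by (simp add: q_def)
    have T1: "1 \<le> T x" if "\<bar>x - x0\<bar> \<le> \<delta>" for x
    proof -
      have "2 * pi * \<bar>x - x0\<bar> \<le> 2 * pi * \<delta>" using that by (intro mult_left_mono) auto
      then have "cos (2 * pi * \<delta>) \<le> cos (2 * pi * \<bar>x - x0\<bar>)" using pd by (intro cos_monotone_0_pi_le) auto
      then show ?thesis unfolding T_def cosabs by simp
    qed
    have Tq: "q \<le> T x" if "\<bar>x - x0\<bar> \<le> \<delta> / 2" for x
    proof -
      have "2 * pi * \<bar>x - x0\<bar> \<le> 2 * pi * (\<delta> / 2)" using that by (intro mult_left_mono) auto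
      then have "2 * pi * \<bar>x - x0\<bar> \<le> pi * \<delta>" by simp
      then have "cos (pi * \<delta>) \<le> cos (2 * pi * \<bar>x - x0\<bar>)" using pd by (intro cos_monotone_0_pi_le) auto
      then show ?thesis unfolding T_def cosabs q_def by simp
    qed
    have T2: "\<bar>T x\<bar> \<le> 1" if "x \<in> {0..1}" "\<delta> < \<bar>x - x0\<bar>" for x
    proof -
      have u: "\<bar>x - x0\<bar> \<le> 1 - \<delta>" using that(1) \<delta> x0 by auto
      have "cos (2 * pi * \<bar>x - x0\<bar>) \<le> cos (2 * pi * \<delta>)"
      proof (cases "\<bar>x - x0\<bar> \<le> 1/2")
        case True
        have "2 * pi * \<bar>x - x0\<bar> \<le> 2 * pi * (1/2)" "2 * pi * \<delta> \<le> 2 * pi * \<bar>x - x0\<bar>"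
          using that True by (auto intro!: mult_left_mono)
        then show ?thesis using pd by (intro cos_monotone_0_pi_le) auto
      next
        case False
        have "cos (2 * pi * \<bar>x - x0\<bar>) = cos (2 * pi * (1 - \<bar>x - x0\<bar>))"
          by (simp add: right_diff_distrib cos_diff)
        moreover have "2 * pi * (1 - \<bar>x - x0\<bar>) \<le> 2 * pi * (1/2)" "2 * pi * \<delta> \<le> 2 * pi * (1 - \<bar>x - x0\<bar>)"
          using u False by (intro mult_left_mono; simp)+
        ultimately show ?thesis using pd by (simp only:) (intro cos_monotone_0_pi_le, auto)
      qed
      moreover have "- 1 \<le> cos (2 * pi * \<bar>x - x0\<bar>)" "cos (2 * pi * \<delta>) \<le> 1" by auto
      ultimately show ?thesis unfolding T_def cosabs by linarith
    qed
    \<comment> \<open>The step function \<phi> lies below f T^N: the product is at least c q^N on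
      the inner interval of length \<delta>, nonnegative on the rest of the \<delta>-neighbourhood,
      and at least - M elsewhere. Comparing integrals gives the bound.\<close>
    have low: "c * q ^ N * \<delta> \<le> M" for N
    proof -
      define \<phi> where "\<phi> x = (if x \<in> {x0 - \<delta> / 2..x0 + \<delta> / 2} then c * q ^ N else 0) - M" for x
      have "((\<lambda>x. if x \<in> {x0 - \<delta> / 2..x0 + \<delta> / 2} then c * q ^ N else 0) has_integral (c * q ^ N * \<delta>)) {0..1}"
      proof (subst has_integral_restrict)
        show "{x0 - \<delta> / 2..x0 + \<delta> / 2} \<subseteq> {0..1}" using \<delta> by auto
        show "((\<lambda>x. c * q ^ N) has_integral c * q ^ N * \<delta>) {x0 - \<delta> / 2..x0 + \<delta> / 2}"
          using has_integral_const_real[of "c * q ^ N" "x0 - \<delta> / 2" "x0 + \<delta> / 2"] \<delta>(1) by (simp add: mult.commute)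
      qed
      then have "(\<phi> has_integral (c * q ^ N * \<delta> - M)) {0..1}"
        unfolding \<phi>_def using has_integral_const_real[of M 0 1] by (intro has_integral_diff) auto
      moreover have "\<phi> x \<le> f x * T x ^ N" if x: "x \<in> {0..1}" for x
      proof (cases "\<bar>x - x0\<bar> \<le> \<delta>")
        case True
        have f1: "c \<le> f x" using \<delta>(5)[OF True] by (simp add: c_def)
        show ?thesis
        proof (cases "\<bar>x - x0\<bar> \<le> \<delta> / 2")
          case True
          have "c * q ^ N \<le> f x * T x ^ N"
            using f1 c q Tq[OF True] by (intro mult_mono power_mono) auto
          moreover have "0 \<le> c * q ^ N" using c q by simp
          then have "\<phi> x \<le> c * q ^ N" using M(1) by (simp add: \<phi>_def)
          ultimately show ?thesis by linarith
        next
          case False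
          then have nin: "x \<notin> {x0 - \<delta> / 2..x0 + \<delta> / 2}" unfolding atLeastAtMost_iff by linarith
          have "\<phi> x \<le> 0" unfolding \<phi>_def if_not_P[OF nin] using M(1) by simp
          moreover have "0 \<le> f x * T x ^ N" using f1 c T1[OF True] by (intro mult_nonneg_nonneg zero_le_power) auto
          ultimately show ?thesis by linarith
        qed
      next
        case False
        then have nin: "x \<notin> {x0 - \<delta> / 2..x0 + \<delta> / 2}" using \<delta>(1) unfolding atLeastAtMost_iff by linarith
        have "\<phi> x = - M" unfolding \<phi>_def if_not_P[OF nin] by simp
        moreover have "\<bar>f x * T x ^ N\<bar> \<le> M * 1"
          unfolding abs_mult power_abs using M(2)[OF x] M(1) T2[OF x] False
          by (intro mult_mono power_le_one) auto
        ultimately show ?thesis by linarith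
      qed
      ultimately have "c * q ^ N * \<delta> - M \<le> 0" by (rule has_integral_le[OF _ I[of N]])
      then show ?thesis by simp
    qed
    obtain N where "M / (c * \<delta>) < q ^ N" using real_arch_pow[OF q] by blast
    then have "M < c * q ^ N * \<delta>" using c \<delta>(1) by (simp add: field_simps)
    with low[of N] show False by simp
  qed
  have "closure {0<..<1::real} = {0..1}" by simp
  moreover have "F y = 0" if "y \<in> closure {0<..<1}" for y
    by (rule continuous_constant_on_closure[of "{0<..<1}" F 0]) (use F inner that in auto)
  ultimately show ?thesis using x by simp
qed

lemma has_integral_cis:
  fixes k :: int
  shows "((\<lambda>x. cis (2 * pi * k * x)) has_integral (if k = 0 then 1 else 0)) {0..1}"
proof (cases "k = 0")
  case True
  then show ?thesis using has_integral_const_real[of "1::complex" 0 1] by simp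
next
  case False
  define w where "w = 2 * pi * real_of_int k"
  have w: "w \<noteq> 0" using False by (simp add: w_def)
  have "((\<lambda>x. cis (w * x)) has_integral (cis (w * 1) / (\<i> * of_real w) - cis (w * 0) / (\<i> * of_real w))) {0..1}"
  proof (rule fundamental_theorem_of_calculus)
    fix x :: real assume "x \<in> {0..1}"
    have "((\<lambda>z. exp (\<i> * of_real w * z) / (\<i> * of_real w)) has_field_derivative exp (\<i> * of_real w * of_real x)) (at (of_real x))"
      using w by (auto intro!: derivative_eq_intros)
    then have "((\<lambda>x. exp (\<i> * of_real w * of_real x) / (\<i> * of_real w)) has_vector_derivative exp (\<i> * of_real w * of_real x)) (at x within {0..1})"
      by (rule has_vector_derivative_real_field)
    then show "((\<lambda>x. cis (w * x) / (\<i> * of_real w)) has_vector_derivative cis (w * x)) (at x within {0..1})"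
      by (simp add: cis_conv_exp mult.assoc)
  qed simp
  moreover have "cis (w * 1) = 1" using cis_multiple_2pi[of "of_int k"] by (simp add: w_def)
  ultimately show ?thesis using False by (simp add: w_def)
qed

text \<open>The substitution x \<mapsto> c x with c = sqrt (2 pi s) reduces this to the
  characteristic function exp (- t^2 / 2) of the standard normal distribution at t = 2 pi k /
  c.\<close>

lemma gaussian_fourier:
  fixes k :: int
  assumes s: "0 < s"
  shows "((\<lambda>x. of_real (exp (- pi * s * x\<^sup>2)) * cis (2 * pi * k * x)) has_integral of_real (exp (- pi * (of_int k)\<^sup>2 / s) / sqrt s)) UNIV"
proof -
  define c where "c = sqrt (2 * pi * s)"
  have c: "0 < c" "c\<^sup>2 = 2 * pi * s" using s by (auto simp: c_def)
  define t where "t = 2 * pi * of_int k / c"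
  define \<psi> where "\<psi> x = std_normal_density x *\<^sub>R cis (t * x)" for x
  have m: "(\<lambda>x. cis (t * x)) \<in> borel_measurable borel"
    by (intro borel_measurable_continuous_onI continuous_intros)
  have int: "integrable lborel \<psi>"
    unfolding \<psi>_def
    by (rule Bochner_Integration.integrable_bound[of _ "std_normal_density"])
       (use m in \<open>auto simp: normal_density_nonneg integrable_normal_density\<close>)
  have "(CLINT x|std_normal_distribution. cis (t * x)) = exp (- t\<^sup>2 / 2)"
    using fun_cong[OF char_std_normal_distribution, of t] unfolding char_def cis_conv_exp by (simp add: mult.commute)
  moreover have "(CLINT x|std_normal_distribution. cis (t * x)) = (LINT x|lborel. \<psi> x)"
    unfolding \<psi>_def using m by (subst integral_density) (auto simp: normal_density_nonneg)
  ultimately have val: "(LINT x|lborel. \<psi> x) = of_real (exp (- t\<^sup>2 / 2))" by simp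
  have e: "\<psi> (0 + c * x) = of_real (1 / sqrt (2 * pi)) * (of_real (exp (- pi * s * x\<^sup>2)) * cis (2 * pi * k * x))" for x
  proof -
    have "(c * x)\<^sup>2 / 2 = pi * s * x\<^sup>2" by (simp add: power_mult_distrib c(2))
    then have a: "std_normal_density (c * x) = 1 / sqrt (2 * pi) * exp (- pi * s * x\<^sup>2)"
      by (simp add: std_normal_density_def)
    have b: "t * (c * x) = 2 * pi * k * x" using c(1) by (simp add: t_def)
    show ?thesis unfolding \<psi>_def add_0 a b scaleR_conv_of_real of_real_mult by (rule mult.assoc)
  qed
  have i2: "integrable lborel (\<lambda>x. \<psi> (0 + c * x))"
    using lborel_integrable_real_affine[OF int, of c 0] c(1) by simp
  have "(LINT x|lborel. \<psi> x) = \<bar>c\<bar> *\<^sub>R (LINT x|lborel. \<psi> (0 + c * x))"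
    using c(1) by (intro lborel_integral_real_affine) auto
  then have v2: "(LINT x|lborel. \<psi> (0 + c * x)) = of_real (exp (- t\<^sup>2 / 2) / c)"
    using c(1) val by (simp add: scaleR_conv_of_real field_simps)
  have "((\<lambda>x. \<psi> (0 + c * x)) has_integral of_real (exp (- t\<^sup>2 / 2) / c)) UNIV"
    using has_integral_integral_lborel[OF i2] unfolding v2 .
  then have "((\<lambda>x. of_real (sqrt (2 * pi)) * \<psi> (0 + c * x)) has_integral of_real (sqrt (2 * pi)) * of_real (exp (- t\<^sup>2 / 2) / c)) UNIV"
    by (rule has_integral_mult_right)
  moreover have "(of_real (sqrt (2 * pi)) :: complex) * of_real (exp (- t\<^sup>2 / 2) / c) = of_real (exp (- pi * (of_int k)\<^sup>2 / s) / sqrt s)"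
  proof -
    have "sqrt (2 * pi) / c = 1 / sqrt s" using s by (simp add: c_def real_sqrt_mult)
    moreover have t2: "t\<^sup>2 / 2 = pi * (of_int k)\<^sup>2 / s"
      using s by (simp add: t_def power_divide c(2) power_mult_distrib) (simp add: power2_eq_square)
    moreover have "- t\<^sup>2 / 2 = - pi * (of_int k)\<^sup>2 / s" using t2 by simp
    moreover have "sqrt (2 * pi) * (E / c) = (sqrt (2 * pi) / c) * E" for E by simp
    ultimately have "sqrt (2 * pi) * (exp (- t\<^sup>2 / 2) / c) = 1 / sqrt s * exp (- pi * (of_int k)\<^sup>2 / s)"
      by (simp only:)
    also have "\<dots> = exp (- pi * (of_int k)\<^sup>2 / s) / sqrt s" by simp
    finally have "sqrt (2 * pi) * (exp (- t\<^sup>2 / 2) / c) = exp (- pi * (of_int k)\<^sup>2 / s) / sqrt s" .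
    then show ?thesis by (simp only: of_real_mult[symmetric])
  qed
  moreover have "of_real (sqrt (2 * pi)) * (of_real (1 / sqrt (2 * pi)) * z) = z" for z :: complex
    by (simp add: mult.assoc[symmetric] of_real_mult[symmetric] del: of_real_mult)
  ultimately show ?thesis unfolding e by simp
qed

lemma integral_infsum_unit:
  fixes f :: "int \<Rightarrow> real \<Rightarrow> complex"
  assumes c: "\<And>n. continuous_on {0..1} (f n)"
    and b: "\<And>n x. x \<in> {0..1} \<Longrightarrow> norm (f n x) \<le> M n" and M: "M summable_on UNIV"
  shows "continuous_on {0..1} (\<lambda>x. \<Sum>\<^sub>\<infinity>n. f n x)"
    "\<exists>J. ((\<lambda>n. integral {0..1} (f n)) has_sum J) UNIV \<and> ((\<lambda>x. \<Sum>\<^sub>\<infinity>n. f n x) has_integral J) {0..1}"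
proof -
  have u: "uniform_limit {0..1} (\<lambda>X x. \<Sum>n\<in>X. f n x) (\<lambda>x. \<Sum>\<^sub>\<infinity>n. f n x) (finite_subsets_at_top UNIV)"
    by (rule Weierstrass_m_test_general[OF b M])
  have cs: "continuous_on {0..1} (\<lambda>x. \<Sum>n\<in>X. f n x)" for X
    by (intro continuous_on_sum c)
  show "continuous_on {0..1} (\<lambda>x. \<Sum>\<^sub>\<infinity>n. f n x)"
    by (rule uniform_limit_theorem[OF always_eventually[OF allI[OF cs]] u]) simp
  obtain I J where I: "\<And>X. ((\<lambda>x. \<Sum>n\<in>X. f n x) has_integral I X) {0..1}"
    and J: "((\<lambda>x. \<Sum>\<^sub>\<infinity>n. f n x) has_integral J) {0..1}" and l: "(I \<longlongrightarrow> J) (finite_subsets_at_top UNIV)"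
    by (rule uniform_limit_integral[OF u cs]) auto
  have "I X = (\<Sum>n\<in>X. integral {0..1} (f n))" if X: "finite X" for X
    using I[of X] integral_sum[OF X, of f "{0..1}"] integrable_continuous_interval[OF c] by (simp add: has_integral_iff)
  then have "eventually (\<lambda>X. I X = (\<Sum>n\<in>X. integral {0..1} (f n))) (finite_subsets_at_top UNIV)"
    by (auto simp: eventually_finite_subsets_at_top)
  then have "((\<lambda>n. integral {0..1} (f n)) has_sum J) UNIV"
    unfolding has_sum_def using l tendsto_cong by fast
  with J show "\<exists>J. ((\<lambda>n. integral {0..1} (f n)) has_sum J) UNIV \<and> ((\<lambda>x. \<Sum>\<^sub>\<infinity>n. f n x) has_integral J) {0..1}"
    by (intro exI conjI)
qed

text \<open>The sum is evaluated along the windows -N \<le> n < N, which exhaust the integers and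
  for which the pieces combine to the integral over [-N, N].\<close>

lemma has_sum_integral_unit_intervals:
  fixes f :: "real \<Rightarrow> complex"
  assumes c: "continuous_on UNIV f" and I: "(f has_integral I) UNIV"
    and J: "((\<lambda>n::int. integral {of_int n..of_int n + 1} f) has_sum J) UNIV"
  shows "J = I"
proof -
  have ci: "f integrable_on {a..b}" for a b
    by (intro integrable_continuous_interval continuous_on_subset[OF c]) simp
  have S: "integral {- real N..real N} f = (\<Sum>n\<in>{- int N..<int N}. integral {of_int n..of_int n + 1} f)" for N
  proof (induction N)
    case 0
    show ?case by simp
  next
    case (Suc N)
    define h where "h n = integral {of_int n..of_int n + 1} f" for n :: int
    have A: "integral {- real (Suc N)..- real N} f = h (- int N - 1)"
      unfolding h_def by (rule arg_cong2[where f = "\<lambda>a b. integral {a..b} f"]) simp_all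
    have C: "integral {real N..real (Suc N)} f = h (int N)"
      unfolding h_def by (rule arg_cong2[where f = "\<lambda>a b. integral {a..b} f"]) simp_all
    have s: "{- int (Suc N)..<int (Suc N)} = insert (- int N - 1) (insert (int N) {- int N..<int N})"
      by auto
    have "integral {- real (Suc N)..real (Suc N)} f
      = integral {- real (Suc N)..- real N} f + (integral {- real N..real N} f + integral {real N..real (Suc N)} f)"
      by (subst Henstock_Kurzweil_Integration.integral_combine, simp, simp, rule ci)+ simp
    also have "\<dots> = h (- int N - 1) + ((\<Sum>n\<in>{- int N..<int N}. h n) + h (int N))"
      unfolding A C Suc.IH h_def ..
    finally show ?case unfolding s h_def[symmetric] by (simp add: add.commute)
  qed
  have "filterlim (\<lambda>N. {- int N..<int N}) (finite_subsets_at_top UNIV) sequentially"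
    unfolding filterlim_finite_subsets_at_top
  proof (intro allI impI)
    fix X :: "int set" assume X: "finite X \<and> X \<subseteq> UNIV"
    define K where "K = Max (insert 0 ((\<lambda>n. nat \<bar>n\<bar>) ` X))"
    have "X \<subseteq> {- int N..<int N}" if "Suc K \<le> N" for N
    proof
      fix n assume "n \<in> X"
      then have "nat \<bar>n\<bar> \<le> K" using X unfolding K_def by (intro Max_ge) auto
      then show "n \<in> {- int N..<int N}" using that by simp linarith
    qed
    then show "eventually (\<lambda>N. finite {- int N..<int N} \<and> X \<subseteq> {- int N..<int N} \<and> {- int N..<int N} \<subseteq> UNIV) sequentially"
      unfolding eventually_sequentially by (intro exI[of _ "Suc K"]) simp
  qed
  with J have 1: "(\<lambda>N. integral {- real N..real N} f) \<longlonglongrightarrow> J"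
    unfolding has_sum_def S by (rule filterlim_compose)
  have "(\<lambda>N. integral {- real N..real N} f) \<longlonglongrightarrow> I"
  proof (rule LIMSEQ_I)
    fix e :: real assume "0 < e"
    then obtain B where B: "0 < B" "\<And>a b. ball 0 B \<subseteq> cbox a b \<Longrightarrow> norm (integral (cbox a b) f - I) < e"
      using I unfolding has_integral_alt' by (auto simp: if_distrib)
    have "norm (integral {- real N..real N} f - I) < e" if "nat \<lceil>B\<rceil> \<le> N" for N
    proof -
      have "B \<le> real N" using that by linarith
      then have "ball 0 B \<subseteq> cbox (- real N) (real N)" by (auto simp: dist_real_def)
      from B(2)[OF this] show ?thesis by simp
    qed
    then show "\<exists>no. \<forall>N\<ge>no. norm (integral {- real N..real N} f - I) < e" by blast
  qed
  with 1 show ?thesis by (rule LIMSEQ_unique)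
qed

text \<open>With u = pi s v^2 the estimate combines (2 + |v|)^2 \<le> 8 + 2 v^2 and 1 + u \<le> exp
  u. The slack |n| \<le> |v| + 1 makes the majorant uniform for v in n + [0, 1].\<close>

lemma gaussian_bound:
  fixes v s :: real and n :: int
  assumes s: "0 < s" and n: "\<bar>of_int n\<bar> \<le> \<bar>v\<bar> + 1"
  shows "exp (- pi * s * v\<^sup>2) \<le> (8 + 2 / (pi * s)) * (1 + \<bar>of_int n\<bar>) powr - 2"
proof -
  define u where "u = pi * s * v\<^sup>2"
  have ps: "0 < pi * s" using s by simp
  have u: "0 \<le> u" "v\<^sup>2 = u / (pi * s)" using s by (simp_all add: u_def)
  have "(1 + \<bar>real_of_int n\<bar>)\<^sup>2 \<le> (2 + \<bar>v\<bar>)\<^sup>2" using n by (intro power_mono) auto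
  also have "\<dots> \<le> 8 + 2 * v\<^sup>2"
    using zero_le_power2[of "2 - \<bar>v\<bar>"] by (simp add: power2_eq_square algebra_simps abs_mult_self_eq)
  also have "\<dots> \<le> (8 + 2 / (pi * s)) * (1 + u)"
    unfolding u(2) using u(1) ps by (simp add: distrib_left distrib_right)
  also have "\<dots> \<le> (8 + 2 / (pi * s)) * exp u"
    using exp_ge_add_one_self[of u] ps by (intro mult_left_mono) auto
  finally have "(1 + \<bar>real_of_int n\<bar>)\<^sup>2 \<le> (8 + 2 / (pi * s)) * exp u" .
  moreover have "(1 + \<bar>real_of_int n\<bar>) powr - 2 = inverse ((1 + \<bar>real_of_int n\<bar>)\<^sup>2)"
    by (simp add: powr_minus powr_numeral)
  moreover have "exp (- pi * s * v\<^sup>2) = inverse (exp u)" by (simp add: u_def exp_minus)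
  moreover have "0 < (1 + \<bar>real_of_int n\<bar>)\<^sup>2" by (rule zero_less_power) simp
  moreover have "inverse E \<le> K * inverse P" if "0 < P" "0 < E" "P \<le> K * E" for P E K :: real
    using that by (simp add: field_simps)
  ultimately show ?thesis by simp
qed

lemma cis_add_int: "cis (2 * pi * of_int k * (x + of_int n)) = cis (2 * pi * of_int k * x)"
proof -
  have "cis (2 * pi * of_int k * (x + of_int n)) = cis (2 * pi * of_int k * x) * cis (2 * pi * of_int (k * n))"
    by (simp add: cis_mult algebra_simps)
  also have "cis (2 * pi * of_int (k * n)) = 1" by (rule cis_multiple_2pi) simp
  finally show ?thesis by simp
qed

text \<open>Both sides are continuous in a with period 1, so it suffices to compare Fourier
  coefficients. On the left the integrals of the translates over [0, 1] unfold to the Fourier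
  transform of the Gaussian on the real line; on the right orthogonality of the characters picks out
  one term.\<close>

lemma poisson_gaussian:
  fixes s a :: real
  assumes s: "0 < s"
  shows "(\<Sum>\<^sub>\<infinity>n::int. complex_of_real (exp (- pi * s * (of_int n + a)\<^sup>2)))
    = (\<Sum>\<^sub>\<infinity>n::int. of_real (exp (- pi * (of_int n)\<^sup>2 / s) / sqrt s) * cis (2 * pi * of_int n * a))"
proof -
  define g where "g v = complex_of_real (exp (- pi * s * v\<^sup>2))" for v
  define w where "w n = complex_of_real (exp (- pi * (of_int n)\<^sup>2 / s) / sqrt s)" for n :: int
  define M1 where "M1 n = (8 + 2 / (pi * s)) * (1 + \<bar>real_of_int n\<bar>) powr - 2" for n
  define M2 where "M2 n = ((8 + 2 / (pi * (1 / s))) * (1 + \<bar>real_of_int n\<bar>) powr - 2) * (1 / sqrt s)" for n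
  have p2: "(\<lambda>n::int. (1 + \<bar>real_of_int n\<bar>) powr - 2) summable_on UNIV"
    by (rule summable_on_int_powr) simp
  have M1: "M1 summable_on UNIV" unfolding M1_def by (rule summable_on_cmult_right[OF p2])
  have M2: "M2 summable_on UNIV" unfolding M2_def by (rule summable_on_cmult_left[OF summable_on_cmult_right[OF p2]])
  have b1: "norm (g (x + of_int n)) \<le> M1 n" if "x \<in> {0..1}" for x n
    unfolding g_def M1_def norm_of_real abs_exp_cancel using that by (intro gaussian_bound s) auto
  have b2: "norm (w n) \<le> M2 n" for n
  proof -
    have "exp (- pi * (1 / s) * (real_of_int n)\<^sup>2) \<le> (8 + 2 / (pi * (1 / s))) * (1 + \<bar>of_int n\<bar>) powr - 2"
      using s by (intro gaussian_bound) auto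
    then have "exp (- pi * (1 / s) * (real_of_int n)\<^sup>2) * (1 / sqrt s) \<le> M2 n"
      unfolding M2_def using s by (intro mult_right_mono) auto
    then show ?thesis using s by (simp add: w_def norm_divide)
  qed
  define G where "G x = (\<Sum>\<^sub>\<infinity>n::int. g (x + of_int n))" for x
  define H where "H x = (\<Sum>\<^sub>\<infinity>n::int. w n * cis (2 * pi * of_int n * x))" for x
  have gc: "continuous_on A g" for A unfolding g_def by (intro continuous_intros)
  have gc': "continuous_on A (\<lambda>x. g (x + c))" for A c unfolding g_def by (intro continuous_intros)
  have Gc: "continuous_on {0..1} G" unfolding G_def
    by (rule integral_infsum_unit(1)[OF gc' b1 M1])
  have Hc: "continuous_on {0..1} H" unfolding H_def
    by (rule integral_infsum_unit(1)[OF _ _ M2]) (auto intro!: continuous_intros simp: norm_mult b2)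
  have Gk: "((\<lambda>x. G x * cis (2 * pi * of_int k * x)) has_integral w k) {0..1}" for k
  proof -
    define f where "f v = g v * cis (2 * pi * of_int k * v)" for v
    obtain J where J: "((\<lambda>n::int. integral {0..1} (\<lambda>x. g (x + of_int n) * cis (2 * pi * of_int k * x))) has_sum J) UNIV"
      "((\<lambda>x. \<Sum>\<^sub>\<infinity>n::int. g (x + of_int n) * cis (2 * pi * of_int k * x)) has_integral J) {0..1}"
    proof -
      have c: "continuous_on {0..1} (\<lambda>x. g (x + of_int n) * cis (2 * pi * of_int k * x))" for n
        by (intro continuous_intros gc')
      have b: "norm (g (x + of_int n) * cis (2 * pi * of_int k * x)) \<le> M1 n" if "x \<in> {0..1}" for x n
        using b1[OF that] by (simp add: norm_mult)
      show thesis
        by (rule exE[OF integral_infsum_unit(2)[of "\<lambda>n x. g (x + of_int n) * cis (2 * pi * of_int k * x)", OF c b M1]])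
           (assumption, elim conjE, rule that)
    qed
    have e: "integral {0..1} (\<lambda>x. g (x + of_int n) * cis (2 * pi * of_int k * x)) = integral {of_int n..of_int n + 1} f" for n
    proof -
      have "(f has_integral integral {of_int n..of_int n + 1} f) {0 + of_int n..1 + of_int n}"
        unfolding add_0 add.commute[of 1]
        by (intro integrable_integral integrable_continuous_interval) (auto simp: f_def intro!: continuous_intros gc)
      then have "((f \<circ> ((+) (of_int n))) has_integral integral {of_int n..of_int n + 1} f) {0..1}"
        unfolding has_integral_shift_Icc_real .
      moreover have "f \<circ> ((+) (of_int n)) = (\<lambda>x. g (x + of_int n) * cis (2 * pi * of_int k * x))"
        by (rule ext) (simp only: o_apply f_def add.commute[of "of_int n"] cis_add_int)
      ultimately show ?thesis by (simp only: has_integral_iff)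
    qed
    have "(f has_integral w k) UNIV" unfolding f_def g_def w_def by (rule gaussian_fourier[OF s])
    moreover have "continuous_on UNIV f" unfolding f_def by (intro continuous_intros gc)
    ultimately have "J = w k" using has_sum_integral_unit_intervals[of f "w k" J] J(1) unfolding e by simp
    then show ?thesis using J(2) unfolding G_def by (simp only: infsum_cmult_left')
  qed
  have Hk: "((\<lambda>x. H x * cis (2 * pi * of_int k * x)) has_integral w k) {0..1}" for k
  proof -
    obtain J where J: "((\<lambda>n::int. integral {0..1} (\<lambda>x. w n * cis (2 * pi * of_int n * x) * cis (2 * pi * of_int k * x))) has_sum J) UNIV"
      "((\<lambda>x. \<Sum>\<^sub>\<infinity>n::int. w n * cis (2 * pi * of_int n * x) * cis (2 * pi * of_int k * x)) has_integral J) {0..1}"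
    proof -
      have c: "continuous_on {0..1} (\<lambda>x. w n * cis (2 * pi * of_int n * x) * cis (2 * pi * of_int k * x))" for n
        by (intro continuous_intros)
      have b: "norm (w n * cis (2 * pi * of_int n * x) * cis (2 * pi * of_int k * x)) \<le> M2 n" if "x \<in> {0..1}" for x n
        using b2[of n] by (simp add: norm_mult)
      show thesis
        by (rule exE[OF integral_infsum_unit(2)[of "\<lambda>n x. w n * cis (2 * pi * of_int n * x) * cis (2 * pi * of_int k * x)", OF c b M2]])
           (assumption, elim conjE, rule that)
    qed
    have "integral {0..1} (\<lambda>x. w n * cis (2 * pi * of_int n * x) * cis (2 * pi * of_int k * x)) = (if n + k = 0 then w k else 0)" for n
    proof -
      have "w n * cis (2 * pi * of_int n * x) * cis (2 * pi * of_int k * x) = w n * cis (2 * pi * of_int (n + k) * x)" for x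
        by (simp add: cis_mult mult.assoc) (simp add: algebra_simps)
      then have f: "(\<lambda>x. w n * cis (2 * pi * of_int n * x) * cis (2 * pi * of_int k * x)) = (\<lambda>x. w n * cis (2 * pi * of_int (n + k) * x))"
        by (rule ext)
      have i: "((\<lambda>x. w n * cis (2 * pi * of_int (n + k) * x)) has_integral w n * (if n + k = 0 then 1 else 0)) {0..1}"
        by (intro has_integral_mult_right has_integral_cis)
      \<comment> \<open>Integration against cis (2 pi k x) selects the index n = - k, and the
        Gaussian weights are even.\<close>
      have "w n = w k" if "n + k = 0"
      proof -
        have "n = - k" using that by simp
        then show ?thesis by (simp add: w_def)
      qed
      then have "w n * (if n + k = 0 then 1 else 0) = (if n + k = 0 then w k else 0)" by simp
      then show ?thesis unfolding f integral_unique[OF i] .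
    qed
    then have "((\<lambda>n. if n + k = 0 then w k else 0) has_sum J) UNIV" using J(1) by simp
    moreover have "((\<lambda>n. if n + k = 0 then w k else 0) has_sum w k) UNIV"
      by (rule has_sum_finite_neutralI[of "{- k}"]) auto
    ultimately have "J = w k" by (rule has_sum_unique)
    then show ?thesis using J(2) unfolding H_def by (simp only: infsum_cmult_left')
  qed
  have GH: "G x = H x" if "x \<in> {0..1}" for x
  proof -
    have "(\<lambda>x. G x - H x) x = 0"
    proof (rule fourier_coefficients_unique[OF _ _ that])
      show "continuous_on {0..1} (\<lambda>x. G x - H x)" by (intro continuous_intros Gc Hc)
      show "((\<lambda>x. (G x - H x) * cis (2 * pi * of_int k * x)) has_integral 0) {0..1}" for k
        using has_integral_diff[OF Gk[of k] Hk[of k]] by (simp add: left_diff_distrib)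
    qed
    then show ?thesis by simp
  qed
  have "(\<Sum>\<^sub>\<infinity>n::int. g (of_int n + a)) = (\<Sum>\<^sub>\<infinity>n::int. g (frac a + of_int (n + \<lfloor>a\<rfloor>)))"
    by (simp add: frac_def algebra_simps)
  also have "\<dots> = G (frac a)"
    unfolding G_def by (rule infsum_reindex_bij_betw) (rule bij_betw_byWitness[where f' = "\<lambda>n. n - \<lfloor>a\<rfloor>"], auto)
  also have "\<dots> = H (frac a)" using GH frac_lt_1[of a] frac_ge_0[of a] by simp
  also have "\<dots> = H a"
  proof -
    have "cis (2 * pi * of_int n * a) = cis (2 * pi * of_int n * frac a)" for n
      using cis_add_int[of n "frac a" "\<lfloor>a\<rfloor>"] by (simp add: frac_def)
    then show ?thesis by (simp add: H_def)
  qed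
  finally show ?thesis by (simp add: g_def H_def w_def)
qed

section \<open>Double exponential kernels and the constant 1\<close>

text \<open>At +\<infinity> the factor exp (- a exp x) beats every exponential, by (t / N)^N \<le>
  exp t for t = a exp x; at -\<infinity> it is at most 1, and exp (c x) is covered by the free
  exponent N. Hence every rate \<beta> is admissible.\<close>

lemma exp_bound_exp_exp:
  fixes a c :: real
  assumes a: "0 < a"
  shows "exp_bound \<beta> (\<lambda>x. exp (c * x) * exp (- a * exp x))"
proof -
  define N where "N = Suc (nat \<lceil>\<bar>c + \<beta>\<bar>\<rceil>)"
  have N: "\<bar>c + \<beta>\<bar> \<le> real N" "0 < real N"
  proof -
    show "\<bar>c + \<beta>\<bar> \<le> real N"
      unfolding N_def of_nat_Suc using real_nat_ceiling_ge[of "\<bar>c + \<beta>\<bar>"] by linarith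
    show "0 < real N" unfolding N_def by (rule of_nat_0_less_iff[THEN iffD2]) simp
  qed
  define C where "C = 1 + (real N / a) ^ N"
  have C: "1 \<le> C" using a by (simp add: C_def)
  have "\<bar>exp (c * x) * exp (- a * exp x)\<bar> \<le> C * (exp (- \<beta> * x) * (1 + exp (- real N * x)))" for x
  proof -
    have "exp ((c + \<beta>) * x) * exp (- a * exp x) \<le> C * (1 + exp (- real N * x))"
    proof (cases "0 \<le> x")
      case True
      have "a * exp x / real N \<le> exp (a * exp x / real N)" using exp_ge_add_one_self[of "a * exp x / real N"] by linarith
      then have "(a * exp x / real N) ^ N \<le> exp (a * exp x / real N) ^ N" using a by (intro power_mono) auto
      also have "\<dots> = exp (a * exp x)" using N(2) by (simp add: exp_of_nat_mult[symmetric])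
      finally have 1: "(a * exp x / real N) ^ N \<le> exp (a * exp x)" .
      have "exp ((c + \<beta>) * x) \<le> exp (real N * x)" using N(1) True by (auto intro!: mult_right_mono)
      also have "\<dots> = (real N / a) ^ N * (a * exp x / real N) ^ N"
        using a N(2) by (simp add: exp_of_nat_mult power_mult_distrib power_divide)
      also have "\<dots> \<le> (real N / a) ^ N * exp (a * exp x)" using 1 a by (intro mult_left_mono) auto
      finally have "exp ((c + \<beta>) * x) * exp (- a * exp x) \<le> (real N / a) ^ N * exp (a * exp x) * exp (- a * exp x)"
        by (rule mult_right_mono) simp
      also have "\<dots> = (real N / a) ^ N" by (simp add: mult.assoc exp_add[symmetric])
      also have "\<dots> \<le> C * 1" by (simp add: C_def)
      also have "\<dots> \<le> C * (1 + exp (- real N * x))" using C by (intro mult_left_mono) auto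
      finally show ?thesis .
    next
      case False
      have "(c + \<beta>) * x \<le> - real N * x" using N(1) False by (intro mult_right_mono_neg) auto
      then have "exp ((c + \<beta>) * x) * exp (- a * exp x) \<le> exp (- real N * x) * 1" using a by (intro mult_mono) auto
      also have "\<dots> \<le> 1 * (1 + exp (- real N * x))" by simp
      also have "\<dots> \<le> C * (1 + exp (- real N * x))" using C by (intro mult_right_mono) (auto intro: add_nonneg_nonneg)
      finally show ?thesis .
    qed
    then have le: "exp (- \<beta> * x) * (exp ((c + \<beta>) * x) * exp (- a * exp x)) \<le> exp (- \<beta> * x) * (C * (1 + exp (- real N * x)))"
      by (rule mult_left_mono) simp
    have eq: "exp (c * x) = exp (- \<beta> * x) * exp ((c + \<beta>) * x)" by (simp add: exp_add[symmetric] algebra_simps)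
    have "exp (c * x) * exp (- a * exp x) \<le> exp (- \<beta> * x) * (C * (1 + exp (- real N * x)))"
      using le unfolding eq mult.assoc .
    also have "\<dots> = C * (exp (- \<beta> * x) * (1 + exp (- real N * x)))" by (rule mult.left_commute)
    finally show ?thesis by (simp only: abs_mult abs_exp_cancel)
  qed
  then show ?thesis unfolding exp_bound_def using N(2) by (intro exI[of _ C] exI[of _ "real N"]) simp
qed

text \<open>Derivatives keep the shape exp (c x) p (exp x) exp (- a exp x) with a polynomial p; this
  shape is the invariant of the coinduction.\<close>

lemma decaying_exp_exp:
  fixes a c :: real
  assumes a: "0 < a"
  shows "decaying \<alpha> (\<lambda>x. exp (c * x) * exp (- a * exp x))"
proof -
  have "decaying \<alpha> (\<lambda>x. exp (c * x) * (poly p (exp x) * exp (- a * exp x)))" for p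
  proof (coinduction arbitrary: p rule: decaying.coinduct)
    case (decaying p)
    have b: "exp_bound \<beta> (\<lambda>x. exp (c * x) * (poly p (exp x) * exp (- a * exp x)))" for \<beta> c
    proof (induction p arbitrary: c)
      case 0
      show ?case using exp_bound_linear[OF exp_bound_exp_exp[OF a] exp_bound_exp_exp[OF a], of \<beta> 0 c 0 c] by simp
    next
      case (pCons u p)
      have "exp (c * x) * (poly (pCons u p) (exp x) * exp (- a * exp x))
        = u * (exp (c * x) * exp (- a * exp x)) + 1 * (exp ((c + 1) * x) * (poly p (exp x) * exp (- a * exp x)))" for x
        by (simp add: distrib_left distrib_right exp_add)
      then show ?case using exp_bound_linear[OF exp_bound_exp_exp[OF a, of \<beta> c] pCons.IH[of "c + 1"], of u 1] by simp
    qed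
    define q where "q = Polynomial.smult c p + pCons 0 (pderiv p) - Polynomial.smult a (pCons 0 p)"
    have "((\<lambda>x. exp (c * x) * (poly p (exp x) * exp (- a * exp x))) has_real_derivative
      exp (c * x) * (poly q (exp x) * exp (- a * exp x))) (at x)" for x
      unfolding q_def
      by (rule derivative_eq_intros DERIV_chain2[OF poly_DERIV] refl)+ (simp add: algebra_simps)
    then show ?case
      by (rule_tac exI[of _ "\<lambda>x. exp (c * x) * (poly p (exp x) * exp (- a * exp x))"],
          rule_tac exI[of _ "\<lambda>x. exp (c * x) * (poly q (exp x) * exp (- a * exp x))"]) (use b in blast)
  qed
  from this[of 1] show ?thesis by simp
qed

text \<open>Let \<Theta> t be the sum of exp (- pi t |l|^2 / y) over all integer vectors, zero
  included, and E t the same sum without zero. The inversion \<Theta> (1 / t) = t \<Theta> t at t =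
  2 reads 1 + E (1/2) = 2 (1 + E 2), so E (1/2) - 2 E 2 = 1. The parameters pi / 2 and 2 pi are pi t
  for the two values of t.\<close>

definition theta_kernel :: "real \<Rightarrow> real" where
  "theta_kernel x = exp (- (pi / 2) * exp x) - 2 * exp (- (2 * pi) * exp x)"

lemma decaying_theta_kernel: "decaying \<alpha> (\<lambda>x. exp (c * x) * theta_kernel x)"
proof -
  have "exp (c * x) * theta_kernel x = exp (c * x) * exp (- (pi / 2) * exp x) - 2 * (exp (c * x) * exp (- (2 * pi) * exp x))" for x
    by (simp add: theta_kernel_def algebra_simps)
  moreover have "decaying \<alpha> (\<lambda>x. exp (c * x) * exp (- (pi / 2) * exp x) - 2 * (exp (c * x) * exp (- (2 * pi) * exp x)))"
    by (intro decaying_diff decaying_cmult decaying_exp_exp) simp_all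
  ultimately show ?thesis by simp
qed

definition lattice_gauss :: "real \<Rightarrow> complex \<Rightarrow> int \<times> int \<Rightarrow> complex" where
  "lattice_gauss t \<tau> \<omega> = of_real (exp (- pi * t * (cmod (ell \<omega> \<tau>))\<^sup>2 / Im \<tau>))"

text \<open>A Gaussian in |l| is a double exponential in ln (|l|^2 / y), so the sum without the zero
  vector is an Eisenstein-type series. The contribution 1 of the zero vector is the origin of the
  constant to be produced.\<close>

lemma lattice_gauss_eis:
  assumes t: "0 < t" and y: "0 < Im \<tau>"
  shows "lattice_gauss t \<tau> summable_on UNIV"
    "infsum (lattice_gauss t \<tau>) UNIV = 1 + eis 0 0 (\<lambda>x. exp (- (pi * t) * exp x)) \<tau>"
proof -
  have "decaying 2 (\<lambda>x. exp (0 * x) * exp (- (pi * t) * exp x))" using t by (intro decaying_exp_exp) simp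
  then have d: "decaying 2 (\<lambda>x. exp (- (pi * t) * exp x))" by simp
  have e: "eis_term 0 0 (\<lambda>x. exp (- (pi * t) * exp x)) \<omega> \<tau> = lattice_gauss t \<tau> \<omega>" if "\<omega> \<in> lattice" for \<omega>
    using ell_nonzero[OF that y] y by (simp add: eis_term_def lattice_gauss_def mult.assoc)
  have "(\<lambda>\<omega>. eis_term 0 0 (\<lambda>x. exp (- (pi * t) * exp x)) \<omega> \<tau>) summable_on lattice"
    by (rule abs_summable_summable[OF abs_summable_eis_term[OF d _ y]]) simp
  then have s: "lattice_gauss t \<tau> summable_on lattice"
    using e by (simp cong: summable_on_cong)
  have U: "(UNIV :: (int \<times> int) set) = insert (0, 0) lattice" by (auto simp: lattice_def)
  show "lattice_gauss t \<tau> summable_on UNIV" unfolding U summable_on_insert_iff by (rule s)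
  have "infsum (lattice_gauss t \<tau>) UNIV = lattice_gauss t \<tau> (0, 0) + infsum (lattice_gauss t \<tau>) lattice"
    unfolding U by (rule infsum_insert[OF s]) (simp add: lattice_def)
  also have "lattice_gauss t \<tau> (0, 0) = 1" by (simp add: lattice_gauss_def ell_def)
  also have "infsum (lattice_gauss t \<tau>) lattice = eis 0 0 (\<lambda>x. exp (- (pi * t) * exp x)) \<tau>"
    unfolding eis_def using e by (simp cong: infsum_cong)
  finally show "infsum (lattice_gauss t \<tau>) UNIV = 1 + eis 0 0 (\<lambda>x. exp (- (pi * t) * exp x)) \<tau>" .
qed

lemma cmod_ell: "(cmod (ell (m, n) \<tau>))\<^sup>2 = (of_int n + of_int m * Re \<tau>)\<^sup>2 + (of_int m)\<^sup>2 * (Im \<tau>)\<^sup>2"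
  by (simp add: ell_def cmod_power2 power_mult_distrib add.commute)

text \<open>Poisson summation is applied in the second coordinate only. Apart from the factor sqrt
  (y / t) the outcome is symmetric under exchanging m and n together with t and 1 / t, and this
  symmetry takes the place of a summation formula in two variables.\<close>

lemma lattice_gauss_poisson:
  assumes t: "0 < t" and y: "0 < Im \<tau>"
  shows "infsum (lattice_gauss t \<tau>) UNIV = of_real (sqrt (Im \<tau> / t)) *
    (\<Sum>\<^sub>\<infinity>m. \<Sum>\<^sub>\<infinity>n. of_real (exp (- pi * Im \<tau> * ((of_int m)\<^sup>2 * t + (of_int n)\<^sup>2 / t))) * cis (2 * pi * of_int n * (of_int m * Re \<tau>)))"
proof -
  define y where "y = Im \<tau>"
  have y0: "0 < y" using y by (simp add: y_def)
  have inner: "(\<Sum>\<^sub>\<infinity>n. lattice_gauss t \<tau> (m, n)) = of_real (sqrt (y / t)) *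
    (\<Sum>\<^sub>\<infinity>n. of_real (exp (- pi * y * ((of_int m)\<^sup>2 * t + (of_int n)\<^sup>2 / t))) * cis (2 * pi * of_int n * (of_int m * Re \<tau>)))" for m
  proof -
    have "lattice_gauss t \<tau> (m, n) = of_real (exp (- pi * y * (of_int m)\<^sup>2 * t)) * of_real (exp (- pi * (t / y) * (of_int n + of_int m * Re \<tau>)\<^sup>2))" for n
      unfolding lattice_gauss_def cmod_ell y_def[symmetric] of_real_mult[symmetric] exp_add[symmetric]
      using y0 by (simp add: field_simps power2_eq_square)
    then have "(\<Sum>\<^sub>\<infinity>n. lattice_gauss t \<tau> (m, n)) = of_real (exp (- pi * y * (of_int m)\<^sup>2 * t)) *
      (\<Sum>\<^sub>\<infinity>n. of_real (exp (- pi * (t / y) * (of_int n + of_int m * Re \<tau>)\<^sup>2)))"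
      by (simp only: infsum_cmult_right')
    also have "\<dots> = of_real (exp (- pi * y * (of_int m)\<^sup>2 * t)) *
      (\<Sum>\<^sub>\<infinity>n. of_real (exp (- pi * (of_int n)\<^sup>2 / (t / y)) / sqrt (t / y)) * cis (2 * pi * of_int n * (of_int m * Re \<tau>)))"
      using t y0 by (subst poisson_gaussian) simp_all
    also have "\<dots> = (\<Sum>\<^sub>\<infinity>n. of_real (sqrt (y / t)) *
      (of_real (exp (- pi * y * ((of_int m)\<^sup>2 * t + (of_int n)\<^sup>2 / t))) * cis (2 * pi * of_int n * (of_int m * Re \<tau>))))"
      unfolding infsum_cmult_right'[symmetric]
    proof (rule infsum_cong)
      fix n :: int
      have "- pi * y * ((of_int m)\<^sup>2 * t + (of_int n)\<^sup>2 / t) = - pi * y * (of_int m)\<^sup>2 * t + - pi * (of_int n)\<^sup>2 / (t / y)"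
        using t y0 by (simp add: field_simps)
      then have "exp (- pi * y * ((of_int m)\<^sup>2 * t + (of_int n)\<^sup>2 / t)) = exp (- pi * y * (of_int m)\<^sup>2 * t) * exp (- pi * (of_int n)\<^sup>2 / (t / y))"
        by (simp only: exp_add)
      moreover have "sqrt (y / t) = 1 / sqrt (t / y)" by (simp add: real_sqrt_divide)
      ultimately have "exp (- pi * y * (of_int m)\<^sup>2 * t) * (exp (- pi * (of_int n)\<^sup>2 / (t / y)) / sqrt (t / y))
        = sqrt (y / t) * exp (- pi * y * ((of_int m)\<^sup>2 * t + (of_int n)\<^sup>2 / t))" by simp
      then have "complex_of_real (exp (- pi * y * (of_int m)\<^sup>2 * t)) * of_real (exp (- pi * (of_int n)\<^sup>2 / (t / y)) / sqrt (t / y))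
        = of_real (sqrt (y / t)) * of_real (exp (- pi * y * ((of_int m)\<^sup>2 * t + (of_int n)\<^sup>2 / t)))"
        by (simp only: of_real_mult[symmetric])
      then show "of_real (exp (- pi * y * (of_int m)\<^sup>2 * t)) * (of_real (exp (- pi * (of_int n)\<^sup>2 / (t / y)) / sqrt (t / y)) * cis (2 * pi * of_int n * (of_int m * Re \<tau>)))
        = of_real (sqrt (y / t)) * (of_real (exp (- pi * y * ((of_int m)\<^sup>2 * t + (of_int n)\<^sup>2 / t))) * cis (2 * pi * of_int n * (of_int m * Re \<tau>)))"
        by (simp only: mult.assoc[symmetric])
    qed
    finally show ?thesis by (simp only: infsum_cmult_right')
  qed
  have "infsum (lattice_gauss t \<tau>) UNIV = (\<Sum>\<^sub>\<infinity>m. \<Sum>\<^sub>\<infinity>n. lattice_gauss t \<tau> (m, n))"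
    using infsum_Sigma_banach[of "lattice_gauss t \<tau>" UNIV "\<lambda>_. UNIV"] lattice_gauss_eis(1)[OF t y] by simp
  then show ?thesis unfolding inner y_def by (simp only: infsum_cmult_right')
qed

lemma eis_theta_kernel:
  assumes y: "0 < Im \<tau>"
  shows "eis 0 0 theta_kernel \<tau> = 1"
proof -
  define y where "y = Im \<tau>"
  have y0: "0 < y" using y by (simp add: y_def)
  define F where "F t m n = complex_of_real (exp (- pi * y * ((of_int m)\<^sup>2 * t + (of_int n)\<^sup>2 / t))) * cis (2 * pi * of_int n * (of_int m * Re \<tau>))"
    for t and m n :: int
  have sw: "F (1 / 2) m n = F 2 n m" for m n by (simp add: F_def mult_ac add_ac)
  \<comment> \<open>The absolute values are those of the lattice Gaussian at the point 2 i with
    parameter y, which is already known to be summable. This justifies exchanging the two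
    sums.\<close>
  have "(\<lambda>(m, n). F 2 m n) summable_on UNIV \<times> UNIV"
  proof (rule abs_summable_summable)
    have "norm (case \<omega> of (m, n) \<Rightarrow> F 2 m n) = norm (lattice_gauss y (2 * \<i>) \<omega>)" for \<omega>
      by (cases \<omega>) (simp add: F_def lattice_gauss_def cmod_ell norm_mult algebra_simps)
    moreover have "(\<lambda>\<omega>. norm (lattice_gauss y (2 * \<i>) \<omega>)) summable_on UNIV"
      using lattice_gauss_eis(1)[OF y0, of "2 * \<i>"] by (simp add: summable_on_iff_abs_summable_on_complex)
    ultimately show "(\<lambda>\<omega>. norm (case \<omega> of (m, n) \<Rightarrow> F 2 m n)) summable_on UNIV \<times> UNIV" by simp
  qed
  then have "(\<Sum>\<^sub>\<infinity>m. \<Sum>\<^sub>\<infinity>n. F 2 m n) = (\<Sum>\<^sub>\<infinity>n. \<Sum>\<^sub>\<infinity>m. F 2 m n)"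
    by (rule infsum_swap_banach)
  then have e: "(\<Sum>\<^sub>\<infinity>m. \<Sum>\<^sub>\<infinity>n. F (1 / 2) m n) = (\<Sum>\<^sub>\<infinity>m. \<Sum>\<^sub>\<infinity>n. F 2 m n)" by (simp only: sw)
  have h: "infsum (lattice_gauss t \<tau>) UNIV = of_real (sqrt (y / t)) * (\<Sum>\<^sub>\<infinity>m. \<Sum>\<^sub>\<infinity>n. F t m n)" if "0 < t" for t
    using lattice_gauss_poisson[OF that y] by (simp only: F_def y_def)
  have "sqrt (y / (1 / 2)) = 2 * sqrt (y / 2)"
    by (simp add: real_sqrt_divide real_sqrt_mult field_simps)
  then have "infsum (lattice_gauss (1 / 2) \<tau>) UNIV = 2 * infsum (lattice_gauss 2 \<tau>) UNIV"
    using h[of "1 / 2"] h[of 2] e by simp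
  then have "eis 0 0 (\<lambda>x. exp (- (pi / 2) * exp x)) \<tau> - 2 * eis 0 0 (\<lambda>x. exp (- (2 * pi) * exp x)) \<tau> = 1"
    using lattice_gauss_eis(2)[of "1 / 2" \<tau>] lattice_gauss_eis(2)[of 2 \<tau>] y by (simp add: mult.commute)
  moreover have "eis 0 0 theta_kernel \<tau> = eis 0 0 (\<lambda>x. exp (- (pi / 2) * exp x)) \<tau> - 2 * eis 0 0 (\<lambda>x. exp (- (2 * pi) * exp x)) \<tau>"
  proof -
    have d: "decaying 2 (\<lambda>x. exp (- a * exp x))" if "0 < a" for a :: real
      using decaying_exp_exp[OF that, of 2 0] by simp
    show ?thesis
      using eis_linear[OF d[of "pi / 2"] d[of "2 * pi"], of 0 \<tau> 0 1 "-2"] y by (simp add: theta_kernel_def[abs_def])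
  qed
  ultimately show ?thesis by simp
qed

text \<open>The factor exp (j x) of the kernel becomes (|l|^2 / y)^j; together with (y l / cnj l)^j
  it is l^(2j) and cancels l^(-\<kappa>) for \<kappa> = 2j. So the constant 1 is available for every
  j.\<close>

lemma eis_theta_kernel_twist:
  assumes y: "0 < Im \<tau>"
  shows "eis (2 * j) j (\<lambda>x. exp (of_int j * x) * theta_kernel x) \<tau> = 1"
proof -
  have "eis_term (2 * j) j (\<lambda>x. exp (of_int j * x) * theta_kernel x) \<omega> \<tau> = eis_term 0 0 theta_kernel \<omega> \<tau>"
    if \<omega>: "\<omega> \<in> lattice" for \<omega>
  proof -
    define l where "l = ell \<omega> \<tau>"
    have l: "l \<noteq> 0" using ell_nonzero[OF \<omega> y] by (simp add: l_def)
    define u where "u = (cmod l)\<^sup>2 / Im \<tau>"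
    have u: "0 < u" using l y by (simp add: u_def)
    have "exp (of_int j * ln u) = u powr of_int j" using u by (simp add: powr_def)
    then have "exp (of_int j * ln u) = u powi j" using u by (simp add: powr_real_of_int')
    moreover have "complex_of_real u = l * cnj l / of_real (Im \<tau>)"
      by (simp only: u_def of_real_divide complex_norm_square)
    ultimately have "complex_of_real (exp (of_int j * ln u)) = (l * cnj l / of_real (Im \<tau>)) powi j"
      by (simp only: of_real_power_int)
    moreover have "l powi (- (2 * j)) * (of_real (Im \<tau>) * l / cnj l) powi j * (l * cnj l / of_real (Im \<tau>)) powi j = 1"
    proof -
      have "(of_real (Im \<tau>) * l / cnj l) powi j * (l * cnj l / of_real (Im \<tau>)) powi j
        = ((of_real (Im \<tau>) * l / cnj l) * (l * cnj l / of_real (Im \<tau>))) powi j"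
        by (rule power_int_mult_distrib[symmetric])
      also have "(of_real (Im \<tau>) * l / cnj l) * (l * cnj l / of_real (Im \<tau>)) = l powi 2"
        using l y by (simp add: field_simps power2_eq_square)
      also have "(l powi 2) powi j = l powi (2 * j)" by (rule power_int_mult[symmetric])
      finally have "(of_real (Im \<tau>) * l / cnj l) powi j * (l * cnj l / of_real (Im \<tau>)) powi j = l powi (2 * j)" .
      then show ?thesis using l by (simp add: mult.assoc power_int_minus)
    qed
    ultimately show ?thesis
      unfolding eis_term_def l_def[symmetric] u_def[symmetric] of_real_mult
      by (simp add: mult.assoc[symmetric])
  qed
  then show ?thesis using eis_theta_kernel[OF y] unfolding eis_def by (simp cong: infsum_cong)
qed

section \<open>Towers of Laplace preimages\<close>

text \<open>Values outside the half plane are arbitrary, and the computed expressions for the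
  operators hold only inside, so forms are identified when they agree there.\<close>

definition eq_uhp :: "(complex \<Rightarrow> complex vec) \<Rightarrow> (complex \<Rightarrow> complex vec) \<Rightarrow> bool" where
  "eq_uhp f g \<longleftrightarrow> (\<forall>\<tau>\<in>upper_half_plane. f \<tau> = g \<tau>)"

lemma eq_uhp_trans: "eq_uhp f g \<Longrightarrow> eq_uhp g h \<Longrightarrow> eq_uhp f h"
  by (simp add: eq_uhp_def)

lemma eq_uhp_refl: "eq_uhp f f"
  by (simp add: eq_uhp_def)

lemma partial_cong:
  assumes "\<tau> \<in> upper_half_plane" "\<And>w. w \<in> upper_half_plane \<Longrightarrow> f w = g w"
  shows "partial_x f \<tau> = partial_x g \<tau>" "partial_y f \<tau> = partial_y g \<tau>"
proof -
  have "(f has_derivative D) (at \<tau>) \<longleftrightarrow> (g has_derivative D) (at \<tau>)" for D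
  proof
    show "(g has_derivative D) (at \<tau>)" if "(f has_derivative D) (at \<tau>)"
      by (rule has_derivative_transform_within_open[OF that open_upper_half_plane assms(1) assms(2)])
    show "(f has_derivative D) (at \<tau>)" if "(g has_derivative D) (at \<tau>)"
      by (rule has_derivative_transform_within_open[OF that open_upper_half_plane assms(1) assms(2)[symmetric]])
  qed
  then have "frechet_derivative f (at \<tau>) = frechet_derivative g (at \<tau>)"
    by (simp only: frechet_derivative_def)
  then show "partial_x f \<tau> = partial_x g \<tau>" "partial_y f \<tau> = partial_y g \<tau>"
    by (simp_all add: partial_x_def partial_y_def)
qed

lemma operator_cong:
  assumes "eq_uhp f g"
  shows "eq_uhp (lowering k f) (lowering k g)" "eq_uhp (raising k f) (raising k g)"
proof -
  have "componentwise D f \<tau> = componentwise D g \<tau>"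
    if "\<tau> \<in> upper_half_plane" "\<And>l. D (\<lambda>w. f w $ l) \<tau> = D (\<lambda>w. g w $ l) \<tau>" for D \<tau>
    using assms that by (simp add: componentwise_def eq_uhp_def)
  moreover have "wirtinger (\<lambda>w. f w $ l) \<tau> = wirtinger (\<lambda>w. g w $ l) \<tau>"
    "wirtinger_bar (\<lambda>w. f w $ l) \<tau> = wirtinger_bar (\<lambda>w. g w $ l) \<tau>" if "\<tau> \<in> upper_half_plane" for \<tau> l
    unfolding wirtinger_def wirtinger_bar_def
    using partial_cong[OF that, of "\<lambda>w. f w $ l" "\<lambda>w. g w $ l"] assms by (simp_all add: eq_uhp_def)
  ultimately show "eq_uhp (lowering k f) (lowering k g)" "eq_uhp (raising k f) (raising k g)"
    using assms unfolding eq_uhp_def lowering_def raising_def by simp_all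
qed

lemma laplace_cong: "eq_uhp f g \<Longrightarrow> eq_uhp (laplace k f) (laplace k g)"
  by (drule operator_cong(1)[of _ _ k], drule operator_cong(2)[of _ _ "k - 2"]) (simp add: eq_uhp_def laplace_def)

lemma laplace_iter_cong: "eq_uhp f g \<Longrightarrow> eq_uhp (laplace_iter k j f) (laplace_iter k j g)"
  by (induction j) (simp_all add: laplace_cong)

lemma raising_iter_cong: "eq_uhp f g \<Longrightarrow> eq_uhp (raising_iter k j f) (raising_iter k j g)"
  by (induction j) (simp_all add: operator_cong)

lemma vanishes_cong: "eq_uhp f g \<Longrightarrow> vanishes n f \<longleftrightarrow> vanishes n g"
  by (simp add: eq_uhp_def vanishes_def)

lemma eis_vec_cong: "(\<And>i. i \<le> m \<Longrightarrow> \<chi> i = \<psi> i) \<Longrightarrow> eis_vec \<kappa> m r \<chi> \<tau> = eis_vec \<kappa> m r \<psi> \<tau>"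
  unfolding eis_vec_def vv_def by (rule sym_vec_cong) simp

text \<open>The products A^(m-i) B^i are linearly independent: every complex t other than 1 / y is
  the quotient B / A at some w, so the polynomial with coefficients a_i has infinitely many zeros.
  The vanishing of a vector-valued series is thereby reduced to its components.\<close>

lemma sym_vec_zero_iff:
  assumes y: "0 < Im \<tau>"
  shows "sym_vec m a \<tau> = 0\<^sub>v (m + 1) \<longleftrightarrow> (\<forall>i\<le>m. a i = 0)"
proof
  assume "sym_vec m a \<tau> = 0\<^sub>v (m + 1)"
  then have c: "coeff (sym_poly m a \<tau>) l = 0" if "l < m + 1" for l
  proof -
    have "sym_vec m a \<tau> $ l = 0" unfolding \<open>sym_vec m a \<tau> = 0\<^sub>v (m + 1)\<close> using that by simp
    then show ?thesis using that by (simp add: sym_vec_def)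
  qed
  have "degree (sym_poly m a \<tau>) \<le> m"
    unfolding sym_poly_def
  proof (rule degree_sum_le)
    fix i assume "i \<in> {..m}"
    then have i: "i \<le> m" by simp
    have "degree (lin_A \<tau> ^ (m - i) * lin_B \<tau> ^ i) \<le> (m - i) + i"
      unfolding lin_A_def lin_B_def smult_pCons smult_0_right by (rule degree_linear_powers)
    then show "degree (Polynomial.smult (a i) (lin_A \<tau> ^ (m - i) * lin_B \<tau> ^ i)) \<le> m"
      using degree_smult_le[of "a i" "lin_A \<tau> ^ (m - i) * lin_B \<tau> ^ i"] i by linarith
  qed simp
  then have "coeff (sym_poly m a \<tau>) l = 0" for l
    using c[of l] by (cases "l < m + 1") (auto simp: coeff_eq_0)
  then have P0: "sym_poly m a \<tau> = 0" by (simp add: poly_eq_iff)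
  define Q where "Q = (\<Sum>i\<le>m. monom (a i) i)"
  have root: "poly Q t = 0" if t: "t \<noteq> inverse (of_real (Im \<tau>))" for t
  proof -
    define v where "v = inverse (complex_of_real (Im \<tau>))"
    \<comment> \<open>This is the solution of v (cnj \<tau> - w) = t (\<tau> - w), that is of B = t
      A.\<close>
    define w where "w = (v * cnj \<tau> - t * \<tau>) / (v - t)"
    have v: "v - t \<noteq> 0" using t by (simp add: v_def)
    have "(v - t) * w = v * cnj \<tau> - t * \<tau>" using v by (simp add: w_def)
    then have Y: "v * (cnj \<tau> - w) = t * (\<tau> - w)" by (simp add: algebra_simps)
    have X: "\<tau> - w \<noteq> 0"
    proof
      assume "\<tau> - w = 0"
      then have "v * (cnj \<tau> - \<tau>) = 0" using Y by simp
      then have "cnj \<tau> = \<tau>" using y by (simp add: v_def)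
      then have "Im (cnj \<tau>) = Im \<tau>" by simp
      then show False using y by simp
    qed
    have "0 = poly (sym_poly m a \<tau>) w" by (simp add: P0)
    also have "\<dots> = (\<Sum>i\<le>m. a i * ((\<tau> - w) ^ (m - i) * (t * (\<tau> - w)) ^ i))"
      unfolding poly_sym_poly v_def[symmetric] Y ..
    also have "\<dots> = (\<Sum>i\<le>m. (\<tau> - w) ^ m * (a i * t ^ i))"
    proof (rule sum.cong)
      fix i assume "i \<in> {..m}"
      then have "(\<tau> - w) ^ m = (\<tau> - w) ^ (m - i) * (\<tau> - w) ^ i" by (simp add: power_add[symmetric])
      then show "a i * ((\<tau> - w) ^ (m - i) * (t * (\<tau> - w)) ^ i) = (\<tau> - w) ^ m * (a i * t ^ i)"
        by (simp only: power_mult_distrib mult_ac)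
    qed simp
    also have "\<dots> = (\<tau> - w) ^ m * poly Q t"
      by (simp add: Q_def poly_sum poly_monom sum_distrib_left)
    finally show ?thesis using X by simp
  qed
  have "Q = 0"
  proof (rule ccontr)
    assume "Q \<noteq> 0"
    then have "finite {t. poly Q t = 0}" by (rule poly_roots_finite)
    then have "finite (UNIV :: complex set)"
      using root by (intro finite_subset[of UNIV "insert (inverse (of_real (Im \<tau>))) {t. poly Q t = 0}"]) auto
    then show False by (simp add: infinite_UNIV_char_0)
  qed
  then have "coeff Q i = 0" for i by simp
  moreover have "coeff Q i = a i" if "i \<le> m" for i using that by (simp add: Q_def coeff_sum)
  ultimately show "\<forall>i\<le>m. a i = 0" by simp
next
  assume "\<forall>i\<le>m. a i = 0"
  then show "sym_vec m a \<tau> = 0\<^sub>v (m + 1)"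
    by (intro eq_vecI) (auto simp: sym_vec_def sym_poly_def)
qed

lemma vanishes_eis_vec_zero:
  assumes "4 \<le> real_of_int \<kappa> + 2 * \<alpha>" "\<And>i. i \<le> m \<Longrightarrow> \<chi> i = (\<lambda>x. 0)"
  shows "vanishes (m + 1) (eis_vec \<kappa> m r \<chi>)"
  unfolding vanishes_def eis_vec_def vv_def upper_half_plane_def
proof (intro ballI iffD2[OF sym_vec_zero_iff] allI impI)
  fix \<tau> i assume "\<tau> \<in> {\<tau>. 0 < Im \<tau>}" and i: "i \<le> m"
  then show "eis \<kappa> (int i + r) (\<chi> i) \<tau> = 0" unfolding assms(2)[OF i] using eis_zero[OF assms(1)] by simp
qed simp

lemma not_vanishes_eis_vec:
  assumes i: "i \<le> m" and \<chi>: "\<chi> i = (\<lambda>x. c * exp (of_int n * x))" and "c \<noteq> 0" "4 \<le> \<kappa> - 2 * n" "even \<kappa>"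
  shows "\<not> vanishes (m + 1) (eis_vec \<kappa> m r \<chi>)"
proof -
  obtain \<tau> where \<tau>: "0 < Im \<tau>" "eis \<kappa> (int i + r) (\<chi> i) \<tau> \<noteq> 0"
    unfolding \<chi> using eis_exp_nonzero[OF assms(4,5,3), of "int i + r"] by (elim exE conjE)
  have "eis_vec \<kappa> m r \<chi> \<tau> \<noteq> 0\<^sub>v (m + 1)"
  proof
    assume "eis_vec \<kappa> m r \<chi> \<tau> = 0\<^sub>v (m + 1)"
    then have "\<forall>i\<le>m. eis \<kappa> (int i + r) (\<chi> i) \<tau> = 0"
      unfolding eis_vec_def vv_def by (rule iffD1[OF sym_vec_zero_iff[OF \<tau>(1)]])
    from this[rule_format, OF i] \<tau>(2) show False by (rule notE[rotated])
  qed
  then show ?thesis using \<tau>(1) by (auto simp: vanishes_def upper_half_plane_def)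
qed

section \<open>Preimages under the Laplace operator\<close>

context
  fixes \<kappa> :: int and m :: nat and \<alpha> :: real and k :: int
  assumes \<kappa>: "4 \<le> real_of_int \<kappa> + 2 * \<alpha>" and k: "k = \<kappa> - int m"
begin

lemma lowering_eq: "decaying_seq \<alpha> \<chi> \<Longrightarrow> eq_uhp (lowering p (eis_vec \<kappa> m r \<chi>)) (eis_vec \<kappa> m (r + 1) (low m r \<chi>))"
  unfolding eq_uhp_def upper_half_plane_def using lowering_eis_vec[OF _ \<kappa>] by simp

lemma raising_eq:
  "decaying_seq \<alpha> \<chi> \<Longrightarrow> p = k - 2 * r \<Longrightarrow> eq_uhp (raising p (eis_vec \<kappa> m r \<chi>)) (eis_vec \<kappa> m (r - 1) (rai \<kappa> m r \<chi>))"
  unfolding eq_uhp_def upper_half_plane_def using raising_eis_vec[OF _ \<kappa>] k by simp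

lemma eis_vec_uminus:
  assumes "decaying_seq \<alpha> \<chi>" "0 < Im \<tau>"
  shows "eis_vec \<kappa> m r (\<lambda>i x. - 1 * \<chi> i x) \<tau> = - eis_vec \<kappa> m r \<chi> \<tau>"
proof -
  have e: "eis \<kappa> j (\<lambda>x. - 1 * \<chi> i x) \<tau> = - 1 * eis \<kappa> j (\<chi> i) \<tau>" for i j
    using eis_cmult[OF _ \<kappa> assms(2), of "\<chi> i" j "-1"] assms(1) by (simp add: decaying_seq_def)
  have "sym_poly m (\<lambda>i. - 1 * a i) \<tau> = - sym_poly m a \<tau>" for a
    by (simp add: sym_poly_def sum_negf)
  then show ?thesis unfolding eis_vec_def vv_def e sym_vec_def by (intro eq_vecI) simp_all
qed

lemma laplace_eq:
  assumes \<chi>: "decaying_seq \<alpha> \<chi>"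
  shows "eq_uhp (laplace k (eis_vec \<kappa> m 0 \<chi>)) (eis_vec \<kappa> m 0 (rai \<kappa> m 1 (\<lambda>i x. - 1 * low m 0 \<chi> i x)))"
proof -
  have d: "decaying_seq \<alpha> (low m 0 \<chi>)" by (rule decaying_low[OF \<chi>])
  have d': "decaying_seq \<alpha> (\<lambda>i x. - 1 * low m 0 \<chi> i x)"
    using d unfolding decaying_seq_def by (intro allI decaying_cmult) auto
  have "eq_uhp (lowering k (eis_vec \<kappa> m 0 \<chi>)) (eis_vec \<kappa> m 1 (low m 0 \<chi>))"
    using lowering_eq[OF \<chi>, of k 0] by simp
  moreover have "eq_uhp (raising (k - 2) (eis_vec \<kappa> m 1 (low m 0 \<chi>))) (eis_vec \<kappa> m 0 (rai \<kappa> m 1 (low m 0 \<chi>)))"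
    using raising_eq[OF d, of "k - 2" 1] by simp
  ultimately have r: "eq_uhp (raising (k - 2) (lowering k (eis_vec \<kappa> m 0 \<chi>))) (eis_vec \<kappa> m 0 (rai \<kappa> m 1 (low m 0 \<chi>)))"
    by (rule eq_uhp_trans[OF operator_cong(2)])
  have "deriv (\<lambda>x. - 1 * low m 0 \<chi> i x) x = - 1 * deriv (low m 0 \<chi> i) x" for i x
    using d unfolding decaying_seq_def by (intro DERIV_imp_deriv DERIV_cmult decayingD(1)) blast
  then have "rai \<kappa> m 1 (\<lambda>i x. - 1 * low m 0 \<chi> i x) i = (\<lambda>x. - 1 * rai \<kappa> m 1 (low m 0 \<chi>) i x)" for i
    unfolding rai_def by (intro ext) (simp add: algebra_simps)
  then have "eis_vec \<kappa> m 0 (rai \<kappa> m 1 (\<lambda>i x. - 1 * low m 0 \<chi> i x)) \<tau> = - eis_vec \<kappa> m 0 (rai \<kappa> m 1 (low m 0 \<chi>)) \<tau>"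
    if "0 < Im \<tau>" for \<tau>
    using eis_vec_uminus[OF decaying_rai[OF d] that, of 0 \<kappa> m 1] eis_vec_cong[of m "rai \<kappa> m 1 (\<lambda>i x. - 1 * low m 0 \<chi> i x)"] by simp
  then show ?thesis using r by (simp add: eq_uhp_def laplace_def upper_half_plane_def)
qed

text \<open>The Laplace operator is - R L, and on kernels both factors are onto: e solves
  \<open>rai\<close> e = t, and \<chi> solves \<open>low\<close> \<chi> = - e. The preimage keeps
  the decay rate \<alpha>, hence the convergence of its series and of those in all further
  steps.\<close>

lemma laplace_surj:
  assumes t: "decaying_seq \<alpha> t"
  shows "\<exists>\<chi>. decaying_seq \<alpha> \<chi> \<and> eq_uhp (laplace k (eis_vec \<kappa> m 0 \<chi>)) (eis_vec \<kappa> m 0 t)"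
proof -
  obtain e where e: "decaying_seq \<alpha> e" "\<forall>i\<le>m. rai \<kappa> m 1 e i = t i"
    using rai_surj[OF t, of m \<kappa> 1] by (elim exE conjE)
  have "decaying_seq \<alpha> (\<lambda>i x. - 1 * e i x)"
    using e(1) unfolding decaying_seq_def by (intro allI decaying_cmult) auto
  from low_surj[OF this, of m 0] obtain \<chi> where \<chi>: "decaying_seq \<alpha> \<chi>" "\<forall>i\<le>m. low m 0 \<chi> i = (\<lambda>x. - 1 * e i x)"
    by (elim exE conjE)
  have le: "(\<lambda>x. - 1 * low m 0 \<chi> i x) = e i" if "i \<le> m" for i using \<chi>(2) that by simp
  have "rai \<kappa> m 1 (\<lambda>i x. - 1 * low m 0 \<chi> i x) i = t i" if i: "i \<le> m" for i
  proof -
    have "i - 1 \<le> m" using i by simp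
    then have le': "- 1 * low m 0 \<chi> (i - 1) x = e (i - 1) x" for x by (rule fun_cong[OF le])
    have "rai \<kappa> m 1 (\<lambda>i x. - 1 * low m 0 \<chi> i x) i = rai \<kappa> m 1 e i"
      unfolding rai_def le[OF i] by (simp only: le')
    then show ?thesis using e(2) i by simp
  qed
  then have "eq_uhp (eis_vec \<kappa> m 0 (rai \<kappa> m 1 (\<lambda>i x. - 1 * low m 0 \<chi> i x))) (eis_vec \<kappa> m 0 t)"
    unfolding eq_uhp_def by (intro ballI eis_vec_cong) auto
  then have "eq_uhp (laplace k (eis_vec \<kappa> m 0 \<chi>)) (eis_vec \<kappa> m 0 t)"
    by (rule eq_uhp_trans[OF laplace_eq[OF \<chi>(1)]])
  with \<chi>(1) show ?thesis by (intro exI[of _ \<chi>] conjI)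
qed

lemma laplace_tower:
  assumes t: "decaying_seq \<alpha> t"
  shows "\<exists>\<chi>. decaying_seq \<alpha> \<chi> \<and> eq_uhp (laplace_iter k d (eis_vec \<kappa> m 0 \<chi>)) (eis_vec \<kappa> m 0 t)"
proof (induction d)
  case 0
  show ?case using t by (intro exI[of _ t]) (simp add: eq_uhp_refl)
next
  case (Suc d)
  then obtain \<psi> where \<psi>: "decaying_seq \<alpha> \<psi>" "eq_uhp (laplace_iter k d (eis_vec \<kappa> m 0 \<psi>)) (eis_vec \<kappa> m 0 t)"
    by (elim exE conjE)
  obtain \<chi> where \<chi>: "decaying_seq \<alpha> \<chi>" "eq_uhp (laplace k (eis_vec \<kappa> m 0 \<chi>)) (eis_vec \<kappa> m 0 \<psi>)"
    using laplace_surj[OF \<psi>(1)] by (elim exE conjE)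
  have "eq_uhp (laplace_iter k (Suc d) (eis_vec \<kappa> m 0 \<chi>)) (laplace_iter k d (eis_vec \<kappa> m 0 \<psi>))"
    using laplace_iter_cong[OF \<chi>(2), of d k] by (simp only: funpow_Suc_right o_apply)
  from eq_uhp_trans[OF this \<psi>(2)] \<chi>(1) show ?case by (intro exI[of _ \<chi>] conjI)
qed

end

section \<open>The vector-valued series as polyharmonic forms\<close>

lemma eis_alg_linear_poly:
  assumes "eis_alg \<kappa> \<alpha> f"
  shows "eis_alg \<kappa> \<alpha> (\<lambda>\<tau>. coeff [:f \<tau>, c:] l)"
proof (cases l)
  case 0
  then show ?thesis using assms by simp
next
  case (Suc l')
  then show ?thesis by (simp add: eis_alg.const)
qed

lemma eis_alg_poly_mult:
  assumes "\<And>l. eis_alg \<kappa> \<alpha> (\<lambda>\<tau>. coeff (P \<tau>) l)" "\<And>l. eis_alg \<kappa> \<alpha> (\<lambda>\<tau>. coeff (Q \<tau>) l)"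
  shows "eis_alg \<kappa> \<alpha> (\<lambda>\<tau>. coeff (P \<tau> * Q \<tau>) l)"
  unfolding coeff_mult by (intro eis_alg_sum eis_alg.mult assms) simp

lemma eis_alg_poly_power:
  assumes "\<And>l. eis_alg \<kappa> \<alpha> (\<lambda>\<tau>. coeff (P \<tau>) l)"
  shows "eis_alg \<kappa> \<alpha> (\<lambda>\<tau>. coeff (P \<tau> ^ n) l)"
proof (induction n arbitrary: l)
  case 0
  show ?case unfolding power_0 by (rule eis_alg.const)
next
  case (Suc n)
  show ?case unfolding power_Suc by (rule eis_alg_poly_mult[OF assms Suc.IH])
qed

lemma eis_alg_eis_vec:
  assumes \<chi>: "decaying_seq \<alpha> \<chi>" and l: "l < m + 1"
  shows "eis_alg \<kappa> \<alpha> (\<lambda>\<tau>. eis_vec \<kappa> m r \<chi> \<tau> $ l)"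
proof -
  have A: "eis_alg \<kappa> \<alpha> (\<lambda>\<tau>. coeff (lin_A \<tau>) l)" for l
    unfolding lin_A_def by (rule eis_alg_linear_poly[OF eis_alg.ident])
  have B: "eis_alg \<kappa> \<alpha> (\<lambda>\<tau>. coeff (lin_B \<tau>) l)" for l
    unfolding lin_B_def coeff_smult by (intro eis_alg.mult eis_alg.inv_Im eis_alg_linear_poly eis_alg.conj)
  have E: "eis_alg \<kappa> \<alpha> (\<lambda>\<tau>. eis \<kappa> (int i + r) (\<chi> i) \<tau>)" for i
    using \<chi> unfolding decaying_seq_def by (intro eis_alg.eis) simp
  show ?thesis
    unfolding eis_vec_def vv_component[OF l] sym_poly_def coeff_sum coeff_smult
    by (intro eis_alg_sum eis_alg.mult E eis_alg_poly_mult eis_alg_poly_power A B) simp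
qed

lemma eis_vec_carrier: "eis_vec \<kappa> m r \<chi> \<tau> \<in> carrier_vec (m + 1)"
  by (simp add: eis_vec_def vv_def sym_vec_def)

lemma eis_vec_slash:
  assumes g: "g \<in> carrier SL2Z" and y: "0 < Im \<tau>" and k: "k = \<kappa> - int m"
  shows "slash k (eis_vec \<kappa> m 0 \<chi>) g \<tau> = sym_rep m g *\<^sub>v eis_vec \<kappa> m 0 \<chi> \<tau>"
  unfolding eis_vec_def
proof (rule vv_slash[OF g y])
  fix i
  have "g $$ (0,0) * g $$ (1,1) - g $$ (0,1) * g $$ (1,0) = 1" by (rule SL2Z_D(2)[OF g])
  from eis_slash[OF this y, of \<kappa> "int i + 0" "\<chi> i"]
  show "eis \<kappa> (int i + 0) (\<chi> i) (moebius g \<tau>) =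
    (of_int (g $$ (1,0)) * \<tau> + of_int (g $$ (1,1))) powi (k + int m - 2 * int i) * eis \<kappa> (int i + 0) (\<chi> i) \<tau>"
    by (simp add: moebius_def k)
qed

lemma eis_alg_exp_growth:
  assumes "eis_alg \<kappa> \<alpha> f" "4 \<le> real_of_int \<kappa> + 2 * \<alpha>"
  shows "\<exists>K. \<forall>\<tau>. \<bar>Re \<tau>\<bar> \<le> B \<longrightarrow> 1 \<le> Im \<tau> \<longrightarrow> norm (f \<tau>) \<le> K * exp (Im \<tau>)"
proof -
  obtain C N where C: "0 \<le> C" "\<And>\<tau>. \<bar>Re \<tau>\<bar> \<le> B \<Longrightarrow> 1 \<le> Im \<tau> \<Longrightarrow> norm (f \<tau>) \<le> C * Im \<tau> ^ N"
    by (rule poly_growth_bound[OF eis_alg_growth[OF assms], where B = B]) (rule that)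
  define M where "M = Suc N"
  have "norm (f \<tau>) \<le> (C * real M ^ M) * exp (Im \<tau>)" if "\<bar>Re \<tau>\<bar> \<le> B" "1 \<le> Im \<tau>" for \<tau>
  proof -
    have M0: "0 < real M" by (simp add: M_def)
    have "Im \<tau> / M \<le> exp (Im \<tau> / M)" using exp_ge_add_one_self[of "Im \<tau> / M"] by linarith
    then have "Im \<tau> \<le> real M * exp (Im \<tau> / M)" using M0 by (simp add: field_simps)
    then have "Im \<tau> ^ M \<le> (real M * exp (Im \<tau> / M)) ^ M" using that by (intro power_mono) auto
    also have "\<dots> = real M ^ M * exp (Im \<tau>)"
      using M0 by (simp add: power_mult_distrib exp_of_nat_mult[symmetric])
    finally have "Im \<tau> ^ M \<le> real M ^ M * exp (Im \<tau>)" .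
    moreover have "Im \<tau> ^ N \<le> Im \<tau> ^ M" using that by (intro power_increasing) (auto simp: M_def)
    ultimately have "C * Im \<tau> ^ N \<le> C * (real M ^ M * exp (Im \<tau>))" using C(1) by (intro mult_left_mono) auto
    then show ?thesis using C(2)[OF that] by (simp add: mult.assoc)
  qed
  then show ?thesis by blast
qed

lemma is_norm_sum: "is_norm n (\<lambda>v. \<Sum>i<n. cmod (v $ i))"
  unfolding is_norm_def
proof (intro conjI ballI allI)
  fix v w :: "complex vec" and c assume v: "v \<in> carrier_vec n"
  show "0 \<le> (\<Sum>i<n. cmod (v $ i))" by (simp add: sum_nonneg)
  show "(\<Sum>i<n. cmod (v $ i)) = 0 \<longleftrightarrow> v = 0\<^sub>v n"
  proof
    assume "(\<Sum>i<n. cmod (v $ i)) = 0"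
    then have "\<forall>i<n. v $ i = 0" by (simp add: sum_nonneg_eq_0_iff)
    then show "v = 0\<^sub>v n" using v by (intro eq_vecI) auto
  qed simp
  show "(\<Sum>i<n. cmod ((c \<cdot>\<^sub>v v) $ i)) = cmod c * (\<Sum>i<n. cmod (v $ i))"
    using v by (simp add: sum_distrib_left norm_mult)
  show "(\<Sum>i<n. cmod ((v + w) $ i)) \<le> (\<Sum>i<n. cmod (v $ i)) + (\<Sum>i<n. cmod (w $ i))" if "w \<in> carrier_vec n"
    using v that by (simp add: sum.distrib[symmetric] sum_mono norm_triangle_ineq)
qed

text \<open>By modularity the slash transform by g is \<open>sym_rep m g\<close> applied to the
  form, a constant combination of its components. Growth at every cusp is thus growth at
  i\<infinity>, where a power of y is absorbed by exp y.\<close>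

lemma exponential_growth_eis_vec:
  assumes \<kappa>: "4 \<le> real_of_int \<kappa> + 2 * \<alpha>" and k: "k = \<kappa> - int m" and \<chi>: "decaying_seq \<alpha> \<chi>"
  shows "exponential_growth k (m + 1) (eis_vec \<kappa> m 0 \<chi>)"
  unfolding exponential_growth_def
proof (rule exI[of _ 1], rule exI[of _ "\<lambda>v. \<Sum>i<m + 1. cmod (v $ i)"], intro conjI ballI allI is_norm_sum)
  fix g B assume g: "g \<in> carrier SL2Z"
  define F where "F i \<tau> = (sym_rep m g *\<^sub>v eis_vec \<kappa> m 0 \<chi> \<tau>) $ i" for i \<tau>
  have F: "F i \<tau> = (\<Sum>j\<in>{0..<m + 1}. sym_rep m g $$ (i, j) * eis_vec \<kappa> m 0 \<chi> \<tau> $ j)" if "i < m + 1" for i \<tau>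
    using that sym_rep_carrier[of m g] eis_vec_carrier[of \<kappa> m 0 \<chi> \<tau>] by (simp add: F_def scalar_prod_def)
  have "eis_alg \<kappa> \<alpha> (F i)" if "i < m + 1" for i
  proof -
    have "F i = (\<lambda>\<tau>. \<Sum>j\<in>{0..<m + 1}. sym_rep m g $$ (i, j) * eis_vec \<kappa> m 0 \<chi> \<tau> $ j)"
      by (rule ext) (rule F[OF that])
    then show ?thesis by (simp only:) (intro eis_alg_sum eis_alg.mult eis_alg.const eis_alg_eis_vec \<chi>, auto)
  qed
  then have "\<forall>i. \<exists>K. i < m + 1 \<longrightarrow> (\<forall>\<tau>. \<bar>Re \<tau>\<bar> \<le> B \<longrightarrow> 1 \<le> Im \<tau> \<longrightarrow> norm (F i \<tau>) \<le> K * exp (Im \<tau>))"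
    using eis_alg_exp_growth[OF _ \<kappa>] by blast
  from choice[OF this] obtain K where K: "\<And>i \<tau>. i < m + 1 \<Longrightarrow> \<bar>Re \<tau>\<bar> \<le> B \<Longrightarrow> 1 \<le> Im \<tau> \<Longrightarrow> norm (F i \<tau>) \<le> K i * exp (Im \<tau>)"
    by blast
  have b: "(\<Sum>i<m + 1. cmod (slash k (eis_vec \<kappa> m 0 \<chi>) g (Complex x y) $ i)) \<le> (\<Sum>i<m + 1. K i) * exp (1 * y)"
    if "\<bar>x\<bar> \<le> B" "1 \<le> y" for x y
  proof -
    have e: "slash k (eis_vec \<kappa> m 0 \<chi>) g (Complex x y) $ i = F i (Complex x y)" for i
      using eis_vec_slash[OF g, of "Complex x y" k \<kappa> m \<chi>] k that by (simp add: F_def)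
    have "(\<Sum>i<m + 1. cmod (F i (Complex x y))) \<le> (\<Sum>i<m + 1. K i * exp y)"
      by (rule sum_mono) (use K[of _ "Complex x y"] that in simp)
    then show ?thesis by (simp only: e mult_1 sum_distrib_right)
  qed
  show "\<exists>C. \<exists>Y>0. \<forall>x y. \<bar>x\<bar> \<le> B \<longrightarrow> Y \<le> y \<longrightarrow>
      (\<Sum>i<m + 1. cmod (slash k (eis_vec \<kappa> m 0 \<chi>) g (Complex x y) $ i)) \<le> C * exp (1 * y)"
    by (rule exI[of _ "\<Sum>i<m + 1. K i"], rule exI[of _ 1]) (use b in auto)
qed

lemma operators_zero:
  "lowering k (\<lambda>_. 0\<^sub>v n) \<tau> = 0\<^sub>v n" "raising k (\<lambda>_. 0\<^sub>v n) \<tau> = 0\<^sub>v n"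
proof -
  have c: "wirtinger (\<lambda>w. 0) \<tau> = 0" "wirtinger_bar (\<lambda>w. 0) \<tau> = 0"
    by (simp_all add: wirtinger_def wirtinger_bar_def partial_x_def partial_y_def frechet_derivative_const)
  show "lowering k (\<lambda>_. 0\<^sub>v n) \<tau> = 0\<^sub>v n" "raising k (\<lambda>_. 0\<^sub>v n) \<tau> = 0\<^sub>v n"
    by (intro eq_vecI; simp add: lowering_def raising_def componentwise_def c)+
qed

lemma vanishes_operators:
  assumes "vanishes n f"
  shows "vanishes n (lowering k f)" "vanishes n (raising k f)" "vanishes n (laplace k f)"
proof -
  have l: "vanishes n (lowering k g)" and r: "vanishes n (raising k g)" if "vanishes n g" for g k
  proof -
    have "eq_uhp g (\<lambda>_. 0\<^sub>v n)" using that by (simp add: eq_uhp_def vanishes_def)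
    then show "vanishes n (lowering k g)" "vanishes n (raising k g)"
      using operator_cong operators_zero by (metis eq_uhp_def vanishes_def)+
  qed
  show "vanishes n (lowering k f)" "vanishes n (raising k f)" by (intro l r assms)+
  have "vanishes n (raising (k - 2) (lowering k f))" by (intro l r assms)
  then show "vanishes n (laplace k f)" by (simp add: vanishes_def laplace_def)
qed

lemma vanishes_laplace_iter: "vanishes n f \<Longrightarrow> vanishes n (laplace_iter k d f)"
  by (induction d) (simp_all add: vanishes_operators)

text \<open>Every series of this kind satisfies the conditions of modularity, smoothness and growth,
  so only the depth depends on the choice of t. Here j is the depth of the series of t itself: j = 0
  if it is harmonic, and j = 1 if the condition to be realized concerns the level one step before
  the last.\<close>

lemma realization:
  assumes \<kappa>: "4 \<le> real_of_int \<kappa> + 2 * \<alpha>" and k: "k = \<kappa> - int m" and t: "decaying_seq \<alpha> t"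
    and nz: "\<not> vanishes (m + 1) (laplace_iter k j (eis_vec \<kappa> m 0 t))"
    and z: "vanishes (m + 1) (laplace k (laplace_iter k j (eis_vec \<kappa> m 0 t)))"
  shows "\<exists>f. modular_data (carrier SL2Z) (m + 1) (sym_rep m) k (d + j) f \<and> eq_uhp (laplace_iter k d f) (eis_vec \<kappa> m 0 t)"
proof -
  obtain \<chi> where \<chi>: "decaying_seq \<alpha> \<chi>" "eq_uhp (laplace_iter k d (eis_vec \<kappa> m 0 \<chi>)) (eis_vec \<kappa> m 0 t)"
    using laplace_tower[OF \<kappa> k t, of d] by (elim exE conjE)
  define f where "f = eis_vec \<kappa> m 0 \<chi>"
  have dj: "laplace_iter k (d + j) f = laplace_iter k j (laplace_iter k d f)"
    by (simp only: add.commute[of d] funpow_add o_apply)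
  have e: "eq_uhp (laplace_iter k (d + j) f) (laplace_iter k j (eis_vec \<kappa> m 0 t))"
    unfolding dj unfolding f_def by (rule laplace_iter_cong[OF \<chi>(2)])
  have n1: "\<not> vanishes (m + 1) (laplace_iter k (d + j) f)" using nz vanishes_cong[OF e] by simp
  have n2: "vanishes (m + 1) (laplace_iter k (d + j + 1) f)"
    using z vanishes_cong[OF laplace_cong[OF e]] by simp
  have f1: "smooth_vec (m + 1) f"
    unfolding smooth_vec_def f_def
    by (intro conjI ballI allI impI eis_vec_carrier eis_alg_smooth[OF eis_alg_eis_vec[OF \<chi>(1)] \<kappa>])
  have f2: "\<forall>\<gamma>\<in>carrier SL2Z. \<forall>\<tau>\<in>upper_half_plane. slash k f \<gamma> \<tau> = sym_rep m \<gamma> *\<^sub>v f \<tau>"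
    using eis_vec_slash[OF _ _ k] by (simp add: f_def upper_half_plane_def)
  have f3: "exponential_growth k (m + 1) f"
    unfolding f_def by (rule exponential_growth_eis_vec[OF \<kappa> k \<chi>(1)])
  have f4: "\<not> vanishes (m + 1) f" by (rule contrapos_nn[OF n1]) (rule vanishes_laplace_iter)
  have "modular_data (carrier SL2Z) (m + 1) (sym_rep m) k (d + j) f"
    unfolding modular_data_def form_of_exact_depth_def polyharmonic_weak_maass_form_def
    by (intro conjI disjI2 finite_index_SL2Z matrix_representation_sym_rep f1 f2 f3 f4 n1 n2)
  with \<chi>(2) show ?thesis unfolding f_def by (intro exI[of _ "eis_vec \<kappa> m 0 \<chi>"] conjI)
qed

section \<open>Power kernels and their coefficient sequences\<close>

definition exp_seq :: "int \<Rightarrow> (nat \<Rightarrow> real) \<Rightarrow> nat \<Rightarrow> real \<Rightarrow> real" where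
  "exp_seq n c i = (\<lambda>x. c i * exp (of_int n * x))"

text \<open>On exp (n x) differentiation is multiplication by n, so \<open>low\<close> and
  \<open>rai\<close> act on power kernels through their coefficients alone; \<open>clow\<close> and
  \<open>crai\<close> are these actions.\<close>

definition clow :: "nat \<Rightarrow> int \<Rightarrow> int \<Rightarrow> (nat \<Rightarrow> real) \<Rightarrow> nat \<Rightarrow> real" where
  "clow m n r c i = of_int (int i + r - n) * c i - (if i < m then of_nat (Suc i) * c (Suc i) else 0)"

definition crai :: "int \<Rightarrow> nat \<Rightarrow> int \<Rightarrow> int \<Rightarrow> (nat \<Rightarrow> real) \<Rightarrow> nat \<Rightarrow> real" where
  "crai \<kappa> m n r c i = of_int (\<kappa> - int i - r - n) * c i - (if 0 < i then of_nat (m - i + 1) * c (i - 1) else 0)"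

text \<open>The iteration starts with r = 1: the initial sequence describes a form that has been
  lowered once, because in several cases L f has power kernels although f has not.\<close>

primrec clows :: "nat \<Rightarrow> int \<Rightarrow> nat \<Rightarrow> (nat \<Rightarrow> real) \<Rightarrow> nat \<Rightarrow> real" where
  "clows m n 0 c = c"
| "clows m n (Suc j) c = clow m n (1 + int j) (clows m n j c)"

primrec crais :: "int \<Rightarrow> nat \<Rightarrow> int \<Rightarrow> nat \<Rightarrow> (nat \<Rightarrow> real) \<Rightarrow> nat \<Rightarrow> real" where
  "crais \<kappa> m n 0 c = c"
| "crais \<kappa> m n (Suc j) c = crai \<kappa> m n (- int j) (crais \<kappa> m n j c)"

lemma deriv_exp_seq: "deriv (exp_seq n c i) x = of_int n * exp_seq n c i x"
  unfolding exp_seq_def by (rule DERIV_imp_deriv) (auto intro!: derivative_eq_intros)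

lemma low_exp_seq: "low m r (exp_seq n c) = exp_seq n (clow m n r c)"
  by (intro ext, simp only: low_def deriv_exp_seq, simp add: exp_seq_def clow_def algebra_simps)

lemma rai_exp_seq: "rai \<kappa> m r (exp_seq n c) = exp_seq n (crai \<kappa> m n r c)"
  by (intro ext, simp only: rai_def deriv_exp_seq, simp add: exp_seq_def crai_def algebra_simps)

context
  fixes \<kappa> :: int and m :: nat and n :: int and k :: int
  assumes \<kappa>: "4 \<le> \<kappa> - 2 * n" "even \<kappa>" and k: "k = \<kappa> - int m"
begin

lemma weight_bound: "4 \<le> real_of_int \<kappa> + 2 * - real_of_int n"
  using \<kappa>(1) by linarith

lemma decaying_exp_seq: "decaying_seq (- real_of_int n) (exp_seq n c)"
  unfolding decaying_seq_def exp_seq_def by (intro allI decaying_exp)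

text \<open>A single nonzero coefficient already makes its component nonzero, by
  \<open>eis_exp_nonzero\<close>. For power kernels all conditions of the classification thus become
  finite identities between coefficients.\<close>

lemma vanishes_exp_seq: "vanishes (m + 1) (eis_vec \<kappa> m r (exp_seq n c)) \<longleftrightarrow> (\<forall>i\<le>m. c i = 0)"
proof
  assume v: "vanishes (m + 1) (eis_vec \<kappa> m r (exp_seq n c))"
  show "\<forall>i\<le>m. c i = 0"
  proof (intro allI impI, rule ccontr)
    fix i assume i: "i \<le> m" "c i \<noteq> 0"
    have "exp_seq n c i = (\<lambda>x. c i * exp (of_int n * x))" by (rule exp_seq_def)
    from not_vanishes_eis_vec[where r = r and \<chi> = "exp_seq n c", OF i(1) this i(2) \<kappa>] v show False by (rule notE)
  qed
next
  assume "\<forall>i\<le>m. c i = 0"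
  then show "vanishes (m + 1) (eis_vec \<kappa> m r (exp_seq n c))"
    by (intro vanishes_eis_vec_zero[OF weight_bound]) (simp add: exp_seq_def)
qed

lemma lowering_exp_seq: "eq_uhp (lowering p (eis_vec \<kappa> m r (exp_seq n c))) (eis_vec \<kappa> m (r + 1) (exp_seq n (clow m n r c)))"
  using lowering_eq[OF weight_bound k decaying_exp_seq] unfolding low_exp_seq .

lemma raising_exp_seq:
  "p = k - 2 * r \<Longrightarrow> eq_uhp (raising p (eis_vec \<kappa> m r (exp_seq n c))) (eis_vec \<kappa> m (r - 1) (exp_seq n (crai \<kappa> m n r c)))"
  using raising_eq[OF weight_bound k decaying_exp_seq] unfolding rai_exp_seq .

lemma lowering_iter_exp_seq:
  assumes "eq_uhp (lowering k f) (eis_vec \<kappa> m 1 (exp_seq n e))"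
  shows "eq_uhp (lowering_iter k (Suc j) f) (eis_vec \<kappa> m (1 + int j) (exp_seq n (clows m n j e)))"
proof (induction j)
  case 0
  show ?case using assms by simp
next
  case (Suc j)
  have "eq_uhp (lowering_iter k (Suc (Suc j)) f) (lowering (k - 2 * int (Suc j)) (eis_vec \<kappa> m (1 + int j) (exp_seq n (clows m n j e))))"
    unfolding lowering_iter.simps(2)[of k "Suc j"] by (rule operator_cong(1)[OF Suc.IH])
  from eq_uhp_trans[OF this lowering_exp_seq] show ?case by (simp add: add_ac)
qed

lemma raising_iter_exp_seq:
  "eq_uhp (raising_iter k j (eis_vec \<kappa> m 0 (exp_seq n c))) (eis_vec \<kappa> m (- int j) (exp_seq n (crais \<kappa> m n j c)))"
proof (induction j)
  case 0
  show ?case by (simp add: eq_uhp_refl)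
next
  case (Suc j)
  have "eq_uhp (raising_iter k (Suc j) (eis_vec \<kappa> m 0 (exp_seq n c))) (raising (k + 2 * int j) (eis_vec \<kappa> m (- int j) (exp_seq n (crais \<kappa> m n j c))))"
    unfolding raising_iter.simps(2) by (rule operator_cong(2)[OF Suc.IH])
  moreover have "k + 2 * int j = k - 2 * (- int j)" by simp
  moreover have "- int j - 1 = - int (Suc j)" by simp
  ultimately show ?case
    using eq_uhp_trans[OF _ raising_exp_seq[of "k + 2 * int j" "- int j"]] by (simp only: crais.simps)
qed

lemma laplace_exp_seq:
  assumes \<chi>: "eq_uhp (lowering k f) (eis_vec \<kappa> m 1 (exp_seq n e))"
  shows "eq_uhp (\<lambda>\<tau>. - laplace k f \<tau>) (eis_vec \<kappa> m 0 (exp_seq n (crai \<kappa> m n 1 e)))"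
  using eq_uhp_trans[OF operator_cong(2)[OF \<chi>, of "k - 2"] raising_exp_seq[of "k - 2" 1 e]]
  by (simp add: laplace_def)

lemma vanishes_laplace_exp_seq:
  assumes \<chi>: "eq_uhp (lowering k f) (eis_vec \<kappa> m 1 (exp_seq n e))"
  shows "vanishes (m + 1) (laplace k f) \<longleftrightarrow> (\<forall>i\<le>m. crai \<kappa> m n 1 e i = 0)"
proof -
  have "- v = 0\<^sub>v (m + 1) \<longleftrightarrow> v = 0\<^sub>v (m + 1)" for v :: "complex vec"
  proof
    assume v: "- v = 0\<^sub>v (m + 1)"
    have "v = - (- v)" by (intro eq_vecI) auto
    then show "v = 0\<^sub>v (m + 1)" unfolding v by (metis uminus_zero_vec)
  qed auto
  then have "vanishes (m + 1) (laplace k f) \<longleftrightarrow> vanishes (m + 1) (\<lambda>\<tau>. - laplace k f \<tau>)"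
    by (simp add: vanishes_def)
  then show ?thesis using vanishes_cong[OF laplace_exp_seq[OF \<chi>]] vanishes_exp_seq by simp
qed

text \<open>This serves the tops that have power kernels themselves; for them lowering and iterated
  raising are both decided by the sequence c.\<close>

lemma realization_coefficients:
  assumes nz: "\<exists>i\<le>m. c i \<noteq> 0" and z: "\<And>i. i \<le> m \<Longrightarrow> crai \<kappa> m n 1 (clow m n 0 c) i = 0"
  shows "\<exists>f. modular_data (carrier SL2Z) (m + 1) (sym_rep m) k d f
    \<and> (vanishes (m + 1) (lowering k (laplace_iter k d f)) \<longleftrightarrow> (\<forall>i\<le>m. clow m n 0 c i = 0))
    \<and> (\<forall>j. vanishes (m + 1) (raising_iter k j (laplace_iter k d f)) \<longleftrightarrow> (\<forall>i\<le>m. crais \<kappa> m n j c i = 0))"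
proof -
  have l: "eq_uhp (lowering k (eis_vec \<kappa> m 0 (exp_seq n c))) (eis_vec \<kappa> m 1 (exp_seq n (clow m n 0 c)))"
    using lowering_exp_seq[of k 0 c] by simp
  have "\<exists>f. modular_data (carrier SL2Z) (m + 1) (sym_rep m) k (d + 0) f \<and> eq_uhp (laplace_iter k d f) (eis_vec \<kappa> m 0 (exp_seq n c))"
  proof (rule realization[OF weight_bound k decaying_exp_seq])
    show "\<not> vanishes (m + 1) (laplace_iter k 0 (eis_vec \<kappa> m 0 (exp_seq n c)))"
      unfolding funpow.simps(1) id_apply vanishes_exp_seq using nz by blast
    show "vanishes (m + 1) (laplace k (laplace_iter k 0 (eis_vec \<kappa> m 0 (exp_seq n c))))"
      unfolding funpow.simps(1) id_apply vanishes_laplace_exp_seq[OF l] using z by blast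
  qed
  then obtain f where f: "modular_data (carrier SL2Z) (m + 1) (sym_rep m) k d f" "eq_uhp (laplace_iter k d f) (eis_vec \<kappa> m 0 (exp_seq n c))"
    by (auto simp only: add_0_right)
  have "vanishes (m + 1) (raising_iter k j (laplace_iter k d f)) \<longleftrightarrow> (\<forall>i\<le>m. crais \<kappa> m n j c i = 0)" for j
    using vanishes_cong[OF eq_uhp_trans[OF raising_iter_cong[OF f(2)] raising_iter_exp_seq]] vanishes_exp_seq by simp
  moreover have "vanishes (m + 1) (lowering k (laplace_iter k d f)) \<longleftrightarrow> (\<forall>i\<le>m. clow m n 0 c i = 0)"
    using vanishes_cong[OF eq_uhp_trans[OF operator_cong(1)[OF f(2)] l]] vanishes_exp_seq by simp
  ultimately show ?thesis using f(1) by (intro exI[of _ f] conjI allI)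
qed

lemma realization_lowered:
  fixes e :: "nat \<Rightarrow> real"
  assumes "\<not> vanishes (m + 1) (laplace_iter k j (eis_vec \<kappa> m 0 \<chi>))" "vanishes (m + 1) (laplace k (laplace_iter k j (eis_vec \<kappa> m 0 \<chi>)))"
    and \<chi>: "decaying_seq (- real_of_int n) \<chi>" and l: "eq_uhp (lowering k (eis_vec \<kappa> m 0 \<chi>)) (eis_vec \<kappa> m 1 (exp_seq n e))"
  shows "\<exists>f. modular_data (carrier SL2Z) (m + 1) (sym_rep m) k (d + j) f \<and> eq_uhp (laplace_iter k d f) (eis_vec \<kappa> m 0 \<chi>)
    \<and> (\<forall>j. vanishes (m + 1) (lowering_iter k (Suc j) (laplace_iter k d f)) \<longleftrightarrow> (\<forall>i\<le>m. clows m n j e i = 0))"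
proof -
  obtain f where f: "modular_data (carrier SL2Z) (m + 1) (sym_rep m) k (d + j) f" "eq_uhp (laplace_iter k d f) (eis_vec \<kappa> m 0 \<chi>)"
    using realization[OF weight_bound k \<chi> assms(1,2), of d] by (elim exE conjE)
  have "vanishes (m + 1) (lowering_iter k (Suc j) (laplace_iter k d f)) \<longleftrightarrow> (\<forall>i\<le>m. clows m n j e i = 0)" for j
    using vanishes_cong[OF lowering_iter_exp_seq[OF eq_uhp_trans[OF operator_cong(1)[OF f(2)] l]]] vanishes_exp_seq by simp
  with f show ?thesis by (intro exI[of _ f] conjI allI)
qed

text \<open>Inverting the lowering operator on exp (n x) meets a resonance at index i = n and may
  produce x exp (n x). Such kernels still decay at every rate below - n but are no longer powers, so
  only the lowered form is described by coefficients.\<close>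

lemma exists_lowered: "\<exists>\<chi>. decaying_seq (- real_of_int n) \<chi> \<and> eq_uhp (lowering k (eis_vec \<kappa> m 0 \<chi>)) (eis_vec \<kappa> m 1 (exp_seq n e))"
proof -
  obtain \<chi> where \<chi>: "decaying_seq (- real_of_int n) \<chi>" "\<forall>i\<le>m. low m 0 \<chi> i = exp_seq n e i"
    using low_surj[OF decaying_exp_seq, of m 0 e] by (elim exE conjE)
  have "eq_uhp (eis_vec \<kappa> m 1 (low m 0 \<chi>)) (eis_vec \<kappa> m 1 (exp_seq n e))"
    unfolding eq_uhp_def using \<chi>(2) by (intro ballI eis_vec_cong) simp
  then have "eq_uhp (lowering k (eis_vec \<kappa> m 0 \<chi>)) (eis_vec \<kappa> m 1 (exp_seq n e))"
    using lowering_eq[OF weight_bound k \<chi>(1), of k 0] unfolding add_0 by (rule eq_uhp_trans[rotated])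
  with \<chi>(1) show ?thesis by (intro exI[of _ \<chi>] conjI)
qed

lemma realization_lowering:
  assumes nz: "\<exists>i\<le>m. e i \<noteq> 0" and z: "\<And>i. i \<le> m \<Longrightarrow> crai \<kappa> m n 1 e i = 0"
  shows "\<exists>f. modular_data (carrier SL2Z) (m + 1) (sym_rep m) k d f
    \<and> (\<forall>j. vanishes (m + 1) (lowering_iter k (Suc j) (laplace_iter k d f)) \<longleftrightarrow> (\<forall>i\<le>m. clows m n j e i = 0))"
proof -
  obtain \<chi> where \<chi>: "decaying_seq (- real_of_int n) \<chi>" "eq_uhp (lowering k (eis_vec \<kappa> m 0 \<chi>)) (eis_vec \<kappa> m 1 (exp_seq n e))"
    using exists_lowered[of e] by (elim exE conjE)
  have "\<not> vanishes (m + 1) (lowering k (eis_vec \<kappa> m 0 \<chi>))"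
    unfolding vanishes_cong[OF \<chi>(2)] vanishes_exp_seq using nz by blast
  then have a1: "\<not> vanishes (m + 1) (laplace_iter k 0 (eis_vec \<kappa> m 0 \<chi>))"
    unfolding funpow.simps(1) id_apply by (rule contrapos_nn) (rule vanishes_operators(1))
  have a2: "vanishes (m + 1) (laplace k (laplace_iter k 0 (eis_vec \<kappa> m 0 \<chi>)))"
    unfolding funpow.simps(1) id_apply vanishes_laplace_exp_seq[OF \<chi>(2)] using z by blast
  obtain f where f: "modular_data (carrier SL2Z) (m + 1) (sym_rep m) k (d + 0) f"
    "\<forall>j. vanishes (m + 1) (lowering_iter k (Suc j) (laplace_iter k d f)) \<longleftrightarrow> (\<forall>i\<le>m. clows m n j e i = 0)"
    using realization_lowered[OF a1 a2 \<chi>, of d] by (elim exE conjE)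
  show ?thesis by (rule exI[of _ f], intro conjI f[unfolded add_0_right])
qed

text \<open>The prescribed level is \<Delta>^d f for a form of depth d + 1. If its lowering has the
  coefficients e, its Laplace image has the coefficients - \<open>crai\<close> e; the hypotheses
  make this image nonzero and annihilated by lowering, so exactly one level remains.\<close>

lemma realization_Suc:
  assumes nz: "\<exists>i\<le>m. crai \<kappa> m n 1 e i \<noteq> 0" and z: "\<forall>i\<le>m. clow m n 0 (crai \<kappa> m n 1 e) i = 0"
  shows "\<exists>f. modular_data (carrier SL2Z) (m + 1) (sym_rep m) k (Suc d) f
    \<and> vanishes (m + 1) (lowering k (laplace_iter k (Suc d) f))
    \<and> (\<forall>j. vanishes (m + 1) (lowering_iter k (Suc j) (laplace_iter k d f)) \<longleftrightarrow> (\<forall>i\<le>m. clows m n j e i = 0))"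
proof -
  obtain \<chi> where \<chi>: "decaying_seq (- real_of_int n) \<chi>" "eq_uhp (lowering k (eis_vec \<kappa> m 0 \<chi>)) (eis_vec \<kappa> m 1 (exp_seq n e))"
    using exists_lowered[of e] by (elim exE conjE)
  obtain \<chi>' where \<chi>': "decaying_seq (- real_of_int n) \<chi>'" "eq_uhp (laplace k (eis_vec \<kappa> m 0 \<chi>)) (eis_vec \<kappa> m 0 \<chi>')"
    "\<chi>' = exp_seq n (crai \<kappa> m n 1 (\<lambda>i. - e i))"
  proof -
    have "eq_uhp (laplace k (eis_vec \<kappa> m 0 \<chi>)) (\<lambda>\<tau>. - eis_vec \<kappa> m 0 (exp_seq n (crai \<kappa> m n 1 e)) \<tau>)"
      using laplace_exp_seq[OF \<chi>(2)] unfolding eq_uhp_def by (metis (no_types, lifting) uminus_uminus_vec)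
    moreover have "- eis_vec \<kappa> m 0 (exp_seq n (crai \<kappa> m n 1 e)) \<tau> = eis_vec \<kappa> m 0 (exp_seq n (crai \<kappa> m n 1 (\<lambda>i. - e i))) \<tau>"
      if "\<tau> \<in> upper_half_plane" for \<tau>
    proof -
      have "exp_seq n (crai \<kappa> m n 1 (\<lambda>i. - e i)) = (\<lambda>i x. - 1 * exp_seq n (crai \<kappa> m n 1 e) i x)"
        by (rule ext)+ (simp add: exp_seq_def crai_def algebra_simps)
      then show ?thesis
        using eis_vec_uminus[OF weight_bound k decaying_exp_seq, of \<tau> 0 "crai \<kappa> m n 1 e"] that
        by (simp add: upper_half_plane_def)
    qed
    ultimately have "eq_uhp (laplace k (eis_vec \<kappa> m 0 \<chi>)) (eis_vec \<kappa> m 0 (exp_seq n (crai \<kappa> m n 1 (\<lambda>i. - e i))))"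
      by (simp add: eq_uhp_def)
    from that[OF decaying_exp_seq this refl] show thesis .
  qed
  have neg: "crai \<kappa> m n 1 (\<lambda>i. - e i) i = - crai \<kappa> m n 1 e i" for i by (simp add: crai_def)
  have negl: "clow m n 0 (crai \<kappa> m n 1 (\<lambda>i. - e i)) i = - clow m n 0 (crai \<kappa> m n 1 e) i" for i
    by (simp add: clow_def neg)
  have L0: "vanishes (m + 1) (lowering k (eis_vec \<kappa> m 0 \<chi>'))"
    using vanishes_cong[OF lowering_exp_seq[of k 0 "crai \<kappa> m n 1 (\<lambda>i. - e i)"]] vanishes_exp_seq z
    unfolding \<chi>'(3) by (simp add: negl)
  have a1: "\<not> vanishes (m + 1) (laplace_iter k 1 (eis_vec \<kappa> m 0 \<chi>))"
  proof -
    have "laplace_iter k 1 (eis_vec \<kappa> m 0 \<chi>) = laplace k (eis_vec \<kappa> m 0 \<chi>)" by simp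
    then show ?thesis
      using nz by (simp only: vanishes_cong[OF \<chi>'(2)] \<chi>'(3) vanishes_exp_seq neg neg_equal_0_iff_equal) blast
  qed
  have a2: "vanishes (m + 1) (laplace k (laplace_iter k 1 (eis_vec \<kappa> m 0 \<chi>)))"
  proof -
    have "vanishes (m + 1) (raising (k - 2) (lowering k (eis_vec \<kappa> m 0 \<chi>')))" by (rule vanishes_operators(2)[OF L0])
    then have "vanishes (m + 1) (laplace k (eis_vec \<kappa> m 0 \<chi>'))" by (simp add: laplace_def vanishes_def)
    then show ?thesis using vanishes_cong[OF laplace_cong[OF \<chi>'(2)]] by simp
  qed
  obtain f where f: "modular_data (carrier SL2Z) (m + 1) (sym_rep m) k (d + 1) f" "eq_uhp (laplace_iter k d f) (eis_vec \<kappa> m 0 \<chi>)"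
    "\<forall>j. vanishes (m + 1) (lowering_iter k (Suc j) (laplace_iter k d f)) \<longleftrightarrow> (\<forall>i\<le>m. clows m n j e i = 0)"
    using realization_lowered[OF a1 a2 \<chi>, of d] by (elim exE conjE)
  have "eq_uhp (laplace_iter k (Suc d) f) (eis_vec \<kappa> m 0 \<chi>')"
    using eq_uhp_trans[OF laplace_cong[OF f(2)] \<chi>'(2)] by simp
  then have "vanishes (m + 1) (lowering k (laplace_iter k (Suc d) f))"
    using L0 by (simp only: vanishes_cong[OF operator_cong(1)])
  with f(1,3) show ?thesis by (intro exI[of _ f] conjI) simp_all
qed

end

section \<open>The cases of the classification\<close>

lemma lowering_const:
  "eq_uhp (lowering p (vv m (\<lambda>i _. h i))) (vv m (\<lambda>i _. - (if i < m then of_nat (Suc i) * h (Suc i) else 0)))"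
  unfolding eq_uhp_def upper_half_plane_def
  using lowering_vv[of _ m "\<lambda>i _. h i" "\<lambda>_. 0" "\<lambda>_. 0" p] has_wirtinger_const by (simp add: vv_def)

text \<open>Component i has weight p + m - 2i. Only where this weight is 0 does the term in 1 / y
  disappear, so that a constant is mapped to a constant.\<close>

lemma raising_const:
  assumes "\<And>i. i \<le> m \<Longrightarrow> p + int m \<noteq> 2 * int i \<Longrightarrow> h i = 0"
  shows "eq_uhp (raising p (vv m (\<lambda>i _. h i))) (vv m (\<lambda>i _. - (if 0 < i then of_nat (m - i + 1) * h (i - 1) else 0)))"
  unfolding eq_uhp_def
proof
  fix \<tau> assume "\<tau> \<in> upper_half_plane"
  then have y: "0 < Im \<tau>" by (simp add: upper_half_plane_def)
  have z: "of_int (p + int m - 2 * int i) / of_real (Im \<tau>) * h i = 0" if "i \<le> m" for i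
    using assms[OF that] by (cases "p + int m = 2 * int i") auto
  show "raising p (vv m (\<lambda>i _. h i)) \<tau> = vv m (\<lambda>i _. - (if 0 < i then of_nat (m - i + 1) * h (i - 1) else 0)) \<tau>"
    unfolding raising_vv[OF y has_wirtinger_const] vv_def
    by (rule sym_vec_cong) (simp only: z mult_zero_right add_0 diff_0)
qed

lemma vanishes_const: "(\<And>i. i \<le> m \<Longrightarrow> h i = 0) \<Longrightarrow> vanishes (m + 1) (vv m (\<lambda>i _. h i))"
  unfolding vanishes_def vv_def upper_half_plane_def
  by (intro ballI iffD2[OF sym_vec_zero_iff] allI impI; simp)

text \<open>Each lowering moves the support down by one index. The number j counts the lowerings
  after the first, so nothing is left once j reaches m + 1.\<close>

lemma lowering_iter_const:
  assumes "eq_uhp (lowering k f) (vv m (\<lambda>i _. h i))"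
  shows "\<exists>h'. eq_uhp (lowering_iter k (Suc j) f) (vv m (\<lambda>i _. h' i)) \<and> (\<forall>i\<le>m. m < i + j \<longrightarrow> h' i = 0)"
proof (induction j)
  case 0
  show ?case using assms by (intro exI[of _ h]) simp
next
  case (Suc j)
  then obtain h' where h': "eq_uhp (lowering_iter k (Suc j) f) (vv m (\<lambda>i _. h' i))" "\<forall>i\<le>m. m < i + j \<longrightarrow> h' i = 0"
    by (elim exE conjE)
  have "eq_uhp (lowering_iter k (Suc (Suc j)) f) (vv m (\<lambda>i _. - (if i < m then of_nat (Suc i) * h' (Suc i) else 0)))"
    unfolding lowering_iter.simps(2)[of k "Suc j"] by (rule eq_uhp_trans[OF operator_cong(1)[OF h'(1)] lowering_const])
  then show ?case using h'(2)
    by (intro exI[of _ "\<lambda>i. - (if i < m then of_nat (Suc i) * h' (Suc i) else 0)"] conjI) auto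
qed

text \<open>Starting from A^m in weight - m, the j-th raising is a multiple of A^(m-j) B^j, whose
  component has weight (- m + 2j) + m - 2j = 0. So constants stay constants, and the sequence ends
  after j = m.\<close>

lemma raising_iter_const:
  assumes "eq_uhp f (vv m (\<lambda>i _. if i = 0 then 1 else 0))" and k: "k = - int m"
  shows "\<exists>h. eq_uhp (raising_iter k j f) (vv m (\<lambda>i _. h i)) \<and> (\<forall>i\<le>m. i \<noteq> j \<longrightarrow> h i = 0)"
proof (induction j)
  case 0
  show ?case using assms by (intro exI[of _ "\<lambda>i. if i = 0 then 1 else 0"]) simp
next
  case (Suc j)
  then obtain h where h: "eq_uhp (raising_iter k j f) (vv m (\<lambda>i _. h i))" "\<forall>i\<le>m. i \<noteq> j \<longrightarrow> h i = 0"
    by (elim exE conjE)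
  have "eq_uhp (raising (k + 2 * int j) (vv m (\<lambda>i _. h i))) (vv m (\<lambda>i _. - (if 0 < i then of_nat (m - i + 1) * h (i - 1) else 0)))"
    by (rule raising_const) (use h(2) k in auto)
  then have "eq_uhp (raising_iter k (Suc j) f) (vv m (\<lambda>i _. - (if 0 < i then of_nat (m - i + 1) * h (i - 1) else 0)))"
    unfolding raising_iter.simps(2) by (rule eq_uhp_trans[OF operator_cong(2)[OF h(1)]])
  then show ?case using h(2)
    by (intro exI[of _ "\<lambda>i. - (if 0 < i then of_nat (m - i + 1) * h (i - 1) else 0)"] conjI) auto
qed

lemma vanishes_laplace: "vanishes n (raising (k - 2) (lowering k f)) \<Longrightarrow> vanishes n (laplace k f)"
  by (simp add: vanishes_def laplace_def)

text \<open>The top is A^m = (\<tau> - w)^m. It is holomorphic of degree m in \<tau>, and R^(m+1) in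
  weight - m annihilates it, as Bol's identity predicts. The theta kernel presents it as an
  Eisenstein-type series, so that Laplace preimages can be taken; for \<kappa> = 0 the rate \<alpha>
  = 2 is just enough.\<close>

lemma realization_theta_constant:
  assumes k: "k = - int m"
  shows "\<exists>f. modular_data (carrier SL2Z) (m + 1) (sym_rep m) k d f \<and> vanishes (m + 1) (lowering k (laplace_iter k d f))
    \<and> vanishes (m + 1) (raising_iter k (Suc m) (laplace_iter k d f))"
proof -
  define t where "t i = (if i = 0 then theta_kernel else (\<lambda>x. 0))" for i :: nat
  have k0: "k = 0 - int m" and \<kappa>: "4 \<le> real_of_int 0 + 2 * (2 :: real)" using k by simp_all
  have t: "decaying_seq 2 t"
    unfolding decaying_seq_def t_def using decaying_theta_kernel[of 2 0] decaying_zero[of 2] by simp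
  have T: "eq_uhp (eis_vec 0 m 0 t) (vv m (\<lambda>i _. if i = 0 then 1 else 0))"
    unfolding eq_uhp_def eis_vec_def vv_def upper_half_plane_def
    by (intro ballI sym_vec_cong) (use eis_theta_kernel eis_zero[OF \<kappa>] in \<open>auto simp: t_def\<close>)
  have L: "vanishes (m + 1) (lowering k (eis_vec 0 m 0 t))"
    using vanishes_cong[OF eq_uhp_trans[OF operator_cong(1)[OF T] lowering_const]] vanishes_const by simp
  have "vv m (\<lambda>i _. if i = 0 then 1 else 0) \<i> \<noteq> 0\<^sub>v (m + 1)"
    unfolding vv_def by (subst sym_vec_zero_iff) auto
  then have nz: "\<not> vanishes (m + 1) (laplace_iter k 0 (eis_vec 0 m 0 t))"
    unfolding funpow.simps(1) id_apply vanishes_cong[OF T] by (auto simp: vanishes_def upper_half_plane_def)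
  have z: "vanishes (m + 1) (laplace k (laplace_iter k 0 (eis_vec 0 m 0 t)))"
    unfolding funpow.simps(1) id_apply by (intro vanishes_laplace vanishes_operators(2) L)
  obtain f where f: "modular_data (carrier SL2Z) (m + 1) (sym_rep m) k (d + 0) f" "eq_uhp (laplace_iter k d f) (eis_vec 0 m 0 t)"
    using realization[OF \<kappa> k0 t nz z, of d] by (elim exE conjE)
  obtain h where h: "eq_uhp (raising_iter k (Suc m) (laplace_iter k d f)) (vv m (\<lambda>i _. h i))" "\<forall>i\<le>m. i \<noteq> Suc m \<longrightarrow> h i = 0"
    using raising_iter_const[OF eq_uhp_trans[OF f(2) T] k, of "Suc m"] by (elim exE conjE)
  have "vanishes (m + 1) (vv m (\<lambda>i _. h i))" by (rule vanishes_const) (use h(2) in simp)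
  then have "vanishes (m + 1) (raising_iter k (Suc m) (laplace_iter k d f))" unfolding vanishes_cong[OF h(1)] .
  moreover have "vanishes (m + 1) (lowering k (laplace_iter k d f))"
    using L unfolding vanishes_cong[OF operator_cong(1)[OF f(2)]] .
  ultimately show ?thesis using f(1) unfolding add_0_right by (intro exI[of _ f] conjI)
qed

text \<open>Here L f is B^m, which has weight m = k - 2 and is annihilated by raising in this
  weight. Further lowerings lead from B^m in m steps to a multiple of A^m and in one more step to 0,
  which makes m + 2 = k in total. After one lowering component m has parameter j = m + 1; this
  explains \<kappa> = 2 (m + 1) and the twist of the kernel.\<close>

lemma realization_theta_antiholomorphic:
  assumes k: "k = int m + 2"
  shows "\<exists>f. modular_data (carrier SL2Z) (m + 1) (sym_rep m) k d f \<and> \<not> vanishes (m + 1) (lowering k (laplace_iter k d f))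
    \<and> vanishes (m + 1) (lowering_iter k (Suc (Suc m)) (laplace_iter k d f))"
proof -
  define \<kappa> where "\<kappa> = 2 * (int m + 1)"
  define t where "t i = (if i = m then (\<lambda>x. exp (of_int (int m + 1) * x) * theta_kernel x) else (\<lambda>x. 0))" for i
  have k0: "k = \<kappa> - int m" and \<kappa>: "4 \<le> real_of_int \<kappa> + 2 * (2 :: real)" using k by (simp_all add: \<kappa>_def)
  have t: "decaying_seq 2 t"
    unfolding decaying_seq_def t_def using decaying_theta_kernel decaying_zero[of 2] by simp
  obtain \<chi> where \<chi>: "decaying_seq 2 \<chi>" "\<forall>i\<le>m. low m 0 \<chi> i = t i"
    using low_surj[OF t, of m 0] by (elim exE conjE)
  have "eq_uhp (eis_vec \<kappa> m 1 (low m 0 \<chi>)) (vv m (\<lambda>i _. if i = m then 1 else 0))"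
    unfolding eq_uhp_def eis_vec_def vv_def upper_half_plane_def
  proof (intro ballI sym_vec_cong)
    fix \<tau> i assume "\<tau> \<in> {\<tau>. 0 < Im \<tau>}" and i: "i \<le> m"
    then have y: "0 < Im \<tau>" by simp
    show "eis \<kappa> (int i + 1) (low m 0 \<chi> i) \<tau> = (if i = m then 1 else 0)"
      using eis_theta_kernel_twist[OF y, of "int m + 1"] eis_zero[OF \<kappa> y] \<chi>(2) i by (simp add: t_def \<kappa>_def)
  qed
  then have L: "eq_uhp (lowering k (eis_vec \<kappa> m 0 \<chi>)) (vv m (\<lambda>i _. if i = m then 1 else 0))"
    using lowering_eq[OF \<kappa> k0 \<chi>(1), of k 0] unfolding add_0 by (rule eq_uhp_trans[rotated])
  have "vv m (\<lambda>i _. if i = m then 1 else 0) \<i> \<noteq> 0\<^sub>v (m + 1)"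
    unfolding vv_def by (subst sym_vec_zero_iff) auto
  then have nzL: "\<not> vanishes (m + 1) (lowering k (eis_vec \<kappa> m 0 \<chi>))"
    unfolding vanishes_cong[OF L] by (auto simp: vanishes_def upper_half_plane_def)
  then have nz: "\<not> vanishes (m + 1) (laplace_iter k 0 (eis_vec \<kappa> m 0 \<chi>))"
    unfolding funpow.simps(1) id_apply using vanishes_operators(1) by blast
  have rr: "eq_uhp (raising (k - 2) (vv m (\<lambda>i _. if i = m then 1 else 0))) (vv m (\<lambda>i _. - (if 0 < i then of_nat (m - i + 1) * (if i - 1 = m then 1 else 0) else 0)))"
    by (rule raising_const) (use k in auto)
  have "vanishes (m + 1) (raising (k - 2) (lowering k (eis_vec \<kappa> m 0 \<chi>)))"
    unfolding vanishes_cong[OF eq_uhp_trans[OF operator_cong(2)[OF L] rr]] by (rule vanishes_const) auto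
  then have z: "vanishes (m + 1) (laplace k (laplace_iter k 0 (eis_vec \<kappa> m 0 \<chi>)))"
    unfolding funpow.simps(1) id_apply by (rule vanishes_laplace)
  obtain f where f: "modular_data (carrier SL2Z) (m + 1) (sym_rep m) k (d + 0) f" "eq_uhp (laplace_iter k d f) (eis_vec \<kappa> m 0 \<chi>)"
    using realization[OF \<kappa> k0 \<chi>(1) nz z, of d] by (elim exE conjE)
  have e: "eq_uhp (lowering k (laplace_iter k d f)) (lowering k (eis_vec \<kappa> m 0 \<chi>))" by (rule operator_cong(1)[OF f(2)])
  obtain h where h: "eq_uhp (lowering_iter k (Suc (Suc m)) (laplace_iter k d f)) (vv m (\<lambda>i _. h i))" "\<forall>i\<le>m. m < i + Suc m \<longrightarrow> h i = 0"
    using lowering_iter_const[OF eq_uhp_trans[OF e L], of "Suc m"] by (elim exE conjE)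
  have "vanishes (m + 1) (vv m (\<lambda>i _. h i))" by (rule vanishes_const) (use h(2) in simp)
  then have "vanishes (m + 1) (lowering_iter k (Suc (Suc m)) (laplace_iter k d f))" unfolding vanishes_cong[OF h(1)] .
  moreover have "\<not> vanishes (m + 1) (lowering k (laplace_iter k d f))" using nzL unfolding vanishes_cong[OF e] .
  ultimately show ?thesis using f(1) unfolding add_0_right by (intro exI[of _ f] conjI)
qed

section \<open>Binomial coefficient sequences for the remaining cases\<close>

text \<open>From j = M on both sides vanish. In this form the identity is the two-term recursion by
  which alternating binomial coefficients are annihilated by \<open>crai\<close> and
  \<open>clow\<close>.\<close>

lemma binomial_step: "(real j + 1) * real (M choose Suc j) = (real M - real j) * real (M choose j)"
proof (cases "j < M")
  case True
  then obtain b where M: "M = Suc (j + b)" using less_iff_Suc_add by blast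
  have "Suc j * (M choose Suc j) = Suc b * (M choose j)" unfolding M by (rule Suc_times_binomial_add)
  then have "real (Suc j) * real (M choose Suc j) = real (Suc b) * real (M choose j)" by (metis of_nat_mult)
  moreover have "real (Suc j) = real j + 1" "real (Suc b) = real M - real j" by (simp_all add: M)
  ultimately show ?thesis by (simp only:)
next
  case False
  then show ?thesis by (cases "j = M") (simp_all add: binomial_eq_0)
qed

definition delta :: "nat \<Rightarrow> nat \<Rightarrow> real" where
  "delta a i = (if i = a then 1 else 0)"

lemma clow_delta_0: "clow m 0 0 (delta 0) = (\<lambda>_. 0)"
  by (intro ext) (simp add: clow_def delta_def)

text \<open>For n = 0 the sequence \<open>delta 0\<close> stands for A^m times the sum of
  l^(-\<kappa>), the holomorphic Eisenstein series of weight \<kappa>. It is annihilated by lowering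
  and hence harmonic.\<close>

lemma realization_delta:
  assumes "4 \<le> \<kappa>" "even \<kappa>" "k = \<kappa> - int m"
  shows "\<exists>f. modular_data (carrier SL2Z) (m + 1) (sym_rep m) k d f \<and> vanishes (m + 1) (lowering k (laplace_iter k d f))
    \<and> (\<forall>j. vanishes (m + 1) (raising_iter k j (laplace_iter k d f)) \<longleftrightarrow> (\<forall>i\<le>m. crais \<kappa> m 0 j (delta 0) i = 0))"
proof -
  have "\<exists>i\<le>m. delta 0 i \<noteq> 0" by (auto simp: delta_def)
  moreover have "crai \<kappa> m 0 1 (clow m 0 0 (delta 0)) i = 0" for i unfolding clow_delta_0 by (simp add: crai_def)
  ultimately show ?thesis
    using realization_coefficients[of \<kappa> 0 k m "delta 0" d] assms unfolding clow_delta_0 by simp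
qed

text \<open>Nothing is shifted into index 0, where the raising with number j only multiplies by
  \<kappa> + j.\<close>

lemma crais_0_pos: "0 < c 0 \<Longrightarrow> 0 < \<kappa> \<Longrightarrow> 0 < crais \<kappa> m 0 j c 0"
  by (induction j) (simp_all add: crai_def)

text \<open>The lower end of the support moves up with every raising: at the index i = \<kappa> + j
  that would remain occupied, the factor \<kappa> - i + j is 0.\<close>

lemma crais_support:
  assumes "\<And>i. int i < \<kappa> \<Longrightarrow> c i = 0" "int i < \<kappa> + int j"
  shows "crais \<kappa> m 0 j c i = 0"
  using assms(2)
proof (induction j arbitrary: i)
  case 0
  then show ?case using assms(1) by simp
next
  case (Suc j)
  have "crais \<kappa> m 0 j c (i - 1) = 0" if "0 < i" using that Suc.prems by (intro Suc.IH) auto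
  moreover have "of_int (\<kappa> - int i - (- int j) - 0) * crais \<kappa> m 0 j c i = 0"
  proof (cases "int i < \<kappa> + int j")
    case True
    then show ?thesis using Suc.IH by simp
  next
    case False
    then have "\<kappa> - int i - (- int j) - 0 = 0" using Suc.prems by simp
    then show ?thesis by (simp only: of_int_0 mult_zero_left)
  qed
  ultimately show ?case unfolding crais.simps crai_def by (cases "i = 0") auto
qed

text \<open>The sequence is found backwards. Raising annihilates the lowered form if that has
  coefficients (-1)^i (N + 1 choose i - 3), and by Pascal's rule these arise by lowering from i c_i
  = (-1)^i (N choose i - 4). The support starts at 4 = \<kappa>, so that repeated raising pushes it
  out of range. The value u at index 0 adds a multiple of the holomorphic Eisenstein series, which
  lowering does not see but raising does.\<close>

definition alt_coeff :: "nat \<Rightarrow> real \<Rightarrow> nat \<Rightarrow> real" where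
  "alt_coeff N u i = (if i = 0 then u else if i < 4 then 0 else (- 1) ^ i * real (N choose (i - 4)) / real i)"

lemma clow_alt_coeff:
  assumes "i \<le> N + 4"
  shows "clow (N + 4) 0 0 (alt_coeff N u) i = (if i < 3 then 0 else (- 1) ^ i * real (Suc N choose (i - 3)))"
proof -
  have d: "real i * alt_coeff N u i = (if i < 4 then 0 else (- 1) ^ i * real (N choose (i - 4)))" for i
    by (simp add: alt_coeff_def)
  \<comment> \<open>The shift term that \<open>clow\<close> cuts off at the last index is 0 in any
    case, since N choose N + 1 vanishes.\<close>
  have "real (Suc i) * alt_coeff N u (Suc i) = 0" if "\<not> i < N + 4"
    unfolding d using that by (simp add: binomial_eq_0)
  then have "clow (N + 4) 0 0 (alt_coeff N u) i = real i * alt_coeff N u i - real (Suc i) * alt_coeff N u (Suc i)"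
    unfolding clow_def by auto
  also have "\<dots> = (if i < 3 then 0 else (- 1) ^ i * real (Suc N choose (i - 3)))"
  proof (cases "i < 4")
    case True
    then show ?thesis unfolding d by (cases "i < 3") (auto simp: not_less less_Suc_eq numeral_eq_Suc)
  next
    case False
    then obtain j where i: "i = j + 4" by (metis add.commute le_add_diff_inverse not_less)
    have "i - 4 = j" "Suc i - 4 = Suc j" "i - 3 = Suc j" using i by simp_all
    then show ?thesis unfolding d using False by (simp add: algebra_simps)
  qed
  finally show ?thesis .
qed

text \<open>The factor 4 - i - 1 vanishes at i = 3, where the support of the lowered sequence
  begins; above that index the recursion is \<open>binomial_step\<close> for N + 1.\<close>

lemma crai_clow_alt_coeff:
  assumes i: "i \<le> N + 4"
  shows "crai 4 (N + 4) 0 1 (clow (N + 4) 0 0 (alt_coeff N u)) i = 0"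
proof (cases "i < 4")
  case True
  then show ?thesis
    unfolding crai_def using clow_alt_coeff[OF i, of u] clow_alt_coeff[of "i - 1" N u] i
    by (cases "i < 3") (auto simp: not_less less_Suc_eq numeral_eq_Suc)
next
  case False
  then obtain j where j: "i = j + 4" by (metis add.commute le_add_diff_inverse not_less)
  have jN: "j \<le> N" using i j by simp
  have 1: "clow (N + 4) 0 0 (alt_coeff N u) i = (- 1) ^ j * real (Suc N choose Suc j)"
    using clow_alt_coeff[of "j + 4" N u] jN unfolding j by (simp add: power_add)
  have 2: "clow (N + 4) 0 0 (alt_coeff N u) (i - 1) = - ((- 1) ^ j * real (Suc N choose j))"
  proof -
    have "i - 1 = j + 3" using j by simp
    then show ?thesis using clow_alt_coeff[of "j + 3" N u] jN by (simp add: power_add)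
  qed
  have 3: "real (N + 4 - i + 1) = real (Suc N) - real j" using jN j by (simp add: of_nat_diff)
  have "crai 4 (N + 4) 0 1 (clow (N + 4) 0 0 (alt_coeff N u)) i
    = (- 1) ^ j * ((real (Suc N) - real j) * real (Suc N choose j) - (real j + 1) * real (Suc N choose Suc j))"
    unfolding crai_def 1 2 3 using j by (simp add: algebra_simps)
  then show ?thesis using binomial_step[of j "Suc N"] by simp
qed

lemma realization_alt_coeff:
  assumes k: "k = - int N"
  shows "\<exists>f. modular_data (carrier SL2Z) (N + 4 + 1) (sym_rep (N + 4)) k d f \<and> \<not> vanishes (N + 4 + 1) (lowering k (laplace_iter k d f))
    \<and> (\<forall>j. vanishes (N + 4 + 1) (raising_iter k j (laplace_iter k d f)) \<longleftrightarrow> (\<forall>i\<le>N + 4. crais 4 (N + 4) 0 j (alt_coeff N u) i = 0))"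
proof -
  have "alt_coeff N u 4 \<noteq> 0" by (simp add: alt_coeff_def)
  then have nz: "\<exists>i\<le>N + 4. alt_coeff N u i \<noteq> 0" by (intro exI[of _ 4]) simp
  have "clow (N + 4) 0 0 (alt_coeff N u) 3 \<noteq> 0" by (subst clow_alt_coeff) simp_all
  then have "\<not> (\<forall>i\<le>N + 4. clow (N + 4) 0 0 (alt_coeff N u) i = 0)" by (intro notI, elim allE[of _ 3]) simp
  with realization_coefficients[of 4 0 k "N + 4" "alt_coeff N u" d, OF _ _ _ nz crai_clow_alt_coeff] k
  show ?thesis by simp
qed

text \<open>Nothing is shifted into index m from above, and there lowering multiplies by m + 1 + j -
  n > 0.\<close>

lemma clows_last_pos: "0 < c m \<Longrightarrow> n \<le> int m \<Longrightarrow> 0 < clows m n j c m"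
  by (induction j) (simp_all add: clow_def)

text \<open>The upper end of the support moves down with every lowering, since the factor i + 1 + j
  - n vanishes at the index i = n - 1 - j that would otherwise remain occupied.\<close>

lemma clows_support:
  assumes "\<And>i. n \<le> int i \<Longrightarrow> c i = 0" "n \<le> int i + int j"
  shows "clows m n j c i = 0"
  using assms(2)
proof (induction j arbitrary: i)
  case 0
  then show ?case using assms(1) by simp
next
  case (Suc j)
  have "clows m n j c (Suc i) = 0" using Suc.prems by (intro Suc.IH) simp
  moreover have "of_int (int i + (1 + int j) - n) * clows m n j c i = 0"
  proof (cases "n \<le> int i + int j")
    case True
    then show ?thesis using Suc.IH by simp
  next
    case False
    then have "int i + (1 + int j) - n = 0" using Suc.prems by simp
    then show ?thesis by (simp only: of_int_0 mult_zero_left)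
  qed
  ultimately show ?case unfolding clows.simps clow_def by simp
qed

text \<open>The lowered form is y^4 B^m times the complex conjugate of the sum of l^(-4): for j = m
  + 1 the exponent j + n - \<kappa> of l is 0, and n - j = -4. Raising annihilates it, so f is
  harmonic, while its single component at index m survives all lowerings. The choice \<kappa> = 2K +
  4, n = K keeps \<kappa> - 2n = 4.\<close>

lemma realization_lowering_delta:
  assumes k: "k = int K + 1"
  shows "\<exists>f. modular_data (carrier SL2Z) (K + 3 + 1) (sym_rep (K + 3)) k d f
    \<and> (\<forall>j. \<not> vanishes (K + 3 + 1) (lowering_iter k (Suc j) (laplace_iter k d f)))"
proof -
  define m where "m = K + 3"
  have z: "crai (2 * int K + 4) m (int K) 1 (delta m) i = 0" if "i \<le> m" for i
    using that by (auto simp: crai_def delta_def m_def)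
  have "0 < clows m (int K) j (delta m) m" for j by (rule clows_last_pos) (simp_all add: delta_def m_def)
  then have nz: "\<not> (\<forall>i\<le>m. clows m (int K) j (delta m) i = 0)" for j by (metis less_irrefl order_refl)
  have nz0: "\<exists>i\<le>m. delta m i \<noteq> 0" by (intro exI[of _ m]) (simp add: delta_def)
  have "k = 2 * int K + 4 - int m" using k by (simp add: m_def)
  from realization_lowering[of "2 * int K + 4" "int K" k m "delta m" d, OF _ _ this nz0 z] nz
  show ?thesis unfolding m_def[symmetric] by simp
qed

text \<open>Up to sign the Laplace image at the last level is to be A^m times the holomorphic
  Eisenstein series of weight 2m, so e has to solve \<open>crai\<close> e = \<open>delta 0\<close>.
  Solving upwards from index 0 yields the quotients below, with denominators 2m - 1 - i that are
  positive for i \<le> m because m \<ge> 2. So e m is positive and survives all lowerings.\<close>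

lemma realization_Suc_lower:
  assumes k: "k = int m" and m: "2 \<le> m"
  shows "\<exists>f. modular_data (carrier SL2Z) (m + 1) (sym_rep m) k (Suc d) f \<and> vanishes (m + 1) (lowering k (laplace_iter k (Suc d) f))
    \<and> (\<forall>j. \<not> vanishes (m + 1) (lowering_iter k (Suc j) (laplace_iter k d f)))"
proof -
  define e where "e i = (\<Prod>l<i. real m - real l) / (\<Prod>l\<le>i. 2 * real m - 1 - real l)" for i
  have pos: "0 < 2 * real m - 1 - real l" if "l \<le> m" for l using that m by linarith
  have E: "crai (2 * int m) m 0 1 e i = delta 0 i" if i: "i \<le> m" for i
  proof (cases i)
    case 0
    then show ?thesis using pos[of 0] by (simp add: crai_def e_def delta_def)
  next
    case (Suc l)
    have p: "2 * real m - 1 - real (Suc l) \<noteq> 0" using pos[of "Suc l"] i Suc by simp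
    have "q * (A * r / (D * q)) = r * (A / D)" if "q \<noteq> 0" for q A r D :: real
      using that by (cases "D = 0") (simp_all add: field_simps)
    from this[OF p] have "(2 * real m - 1 - real (Suc l)) * e (Suc l) = (real m - real l) * e l"
      unfolding e_def prod.lessThan_Suc prod.atMost_Suc .
    moreover have "real (m - i + 1) = real m - real l" using i Suc by (simp add: of_nat_diff)
    ultimately show ?thesis using Suc by (simp add: crai_def delta_def algebra_simps)
  qed
  have nz: "\<exists>i\<le>m. crai (2 * int m) m 0 1 e i \<noteq> 0" using E[of 0] by (intro exI[of _ 0]) (simp add: delta_def)
  have z: "clow m 0 0 (crai (2 * int m) m 0 1 e) i = 0" if "i \<le> m" for i
    unfolding clow_def using E[OF that] E[of "Suc i"] by (simp add: delta_def)
  have "0 < e m"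
    unfolding e_def using pos by (intro divide_pos_pos prod_pos) auto
  then have "0 < clows m 0 j e m" for j by (intro clows_last_pos) simp_all
  then have c: "\<not> (\<forall>i\<le>m. clows m 0 j e i = 0)" for j by (metis less_irrefl order_refl)
  have zz: "\<forall>i\<le>m. clow m 0 0 (crai (2 * int m) m 0 1 e) i = 0" using z by blast
  have \<kappa>: "4 \<le> 2 * int m - 2 * 0" "even (2 * int m)" "k = 2 * int m - int m" using k m by simp_all
  obtain f where f: "modular_data (carrier SL2Z) (m + 1) (sym_rep m) k (Suc d) f" "vanishes (m + 1) (lowering k (laplace_iter k (Suc d) f))"
    "\<forall>j. vanishes (m + 1) (lowering_iter k (Suc j) (laplace_iter k d f)) \<longleftrightarrow> (\<forall>i\<le>m. clows m 0 j e i = 0)"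
    using realization_Suc[OF \<kappa> nz zz, of d] by (elim exE conjE)
  have "\<not> vanishes (m + 1) (lowering_iter k (Suc j) (laplace_iter k d f))" for j
    unfolding spec[OF f(3), of j] by (rule c)
  with f(1,2) show ?thesis by (intro exI[of _ f] conjI allI)
qed

text \<open>Two requirements have to be reconciled: e is supported below n, so that n + 1 = k
  lowerings kill the form, while \<open>crai\<close> e is nonzero and annihilated by lowering. With
  these parameters the factor of \<open>crai\<close> at i is m - i. Dividing by it, with alternating
  signs, turns P choose i into P + 1 choose i by Pascal's rule, and the latter is annihilated by
  \<open>clow\<close> as n = P + 1.\<close>

lemma realization_Suc_truncated:
  assumes k: "k = int P + 2"
  shows "\<exists>f. modular_data (carrier SL2Z) (P + 4 + 1) (sym_rep (P + 4)) k (Suc d) f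
    \<and> vanishes (P + 4 + 1) (lowering_iter k (Suc (P + 1)) (laplace_iter k d f))"
proof -
  define m \<kappa> n where "m = P + 4" and "\<kappa> = 2 * int P + 6" and "n = int P + 1"
  define e where "e i = (- 1) ^ i * real (P choose i) / (real m - real i)" for i
  \<comment> \<open>At i = m the quotient is 0 by the convention for division by zero, in accordance
    with P choose m = 0 for P < m.\<close>
  have E: "(real m - real i) * e i = (- 1) ^ i * real (P choose i)" for i
    by (cases "i = m") (simp_all add: e_def m_def binomial_eq_0)
  have G: "crai \<kappa> m n 1 e i = (- 1) ^ i * real (Suc P choose i)" if i: "i \<le> m" for i
  proof -
    have c: "real_of_int (\<kappa> - int i - 1 - n) = real m - real i" by (simp add: \<kappa>_def n_def m_def)
    show ?thesis
    proof (cases i)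
      case 0
      then show ?thesis unfolding crai_def c E by simp
    next
      case (Suc l)
      have "real (m - i + 1) = real m - real l" using i Suc by (simp add: of_nat_diff)
      then show ?thesis unfolding crai_def c E using Suc E[of l] by (simp add: algebra_simps)
    qed
  qed
  have z: "clow m n 0 (crai \<kappa> m n 1 e) i = 0" if i: "i \<le> m" for i
  proof (cases "i = m")
    case True
    then show ?thesis unfolding clow_def G[OF i] by (simp add: m_def binomial_eq_0)
  next
    case False
    then have im: "i < m" "Suc i \<le> m" using i by simp_all
    have "clow m n 0 (crai \<kappa> m n 1 e) i = (- 1) ^ i * ((real i + 1) * real (Suc P choose Suc i) - (real (Suc P) - real i) * real (Suc P choose i))"
      unfolding clow_def G[OF i] G[OF im(2)] using im(1) by (simp add: n_def algebra_simps)
    then show ?thesis using binomial_step[of i "Suc P"] by simp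
  qed
  have nz: "\<exists>i\<le>m. crai \<kappa> m n 1 e i \<noteq> 0" using G[of 0] by (intro exI[of _ 0]) simp
  have s: "clows m n (P + 1) e i = 0" for i
    by (rule clows_support) (simp_all add: e_def n_def binomial_eq_0)
  have zz: "\<forall>i\<le>m. clow m n 0 (crai \<kappa> m n 1 e) i = 0" using z by blast
  have \<kappa>: "4 \<le> \<kappa> - 2 * n" "even \<kappa>" "k = \<kappa> - int m" using k by (simp_all add: \<kappa>_def m_def n_def)
  obtain f where f: "modular_data (carrier SL2Z) (m + 1) (sym_rep m) k (Suc d) f"
    "\<forall>j. vanishes (m + 1) (lowering_iter k (Suc j) (laplace_iter k d f)) \<longleftrightarrow> (\<forall>i\<le>m. clows m n j e i = 0)"
    using realization_Suc[OF \<kappa> nz zz, of d] by (elim exE conjE)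
  have "vanishes (m + 1) (lowering_iter k (Suc (P + 1)) (laplace_iter k d f))"
    unfolding spec[OF f(2), of "P + 1"] using s by blast
  with f(1) show ?thesis unfolding m_def[symmetric] by (intro exI[of _ f] conjI)
qed

theorem theoremC:
  fixes k :: int and d :: nat
  shows
    "(k < 1 \<longrightarrow>
       (\<exists>\<Gamma> n \<rho> f. modular_data \<Gamma> n \<rho> k d f \<and>
          vanishes n (lowering k (laplace_iter k d f)) \<and>
          vanishes n (raising_iter k (nat (1 - k)) (laplace_iter k d f))) \<and>
       (\<exists>\<Gamma> n \<rho> f. modular_data \<Gamma> n \<rho> k d f \<and>
          vanishes n (lowering k (laplace_iter k d f)) \<and>
          \<not> vanishes n (raising_iter k (nat (1 - k)) (laplace_iter k d f))) \<and>
       (\<exists>\<Gamma> n \<rho> f. modular_data \<Gamma> n \<rho> k d f \<and>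
          \<not> vanishes n (lowering k (laplace_iter k d f)) \<and>
          vanishes n (raising_iter k (nat (1 - k)) (laplace_iter k d f))) \<and>
       (\<exists>\<Gamma> n \<rho> f. modular_data \<Gamma> n \<rho> k d f \<and>
          \<not> vanishes n (lowering k (laplace_iter k d f)) \<and>
          \<not> vanishes n (raising_iter k (nat (1 - k)) (laplace_iter k d f)))) \<and>
     (k = 1 \<longrightarrow>
       (\<exists>\<Gamma> n \<rho> f. modular_data \<Gamma> n \<rho> k d f \<and>
          vanishes n (lowering k (laplace_iter k d f))) \<and>
       (\<exists>\<Gamma> n \<rho> f. modular_data \<Gamma> n \<rho> k d f \<and>
          \<not> vanishes n (lowering k (laplace_iter k d f)))) \<and>
     (k > 1 \<longrightarrow>
       (\<exists>\<Gamma> n \<rho> f. modular_data \<Gamma> n \<rho> k d f \<and>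
          vanishes n (lowering k (laplace_iter k d f)) \<and>
          (d \<ge> 1 \<longrightarrow> \<not> vanishes n (lowering_iter k (nat k) (laplace_iter k (d - 1) f)))) \<and>
       (\<exists>\<Gamma> n \<rho> f. modular_data \<Gamma> n \<rho> k d f \<and>
          \<not> vanishes n (lowering k (laplace_iter k d f)) \<and>
          vanishes n (lowering_iter k (nat k) (laplace_iter k d f))) \<and>
       (\<exists>\<Gamma> n \<rho> f. modular_data \<Gamma> n \<rho> k d f \<and>
          \<not> vanishes n (lowering_iter k (nat k) (laplace_iter k d f))) \<and>
       (d \<ge> 1 \<longrightarrow> (\<exists>\<Gamma> n \<rho> f. modular_data \<Gamma> n \<rho> k d f \<and>
          vanishes n (lowering_iter k (nat k) (laplace_iter k (d - 1) f)))))"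
proof (intro conjI impI)
  assume "k < 1"
  define N where "N = nat (- k)"
  have k: "k = - int N" and s: "nat (1 - k) = Suc N" using \<open>k < 1\<close> by (simp_all add: N_def)
  obtain f where f: "modular_data (carrier SL2Z) (N + 1) (sym_rep N) k d f"
    "vanishes (N + 1) (lowering k (laplace_iter k d f))" "vanishes (N + 1) (raising_iter k (nat (1 - k)) (laplace_iter k d f))"
    using realization_theta_constant[OF k, of d] unfolding s by (elim exE conjE)
  show "\<exists>\<Gamma> n \<rho> f. modular_data \<Gamma> n \<rho> k d f \<and> vanishes n (lowering k (laplace_iter k d f)) \<and>
      vanishes n (raising_iter k (nat (1 - k)) (laplace_iter k d f))"
    by (rule exI[of _ "carrier SL2Z"], rule exI[of _ "N + 1"], rule exI[of _ "sym_rep N"], rule exI[of _ f], intro conjI f)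
next
  assume "k < 1"
  define N where "N = nat (- k)"
  have k: "k = 4 - int (N + 4)" using \<open>k < 1\<close> by (simp add: N_def)
  obtain f where f: "modular_data (carrier SL2Z) (N + 4 + 1) (sym_rep (N + 4)) k d f" "vanishes (N + 4 + 1) (lowering k (laplace_iter k d f))"
    "\<forall>j. vanishes (N + 4 + 1) (raising_iter k j (laplace_iter k d f)) \<longleftrightarrow> (\<forall>i\<le>N + 4. crais 4 (N + 4) 0 j (delta 0) i = 0)"
    using realization_delta[of 4 k "N + 4" d, OF _ _ k] by (auto simp only: even_numeral order_refl simp_thms)
  \<comment> \<open>The entry at index 0 stays positive under any number of raisings, in particular
    under 1 - k of them.\<close>
  have "0 < crais 4 (N + 4) 0 j (delta 0) 0" for j by (rule crais_0_pos) (simp_all add: delta_def)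
  then have "crais 4 (N + 4) 0 j (delta 0) 0 \<noteq> 0" for j by (metis less_irrefl)
  then have "\<not> vanishes (N + 4 + 1) (raising_iter k (nat (1 - k)) (laplace_iter k d f))"
    using f(3) by blast
  with f(1,2) show "\<exists>\<Gamma> n \<rho> f. modular_data \<Gamma> n \<rho> k d f \<and> vanishes n (lowering k (laplace_iter k d f)) \<and>
      \<not> vanishes n (raising_iter k (nat (1 - k)) (laplace_iter k d f))"
    by (rule_tac exI[of _ "carrier SL2Z"], rule_tac exI[of _ "N + 4 + 1"], rule_tac exI[of _ "sym_rep (N + 4)"], rule_tac exI[of _ f], intro conjI)
next
  assume "k < 1"
  define N where "N = nat (- k)"
  have k: "k = - int N" and s: "nat (1 - k) = Suc N" using \<open>k < 1\<close> by (simp_all add: N_def)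
  obtain f where f: "modular_data (carrier SL2Z) (N + 4 + 1) (sym_rep (N + 4)) k d f" "\<not> vanishes (N + 4 + 1) (lowering k (laplace_iter k d f))"
    "\<forall>j. vanishes (N + 4 + 1) (raising_iter k j (laplace_iter k d f)) \<longleftrightarrow> (\<forall>i\<le>N + 4. crais 4 (N + 4) 0 j (alt_coeff N 0) i = 0)"
    using realization_alt_coeff[OF k, of d 0] by (elim exE conjE)
  \<comment> \<open>With u = 0 the support begins at 4; after N + 1 raisings it could begin only at
    N + 5, beyond the last index N + 4.\<close>
  have "crais 4 (N + 4) 0 (Suc N) (alt_coeff N 0) i = 0" if "i \<le> N + 4" for i
    by (rule crais_support) (use that in \<open>simp_all add: alt_coeff_def\<close>)
  then have "vanishes (N + 4 + 1) (raising_iter k (nat (1 - k)) (laplace_iter k d f))"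
    unfolding s using f(3) by blast
  with f(1,2) show "\<exists>\<Gamma> n \<rho> f. modular_data \<Gamma> n \<rho> k d f \<and> \<not> vanishes n (lowering k (laplace_iter k d f)) \<and>
      vanishes n (raising_iter k (nat (1 - k)) (laplace_iter k d f))"
    by (rule_tac exI[of _ "carrier SL2Z"], rule_tac exI[of _ "N + 4 + 1"], rule_tac exI[of _ "sym_rep (N + 4)"], rule_tac exI[of _ f], intro conjI)
next
  assume "k < 1"
  define N where "N = nat (- k)"
  have k: "k = - int N" using \<open>k < 1\<close> by (simp add: N_def)
  obtain f where f: "modular_data (carrier SL2Z) (N + 4 + 1) (sym_rep (N + 4)) k d f" "\<not> vanishes (N + 4 + 1) (lowering k (laplace_iter k d f))"
    "\<forall>j. vanishes (N + 4 + 1) (raising_iter k j (laplace_iter k d f)) \<longleftrightarrow> (\<forall>i\<le>N + 4. crais 4 (N + 4) 0 j (alt_coeff N 1) i = 0)"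
    using realization_alt_coeff[OF k, of d 1] by (elim exE conjE)
  \<comment> \<open>The added entry u = 1 at index 0 survives all raisings, while the lowered form
    remains as for u = 0.\<close>
  have "0 < crais 4 (N + 4) 0 j (alt_coeff N 1) 0" for j by (rule crais_0_pos) (simp_all add: alt_coeff_def)
  then have "crais 4 (N + 4) 0 j (alt_coeff N 1) 0 \<noteq> 0" for j by (metis less_irrefl)
  then have "\<not> vanishes (N + 4 + 1) (raising_iter k (nat (1 - k)) (laplace_iter k d f))"
    using f(3) by blast
  with f(1,2) show "\<exists>\<Gamma> n \<rho> f. modular_data \<Gamma> n \<rho> k d f \<and> \<not> vanishes n (lowering k (laplace_iter k d f)) \<and>
      \<not> vanishes n (raising_iter k (nat (1 - k)) (laplace_iter k d f))"
    by (rule_tac exI[of _ "carrier SL2Z"], rule_tac exI[of _ "N + 4 + 1"], rule_tac exI[of _ "sym_rep (N + 4)"], rule_tac exI[of _ f], intro conjI)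
next
  assume "k = 1"
  then have k: "k = 4 - int 3" by simp
  obtain f where f: "modular_data (carrier SL2Z) (3 + 1) (sym_rep 3) k d f" "vanishes (3 + 1) (lowering k (laplace_iter k d f))"
    using realization_delta[of 4 k 3 d, OF _ _ k] by (auto simp only: even_numeral order_refl simp_thms)
  show "\<exists>\<Gamma> n \<rho> f. modular_data \<Gamma> n \<rho> k d f \<and> vanishes n (lowering k (laplace_iter k d f))"
    by (rule exI[of _ "carrier SL2Z"], rule exI[of _ "3 + 1"], rule exI[of _ "sym_rep 3"], rule exI[of _ f], intro conjI f)
next
  assume "k = 1"
  then have k: "k = int 0 + 1" by simp
  obtain f where f: "modular_data (carrier SL2Z) (0 + 3 + 1) (sym_rep (0 + 3)) k d f"
    "\<forall>j. \<not> vanishes (0 + 3 + 1) (lowering_iter k (Suc j) (laplace_iter k d f))"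
    using realization_lowering_delta[OF k, of d] by (elim exE conjE)
  have "lowering_iter k (Suc 0) (laplace_iter k d f) = lowering k (laplace_iter k d f)" by simp
  with spec[OF f(2), of 0] have "\<not> vanishes (0 + 3 + 1) (lowering k (laplace_iter k d f))" by (simp only: not_False_eq_True)
  with f(1) show "\<exists>\<Gamma> n \<rho> f. modular_data \<Gamma> n \<rho> k d f \<and> \<not> vanishes n (lowering k (laplace_iter k d f))"
    by (rule_tac exI[of _ "carrier SL2Z"], rule_tac exI[of _ "0 + 3 + 1"], rule_tac exI[of _ "sym_rep (0 + 3)"], rule_tac exI[of _ f], intro conjI)
next
  assume "1 < k"
  define m where "m = nat k"
  have k: "k = int m" "2 \<le> m" using \<open>1 < k\<close> by (simp_all add: m_def)
  have nk: "nat k = Suc (m - 1)" using k(2) by (simp add: m_def)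
  have "\<exists>f. modular_data (carrier SL2Z) (m + 1) (sym_rep m) k d f \<and> vanishes (m + 1) (lowering k (laplace_iter k d f)) \<and>
      (d \<ge> 1 \<longrightarrow> \<not> vanishes (m + 1) (lowering_iter k (nat k) (laplace_iter k (d - 1) f)))"
  proof (cases d)
    case 0
    \<comment> \<open>At depth 0 only the condition on lowering remains, and \<kappa> = 2k is even
      and at least 4 for every k \<ge> 2.\<close>
    have "4 \<le> 2 * k" "even (2 * k)" "k = 2 * k - int m" using k by simp_all
    from realization_delta[OF this, of d] show ?thesis unfolding 0 by auto
  next
    case (Suc d')
    show ?thesis
      using realization_Suc_lower[OF k, of d'] unfolding Suc diff_Suc_1 nk by (elim exE conjE) (intro exI conjI, auto)
  qed
  then show "\<exists>\<Gamma> n \<rho> f. modular_data \<Gamma> n \<rho> k d f \<and> vanishes n (lowering k (laplace_iter k d f)) \<and>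
      (d \<ge> 1 \<longrightarrow> \<not> vanishes n (lowering_iter k (nat k) (laplace_iter k (d - 1) f)))"
    by (rule_tac exI[of _ "carrier SL2Z"], rule_tac exI[of _ "m + 1"], rule_tac exI[of _ "sym_rep m"])
next
  assume "1 < k"
  define m where "m = nat (k - 2)"
  have k: "k = int m + 2" and s: "nat k = Suc (Suc m)" using \<open>1 < k\<close> by (simp_all add: m_def)
  show "\<exists>\<Gamma> n \<rho> f. modular_data \<Gamma> n \<rho> k d f \<and> \<not> vanishes n (lowering k (laplace_iter k d f)) \<and>
      vanishes n (lowering_iter k (nat k) (laplace_iter k d f))"
    unfolding s
    by (rule exI[of _ "carrier SL2Z"], rule exI[of _ "m + 1"], rule exI[of _ "sym_rep m"], rule realization_theta_antiholomorphic[OF k])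
next
  assume "1 < k"
  define K where "K = nat (k - 1)"
  have k: "k = int K + 1" and s: "nat k = Suc K" using \<open>1 < k\<close> by (simp_all add: K_def)
  obtain f where f: "modular_data (carrier SL2Z) (K + 3 + 1) (sym_rep (K + 3)) k d f"
    "\<forall>j. \<not> vanishes (K + 3 + 1) (lowering_iter k (Suc j) (laplace_iter k d f))"
    using realization_lowering_delta[OF k, of d] by (elim exE conjE)
  show "\<exists>\<Gamma> n \<rho> f. modular_data \<Gamma> n \<rho> k d f \<and> \<not> vanishes n (lowering_iter k (nat k) (laplace_iter k d f))"
    unfolding s by (rule exI[of _ "carrier SL2Z"], rule exI[of _ "K + 3 + 1"], rule exI[of _ "sym_rep (K + 3)"], rule exI[of _ f], intro conjI f(1) spec[OF f(2)])
next
  assume "1 < k" "1 \<le> d"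
  define P where "P = nat (k - 2)"
  have k: "k = int P + 2" and s: "nat k = Suc (P + 1)" using \<open>1 < k\<close> by (simp_all add: P_def)
  \<comment> \<open>The truncated form has a depth one larger than the level at which its iterated
    lowering is prescribed, which is why it is constructed over d - 1.\<close>
  have d: "Suc (d - 1) = d" using \<open>1 \<le> d\<close> by simp
  show "\<exists>\<Gamma> n \<rho> f. modular_data \<Gamma> n \<rho> k d f \<and> vanishes n (lowering_iter k (nat k) (laplace_iter k (d - 1) f))"
    unfolding s
    by (rule exI[of _ "carrier SL2Z"], rule exI[of _ "P + 4 + 1"], rule exI[of _ "sym_rep (P + 4)"])
      (rule realization_Suc_truncated[OF k, of "d - 1", unfolded d])
qed

end
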